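(* Let $W$ be an irreducible Weyl group with complex reflection representation $\mathfrak{h}$, let $L\subset\mathfrak{h}$ be a $W$-invariant lattice, and let $H=\mathfrak{h}/L$ be the corresponding torus. Let $c$ be a $W$-invariant complex-valued function on the set of reflection hypertori of $H$, and let $H_c(W,H)$ be the degenerate double affine Hecke algebra (trigonometric Cherednik algebra) with parameter $c$. Then the polynomial representation $M=\mathbb{C}[H]$ of $H_c(W,H)$ is reducible if and only if there exists $g\in\Sigma$ such that $c_g\in\mathrm{Sing}(W_g,\mathfrak{h})$; that is, if and only if $c\in\bigcup_{g\in\Sigma}\mathrm{Sing}_g(W,L)$, where $\mathrm{Sing}_g(W,L)$ denotes the set of all $c$ with $c_g\in\mathrm{Sing}(W_g,\mathfrak{h})$.
   Context: **Lattice and roots.** $L\subset\mathfrak h$ is a free abelian subgroup of rank $\dim_{\mathbb C}\mathfrak h$, spanning $\mathfrak h$ over $\mathbb C$ and stable under $W$. For each reflection $s\in W$, let $\alpha_s^\vee$ be a generator of the intersection of $L$ with the $(-1)$-eigenspace of $s$ in $\mathfrak h$, and let $\alpha_s\in\mathfrak h^*$ be the element with $s\alpha_s=-\alpha_s$ and $(\alpha_s,\alpha_s^\vee)=2$. Then $R=\{\pm\alpha_s\}\subset\mathfrak h^*$ and $R^\vee=\{\pm\alpha_s^\vee\}\subset\mathfrak h$ are mutually dual reduced root systems, and $Q^\vee\subset L\subset P^\vee$ (coroot and coweight lattices). **The set $\Sigma$.** Let $G$ be the simple complex Lie group with root system $R$ and center $P^\vee/L$, with Lie algebra $\mathfrak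 g$; its maximal torus is identified with $H=\mathfrak h/L$ via the exponential map. For $g\in H$, $C_{\mathfrak g}(g)$ is the centralizer of $g$ in $\mathfrak g$, and $W_g\subset W$ is the stabilizer of $g$. The set $\Sigma\subset H$ consists of those $g$ for which $C_{\mathfrak g}(g)$ is semisimple. Equivalently, $g=x+L\in\Sigma$ iff the roots $\alpha\in R$ with $(x,\alpha)\in\mathbb Z$ span $\mathfrak h^*$. **Reflection hypertori and $c_g$.** A reflection hypertorus is a connected component $T$ of the fixed set $H^s$ of a reflection $s\in W$; the reflection $s=s_T$ is determined by $T$. The group $W$ permutes the reflection hypertori, and $c$ is constant on orbits. For $g\in\Sigma$ and a reflection $s\in W_g$, put $c_g(s)=c(T_{g,s})$, where $T_{g,s}$ is the unique component of $H^s$ passing through $g$. This is a conjugation-invariant function on the reflections of $W_g$. **Degenerate DAHA.** $H_c(W,H)$ is the algebra of operators on $\mathbb C[H]$ (regular functions on $H$) generated by multiplication by elements of $\mathbb C[H]$, the action of $W$, and the trigonometric Dunkl operators $$D_v=\partial_v-\sum_T c(T)\,f_{T,v}\,(1-s_T),\qquad v\in\mathfrak h.$$ Here $\partial_v$ is the translation-invariant vector field defined by $v$, the sum is over all reflection hypertori $T$, and $f_{T,v}$ is a rational function on $H$, regular outside $T$, with at most a simple pole along $T$, such that $f_{T,v}-\partial_v(\ell)/\ell$ is regular for any local equation $\ell$ of $T$. Different choices of $f_{T,v}$ give the same algebra. The polynomial representation is the tautological action on $M=\mathbb C[H]$. **Rational Cherednik algebra and $\mathrm{Sing}$.** Let $\Gamma\subset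 GL(\mathfrak h)$ be a finite group whose reflections all have order 2, and let $k$ be a conjugation-invariant complex function on the set of reflections of $\Gamma$. The rational Cherednik algebra $H_k(\Gamma,\mathfrak h)$ is the algebra of operators on $\mathbb C[\mathfrak h]$ generated by multiplication by $\mathbb C[\mathfrak h]$, the group $\Gamma$, and the Dunkl operators $$\partial_v-\sum_s k(s)\frac{\alpha_s(v)}{\alpha_s}(1-s),\qquad v\in\mathfrak h.$$ Here the sum is over reflections $s\in\Gamma$ and $\alpha_s\in\mathfrak h^*$ is a nonzero element with $s\alpha_s=-\alpha_s$. Its polynomial representation is $\mathbb C[\mathfrak h]$. $\mathrm{Sing}(\Gamma,\mathfrak h)$ is the set of $k$ for which $\mathbb C[\mathfrak h]$ is a reducible $H_k(\Gamma,\mathfrak h)$-module. *)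

theory Defs
  imports "HOL-Analysis.Analysis"
begin

text \<open>
  The space \<open>\<hh>\<close> is \<^typ>\<open>complex^'n\<close>, linear maps of \<open>\<hh>\<close> are square matrices, and elements of
  \<open>\<hh>*\<close> are complex-linear functions.  Complex scalar multiplication on vectors is \<open>(*s)\<close>, and
  \<open>vec.span\<close>, \<open>vec.subspace\<close> are taken over the complex numbers.
\<close>

abbreviation linear_form :: "(complex^'n \<Rightarrow> complex) \<Rightarrow> bool" where
  "linear_form \<equiv> Vector_Spaces.linear (*s) (*)"

section \<open>Weyl groups and lattices\<close>

text \<open>Root systems over a field of characteristic 0 (here the complex numbers) in the sense of
  Bourbaki; \<open>co \<alpha>\<close> is the coroot of \<open>\<alpha>\<close>, as a linear form.\<close>

definition root_system :: "(complex^'n) set \<Rightarrow> (complex^'n \<Rightarrow> complex^'n \<Rightarrow> complex) \<Rightarrow> bool" where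
  "root_system \<Phi> co \<longleftrightarrow>
     finite \<Phi> \<and> 0 \<notin> \<Phi> \<and> vec.span \<Phi> = UNIV \<and>
     (\<forall>\<alpha>\<in>\<Phi>. linear_form (co \<alpha>) \<and> co \<alpha> \<alpha> = 2 \<and>
        (\<lambda>x. x - co \<alpha> x *s \<alpha>) ` \<Phi> = \<Phi> \<and> co \<alpha> ` \<Phi> \<subseteq> \<int>)"

definition irreducible_root_system ::
    "(complex^'n) set \<Rightarrow> (complex^'n \<Rightarrow> complex^'n \<Rightarrow> complex) \<Rightarrow> bool" where
  "irreducible_root_system \<Phi> co \<longleftrightarrow>
     root_system \<Phi> co \<and> \<Phi> \<noteq> {} \<and>
     \<not> (\<exists>A B. A \<noteq> {} \<and> B \<noteq> {} \<and> A \<inter> B = {} \<and> A \<union> B = \<Phi> \<and>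
            (\<forall>\<alpha>\<in>A. \<forall>\<beta>\<in>B. co \<alpha> \<beta> = 0))"

inductive_set generated_group :: "(complex^'n^'n) set \<Rightarrow> (complex^'n^'n) set"
  for S where
  one: "mat 1 \<in> generated_group S"
| gen: "s \<in> S \<Longrightarrow> s \<in> generated_group S"
| mult: "a \<in> generated_group S \<Longrightarrow> b \<in> generated_group S \<Longrightarrow> a ** b \<in> generated_group S"
| inv: "a \<in> generated_group S \<Longrightarrow> matrix_inv a \<in> generated_group S"

definition irreducible_Weyl_group :: "(complex^'n^'n) set \<Rightarrow> bool" where
  "irreducible_Weyl_group W \<longleftrightarrow>
     (\<exists>\<Phi> co. irreducible_root_system \<Phi> co \<and>
        W = generated_group ((\<lambda>\<alpha>. matrix (\<lambda>x. x - co \<alpha> x *s \<alpha>)) ` \<Phi>))"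

definition reflections :: "(complex^'n^'n) set \<Rightarrow> (complex^'n^'n) set" where
  "reflections \<Gamma> = {s \<in> \<Gamma>. rank (mat 1 - s) = 1}"

text \<open>The group generated by \<open>n = dim \<hh>\<close> vectors spanning \<open>\<hh>\<close> over the complex numbers; such
  vectors are linearly independent, so this group is free abelian of rank \<open>n\<close>.\<close>

definition lattice :: "(complex^'n) set \<Rightarrow> bool" where
  "lattice L \<longleftrightarrow>
     (\<exists>b :: 'n \<Rightarrow> complex^'n. vec.span (range b) = UNIV \<and>
        L = range (\<lambda>m :: 'n \<Rightarrow> int. \<Sum>i\<in>UNIV. of_int (m i) *s b i))"

definition stable_under :: "(complex^'n^'n) set \<Rightarrow> (complex^'n) set \<Rightarrow> bool" where
  "stable_under W L \<longleftrightarrow> (\<forall>w\<in>W. (*v) w ` L = L)"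

text \<open>Action of a linear transformation on functions on \<open>\<hh>\<close>, in particular on \<open>\<hh>*\<close>.\<close>

definition act :: "complex^'n^'n \<Rightarrow> (complex^'n \<Rightarrow> complex) \<Rightarrow> (complex^'n \<Rightarrow> complex)" where
  "act w F = (\<lambda>x. F (matrix_inv w *v x))"

text \<open>\<open>\<alpha>_s^\<or>\<close> is determined up to sign by \<open>s\<close>, and \<open>\<alpha>_s\<close> by \<open>\<alpha>_s^\<or>\<close>.\<close>

definition is_coroot :: "(complex^'n) set \<Rightarrow> complex^'n^'n \<Rightarrow> complex^'n \<Rightarrow> bool" where
  "is_coroot L s a \<longleftrightarrow> L \<inter> {x. s *v x = - x} = range (\<lambda>m :: int. of_int m *s a)"

definition roots :: "(complex^'n^'n) set \<Rightarrow> (complex^'n) set \<Rightarrow> (complex^'n \<Rightarrow> complex) set" where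
  "roots W L =
     {\<alpha>. \<exists>s\<in>reflections W. \<exists>a. is_coroot L s a \<and>
            linear_form \<alpha> \<and> act s \<alpha> = (\<lambda>x. - \<alpha> x) \<and> \<alpha> a = 2}"

section \<open>The torus and its reflection hypertori\<close>

definition coset :: "(complex^'n) set \<Rightarrow> complex^'n \<Rightarrow> (complex^'n) set" where
  "coset L x = (\<lambda>l. x + l) ` L"

definition torus :: "(complex^'n) set \<Rightarrow> (complex^'n) set set" where
  "torus L = range (coset L)"

text \<open>The quotient topology of \<open>\<hh>/L\<close>.\<close>

definition torus_topology :: "(complex^'n) set \<Rightarrow> (complex^'n) set topology" where
  "torus_topology L = topology (\<lambda>U. U \<subseteq> torus L \<and> open (\<Union>U))"

lemma openin_torus_topology:
  fixes L :: "(complex^'n) set"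
  assumes "lattice L"
  shows "openin (torus_topology L) U \<longleftrightarrow> U \<subseteq> torus L \<and> open (\<Union>U)"
proof -
  obtain b :: "'n \<Rightarrow> complex^'n"
    where L: "L = range (\<lambda>m :: 'n \<Rightarrow> int. \<Sum>i\<in>UNIV. of_int (m i) *s b i)"
    using assms unfolding lattice_def by blast
  have diff: "x - y \<in> L" if xL: "x \<in> L" and yL: "y \<in> L" for x y
  proof -
    obtain m :: "'n \<Rightarrow> int" where m: "x = (\<Sum>i\<in>UNIV. of_int (m i) *s b i)"
      using xL unfolding L by (elim rangeE)
    obtain k :: "'n \<Rightarrow> int" where k: "y = (\<Sum>i\<in>UNIV. of_int (k i) *s b i)"
      using yL unfolding L by (elim rangeE)
    have "x - y = (\<Sum>i\<in>UNIV. of_int (m i - k i) *s b i)"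
      by (simp add: m k sum_subtractf vec.scale_left_diff_distrib)
    then show ?thesis unfolding L by (intro range_eqI[where x = "\<lambda>i. m i - k i"]) simp
  qed
  have zero: "0 \<in> L"
    unfolding L by (intro range_eqI[where x = "\<lambda>i. 0"]) simp
  have coset_iff: "z \<in> coset L x \<longleftrightarrow> z - x \<in> L" for z x
    unfolding coset_def by (auto intro: image_eqI[where x = "z - x"])
  have sub: "coset L x \<subseteq> coset L y" if "z \<in> coset L x" "z \<in> coset L y" for x y z
  proof
    fix t assume "t \<in> coset L x"
    then have "(t - x) - ((z - x) - (z - y)) \<in> L"
      using that diff zero unfolding coset_iff by blast
    then show "t \<in> coset L y" unfolding coset_iff by (simp add: algebra_simps)
  qed
  have disj: "g = h" if "g \<in> torus L" "h \<in> torus L" "z \<in> g" "z \<in> h" for g h z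
    using that sub unfolding torus_def by blast
  have inter: "\<Union>(A \<inter> B) = \<Union>A \<inter> \<Union>B" if "A \<subseteq> torus L" "B \<subseteq> torus L" for A B
    using that disj by blast
  have "istopology (\<lambda>U. U \<subseteq> torus L \<and> open (\<Union>U))"
    unfolding istopology_def
  proof (intro conjI allI impI)
    fix A B assume "A \<subseteq> torus L \<and> open (\<Union>A)" "B \<subseteq> torus L \<and> open (\<Union>B)"
    then show "A \<inter> B \<subseteq> torus L" "open (\<Union>(A \<inter> B))" using inter by auto
  next
    fix K assume K: "\<forall>A\<in>K. A \<subseteq> torus L \<and> open (\<Union>A)"
    then show "\<Union>K \<subseteq> torus L" by blast
    have "\<Union>(\<Union>K) = (\<Union>A\<in>K. \<Union>A)" by blast
    then show "open (\<Union>(\<Union>K))" using K by auto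
  qed
  then show ?thesis unfolding torus_topology_def by (simp add: topology_inverse')
qed

definition fixed_set :: "(complex^'n) set \<Rightarrow> complex^'n^'n \<Rightarrow> (complex^'n) set set" where
  "fixed_set L s = {g \<in> torus L. (*v) s ` g = g}"

definition fixed_components ::
    "(complex^'n) set \<Rightarrow> complex^'n^'n \<Rightarrow> (complex^'n) set set set" where
  "fixed_components L s = connected_components_of (subtopology (torus_topology L) (fixed_set L s))"

definition hypertori ::
    "(complex^'n^'n) set \<Rightarrow> (complex^'n) set \<Rightarrow> (complex^'n) set set set" where
  "hypertori W L = (\<Union>s\<in>reflections W. fixed_components L s)"

definition hypertorus_reflection ::
    "(complex^'n^'n) set \<Rightarrow> (complex^'n) set \<Rightarrow> (complex^'n) set set \<Rightarrow> complex^'n^'n" where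
  "hypertorus_reflection W L T = (THE s. s \<in> reflections W \<and> T \<in> fixed_components L s)"

definition invariant_parameter ::
    "(complex^'n^'n) set \<Rightarrow> (complex^'n) set \<Rightarrow> ((complex^'n) set set \<Rightarrow> complex) \<Rightarrow> bool" where
  "invariant_parameter W L c \<longleftrightarrow>
     (\<forall>w\<in>W. \<forall>T\<in>hypertori W L. c ((\<lambda>g. (*v) w ` g) ` T) = c T)"

definition stabilizer :: "(complex^'n^'n) set \<Rightarrow> (complex^'n) set \<Rightarrow> (complex^'n^'n) set" where
  "stabilizer W g = {w \<in> W. (*v) w ` g = g}"

definition local_parameter ::
    "(complex^'n) set \<Rightarrow> ((complex^'n) set set \<Rightarrow> complex) \<Rightarrow> (complex^'n) set
      \<Rightarrow> complex^'n^'n \<Rightarrow> complex" where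
  "local_parameter L c g s =
     c (connected_component_of_set (subtopology (torus_topology L) (fixed_set L s)) g)"

section \<open>Algebras of operators on functions and their modules\<close>

type_synonym 'n operator = "(complex^'n \<Rightarrow> complex) \<Rightarrow> (complex^'n \<Rightarrow> complex)"

inductive_set operator_algebra :: "'n operator set \<Rightarrow> 'n operator set"
  for S where
  one: "(\<lambda>F. F) \<in> operator_algebra S"
| gen: "A \<in> S \<Longrightarrow> A \<in> operator_algebra S"
| add: "A \<in> operator_algebra S \<Longrightarrow> B \<in> operator_algebra S
          \<Longrightarrow> (\<lambda>F x. A F x + B F x) \<in> operator_algebra S"
| scale: "A \<in> operator_algebra S \<Longrightarrow> (\<lambda>F x. a * A F x) \<in> operator_algebra S"
| comp: "A \<in> operator_algebra S \<Longrightarrow> B \<in> operator_algebra S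
          \<Longrightarrow> (\<lambda>F. A (B F)) \<in> operator_algebra S"

definition function_subspace :: "(complex^'n \<Rightarrow> complex) set \<Rightarrow> bool" where
  "function_subspace N \<longleftrightarrow>
     (\<lambda>x. 0) \<in> N \<and> (\<forall>F\<in>N. \<forall>G\<in>N. (\<lambda>x. F x + G x) \<in> N) \<and> (\<forall>a. \<forall>F\<in>N. (\<lambda>x. a * F x) \<in> N)"

definition submodule ::
    "'n::finite operator set \<Rightarrow> (complex^'n \<Rightarrow> complex) set \<Rightarrow> (complex^'n \<Rightarrow> complex) set \<Rightarrow> bool" where
  "submodule \<A> M N \<longleftrightarrow> function_subspace N \<and> N \<subseteq> M \<and> (\<forall>A\<in>\<A>. A ` N \<subseteq> N)"

text \<open>Only the restrictions of the operators to \<open>M\<close> matter.\<close>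

definition reducible_module ::
    "'n::finite operator set \<Rightarrow> (complex^'n \<Rightarrow> complex) set \<Rightarrow> bool" where
  "reducible_module \<A> M \<longleftrightarrow> (\<exists>N. submodule \<A> M N \<and> N \<noteq> {\<lambda>x. 0} \<and> N \<noteq> M)"

definition directional :: "complex^'n \<Rightarrow> (complex^'n \<Rightarrow> complex) \<Rightarrow> (complex^'n \<Rightarrow> complex)" where
  "directional v F = (\<lambda>x. deriv (\<lambda>t. F (x + t *s v)) 0)"

section \<open>The degenerate double affine Hecke algebra\<close>

text \<open>Functions on \<open>H = \<hh>/L\<close> are represented by their pullbacks to \<open>\<hh>\<close>.  Regular functions on
  \<open>H\<close> are the linear combinations of the characters \<open>exp (2\<pi>i \<mu>)\<close>, with \<open>\<mu>\<close> in the dual lattice.\<close>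

definition dual_lattice :: "(complex^'n) set \<Rightarrow> (complex^'n \<Rightarrow> complex) set" where
  "dual_lattice L = {\<mu>. linear_form \<mu> \<and> \<mu> ` L \<subseteq> \<int>}"

definition torus_functions :: "(complex^'n) set \<Rightarrow> (complex^'n \<Rightarrow> complex) set" where
  "torus_functions L =
     {\<lambda>x. \<Sum>\<mu>\<in>S. a \<mu> * exp (2 * of_real pi * \<i> * \<mu> x) | S a. finite S \<and> S \<subseteq> dual_lattice L}"

text \<open>\<open>\<phi>\<close> is a partial function on \<open>H\<close> with domain \<open>U\<close>, a dense open subset; its values outside
  \<open>U\<close> are irrelevant.  The predicate says that near \<open>p\<close>, which need not lie in \<open>U\<close>, it is given by
  an element of the local ring of \<open>H\<close> at \<open>p\<close>.\<close>

definition regular_near ::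
    "(complex^'n) set \<Rightarrow> (complex^'n) set \<Rightarrow> (complex^'n \<Rightarrow> complex) \<Rightarrow> complex^'n \<Rightarrow> bool" where
  "regular_near L U \<phi> p \<longleftrightarrow>
     (\<exists>A\<in>torus_functions L. \<exists>B\<in>torus_functions L.
        B p \<noteq> 0 \<and> (\<forall>y\<in>U. B y \<noteq> 0 \<longrightarrow> \<phi> y = A y / B y))"

text \<open>\<open>l\<close> is regular on the principal open neighbourhood \<open>B \<noteq> 0\<close> of \<open>p\<close>, vanishes on \<open>T\<close> there, and
  generates the ideal of \<open>T\<close> in the local ring at \<open>p\<close>.\<close>

definition local_equation ::
    "(complex^'n) set \<Rightarrow> (complex^'n) set set \<Rightarrow> complex^'n \<Rightarrow> (complex^'n \<Rightarrow> complex) \<Rightarrow> bool" where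
  "local_equation L T p l \<longleftrightarrow>
     (\<exists>A\<in>torus_functions L. \<exists>B\<in>torus_functions L. B p \<noteq> 0 \<and>
        (\<forall>y. B y \<noteq> 0 \<longrightarrow> l y = A y / B y) \<and>
        (\<forall>y. B y \<noteq> 0 \<and> coset L y \<in> T \<longrightarrow> l y = 0) \<and>
        (\<forall>F\<in>torus_functions L. (\<forall>y. coset L y \<in> T \<longrightarrow> F y = 0) \<longrightarrow>
           (\<exists>q. regular_near L UNIV q p \<and>
              (\<exists>D\<in>torus_functions L. D p \<noteq> 0 \<and> (\<forall>y. D y \<noteq> 0 \<longrightarrow> F y = q y * l y)))))"

definition off_hypertorus :: "(complex^'n) set \<Rightarrow> (complex^'n) set set \<Rightarrow> (complex^'n) set" where
  "off_hypertorus L T = {y. coset L y \<notin> T}"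

text \<open>The functions allowed as \<open>f_{T,v}\<close>.  A function which is regular at every point outside \<open>T\<close> is
  a rational function on \<open>H\<close>.\<close>

definition admissible ::
    "(complex^'n) set \<Rightarrow> (complex^'n) set set \<Rightarrow> complex^'n \<Rightarrow> (complex^'n \<Rightarrow> complex) \<Rightarrow> bool" where
  "admissible L T v \<phi> \<longleftrightarrow>
     (\<forall>p\<in>off_hypertorus L T. regular_near L (off_hypertorus L T) \<phi> p) \<and>
     (\<forall>p l. coset L p \<in> T \<and> local_equation L T p l \<longrightarrow>
        regular_near L (off_hypertorus L T) (\<lambda>y. l y * \<phi> y) p \<and>
        regular_near L (off_hypertorus L T) (\<lambda>y. \<phi> y - directional v l y / l y) p)"

definition admissible_family ::
    "(complex^'n^'n) set \<Rightarrow> (complex^'n) set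
      \<Rightarrow> ((complex^'n) set set \<Rightarrow> complex^'n \<Rightarrow> complex^'n \<Rightarrow> complex) \<Rightarrow> bool" where
  "admissible_family W L f \<longleftrightarrow> (\<forall>T\<in>hypertori W L. \<forall>v. admissible L T v (f T v))"

text \<open>The formula for \<open>D_v F\<close> makes sense off the reflection hypertori; \<open>D_v F\<close> is the unique
  regular function on \<open>H\<close> given by it there.\<close>

definition trig_dunkl ::
    "(complex^'n^'n) set \<Rightarrow> (complex^'n) set \<Rightarrow> ((complex^'n) set set \<Rightarrow> complex)
      \<Rightarrow> ((complex^'n) set set \<Rightarrow> complex^'n \<Rightarrow> complex^'n \<Rightarrow> complex)
      \<Rightarrow> complex^'n \<Rightarrow> 'n operator" where
  "trig_dunkl W L c f v F =
     (THE G. G \<in> torus_functions L \<and>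
        (\<forall>x. (\<forall>T\<in>hypertori W L. coset L x \<notin> T) \<longrightarrow>
           G x = directional v F x -
             (\<Sum>T\<in>hypertori W L. c T * f T v x * (F x - act (hypertorus_reflection W L T) F x))))"

definition degenerate_DAHA ::
    "(complex^'n^'n) set \<Rightarrow> (complex^'n) set \<Rightarrow> ((complex^'n) set set \<Rightarrow> complex)
      \<Rightarrow> ((complex^'n) set set \<Rightarrow> complex^'n \<Rightarrow> complex^'n \<Rightarrow> complex) \<Rightarrow> 'n operator set" where
  "degenerate_DAHA W L c f =
     operator_algebra
       ({\<lambda>F x. P x * F x | P. P \<in> torus_functions L} \<union> act ` W \<union> range (trig_dunkl W L c f))"

section \<open>Rational Cherednik algebras\<close>

inductive_set polynomial_functions :: "(complex^'n \<Rightarrow> complex) set" where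
  const: "(\<lambda>x. a) \<in> polynomial_functions"
| coord: "(\<lambda>x. x $ i) \<in> polynomial_functions"
| add: "P \<in> polynomial_functions \<Longrightarrow> Q \<in> polynomial_functions
          \<Longrightarrow> (\<lambda>x. P x + Q x) \<in> polynomial_functions"
| mult: "P \<in> polynomial_functions \<Longrightarrow> Q \<in> polynomial_functions
          \<Longrightarrow> (\<lambda>x. P x * Q x) \<in> polynomial_functions"

text \<open>Determined up to a nonzero scalar, which cancels in the Dunkl operators.\<close>

definition reflection_form :: "complex^'n^'n \<Rightarrow> complex^'n \<Rightarrow> complex" where
  "reflection_form s = (SOME \<alpha>. linear_form \<alpha> \<and> \<alpha> \<noteq> (\<lambda>x. 0) \<and> act s \<alpha> = (\<lambda>x. - \<alpha> x))"

text \<open>As above, the formula is used off the reflection hyperplanes only.\<close>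

definition rational_dunkl ::
    "(complex^'n^'n) set \<Rightarrow> (complex^'n^'n \<Rightarrow> complex) \<Rightarrow> complex^'n \<Rightarrow> 'n operator" where
  "rational_dunkl \<Gamma> k v F =
     (THE G. G \<in> polynomial_functions \<and>
        (\<forall>x. (\<forall>s\<in>reflections \<Gamma>. reflection_form s x \<noteq> 0) \<longrightarrow>
           G x = directional v F x -
             (\<Sum>s\<in>reflections \<Gamma>.
                k s * (reflection_form s v / reflection_form s x) * (F x - act s F x))))"

definition rational_Cherednik_algebra ::
    "(complex^'n^'n) set \<Rightarrow> (complex^'n^'n \<Rightarrow> complex) \<Rightarrow> 'n operator set" where
  "rational_Cherednik_algebra \<Gamma> k =
     operator_algebra
       ({\<lambda>F x. P x * F x | P. P \<in> polynomial_functions} \<union> act ` \<Gamma> \<union> range (rational_dunkl \<Gamma> k))"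

text \<open>Parameters are functions on all matrices, of which only the values on reflections of \<open>\<Gamma>\<close> are
  used.\<close>

definition Sing :: "(complex^'n^'n) set \<Rightarrow> (complex^'n^'n \<Rightarrow> complex) set" where
  "Sing \<Gamma> =
     {k. (\<forall>w\<in>\<Gamma>. \<forall>s\<in>reflections \<Gamma>. k (w ** s ** matrix_inv w) = k s) \<and>
         reducible_module (rational_Cherednik_algebra \<Gamma> k) polynomial_functions}"

section \<open>The simple Lie algebra and the set \<open>\<Sigma>\<close>\<close>

type_synonym 'm bracket = "complex^'m \<Rightarrow> complex^'m \<Rightarrow> complex^'m"

definition lie_algebra :: "'m::finite bracket \<Rightarrow> bool" where
  "lie_algebra br \<longleftrightarrow>
     (\<forall>x. Vector_Spaces.linear (*s) (*s) (br x)) \<and>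
     (\<forall>y. Vector_Spaces.linear (*s) (*s) (\<lambda>x. br x y)) \<and>
     (\<forall>x. br x x = 0) \<and>
     (\<forall>x y z. br x (br y z) + br y (br z x) + br z (br x y) = 0)"

definition lie_ideal :: "'m::finite bracket \<Rightarrow> (complex^'m) set \<Rightarrow> (complex^'m) set \<Rightarrow> bool" where
  "lie_ideal br K I \<longleftrightarrow> vec.subspace I \<and> I \<subseteq> K \<and> (\<forall>x\<in>K. \<forall>y\<in>I. br x y \<in> I)"

definition simple_lie_algebra :: "'m::finite bracket \<Rightarrow> bool" where
  "simple_lie_algebra br \<longleftrightarrow>
     lie_algebra br \<and> (\<exists>x y. br x y \<noteq> 0) \<and> (\<forall>I. lie_ideal br UNIV I \<longrightarrow> I = {0} \<or> I = UNIV)"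

definition derived_subalgebra :: "'m::finite bracket \<Rightarrow> (complex^'m) set \<Rightarrow> (complex^'m) set" where
  "derived_subalgebra br K = vec.span {br x y | x y. x \<in> K \<and> y \<in> K}"

definition solvable :: "'m::finite bracket \<Rightarrow> (complex^'m) set \<Rightarrow> bool" where
  "solvable br K \<longleftrightarrow> (\<exists>k. (derived_subalgebra br ^^ k) K = {0})"

definition semisimple :: "'m::finite bracket \<Rightarrow> (complex^'m) set \<Rightarrow> bool" where
  "semisimple br K \<longleftrightarrow> (\<forall>I. lie_ideal br K I \<and> solvable br I \<longrightarrow> I = {0})"

definition root_space ::
    "'m::finite bracket \<Rightarrow> (complex^'n \<Rightarrow> complex^'m) \<Rightarrow> (complex^'n \<Rightarrow> complex) \<Rightarrow> (complex^'m) set" where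
  "root_space br \<iota> \<alpha> = {y. \<forall>t. br (\<iota> t) y = \<alpha> t *s y}"

text \<open>\<open>\<iota>\<close> identifies \<open>\<hh>\<close> with a Cartan subalgebra, that is, with a subalgebra which acts
  diagonalizably and equals its own centralizer, in such a way that the set of roots becomes \<open>R\<close>.\<close>

definition simple_lie_algebra_with_roots ::
    "'m::finite bracket \<Rightarrow> (complex^'n \<Rightarrow> complex^'m) \<Rightarrow> (complex^'n \<Rightarrow> complex) set \<Rightarrow> bool" where
  "simple_lie_algebra_with_roots br \<iota> R \<longleftrightarrow>
     simple_lie_algebra br \<and>
     Vector_Spaces.linear (*s) (*s) \<iota> \<and> inj \<iota> \<and>
     root_space br \<iota> (\<lambda>t. 0) = range \<iota> \<and>
     R = {\<alpha>. linear_form \<alpha> \<and> \<alpha> \<noteq> (\<lambda>t. 0) \<and> root_space br \<iota> \<alpha> \<noteq> {0}} \<and>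
     vec.span (\<Union>\<alpha>\<in>insert (\<lambda>t. 0) R. root_space br \<iota> \<alpha>) = UNIV"

definition exp_ad :: "'m::finite bracket \<Rightarrow> complex^'m \<Rightarrow> complex^'m \<Rightarrow> complex^'m" where
  "exp_ad br z y = (\<Sum>k. (1 / fact k) *s (br z ^^ k) y)"

text \<open>The point \<open>x + L\<close> of \<open>\<hh>/L\<close> is the element \<open>exp (2\<pi>i x)\<close> of the maximal torus of \<open>G\<close>, and
  its adjoint action on the Lie algebra is \<open>exp (ad (2\<pi>i x))\<close>.\<close>

definition lie_centralizer ::
    "'m::finite bracket \<Rightarrow> (complex^'n \<Rightarrow> complex^'m) \<Rightarrow> (complex^'n) set \<Rightarrow> (complex^'m) set" where
  "lie_centralizer br \<iota> g = {y. \<forall>x\<in>g. exp_ad br (\<iota> ((2 * of_real pi * \<i>) *s x)) y = y}"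

definition Sigma_points ::
    "'m::finite bracket \<Rightarrow> (complex^'n \<Rightarrow> complex^'m) \<Rightarrow> (complex^'n) set \<Rightarrow> (complex^'n) set set" where
  "Sigma_points br \<iota> L = {g \<in> torus L. semisimple br (lie_centralizer br \<iota> g)}"

definition Sing_at ::
    "(complex^'n^'n) set \<Rightarrow> (complex^'n) set \<Rightarrow> (complex^'n) set
      \<Rightarrow> ((complex^'n) set set \<Rightarrow> complex) set" where
  "Sing_at W L g =
     {c. invariant_parameter W L c \<and> local_parameter L c g \<in> Sing (stabilizer W g)}"

end

theory Submission imports Defs "HOL-Complex_Analysis.Complex_Analysis" begin

text \<open>Near a point \<open>g = x + L\<close> every trigonometric Dunkl operator agrees, up to operators that do not lower
  the order of vanishing at \<open>g\<close>, with a rational Dunkl operator of \<open>W_g\<close> with parameter \<open>c_g\<close>.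

  Let \<open>I\<close> be a proper nonzero submodule of the rational polynomial representation at some \<open>g\<close>. The functions on \<open>H\<close>
  whose Taylor polynomials at all points of the orbit of \<open>g\<close> lie in \<open>I\<close> form a submodule of \<open>\<complex>[H]\<close>. It is
  proper because the Euler field forces all elements of \<open>I\<close> to vanish at the origin, and nonzero because \<open>I\<close>
  contains a power of the discriminant. This direction does not need \<open>g \<in> \<Sigma>\<close>.

  Conversely, a proper submodule \<open>N\<close> has a common zero by the Nullstellensatz, and its zero set is stable under
  translation in directions tangent to all hypertori through a point. A zero lying on a maximal set of hypertori
  therefore has integral roots that span the dual space, and the leading terms of \<open>N\<close> there form a
  proper nonzero submodule of the rational polynomial representation. Such a point lies in \<open>\<Sigma>\<close>: an abelian ideal of
  its centralizer is graded by the roots, meets the Cartan subalgebra trivially, and lies in the radical of the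
  Killing form of the simple Lie algebra.\<close>

text \<open>The operators are given in an incomplete form: \<open>f T v\<close> is known only near
  each point, as a fraction, and a Dunkl operator is specified only off the hypertori. Both are made
  global. The denominators that clear \<open>f T v\<close> times \<open>F - s_T F\<close> form an
  ideal of C[H] without common zero, so by the Nullstellensatz this function is regular; and all
  functions compared lie in one algebra of exponential polynomials without zero divisors, so
  identities may be checked off the hypertori. Completed local rings are replaced by orders of
  vanishing. Up to high order, the part of \<open>D_v\<close> that has no rational counterpart is a
  sum of operators \<open>r_T (1 - s_T)\<close> with \<open>r_T\<close> regular on all of H. Such
  operators preserve every W-stable ideal of C[H], but \<open>s_T\<close> may move g when T does not
  contain it; for this reason the first construction imposes conditions on the whole orbit of g. In
  the converse, leading terms suffice, because the rational operators are homogeneous.\<close>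

lemma linear_form_iff:
  "linear_form \<mu> \<longleftrightarrow> (\<forall>x y. \<mu> (x + y) = \<mu> x + \<mu> y) \<and> (\<forall>a x. \<mu> (a *s x) = a * \<mu> x)"
  by (auto simp: Vector_Spaces.linear_iff vec.vector_space_axioms
      vector_space_over_itself.vector_space_axioms)

lemma
  assumes "linear_form \<mu>"
  shows linear_form_add: "\<mu> (x + y) = \<mu> x + \<mu> y"
    and linear_form_scale: "\<mu> (a *s x) = a * \<mu> x"
    and linear_form_zero: "\<mu> 0 = 0"
    and linear_form_minus: "\<mu> (- x) = - \<mu> x"
    and linear_form_diff: "\<mu> (x - y) = \<mu> x - \<mu> y"
proof -
  show add: "\<mu> (x + y) = \<mu> x + \<mu> y" for x y using assms by (simp add: linear_form_iff)
  show "\<mu> (a *s x) = a * \<mu> x" for a x using assms by (simp add: linear_form_iff)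
  show zero: "\<mu> 0 = 0" using add[of 0 0] by simp
  show minus: "\<mu> (- x) = - \<mu> x" for x
    using add[of x "- x"] zero by (simp add: add_eq_0_iff)
  show "\<mu> (x - y) = \<mu> x - \<mu> y" using add[of x "- y"] minus by simp
qed

lemmas linear_form_simps =
  linear_form_add linear_form_scale linear_form_zero linear_form_minus linear_form_diff

lemma linear_form_sum: "linear_form \<mu> \<Longrightarrow> \<mu> (\<Sum>i\<in>A. g i) = (\<Sum>i\<in>A. \<mu> (g i))"
  by (induction A rule: infinite_finite_induct) (auto simp: linear_form_simps)

lemma linear_form_expand: "linear_form \<mu> \<Longrightarrow> \<mu> x = (\<Sum>i\<in>UNIV. x $ i * \<mu> (axis i 1))"
  by (subst basis_expansion[of x, symmetric]) (simp add: linear_form_sum linear_form_scale)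

lemma linear_form_coord: "linear_form (\<lambda>x. x $ i)"
  by (simp add: linear_form_iff)

lemma linear_form_null: "linear_form (\<lambda>x. 0)"
  by (simp add: linear_form_iff)

lemma linear_form_plus: "linear_form \<mu> \<Longrightarrow> linear_form \<nu> \<Longrightarrow> linear_form (\<lambda>x. \<mu> x + \<nu> x)"
  by (simp add: linear_form_iff algebra_simps)

lemma linear_form_mult: "linear_form \<mu> \<Longrightarrow> linear_form (\<lambda>x. a * \<mu> x)"
  by (simp add: linear_form_iff algebra_simps)

lemma linear_form_comp_matrix: "linear_form \<mu> \<Longrightarrow> linear_form (\<lambda>x. \<mu> (A *v x))"
  by (simp add: linear_form_iff matrix_vector_right_distrib vector_scalar_commute)

lemma continuous_on_linear_form:
  assumes "linear_form \<mu>"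
  shows "continuous_on S \<mu>"
proof -
  have "continuous_on S (\<lambda>x. \<Sum>i\<in>UNIV. x $ i * \<mu> (axis i 1))" by (intro continuous_intros)
  then show ?thesis by (rule continuous_on_eq) (rule linear_form_expand[OF assms, symmetric])
qed

lemma norm_vec_scale: "norm (t *s v) = cmod t * norm (v :: complex^'n)"
  by (simp add: norm_vec_def norm_mult L2_set_right_distrib)

lemma linear_form_bounded:
  assumes "linear_form (\<mu> :: complex^'n \<Rightarrow> complex)"
  obtains K where "K \<ge> 0" "\<And>x. cmod (\<mu> x) \<le> K * norm x"
proof
  let ?K = "\<Sum>i\<in>UNIV. cmod (\<mu> (axis i 1))"
  show "?K \<ge> 0" by (simp add: sum_nonneg)
  fix x :: "complex^'n"
  have "cmod (\<mu> x) \<le> (\<Sum>i\<in>UNIV. cmod (x $ i * \<mu> (axis i 1)))"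
    by (subst linear_form_expand[OF assms]) (rule norm_sum)
  also have "\<dots> \<le> (\<Sum>i\<in>UNIV. norm x * cmod (\<mu> (axis i 1)))"
    by (auto simp: norm_mult intro!: sum_mono mult_right_mono Finite_Cartesian_Product.norm_nth_le)
  finally show "cmod (\<mu> x) \<le> ?K * norm x" by (simp add: sum_distrib_left mult.commute)
qed

section \<open>Exponential polynomials\<close>

text \<open>A common home for polynomials and for regular functions on the torus, in which the two
  kinds of Dunkl operators can be subtracted. It is closed under affine substitutions and
  directional derivatives, and its elements restrict to entire functions on complex lines.\<close>

inductive_set exp_poly :: "(complex^'n \<Rightarrow> complex) set" where
  const: "(\<lambda>x. a) \<in> exp_poly"
| form: "linear_form \<mu> \<Longrightarrow> \<mu> \<in> exp_poly"
| exp: "linear_form \<mu> \<Longrightarrow> (\<lambda>x. exp (\<mu> x)) \<in> exp_poly"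
| add: "P \<in> exp_poly \<Longrightarrow> Q \<in> exp_poly \<Longrightarrow> (\<lambda>x. P x + Q x) \<in> exp_poly"
| mult: "P \<in> exp_poly \<Longrightarrow> Q \<in> exp_poly \<Longrightarrow> (\<lambda>x. P x * Q x) \<in> exp_poly"

lemmas exp_poly_intros = exp_poly.const exp_poly.add exp_poly.mult

lemma exp_poly_scale: "P \<in> exp_poly \<Longrightarrow> (\<lambda>x. a * P x) \<in> exp_poly"
  by (intro exp_poly.mult exp_poly.const)

lemma exp_poly_minus: "P \<in> exp_poly \<Longrightarrow> (\<lambda>x. - P x) \<in> exp_poly"
  using exp_poly_scale[of P "-1"] by simp

lemma exp_poly_diff: "P \<in> exp_poly \<Longrightarrow> Q \<in> exp_poly \<Longrightarrow> (\<lambda>x. P x - Q x) \<in> exp_poly"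
  using exp_poly.add[OF _ exp_poly_minus[of Q]] by simp

lemma exp_poly_sum: "(\<And>i. i \<in> A \<Longrightarrow> P i \<in> exp_poly) \<Longrightarrow> (\<lambda>x. \<Sum>i\<in>A. P i x) \<in> exp_poly"
  by (induction A rule: infinite_finite_induct) (auto intro: exp_poly_intros)

lemma exp_poly_prod: "(\<And>i. i \<in> A \<Longrightarrow> P i \<in> exp_poly) \<Longrightarrow> (\<lambda>x. \<Prod>i\<in>A. P i x) \<in> exp_poly"
  by (induction A rule: infinite_finite_induct) (auto intro: exp_poly_intros)

lemma exp_poly_power: "P \<in> exp_poly \<Longrightarrow> (\<lambda>x. P x ^ n) \<in> exp_poly"
  by (induction n) (auto intro: exp_poly_intros)

lemma polynomial_functions_subset_exp_poly: "polynomial_functions \<subseteq> exp_poly"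
proof
  fix P :: "complex^'n \<Rightarrow> complex" assume "P \<in> polynomial_functions"
  then show "P \<in> exp_poly"
    by induction (auto intro: exp_poly_intros exp_poly.form linear_form_coord)
qed

lemma exp_poly_affine: "P \<in> exp_poly \<Longrightarrow> (\<lambda>y. P (A *v y + p)) \<in> exp_poly"
proof (induction rule: exp_poly.induct)
  case (form \<mu>)
  then show ?case
    by (auto simp: linear_form_add intro!: exp_poly_intros exp_poly.form[of "\<lambda>y. \<mu> (A *v y)"] linear_form_comp_matrix)
next
  case (exp \<mu>)
  then have "(\<lambda>y. exp (\<mu> p) * exp (\<mu> (A *v y))) \<in> exp_poly"
    by (intro exp_poly_scale exp_poly.exp linear_form_comp_matrix)
  with exp show ?case by (simp add: linear_form_add exp_add mult.commute)
qed (auto intro: exp_poly_intros)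

lemma exp_poly_comp_matrix: "P \<in> exp_poly \<Longrightarrow> (\<lambda>y. P (A *v y)) \<in> exp_poly"
  using exp_poly_affine[of P A 0] by simp

lemma exp_poly_continuous: "P \<in> exp_poly \<Longrightarrow> continuous_on S P"
  by (induction rule: exp_poly.induct)
    (auto intro: continuous_on_linear_form continuous_intros)

text \<open>\<open>directional\<close> is total because \<open>deriv\<close> is, so it carries no
  information until differentiability is known; the induction yields the derivative and its
  membership in the class together.\<close>

lemma exp_poly_has_directional:
  assumes "P \<in> exp_poly"
  shows "\<exists>G\<in>exp_poly. \<forall>x. ((\<lambda>t. P (x + t *s v)) has_field_derivative G x) (at 0)"
  using assms
proof induction
  case (const a)
  show ?case by (rule bexI[of _ "\<lambda>x. 0"]) (auto intro: exp_poly.const)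
next
  case (form \<mu>)
  then show ?case
    by (intro bexI[of _ "\<lambda>x. \<mu> v"])
      (auto simp: linear_form_simps intro!: exp_poly.const derivative_eq_intros)
next
  case (exp \<mu>)
  then show ?case
    by (intro bexI[of _ "\<lambda>x. \<mu> v * exp (\<mu> x)"])
      (auto simp: linear_form_simps intro!: exp_poly_scale exp_poly.exp derivative_eq_intros)
next
  case (add P Q)
  then obtain G H where "G \<in> exp_poly" "H \<in> exp_poly"
    "\<And>x. ((\<lambda>t. P (x + t *s v)) has_field_derivative G x) (at 0)"
    "\<And>x. ((\<lambda>t. Q (x + t *s v)) has_field_derivative H x) (at 0)" by blast
  then show ?case
    by (intro bexI[of _ "\<lambda>x. G x + H x"]) (auto intro!: exp_poly.add DERIV_add)
next
  case (mult P Q)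
  then obtain G H where GH: "G \<in> exp_poly" "H \<in> exp_poly"
    "\<And>x. ((\<lambda>t. P (x + t *s v)) has_field_derivative G x) (at 0)"
    "\<And>x. ((\<lambda>t. Q (x + t *s v)) has_field_derivative H x) (at 0)" by blast
  have "((\<lambda>t. P (x + t *s v) * Q (x + t *s v)) has_field_derivative G x * Q x + H x * P x) (at 0)"
    for x using DERIV_mult[OF GH(3,4)[of x]] by simp
  then show ?case using GH mult
    by (intro bexI[of _ "\<lambda>x. G x * Q x + H x * P x"]) (auto intro!: exp_poly_intros)
qed

lemma exp_poly_directional: "P \<in> exp_poly \<Longrightarrow> directional v P \<in> exp_poly"
proof -
  assume "P \<in> exp_poly"
  then obtain G where G: "G \<in> exp_poly"
    "\<And>x. ((\<lambda>t. P (x + t *s v)) has_field_derivative G x) (at 0)"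
    using exp_poly_has_directional by blast
  then have "directional v P = G" by (auto simp: directional_def DERIV_imp_deriv)
  with G show ?thesis by simp
qed

lemma exp_poly_has_field_derivative:
  assumes "P \<in> exp_poly"
  shows "((\<lambda>t. P (x + t *s v)) has_field_derivative directional v P (x + t *s v)) (at t)"
proof -
  obtain G where G: "\<And>x. ((\<lambda>t. P (x + t *s v)) has_field_derivative G x) (at 0)"
    using exp_poly_has_directional[OF assms] by blast
  then have dir: "directional v P = G" by (auto simp: directional_def DERIV_imp_deriv)
  have "((\<lambda>u. P ((x + t *s v) + (u + - t) *s v)) has_field_derivative G (x + t *s v)) (at t)"
    using G[of "x + t *s v"] by (subst DERIV_shift[symmetric]) simp
  then show ?thesis by (simp add: dir algebra_simps vec.scale_left_diff_distrib)
qed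

lemma exp_poly_has_directional_at:
  "P \<in> exp_poly \<Longrightarrow> ((\<lambda>t. P (x + t *s v)) has_field_derivative directional v P x) (at 0)"
  using exp_poly_has_field_derivative[of P x v 0] by simp

lemma exp_poly_line_holomorphic: "P \<in> exp_poly \<Longrightarrow> (\<lambda>t. P (x + t *s v)) holomorphic_on S"
  using exp_poly_has_field_derivative holomorphic_on_open
  by (metis field_differentiable_at_within field_differentiable_def holomorphic_on_def)

lemma directional_eqI:
  "(\<And>x. ((\<lambda>t. P (x + t *s v)) has_field_derivative G x) (at 0)) \<Longrightarrow> directional v P = G"
  by (auto simp: directional_def DERIV_imp_deriv)

lemma directional_const: "directional v (\<lambda>x. a) = (\<lambda>x. 0)"
  by (rule directional_eqI) simp

lemma directional_form: "linear_form \<mu> \<Longrightarrow> directional v \<mu> = (\<lambda>x. \<mu> v)"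
  by (rule directional_eqI) (auto simp: linear_form_simps intro!: derivative_eq_intros)

lemma directional_exp:
  "linear_form \<mu> \<Longrightarrow> directional v (\<lambda>x. exp (\<mu> x)) = (\<lambda>x. \<mu> v * exp (\<mu> x))"
  by (rule directional_eqI) (auto simp: linear_form_simps intro!: derivative_eq_intros)

lemma directional_add:
  "P \<in> exp_poly \<Longrightarrow> Q \<in> exp_poly \<Longrightarrow>
    directional v (\<lambda>x. P x + Q x) = (\<lambda>x. directional v P x + directional v Q x)"
  by (intro directional_eqI DERIV_add exp_poly_has_directional_at)

lemma directional_diff:
  "P \<in> exp_poly \<Longrightarrow> Q \<in> exp_poly \<Longrightarrow>
    directional v (\<lambda>x. P x - Q x) = (\<lambda>x. directional v P x - directional v Q x)"
  by (intro directional_eqI DERIV_diff exp_poly_has_directional_at)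

lemma directional_mult:
  assumes "P \<in> exp_poly" "Q \<in> exp_poly"
  shows "directional v (\<lambda>x. P x * Q x) = (\<lambda>x. directional v P x * Q x + P x * directional v Q x)"
proof (rule directional_eqI)
  fix x
  show "((\<lambda>t. P (x + t *s v) * Q (x + t *s v)) has_field_derivative
      directional v P x * Q x + P x * directional v Q x) (at 0)"
    using DERIV_mult[OF exp_poly_has_directional_at[OF assms(1)] exp_poly_has_directional_at[OF assms(2)],
        of x v x v] by (simp add: mult.commute)
qed

lemma directional_scale: "P \<in> exp_poly \<Longrightarrow> directional v (\<lambda>x. a * P x) = (\<lambda>x. a * directional v P x)"
  using directional_mult[OF exp_poly.const, of P v a] by (simp add: directional_const)

lemma directional_sum:
  assumes "\<And>i. i \<in> A \<Longrightarrow> P i \<in> exp_poly"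
  shows "directional v (\<lambda>x. \<Sum>i\<in>A. P i x) = (\<lambda>x. \<Sum>i\<in>A. directional v (P i) x)"
  using assms
  by (induction A rule: infinite_finite_induct)
    (simp_all add: directional_const directional_add exp_poly_sum)

lemma directional_affine:
  assumes "P \<in> exp_poly"
  shows "directional v (\<lambda>y. P (A *v y + p)) = (\<lambda>y. directional (A *v v) P (A *v y + p))"
proof (rule directional_eqI)
  fix x
  show "((\<lambda>t. P (A *v (x + t *s v) + p)) has_field_derivative directional (A *v v) P (A *v x + p)) (at 0)"
    using exp_poly_has_directional_at[OF assms, of "A *v x + p" "A *v v"]
    by (simp add: matrix_vector_right_distrib vector_scalar_commute algebra_simps)
qed

lemma directional_scale_vector:
  "P \<in> exp_poly \<Longrightarrow> directional (a *s v) P x = a * directional v P x"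
proof -
  assume P: "P \<in> exp_poly"
  have "((\<lambda>t. P (x + (a * t) *s v)) has_field_derivative directional v P x * a) (at 0)"
    by (rule DERIV_chain2[where g = "\<lambda>t. a * t"])
      (auto intro!: derivative_eq_intros simp: exp_poly_has_directional_at[OF P])
  then show ?thesis
    by (simp add: directional_def DERIV_imp_deriv vector_smult_assoc mult.commute)
qed

text \<open>Two points are joined by a complex line on which the function is entire in one variable;
  the identity theorem carries vanishing near one point over to the other.\<close>

lemma exp_poly_nonzero_dense:
  assumes "P \<in> exp_poly" "P y \<noteq> 0" "open U" "x \<in> U"
  shows "\<exists>z\<in>U. P z \<noteq> 0"
proof (rule ccontr)
  assume "\<not> (\<exists>z\<in>U. P z \<noteq> 0)"
  then have zero: "\<And>z. z \<in> U \<Longrightarrow> P z = 0" by blast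
  let ?l = "\<lambda>t. x + t *s (y - x)"
  have "continuous_on UNIV ?l" by (simp add: vector_scalar_mult_def) (intro continuous_intros continuous_on_vec_lambda)
  then have op: "open (?l -` U)" using assms(3) by (simp add: open_vimage)
  have "0 islimpt (?l -` U)" using op assms(4) by (intro interior_limit_point) (simp add: interior_open)
  then have "P (?l 1) = 0"
    by (rule analytic_continuation[OF exp_poly_line_holomorphic[OF assms(1)] open_UNIV connected_UNIV
          subset_UNIV UNIV_I]) (auto simp: zero)
  with assms(2) show False by simp
qed

lemma exp_poly_mult_eq_0:
  assumes "P \<in> exp_poly" "Q \<in> exp_poly" "\<And>x. P x * Q x = 0" "P y \<noteq> 0"
  shows "Q x = 0"
proof (rule ccontr)
  assume "Q x \<noteq> 0"
  moreover have "open {z. P z \<noteq> 0}"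
    using exp_poly_continuous[OF assms(1)] by (intro open_Collect_neq continuous_on_const)
  ultimately obtain z where "P z \<noteq> 0" "Q z \<noteq> 0"
    using exp_poly_nonzero_dense[OF assms(2)] assms(4) by blast
  with assms(3)[of z] show False by simp
qed

text \<open>\<open>D * (P - Q)\<close> is zero and there are no zero divisors. With \<open>D\<close>
  a discriminant, this promotes formulas valid off finitely many hypersurfaces to
  identities.\<close>

lemma exp_poly_eqI:
  assumes "P \<in> exp_poly" "Q \<in> exp_poly" "D \<in> exp_poly" "D y \<noteq> 0"
    and "\<And>x. D x \<noteq> 0 \<Longrightarrow> P x = Q x"
  shows "P = Q"
proof
  fix x
  have "P x - Q x = 0"
    using exp_poly_mult_eq_0[of D "\<lambda>x. P x - Q x" y x] assms by (auto intro: exp_poly_diff)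
  then show "P x = Q x" by simp
qed

lemma exp_poly_prod_nonzero:
  assumes "finite A" "\<And>i. i \<in> A \<Longrightarrow> P i \<in> exp_poly" "\<And>i. i \<in> A \<Longrightarrow> \<exists>y. P i y \<noteq> 0"
  shows "\<exists>y. (\<Prod>i\<in>A. P i y) \<noteq> 0"
  using assms
proof (induction A)
  case (insert i A)
  then obtain y where y: "(\<Prod>i\<in>A. P i y) \<noteq> 0" by auto
  show ?case
  proof (rule ccontr)
    assume "\<not> ?thesis"
    then have "(\<Prod>i\<in>A. P i x) * P i x = 0" for x
      using insert(1,2) by (metis prod.insert mult.commute)
    then have "P i x = 0" for x
      using exp_poly_mult_eq_0[of "\<lambda>x. \<Prod>i\<in>A. P i x" "P i" y x] insert y
      by (auto intro: exp_poly_prod)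
    with insert(5) show False by blast
  qed
qed auto

section \<open>Orders of vanishing at the origin\<close>

text \<open>The bound plays the role of the k-th power of the maximal ideal at the origin. It makes
  sense for arbitrary functions, so it also covers errors that are set to 0 on a hypersurface by a
  case distinction.\<close>

definition vanishes_to :: "nat \<Rightarrow> (complex^'n \<Rightarrow> complex) \<Rightarrow> bool" where
  "vanishes_to k h \<longleftrightarrow> (\<exists>C r. 0 \<le> C \<and> 0 < r \<and> (\<forall>y. norm y < r \<longrightarrow> cmod (h y) \<le> C * norm y ^ k))"

lemma vanishes_toI:
  "0 < r \<Longrightarrow> (\<And>y. norm y < r \<Longrightarrow> cmod (h y) \<le> C * norm y ^ k) \<Longrightarrow> vanishes_to k h"
  unfolding vanishes_to_def
  by (rule exI[of _ "\<bar>C\<bar>"], rule exI[of _ r])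
    (auto intro: order_trans[OF _ mult_right_mono[OF abs_ge_self]])

lemma vanishes_toE:
  assumes "vanishes_to k h"
  obtains C r where "0 \<le> C" "0 < r" "\<And>y. norm y < r \<Longrightarrow> cmod (h y) \<le> C * norm y ^ k"
  using assms unfolding vanishes_to_def by blast

lemma vanishes_to_zero: "vanishes_to k (\<lambda>y. 0)"
  by (rule vanishes_toI[of 1 _ 0]) auto

lemma vanishes_to_add:
  assumes "vanishes_to k g" "vanishes_to k h"
  shows "vanishes_to k (\<lambda>y. g y + h y)"
proof -
  obtain C r where 1: "0 \<le> C" "0 < r" "\<And>y. norm y < r \<Longrightarrow> cmod (g y) \<le> C * norm y ^ k"
    using assms(1) by (rule vanishes_toE) blast
  obtain D s where 2: "0 \<le> D" "0 < s" "\<And>y. norm y < s \<Longrightarrow> cmod (h y) \<le> D * norm y ^ k"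
    using assms(2) by (rule vanishes_toE) blast
  show ?thesis
  proof (rule vanishes_toI[of "min r s" _ "C + D"])
    fix y :: "complex^'a" assume "norm y < min r s"
    then have "cmod (g y) \<le> C * norm y ^ k" "cmod (h y) \<le> D * norm y ^ k" using 1 2 by auto
    then show "cmod (g y + h y) \<le> (C + D) * norm y ^ k"
      using norm_triangle_ineq[of "g y" "h y"] by (simp add: algebra_simps)
  qed (use 1 2 in auto)
qed

lemma vanishes_to_mult:
  assumes "vanishes_to k g" "vanishes_to l h"
  shows "vanishes_to (k + l) (\<lambda>y. g y * h y)"
proof -
  obtain C r where 1: "0 \<le> C" "0 < r" "\<And>y. norm y < r \<Longrightarrow> cmod (g y) \<le> C * norm y ^ k"
    using assms(1) by (rule vanishes_toE) blast
  obtain D s where 2: "0 \<le> D" "0 < s" "\<And>y. norm y < s \<Longrightarrow> cmod (h y) \<le> D * norm y ^ l"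
    using assms(2) by (rule vanishes_toE) blast
  show ?thesis
  proof (rule vanishes_toI[of "min r s" _ "C * D"])
    fix y :: "complex^'a" assume "norm y < min r s"
    then have "cmod (g y) \<le> C * norm y ^ k" "cmod (h y) \<le> D * norm y ^ l" using 1 2 by auto
    then have "cmod (g y) * cmod (h y) \<le> (C * norm y ^ k) * (D * norm y ^ l)"
      using 1 by (intro mult_mono) auto
    then show "cmod (g y * h y) \<le> (C * D) * norm y ^ (k + l)"
      by (simp add: norm_mult power_add algebra_simps)
  qed (use 1 2 in auto)
qed

lemma vanishes_to_mono:
  assumes "vanishes_to l h" "k \<le> l"
  shows "vanishes_to k h"
proof -
  obtain C r where 1: "0 \<le> C" "0 < r" "\<And>y. norm y < r \<Longrightarrow> cmod (h y) \<le> C * norm y ^ l"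
    using assms(1) by (rule vanishes_toE) blast
  show ?thesis
  proof (rule vanishes_toI[of "min r 1" _ C])
    fix y :: "complex^'a" assume "norm y < min r 1"
    then have "cmod (h y) \<le> C * norm y ^ l" "norm y ^ l \<le> norm y ^ k"
      using 1 assms(2) by (auto intro: power_decreasing)
    then show "cmod (h y) \<le> C * norm y ^ k" using 1(1) by (meson mult_left_mono order_trans)
  qed (use 1 in auto)
qed

lemma vanishes_to_continuous:
  assumes "continuous_on UNIV h"
  shows "vanishes_to 0 h"
proof -
  have "isCont h 0" using assms by (simp add: continuous_on_eq_continuous_at)
  then obtain d where d: "d > 0" "\<And>y. dist y 0 < d \<Longrightarrow> dist (h y) (h 0) < 1"
    unfolding continuous_at_eps_delta by (meson zero_less_one)
  show ?thesis
  proof (rule vanishes_toI[of d _ "cmod (h 0) + 1"])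
    fix y :: "complex^'a" assume "norm y < d"
    then have "cmod (h y - h 0) < 1" using d(2)[of y] by (simp add: dist_norm)
    then show "cmod (h y) \<le> (cmod (h 0) + 1) * norm y ^ 0"
      using norm_triangle_ineq2[of "h y" "h 0"] by simp
  qed (use d in auto)
qed

lemma vanishes_to_exp_poly: "P \<in> exp_poly \<Longrightarrow> vanishes_to 0 P"
  by (intro vanishes_to_continuous exp_poly_continuous)

lemma vanishes_to_mult_bounded:
  "vanishes_to 0 g \<Longrightarrow> vanishes_to k h \<Longrightarrow> vanishes_to k (\<lambda>y. g y * h y)"
  using vanishes_to_mult[of 0 g k h] by simp

lemma vanishes_to_scale: "vanishes_to k h \<Longrightarrow> vanishes_to k (\<lambda>y. a * h y)"
  by (intro vanishes_to_mult_bounded vanishes_to_continuous continuous_intros)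

lemma vanishes_to_minus: "vanishes_to k h \<Longrightarrow> vanishes_to k (\<lambda>y. - h y)"
  using vanishes_to_scale[of k h "-1"] by simp

lemma vanishes_to_diff: "vanishes_to k g \<Longrightarrow> vanishes_to k h \<Longrightarrow> vanishes_to k (\<lambda>y. g y - h y)"
  using vanishes_to_add[OF _ vanishes_to_minus[of k h]] by simp

lemma vanishes_to_sum:
  "(\<And>i. i \<in> A \<Longrightarrow> vanishes_to k (h i)) \<Longrightarrow> vanishes_to k (\<lambda>y. \<Sum>i\<in>A. h i y)"
  by (induction A rule: infinite_finite_induct) (auto intro: vanishes_to_zero vanishes_to_add)

lemma vanishes_to_form: "linear_form \<mu> \<Longrightarrow> vanishes_to 1 \<mu>"
  by (metis linear_form_bounded vanishes_toI zero_less_one power_one_right)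

lemma vanishes_to_comp_matrix:
  assumes "vanishes_to k h"
  shows "vanishes_to k (\<lambda>y. h (A *v y))"
proof -
  obtain C r where 1: "0 \<le> C" "0 < r" "\<And>y. norm y < r \<Longrightarrow> cmod (h y) \<le> C * norm y ^ k"
    using assms by (rule vanishes_toE) blast
  have "bounded_linear ((*v) A)" by (rule matrix_vector_mul_bounded_linear)
  then obtain K where K: "K > 0" "\<And>y. norm (A *v y) \<le> norm y * K"
    using bounded_linear.pos_bounded by blast
  show ?thesis
  proof (rule vanishes_toI[of "r / K" _ "C * K ^ k"])
    fix y :: "complex^'b" assume "norm y < r / K"
    then have "norm y * K < r" using K by (simp add: field_simps)
    then have "norm (A *v y) < r" using K(2)[of y] by linarith
    then have "cmod (h (A *v y)) \<le> C * norm (A *v y) ^ k" using 1 by blast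
    also have "\<dots> \<le> C * (norm y * K) ^ k" using 1 K by (intro mult_left_mono power_mono) auto
    finally show "cmod (h (A *v y)) \<le> (C * K ^ k) * norm y ^ k"
      by (simp add: power_mult_distrib algebra_simps)
  qed (use 1 K in auto)
qed

lemma vanishes_to_at_0: "vanishes_to 1 h \<Longrightarrow> h 0 = 0"
  by (erule vanishes_toE) (metis mult_zero_right norm_le_zero_iff norm_zero power_one_right)

text \<open>Where the estimate fails, it fails on an open set, and a nonempty open set contains
  points with \<open>D \<noteq> 0\<close>.\<close>

lemma vanishes_to_dense:
  assumes "continuous_on UNIV h" "D \<in> exp_poly" "D z \<noteq> 0" "0 < r"
    and "\<And>y. norm y < r \<Longrightarrow> D y \<noteq> 0 \<Longrightarrow> cmod (h y) \<le> C * norm y ^ k"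
  shows "vanishes_to k h"
proof (rule vanishes_toI[OF assms(4)], rule ccontr)
  fix y :: "complex^'a" assume y: "norm y < r" "\<not> cmod (h y) \<le> C * norm y ^ k"
  let ?U = "{y. norm y < r} \<inter> {y. C * norm y ^ k < cmod (h y)}"
  have "open ?U"
    by (intro open_Int open_Collect_less continuous_intros assms(1))
  with y assms obtain u where "u \<in> ?U" "D u \<noteq> 0"
    using exp_poly_nonzero_dense[of D z ?U y] by auto
  with assms(5)[of u] show False by simp
qed

text \<open>Cauchy's inequality on the line through \<open>y\<close> in direction \<open>v\<close>,
  with radius proportional to \<open>norm y\<close>: division by the radius costs exactly one
  order.\<close>

lemma vanishes_to_directional:
  fixes P :: "complex^'a \<Rightarrow> complex"
  assumes "P \<in> exp_poly" "vanishes_to (Suc k) P"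
  shows "vanishes_to k (directional v P)"
proof -
  obtain C r where 1: "0 \<le> C" "0 < r" "\<And>y. norm y < r \<Longrightarrow> cmod (P y) \<le> C * norm y ^ Suc k"
    using assms(2) by (rule vanishes_toE) blast
  \<comment> \<open>At \<open>y = 0\<close> the radius degenerates, so the estimate is shown where a
    fixed coordinate is nonzero and extended by density.\<close>
  fix i :: 'a
  show ?thesis
  proof (rule vanishes_to_dense[where D = "\<lambda>y. y $ i" and z = "axis i 1" and r = "r / 2"
        and C = "C * 2 ^ Suc k * (norm v + 1)"])
    show "continuous_on UNIV (directional v P)"
      by (intro exp_poly_continuous exp_poly_directional assms)
    fix y :: "complex^'a" assume y: "norm y < r / 2" "y $ i \<noteq> 0"
    then have y0: "norm y > 0" by (auto simp: norm_eq_zero)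
    \<comment> \<open>The summand 1 guards against \<open>v = 0\<close>; moving \<open>y\<close> by
      a parameter of this size changes it by at most \<open>norm y\<close>.\<close>
    define R where "R = norm y / (norm v + 1)"
    have v1: "norm v + 1 > 0" by (simp add: add_nonneg_pos)
    have R: "R > 0" using y0 v1 by (simp add: R_def)
    have "norm ((deriv ^^ 1) (\<lambda>t. P (y + t *s v)) 0) \<le> fact 1 * (C * (2 * norm y) ^ Suc k) / R ^ 1"
    proof (rule Cauchy_inequality[OF _ _ R])
      show "(\<lambda>t. P (y + t *s v)) holomorphic_on ball 0 R"
        by (rule exp_poly_line_holomorphic[OF assms(1)])
      show "continuous_on (cball 0 R) (\<lambda>t. P (y + t *s v))"
        by (rule holomorphic_on_imp_continuous_on[OF exp_poly_line_holomorphic[OF assms(1)]])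
      fix t :: complex assume "norm (0 - t) = R"
      then have "norm (t *s v) = R * norm v" by (simp add: norm_vec_scale)
      also have "\<dots> \<le> R * (norm v + 1)" using R by (intro mult_left_mono) auto
      also have "\<dots> = norm y" using v1 by (simp add: R_def)
      finally have n: "norm (y + t *s v) \<le> 2 * norm y"
        using norm_triangle_ineq[of y "t *s v"] by simp
      then have "cmod (P (y + t *s v)) \<le> C * norm (y + t *s v) ^ Suc k" using 1 y by auto
      also have "\<dots> \<le> C * (2 * norm y) ^ Suc k" using n 1 by (intro mult_left_mono power_mono) auto
      finally show "norm (P (y + t *s v)) \<le> C * (2 * norm y) ^ Suc k" .
    qed
    then have "cmod (directional v P y) \<le> C * (2 * norm y) ^ Suc k / R" by (simp add: directional_def)
    also have "\<dots> = C * 2 ^ Suc k * (norm v + 1) * norm y ^ k"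
      using y0 v1 by (simp add: R_def power_mult_distrib field_simps)
    finally show "cmod (directional v P y) \<le> C * 2 ^ Suc k * (norm v + 1) * norm y ^ k" .
  qed (use 1 in \<open>auto intro: exp_poly.form linear_form_coord\<close>)
qed

text \<open>The difference is controlled by the derivative on the segment from \<open>y\<close> to
  \<open>y - \<mu> y *s a\<close>, whose length is proportional to \<open>cmod (\<mu> y)\<close>.
  Since this factor stays explicit, division by \<open>\<mu> y\<close> is possible later, and the
  reflection part of a Dunkl operator loses only one order.\<close>

lemma vanishes_to_divided_difference:
  fixes P :: "complex^'n \<Rightarrow> complex"
  assumes "P \<in> exp_poly" "vanishes_to (Suc k) P" "linear_form \<mu>"
  obtains C r where "0 < r" "\<And>y. norm y < r \<Longrightarrow> cmod (P y - P (y - \<mu> y *s a)) \<le> cmod (\<mu> y) * (C * norm y ^ k)"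
proof -
  obtain C r where 1: "0 \<le> C" "0 < r" "\<And>y. norm y < r \<Longrightarrow> cmod (directional a P y) \<le> C * norm y ^ k"
    using vanishes_to_directional[OF assms(1,2), of a] by (rule vanishes_toE) blast
  obtain K where K: "K \<ge> 0" "\<And>x. cmod (\<mu> x) \<le> K * norm x" using linear_form_bounded[OF assms(3)] by blast
  define M where "M = 1 + K * norm a"
  have M: "M > 0" using K by (simp add: M_def add_pos_nonneg)
  show thesis
  proof (rule that[of "r / M" "C * M ^ k"])
    show "0 < r / M" using 1 M by simp
    fix y :: "complex^'n" assume "norm y < r / M"
    then have y: "M * norm y < r" using M by (simp add: field_simps)
    have b: "cmod (directional a P (y + t *s a)) \<le> C * (M * norm y) ^ k"
      if "t \<in> closed_segment 0 (- \<mu> y)" for t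
    proof -
      have "cmod t \<le> cmod (\<mu> y)" using segment_bound[OF that] by simp
      also have "\<dots> \<le> K * norm y" by (rule K)
      finally have "norm (t *s a) \<le> K * norm y * norm a"
        by (simp add: norm_vec_scale mult_right_mono)
      then have n: "norm (y + t *s a) \<le> M * norm y"
        using norm_triangle_ineq[of y "t *s a"] by (simp add: M_def algebra_simps)
      then have "cmod (directional a P (y + t *s a)) \<le> C * norm (y + t *s a) ^ k" using 1 y by auto
      also have "\<dots> \<le> C * (M * norm y) ^ k" using n 1 by (intro mult_left_mono power_mono) auto
      finally show ?thesis .
    qed
    have "norm (P (y + 0 *s a) - P (y + (- \<mu> y) *s a)) \<le> C * (M * norm y) ^ k * norm (0 - (- \<mu> y))"
      by (rule field_differentiable_bound[OF convex_closed_segment[of 0 "- \<mu> y"] _ b])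
        (auto intro!: DERIV_subset[OF exp_poly_has_field_derivative[OF assms(1)]])
    then show "cmod (P y - P (y - \<mu> y *s a)) \<le> cmod (\<mu> y) * (C * M ^ k * norm y ^ k)"
      by (simp add: power_mult_distrib mult_ac)
  qed
qed

section \<open>Taylor polynomials of holomorphic functions\<close>

lemma holomorphic_taylor:
  assumes "\<phi> holomorphic_on ball 0 \<rho>" "0 < \<rho>"
  shows "\<exists>p C r. 0 < r \<and> (\<forall>z. cmod z < r \<longrightarrow> cmod (\<phi> z - poly p z) \<le> C * cmod z ^ k)"
  using assms(1)
proof (induction k arbitrary: \<phi>)
  case 0
  have "continuous_on (cball 0 (\<rho> / 2)) \<phi>"
    by (rule continuous_on_subset[OF holomorphic_on_imp_continuous_on[OF 0]])
      (use assms(2) in auto)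
  then have "bounded (\<phi> ` cball 0 (\<rho> / 2))"
    by (intro compact_imp_bounded compact_continuous_image compact_cball)
  then obtain C where "\<And>z. z \<in> cball 0 (\<rho> / 2) \<Longrightarrow> cmod (\<phi> z) \<le> C"
    unfolding bounded_iff by blast
  then show ?case using assms(2)
    by (intro exI[of _ 0] exI[of _ C] exI[of _ "\<rho> / 2"]) auto
next
  case (Suc k)
  \<comment> \<open>The difference quotient at 0 with its removable singularity filled in; a
    polynomial for it to order \<open>k\<close> gives one for \<open>\<phi>\<close> to order
    \<open>Suc k\<close>.\<close>
  define \<psi> where "\<psi> = (\<lambda>z. if z = 0 then deriv \<phi> 0 else (\<phi> z - \<phi> 0) / (z - 0))"
  have "\<psi> holomorphic_on ball 0 \<rho>"
    unfolding \<psi>_def by (rule pole_lemma_open[OF Suc.prems open_ball])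
  then obtain p C r where p: "0 < r" "\<And>z. cmod z < r \<Longrightarrow> cmod (\<psi> z - poly p z) \<le> C * cmod z ^ k"
    using Suc.IH by blast
  have "cmod (\<phi> z - poly (pCons (\<phi> 0) p) z) \<le> C * cmod z ^ Suc k" if "cmod z < r" for z
  proof -
    have "\<phi> z - poly (pCons (\<phi> 0) p) z = z * (\<psi> z - poly p z)"
      by (cases "z = 0") (auto simp: \<psi>_def field_simps)
    then have "cmod (\<phi> z - poly (pCons (\<phi> 0) p) z) = cmod z * cmod (\<psi> z - poly p z)"
      by (simp add: norm_mult)
    also have "\<dots> \<le> cmod z * (C * cmod z ^ k)" by (intro mult_left_mono p that) auto
    finally show ?thesis by (simp add: mult_ac)
  qed
  with p(1) show ?case by blast
qed

text \<open>Orders in one variable become orders in \<open>y\<close>, as \<open>u y\<close> is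
  bounded by a multiple of \<open>norm y\<close>. The inner function will be a linear form, a
  denominator minus its value, or the equation of a hypertorus.\<close>

lemma holomorphic_taylor_compose:
  assumes "\<phi> holomorphic_on ball 0 \<rho>" "0 < \<rho>" "vanishes_to 1 u"
  shows "\<exists>p. vanishes_to k (\<lambda>y. \<phi> (u y) - poly p (u y))"
proof -
  obtain p C r where p: "0 < r" "\<And>z. cmod z < r \<Longrightarrow> cmod (\<phi> z - poly p z) \<le> C * cmod z ^ k"
    using holomorphic_taylor[OF assms(1,2)] by blast
  obtain D s where u: "0 \<le> D" "0 < s" "\<And>y. norm y < s \<Longrightarrow> cmod (u y) \<le> D * norm y ^ 1"
    using assms(3) by (rule vanishes_toE) blast
  have "vanishes_to k (\<lambda>y. \<phi> (u y) - poly p (u y))"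
  proof (rule vanishes_toI[of "min s (r / (D + 1))" _ "\<bar>C\<bar> * D ^ k"])
    show "0 < min s (r / (D + 1))" using u p by simp
    fix y :: "complex^'a" assume y: "norm y < min s (r / (D + 1))"
    then have uy: "cmod (u y) \<le> D * norm y" using u by auto
    also have "\<dots> \<le> (D + 1) * norm y" by (simp add: algebra_simps)
    also have "\<dots> < r" using y u by (simp add: field_simps)
    finally have "cmod (\<phi> (u y) - poly p (u y)) \<le> C * cmod (u y) ^ k" by (rule p)
    also have "\<dots> \<le> \<bar>C\<bar> * cmod (u y) ^ k" by (intro mult_right_mono) auto
    also have "\<dots> \<le> \<bar>C\<bar> * (D * norm y) ^ k" using uy by (intro mult_left_mono power_mono) auto
    finally show "cmod (\<phi> (u y) - poly p (u y)) \<le> \<bar>C\<bar> * D ^ k * norm y ^ k"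
      by (simp add: power_mult_distrib mult_ac)
  qed
  then show ?thesis by blast
qed

section \<open>Finite groups acting on a lattice\<close>

definition expi :: "complex \<Rightarrow> complex" where
  "expi z = exp (2 * of_real pi * \<i> * z)"

lemma expi_add: "expi (a + b) = expi a * expi b"
  by (simp add: expi_def exp_add distrib_left)

lemma expi_minus: "expi (- a) = inverse (expi a)"
  by (simp add: expi_def exp_minus)

lemma expi_diff: "expi (a - b) = expi a / expi b"
  by (simp add: expi_def exp_diff right_diff_distrib)

lemma expi_0 [simp]: "expi 0 = 1"
  by (simp add: expi_def)

lemma expi_nonzero [simp]: "expi z \<noteq> 0"
  by (simp add: expi_def)

lemma continuous_on_expi [continuous_intros]: "continuous_on S g \<Longrightarrow> continuous_on S (\<lambda>x. expi (g x))"
  unfolding expi_def by (intro continuous_intros)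

lemma expi_eq_1_iff: "expi z = 1 \<longleftrightarrow> z \<in> \<int>"
proof
  assume "expi z = 1"
  then obtain n :: int where n: "Re (2 * of_real pi * \<i> * z) = 0"
    "Im (2 * of_real pi * \<i> * z) = of_int (2 * n) * pi" unfolding expi_def exp_eq_1 by blast
  then have "z = of_int n" by (simp add: complex_eq_iff)
  then show "z \<in> \<int>" by simp
next
  assume "z \<in> \<int>"
  then obtain n :: int where "z = of_int n" by (elim Ints_cases)
  then show "expi z = 1" unfolding expi_def exp_eq_1 by (intro conjI exI[of _ n]) auto
qed

text \<open>The least positive element generates, by division with remainder. The set is taken in
  the complex numbers because values of complex linear forms are to be normalized.\<close>

lemma Ints_subgroup_cyclic:
  fixes S :: "complex set"
  assumes "S \<subseteq> \<int>" "0 \<in> S" "\<And>x y. x \<in> S \<Longrightarrow> y \<in> S \<Longrightarrow> x - y \<in> S"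
  shows "\<exists>d\<in>S. S = range (\<lambda>m :: int. of_int m * d)"
proof -
  have minus: "- x \<in> S" if "x \<in> S" for x using assms(3)[OF assms(2) that] by simp
  have add: "x + y \<in> S" if "x \<in> S" "y \<in> S" for x y using assms(3)[OF that(1) minus[OF that(2)]] by simp
  have natmult: "of_nat k * x \<in> S" if "x \<in> S" for k x
    by (induction k) (auto simp: assms(2) algebra_simps intro: add that)
  have intmult: "of_int k * x \<in> S" if "x \<in> S" for k x
    by (cases k) (use natmult[OF that] minus in \<open>auto simp del: of_nat_Suc simp: algebra_simps\<close>)
  show ?thesis
  proof (cases "S = {0}")
    case True
    then show ?thesis by auto
  next
    case False
    then obtain x where x: "x \<in> S" "x \<noteq> 0" using assms(2) by blast
    then obtain i :: int where i: "x = of_int i" using assms(1) by (meson Ints_cases subsetD)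
    have "\<exists>n>0. of_nat n \<in> S"
    proof (cases "i > 0")
      case True
      then show ?thesis using x i by (intro exI[of _ "nat i"]) auto
    next
      case False
      then show ?thesis using x i minus[OF x(1)] by (intro exI[of _ "nat (- i)"]) auto
    qed
    define n where "n = (LEAST n. n > 0 \<and> (of_nat n :: complex) \<in> S)"
    have n: "n > 0" "(of_nat n :: complex) \<in> S"
      using LeastI_ex[OF \<open>\<exists>n>0. of_nat n \<in> S\<close>] by (auto simp: n_def)
    have least: "n \<le> m" if "m > 0" "(of_nat m :: complex) \<in> S" for m
      unfolding n_def using that by (intro Least_le) auto
    have "x \<in> range (\<lambda>m :: int. of_int m * of_nat n)" if xS: "x \<in> S" for x
    proof -
      obtain i :: int where i: "x = of_int i" using assms(1) xS by (meson Ints_cases subsetD)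
      have "x - of_int (i div int n) * of_nat n \<in> S" by (intro assms(3) xS intmult n)
      moreover have "x - of_int (i div int n) * of_nat n = of_int (i mod int n)"
        by (simp add: i minus_div_mult_eq_mod[symmetric])
      moreover have "of_int (i mod int n) = (of_nat (nat (i mod int n)) :: complex)"
        using n by simp
      ultimately have "(of_nat (nat (i mod int n)) :: complex) \<in> S" by simp
      moreover have "nat (i mod int n) < n" using n by (simp add: nat_less_iff)
      ultimately have "nat (i mod int n) = 0" using least by (metis leD not_gr_zero)
      then have "i mod int n = 0" using n pos_mod_sign[of "int n" i] by linarith
      then have "i = (i div int n) * int n" by (metis add.right_neutral div_mult_mod_eq)
      then have "x = of_int (i div int n) * of_nat n" by (metis i of_int_mult of_int_of_nat_eq)
      then show ?thesis by blast
    qed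
    then show ?thesis using n intmult by (intro bexI[of _ "of_nat n"]) auto
  qed
qed

text \<open>The coordinates are the rows of the inverse of the matrix whose columns form a lattice
  basis.\<close>

lemma lattice_coordinates:
  assumes "lattice (L :: (complex^'n) set)"
  shows "\<exists>\<nu> (b :: 'n \<Rightarrow> complex^'n). (\<forall>i. linear_form (\<nu> i)) \<and> (\<forall>x. x \<in> L \<longleftrightarrow> (\<forall>i. \<nu> i x \<in> \<int>)) \<and>
    (\<forall>x. x = (\<Sum>i\<in>UNIV. \<nu> i x *s b i)) \<and> (\<forall>i j. \<nu> i (b j) = (if i = j then 1 else 0))"
proof -
  obtain b :: "'n \<Rightarrow> complex^'n" where b: "vec.span (range b) = UNIV"
    and L: "L = range (\<lambda>m :: 'n \<Rightarrow> int. \<Sum>i\<in>UNIV. of_int (m i) *s b i)"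
    using assms unfolding lattice_def by blast
  define B :: "complex^'n^'n" where "B = transpose (\<chi> i. b i)"
  have Bx: "B *v x = (\<Sum>i\<in>UNIV. x $ i *s b i)" for x
    by (simp add: B_def matrix_vector_mult_def vec_eq_iff transpose_def mult.commute)
  have "columns B = range b"
    by (auto simp: columns_def column_def B_def transpose_def)
  then obtain C where C: "B ** C = mat 1" using b matrix_right_invertible_span_columns[of B] by auto
  then have CB: "C ** B = mat 1" by (simp add: matrix_left_right_inverse)
  define \<nu> where "\<nu> = (\<lambda>i x. (C *v x) $ i)"
  have lin: "linear_form (\<nu> i)" for i
    unfolding \<nu>_def by (rule linear_form_comp_matrix[OF linear_form_coord])
  have ex: "x = (\<Sum>i\<in>UNIV. \<nu> i x *s b i)" for x
    using Bx[of "C *v x"] C by (simp add: \<nu>_def matrix_vector_mul_assoc)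
  have co: "\<nu> i (\<Sum>i\<in>UNIV. m i *s b i) = m i" for i m
  proof -
    have "C *v (B *v (\<chi> i. m i)) = (\<chi> i. m i)" by (simp add: matrix_vector_mul_assoc CB)
    then show ?thesis by (simp add: \<nu>_def Bx)
  qed
  have "x \<in> L \<longleftrightarrow> (\<forall>i. \<nu> i x \<in> \<int>)" for x
  proof
    assume "x \<in> L"
    then show "\<forall>i. \<nu> i x \<in> \<int>" unfolding L by (auto simp: co)
  next
    assume "\<forall>i. \<nu> i x \<in> \<int>"
    then obtain m :: "'n \<Rightarrow> int" where "\<And>i. \<nu> i x = of_int (m i)" unfolding Ints_def image_def by (auto, metis)
    then have "x = (\<Sum>i\<in>UNIV. of_int (m i) *s b i)" using ex[of x] by simp
    then show "x \<in> L" unfolding L by blast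
  qed
  moreover have "\<nu> i (b j) = (if i = j then 1 else 0)" for i j
  proof -
    have "b j = (\<Sum>k\<in>UNIV. (if k = j then 1 else 0) *s b k)"
      by (simp add: if_distrib[of "\<lambda>c. c *s _"] cong: if_cong)
    then show ?thesis using co[of i "\<lambda>k. if k = j then 1 else 0"] by metis
  qed
  ultimately show ?thesis using lin ex by (intro exI[of _ \<nu>] exI[of _ b]) simp
qed

lemma in_coset_iff: "z \<in> coset L x \<longleftrightarrow> z - x \<in> L"
  unfolding coset_def by (auto intro: image_eqI[where x = "z - x"])

text \<open>The form \<open>\<mu>\<close> is primitive in the dual lattice, whereas the root of
  \<open>s\<close> is \<open>\<mu>\<close> or \<open>2 * \<mu>\<close> up to sign. The primitive
  form is the one whose values modulo the integers distinguish the components of the fixed set of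
  \<open>s\<close>.\<close>

definition reflection_data ::
    "(complex^'n) set \<Rightarrow> complex^'n^'n \<Rightarrow> (complex^'n \<Rightarrow> complex) \<Rightarrow> complex^'n \<Rightarrow> bool" where
  "reflection_data L s \<mu> a \<longleftrightarrow>
     \<mu> \<in> dual_lattice L \<and> (\<exists>l\<in>L. \<mu> l = 1) \<and> a \<in> L \<and> \<mu> a = 2 \<and> (\<forall>x. s *v x = x - \<mu> x *s a)"

lemma rank_1_factor:
  assumes "rank (A :: complex^'n^'n) = 1"
  obtains u \<rho> where "linear_form \<rho>" "\<And>x. A *v x = \<rho> x *s u" "u \<noteq> 0" "\<exists>x. \<rho> x \<noteq> 0"
proof -
  have "vec.dim (rows A) = 1" using assms by (simp add: row_rank_def_gen)
  then obtain B where B: "B \<subseteq> rows A" "vec.independent B" "rows A \<subseteq> vec.span B" "card B = 1"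
    using vec.basis_exists[of "rows A"] by metis
  then obtain r where r: "B = {r}" by (meson card_1_singletonE)
  then have r0: "r \<noteq> 0" using B(2) vec.dependent_zero by blast
  obtain i0 where i0: "r = row i0 A" using B(1) r by (auto simp: rows_def)
  have "\<exists>k. row i A = k *s r" for i
  proof -
    have "row i A \<in> vec.span {r}" using B(3) r by (auto simp: rows_def)
    then show ?thesis by (auto simp: vec.span_singleton)
  qed
  then obtain k where k: "\<And>i. row i A = k i *s r" by metis
  define \<rho> where "\<rho> = (\<lambda>x :: complex^'n. \<Sum>j\<in>UNIV. r $ j * x $ j)"
  have "linear_form \<rho>"
    unfolding \<rho>_def by (simp add: linear_form_iff algebra_simps sum.distrib sum_distrib_left)
  moreover have "A *v x = \<rho> x *s (\<chi> i. k i)" for x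
  proof -
    have "A $ i $ j = k i * r $ j" for i j
      using k[of i] by (simp add: row_def vec_eq_iff)
    then show ?thesis
      by (simp add: matrix_vector_mult_def vec_eq_iff \<rho>_def sum_distrib_left sum_distrib_right mult_ac)
  qed
  moreover have "(\<chi> i. k i) \<noteq> 0"
  proof
    assume "(\<chi> i. k i) = 0"
    then have "k i0 = 0" by (simp add: vec_eq_iff)
    then show False using k[of i0] r0 i0 by simp
  qed
  moreover have "\<exists>x. \<rho> x \<noteq> 0"
  proof -
    obtain j where "r $ j \<noteq> 0" using r0 by (auto simp: vec_eq_iff)
    moreover have "\<rho> (axis j 1) = r $ j" by (simp add: \<rho>_def axis_def if_distrib cong: if_cong)
    ultimately show ?thesis by metis
  qed
  ultimately show thesis by (rule that)
qed

lemma rank_1I: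
  assumes "linear_form \<rho>" "\<And>x. (A :: complex^'n^'n) *v x = \<rho> x *s u" "u \<noteq> 0" "\<rho> x \<noteq> 0"
  shows "rank A = 1"
proof -
  obtain i where i: "u $ i \<noteq> 0" using assms(3) by (auto simp: vec_eq_iff)
  have ent: "row k A = u $ k *s (\<chi> j. \<rho> (axis j 1))" for k
  proof -
    have "A $ k $ j = \<rho> (axis j 1) * u $ k" for j
      using arg_cong[OF assms(2)[of "axis j 1"], of "\<lambda>v. v $ k"]
      by (simp add: matrix_vector_mult_def axis_def if_distrib cong: if_cong)
    then show ?thesis by (simp add: row_def vec_eq_iff mult.commute)
  qed
  have nz: "row i A \<noteq> 0"
  proof
    assume "row i A = 0"
    then have "\<And>j. \<rho> (axis j 1) = 0" using i ent[of i] by (simp add: vec_eq_iff)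
    then have "\<rho> x = 0" using linear_form_expand[OF assms(1), of x] by simp
    with assms(4) show False by simp
  qed
  have "rows A \<subseteq> vec.span {row i A}"
  proof
    fix v assume "v \<in> rows A"
    then obtain k where "v = row k A" by (auto simp: rows_def)
    then have "v = (u $ k / u $ i) *s row i A" using i by (simp add: ent vector_smult_assoc)
    then show "v \<in> vec.span {row i A}" by (auto simp: vec.span_singleton)
  qed
  then have "vec.dim (rows A) = 1"
    by (intro vec.dim_unique[of "{row i A}"]) (use nz in \<open>auto simp: rows_def\<close>)
  then show ?thesis by (simp add: row_rank_def_gen)
qed

text \<open>What the geometry of the torus uses of a Weyl group and its lattice.
  \<open>fixed_vector\<close> says that the reflection hyperplanes meet only in 0; it is the reason
  why a point on a maximal set of hypertori has integral roots that span.\<close>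

locale torus_reflection_group =
  fixes W :: "(complex^'n^'n) set" and L :: "(complex^'n) set"
  assumes finite_W: "finite W"
    and one_W: "mat 1 \<in> W"
    and mult_W: "a \<in> W \<Longrightarrow> b \<in> W \<Longrightarrow> a ** b \<in> W"
    and inv_W: "a \<in> W \<Longrightarrow> matrix_inv a \<in> W"
    and left_inverse_W: "a \<in> W \<Longrightarrow> matrix_inv a ** a = mat 1"
    and lattice_L: "lattice L"
    and stable_L: "stable_under W L"
    and fixed_vector: "(\<And>s. s \<in> reflections W \<Longrightarrow> s *v v = v) \<Longrightarrow> v = 0"
begin

lemma right_inverse_W: "a \<in> W \<Longrightarrow> a ** matrix_inv a = mat 1"
  using left_inverse_W matrix_left_right_inverse by blast

lemma inv_apply: "a \<in> W \<Longrightarrow> matrix_inv a *v (a *v x) = x"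
  by (simp add: matrix_vector_mul_assoc left_inverse_W)

lemma apply_inv: "a \<in> W \<Longrightarrow> a *v (matrix_inv a *v x) = x"
  by (simp add: matrix_vector_mul_assoc right_inverse_W)

lemma L_apply: "a \<in> W \<Longrightarrow> x \<in> L \<Longrightarrow> a *v x \<in> L"
  using stable_L unfolding stable_under_def by blast

lemma L_apply_iff: "a \<in> W \<Longrightarrow> a *v x \<in> L \<longleftrightarrow> x \<in> L"
  using L_apply[of a x] L_apply[of "matrix_inv a" "a *v x"] inv_W inv_apply by auto

definition coord :: "'n \<Rightarrow> complex^'n \<Rightarrow> complex" where
  "coord = (SOME \<nu>. \<exists>b. (\<forall>i. linear_form (\<nu> i)) \<and> (\<forall>x. x \<in> L \<longleftrightarrow> (\<forall>i. \<nu> i x \<in> \<int>)) \<and>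
    (\<forall>x. x = (\<Sum>i\<in>UNIV. \<nu> i x *s b i)) \<and> (\<forall>i j. \<nu> i (b j) = (if i = j then 1 else 0)))"

definition basis :: "'n \<Rightarrow> complex^'n" where
  "basis = (SOME b. (\<forall>i. linear_form (coord i)) \<and> (\<forall>x. x \<in> L \<longleftrightarrow> (\<forall>i. coord i x \<in> \<int>)) \<and>
    (\<forall>x. x = (\<Sum>i\<in>UNIV. coord i x *s b i)) \<and> (\<forall>i j. coord i (b j) = (if i = j then 1 else 0)))"

lemma coord_form: "linear_form (coord i)"
  and in_L_iff: "x \<in> L \<longleftrightarrow> (\<forall>i. coord i x \<in> \<int>)"
  and coord_expand: "x = (\<Sum>i\<in>UNIV. coord i x *s basis i)"
  and coord_basis: "coord i (basis j) = (if i = j then 1 else 0)"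
proof -
  have "\<exists>b. (\<forall>i. linear_form (coord i)) \<and> (\<forall>x. x \<in> L \<longleftrightarrow> (\<forall>i. coord i x \<in> \<int>)) \<and>
    (\<forall>x. x = (\<Sum>i\<in>UNIV. coord i x *s b i)) \<and> (\<forall>i j. coord i (b j) = (if i = j then 1 else 0))"
    unfolding coord_def by (rule someI_ex[OF lattice_coordinates[OF lattice_L]])
  then have *: "(\<forall>i. linear_form (coord i)) \<and> (\<forall>x. x \<in> L \<longleftrightarrow> (\<forall>i. coord i x \<in> \<int>)) \<and>
    (\<forall>x. x = (\<Sum>i\<in>UNIV. coord i x *s basis i)) \<and> (\<forall>i j. coord i (basis j) = (if i = j then 1 else 0))"
    unfolding basis_def by (rule someI_ex)
  show "linear_form (coord i)" using * by blast
  show "x \<in> L \<longleftrightarrow> (\<forall>i. coord i x \<in> \<int>)" using * by blast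
  show "x = (\<Sum>i\<in>UNIV. coord i x *s basis i)" using * by blast
  show "coord i (basis j) = (if i = j then 1 else 0)" using * by blast
qed

lemmas coord_simps = linear_form_simps[OF coord_form]

lemma L_zero: "0 \<in> L"
  and L_add: "x \<in> L \<Longrightarrow> y \<in> L \<Longrightarrow> x + y \<in> L"
  and L_diff: "x \<in> L \<Longrightarrow> y \<in> L \<Longrightarrow> x - y \<in> L"
  and L_minus: "x \<in> L \<Longrightarrow> - x \<in> L"
  and L_scale: "k \<in> \<int> \<Longrightarrow> x \<in> L \<Longrightarrow> k *s x \<in> L"
  by (auto simp: in_L_iff coord_simps)

lemma L_diff_commute: "x - y \<in> L \<longleftrightarrow> y - x \<in> L"
  using L_minus[of "x - y"] L_minus[of "y - x"] by auto

lemma linear_form_zero_on_L: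
  assumes "linear_form \<rho>" "\<And>l. l \<in> L \<Longrightarrow> \<rho> l = 0"
  shows "\<rho> x = 0"
proof -
  have "\<rho> (basis i) = 0" for i by (rule assms(2)) (auto simp: in_L_iff coord_basis)
  then show ?thesis by (subst coord_expand) (simp add: linear_form_sum linear_form_scale assms(1))
qed

lemma coset_eq_iff: "coset L x = coset L y \<longleftrightarrow> x - y \<in> L"
proof
  assume "coset L x = coset L y"
  then have "x \<in> coset L y" using L_zero by (metis in_coset_iff diff_self)
  then show "x - y \<in> L" by (simp add: in_coset_iff)
next
  assume xy: "x - y \<in> L"
  have "z - x \<in> L \<longleftrightarrow> z - y \<in> L" for z
    using L_add[OF _ xy, of "z - x"] L_diff[OF _ xy, of "z - y"] by auto
  then show "coset L x = coset L y" by (auto simp: in_coset_iff)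
qed

lemma image_coset: "w \<in> W \<Longrightarrow> (*v) w ` coset L x = coset L (w *v x)"
proof (intro set_eqI iffI)
  fix z assume w: "w \<in> W" and "z \<in> coset L (w *v x)"
  then have "z - w *v x \<in> L" by (simp add: in_coset_iff)
  then have "matrix_inv w *v (z - w *v x) \<in> L" using w by (intro L_apply inv_W)
  then have "matrix_inv w *v z \<in> coset L x"
    by (simp add: in_coset_iff matrix_vector_mult_diff_distrib inv_apply w)
  then show "z \<in> (*v) w ` coset L x" using apply_inv[OF w, of z] by (metis imageI)
qed (auto simp: in_coset_iff L_apply matrix_vector_mult_diff_distrib[symmetric])

text \<open>Two powers of \<open>w\<close> coincide in the finite group and \<open>w\<close> is
  injective. Finite order is used to exclude transvections.\<close>

lemma W_finite_order:
  assumes "w \<in> W"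
  obtains n where "n > 0" "\<And>x. ((*v) w ^^ n) x = x"
proof -
  define P where "P = (\<lambda>n. (((**) w) ^^ n) (mat 1))"
  have PW: "P n \<in> W" for n by (induction n) (auto simp: P_def one_W mult_W assms)
  have Px: "P n *v x = ((*v) w ^^ n) x" for n x
    by (induction n) (auto simp: P_def matrix_vector_mul_assoc[symmetric])
  have "\<not> inj P" using PW finite_W by (meson finite_imageD finite_subset image_subsetI infinite_UNIV_nat)
  then obtain i j where ij: "i < j" "P i = P j"
    unfolding inj_def by (metis linorder_neqE_nat)
  have inj: "inj ((*v) w)" by (rule injI) (metis inv_apply assms)
  have "((*v) w ^^ (j - i)) x = x" for x
  proof -
    have "((*v) w ^^ i) (((*v) w ^^ (j - i)) x) = ((*v) w ^^ i) x"
      using ij by (metis Px add_diff_inverse_nat comp_apply funpow_add less_imp_not_less)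
    then show ?thesis using inj_fn[OF inj, of i] by (simp add: inj_eq)
  qed
  then show thesis using ij by (intro that[of "j - i"]) auto
qed

text \<open>A nonzero lattice coordinate of \<open>u\<close> embeds the lattice points of its line
  into the integers.\<close>

lemma lattice_line_cyclic:
  assumes "u \<in> L" "u \<noteq> 0"
  obtains z where "z \<noteq> 0" "z *s u \<in> L" "\<And>y. y *s u \<in> L \<Longrightarrow> y / z \<in> \<int>"
proof -
  obtain i where i: "coord i u \<noteq> 0"
    using coord_expand[of u] assms(2) by (metis (no_types, lifting) sum.neutral vec.scale_eq_0_iff)
  define S where "S = {y * coord i u | y. y *s u \<in> L}"
  have "S \<subseteq> \<int>" by (auto simp: S_def in_L_iff coord_simps)
  moreover have "0 \<in> S" unfolding S_def by (auto intro!: exI[of _ 0] simp: L_zero)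
  moreover have "p - q \<in> S" if pq: "p \<in> S" "q \<in> S" for p q
  proof -
    obtain y y' where "p = y * coord i u" "y *s u \<in> L" "q = y' * coord i u" "y' *s u \<in> L"
      using pq unfolding S_def by blast
    then show ?thesis unfolding S_def using L_diff[of "y *s u" "y' *s u"]
      by (intro CollectI exI[of _ "y - y'"]) (auto simp: algebra_simps vec.scale_left_diff_distrib)
  qed
  ultimately have "\<exists>d\<in>S. S = range (\<lambda>m :: int. of_int m * d)" by (rule Ints_subgroup_cyclic)
  then obtain d where d: "d \<in> S" "S = range (\<lambda>m :: int. of_int m * d)" by (rule bexE) (rule that)
  then obtain z where z: "d = z * coord i u" "z *s u \<in> L" unfolding S_def by blast
  have "1 * coord i u \<in> S" using assms(1) unfolding S_def by (intro CollectI exI[of _ 1]) simp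
  then have "d \<noteq> 0" using i d(2) by auto
  show thesis
  proof
    show "z \<noteq> 0" using \<open>d \<noteq> 0\<close> z by auto
    show "z *s u \<in> L" by fact
    fix y assume "y *s u \<in> L"
    then have "y * coord i u \<in> S" unfolding S_def by blast
    then have "y * coord i u \<in> range (\<lambda>m :: int. of_int m * d)" by (subst d(2)[symmetric])
    then obtain m :: int where "y * coord i u = of_int m * (z * coord i u)" using z(1) by auto
    then have "y = of_int m * z" using i by simp
    then show "y / z \<in> \<int>" using \<open>z \<noteq> 0\<close> by simp
  qed
qed

text \<open>\<open>1 - s\<close> is a form times a vector, and the two are normalized in turn: once
  the vector generates the lattice points of its line, the form is integral on \<open>L\<close>;
  then the generator \<open>d\<close> of the values of the form is moved from the form to the
  vector. Finite order makes the integer \<open>\<mu> a\<close> equal to 2.\<close>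

lemma reflections_data:
  assumes "s \<in> reflections W"
  obtains \<mu> a where "reflection_data L s \<mu> a"
proof -
  have s: "s \<in> W" "rank (mat 1 - s) = 1" using assms by (auto simp: reflections_def)
  obtain u \<rho> where \<rho>: "linear_form \<rho>" "\<And>x. (mat 1 - s) *v x = \<rho> x *s u" "u \<noteq> 0" "\<exists>x. \<rho> x \<noteq> 0"
    using rank_1_factor[OF s(2)] by metis
  have sx: "x - s *v x = \<rho> x *s u" for x
    using \<rho>(2)[of x] by (simp add: matrix_vector_mult_diff_rdistrib)
  obtain l where l: "l \<in> L" "\<rho> l \<noteq> 0" using linear_form_zero_on_L[OF \<rho>(1)] \<rho>(4) by blast
  \<comment> \<open>This multiple of \<open>u\<close> is \<open>l - s *v l\<close>, hence a lattice
    vector.\<close>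
  define u' where "u' = \<rho> l *s u"
  have u': "u' \<in> L" "u' \<noteq> 0" using sx[of l] L_diff[OF l(1) L_apply[OF s(1) l(1)]] l \<rho>(3) by (auto simp: u'_def)
  obtain z where z: "z \<noteq> 0" "z *s u' \<in> L" "\<And>y. y *s u' \<in> L \<Longrightarrow> y / z \<in> \<int>"
    using lattice_line_cyclic[OF u'] by metis
  define \<alpha> where "\<alpha> = (\<lambda>x. \<rho> x / \<rho> l / z)"
  have \<alpha>: "linear_form \<alpha>"
    unfolding \<alpha>_def using linear_form_mult[OF \<rho>(1), of "1 / \<rho> l / z"] by simp
  have s\<alpha>: "x - s *v x = (\<alpha> x * z) *s u'" for x
    using l z by (simp add: \<alpha>_def u'_def sx vector_smult_assoc)
  have \<alpha>L: "\<alpha> x \<in> \<int>" if "x \<in> L" for x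
    using z(3)[of "\<alpha> x * z"] L_diff[OF that L_apply[OF s(1) that]] z(1) by (simp add: s\<alpha>)
  have "\<alpha> ` L \<subseteq> \<int>" "0 \<in> \<alpha> ` L" using \<alpha>L L_zero linear_form_zero[OF \<alpha>] by (auto intro: image_eqI[of _ _ 0])
  moreover have "p - q \<in> \<alpha> ` L" if "p \<in> \<alpha> ` L" "q \<in> \<alpha> ` L" for p q
    using that L_diff by (auto simp: linear_form_diff[OF \<alpha>, symmetric])
  ultimately have "\<exists>d\<in>\<alpha> ` L. \<alpha> ` L = range (\<lambda>m :: int. of_int m * d)"
    by (rule Ints_subgroup_cyclic)
  then obtain d where d: "d \<in> \<alpha> ` L" "\<alpha> ` L = range (\<lambda>m :: int. of_int m * d)" by (rule bexE) (rule that)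
  have "\<alpha> l \<noteq> 0" using l z by (simp add: \<alpha>_def)
  moreover have \<alpha>d: "\<alpha> x \<in> range (\<lambda>m :: int. of_int m * d)" if "x \<in> L" for x
    by (subst d(2)[symmetric]) (rule imageI[OF that])
  ultimately have d0: "d \<noteq> 0" using \<alpha>d[OF l(1)] by auto
  define \<mu> where "\<mu> = (\<lambda>x. \<alpha> x / d)"
  define a where "a = (d * z) *s u'"
  have \<mu>: "linear_form \<mu>"
    unfolding \<mu>_def using linear_form_mult[OF \<alpha>, of "1 / d"] by simp
  have s\<mu>: "s *v x = x - \<mu> x *s a" for x
  proof -
    have "s *v x = x - (\<alpha> x * z) *s u'" using s\<alpha>[of x] by (metis diff_diff_eq2 add_diff_cancel_left')
    then show ?thesis using d0 by (simp add: \<mu>_def a_def vector_smult_assoc)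
  qed
  have \<mu>L: "\<mu> x \<in> \<int>" if "x \<in> L" for x
  proof -
    show ?thesis using \<alpha>d[OF that] d0 by (auto simp: \<mu>_def)
  qed
  obtain l1 where l1: "l1 \<in> L" "\<mu> l1 = 1" using d(1) d0 by (auto simp: \<mu>_def)
  have aL: "a \<in> L" using L_diff[OF l1(1) L_apply[OF s(1) l1(1)]] s\<mu>[of l1] l1(2) by simp
  have a0: "a \<noteq> 0" using d0 z u' by (simp add: a_def)
  obtain n where n: "n > 0" "\<And>x. ((*v) s ^^ n) x = x" using W_finite_order[OF s(1)] by blast
  note [simp] = linear_form_simps[OF \<mu>]
  obtain k :: int where k: "\<mu> a = of_int k" using \<mu>L[OF aL] by (elim Ints_cases)
  have "((*v) s ^^ m) a = (1 - \<mu> a) ^ m *s a" for m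
    by (induction m) (auto simp: s\<mu> algebra_simps vec.scale_left_diff_distrib vector_smult_assoc)
  then have "((1 - \<mu> a) ^ n - 1) *s a = 0" using n(2)[of a] by (simp add: vec.scale_left_diff_distrib)
  \<comment> \<open>\<open>s\<close> scales \<open>a\<close> by the integer
    \<open>1 - \<mu> a\<close>, which finite order restricts to 1 and -1.\<close>
  then have "(1 - \<mu> a) ^ n = 1" using a0 by (metis vec.scale_eq_0_iff right_minus_eq)
  then have "(of_int (1 - k) :: complex) ^ n = of_int 1" by (simp add: k)
  then have "(1 - k) ^ n = 1" by (metis of_int_eq_iff of_int_power)
  then have "\<bar>1 - k\<bar> = 1"
    using n(1) power_eq_iff_eq_base[of n "\<bar>1 - k\<bar>" 1] by (simp add: power_abs[symmetric])
  then have "k = 0 \<or> k = 2" by arith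
  \<comment> \<open>For \<open>k = 0\<close> the map is a transvection, and its powers move
    \<open>l1\<close> by ever larger multiples of \<open>a\<close>.\<close>
  moreover have "k \<noteq> 0"
  proof
    assume "k = 0"
    then have "\<mu> a = 0" using k by simp
    have "((*v) s ^^ m) l1 = l1 - of_nat m *s a" for m
    proof (induction m)
      case (Suc m)
      have "s *v (l1 - of_nat m *s a) = l1 - of_nat m *s a - a"
        using \<open>\<mu> a = 0\<close> l1(2) by (simp add: s\<mu>)
      then have "((*v) s ^^ Suc m) l1 = l1 - of_nat m *s a - a" by (simp only: funpow.simps comp_apply Suc)
      also have "\<dots> = l1 - of_nat (Suc m) *s a" by (simp add: vec_eq_iff algebra_simps)
      finally show ?case .
    qed simp
    then have "of_nat n *s a = 0" using n(2)[of l1] by (metis diff_0_right diff_left_imp_eq)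
    then show False using n(1) a0 by simp
  qed
  ultimately have "\<mu> a = 2" using k by simp
  then show thesis
    using \<mu> \<mu>L l1 aL s\<mu> by (intro that[of \<mu> a]) (auto simp: reflection_data_def dual_lattice_def)
qed

lemma reflection_data_form: "reflection_data L s \<mu> a \<Longrightarrow> linear_form \<mu>"
  by (simp add: reflection_data_def dual_lattice_def)

lemma reflection_data_L: "reflection_data L s \<mu> a \<Longrightarrow> x \<in> L \<Longrightarrow> \<mu> x \<in> \<int>"
  by (auto simp: reflection_data_def dual_lattice_def)

lemma reflection_data_reflection:
  assumes "reflection_data L s \<mu> a" "s \<in> W"
  shows "s \<in> reflections W"
proof -
  have "rank (mat 1 - s) = 1"
  proof (rule rank_1I[of \<mu> _ a a])
    show "linear_form \<mu>" by (rule reflection_data_form[OF assms(1)])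
    then show "a \<noteq> 0" using assms(1) linear_form_zero[of \<mu>] by (auto simp: reflection_data_def)
  qed (use assms(1) in \<open>auto simp: reflection_data_def matrix_vector_mult_diff_rdistrib\<close>)
  with assms(2) show ?thesis by (simp add: reflections_def)
qed

lemma reflection_involution: "s \<in> reflections W \<Longrightarrow> s *v (s *v x) = x"
proof -
  assume "s \<in> reflections W"
  then obtain \<mu> a where "reflection_data L s \<mu> a" using reflections_data by blast
  then have sx: "\<And>x. s *v x = x - \<mu> x *s a" and "\<mu> a = 2" "linear_form \<mu>"
    by (auto simp: reflection_data_def dual_lattice_def)
  then show ?thesis by (simp add: sx linear_form_simps)
qed

lemma matrix_inv_reflection: "s \<in> reflections W \<Longrightarrow> matrix_inv s = s"
proof -
  assume s: "s \<in> reflections W"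
  have "matrix_inv s *v x = s *v x" for x
    using reflection_involution[OF s, of x] inv_apply[of s "s *v x"] s by (simp add: reflections_def)
  then show ?thesis by (simp add: matrix_eq)
qed

lemma act_reflection: "s \<in> reflections W \<Longrightarrow> act s F = (\<lambda>x. F (s *v x))"
  by (simp add: act_def matrix_inv_reflection)

text \<open>The product of two reflections with the same hyperplane has the form
  \<open>x + \<mu> x *s c\<close> with \<open>\<mu> c = 0\<close>. Its m-th power adds m times as
  much, so finite order gives \<open>c = 0\<close>.\<close>

lemma reflections_eq:
  assumes s: "s \<in> reflections W" "reflection_data L s \<mu> a"
    and t: "t \<in> reflections W" "reflection_data L t \<nu> b"
    and ker: "\<And>v. \<mu> v = 0 \<Longrightarrow> \<nu> v = 0"
  shows "s = t"
proof -
  have lin: "linear_form \<mu>" "linear_form \<nu>" using reflection_data_form[OF s(2)] reflection_data_form[OF t(2)] by -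
  note [simp] = linear_form_simps[OF lin(1)] linear_form_simps[OF lin(2)]
  have d: "\<mu> a = 2" "\<nu> b = 2" "\<And>x. s *v x = x - \<mu> x *s a" "\<And>x. t *v x = x - \<nu> x *s b"
    using s(2) t(2) by (simp_all add: reflection_data_def)
  define \<kappa> where "\<kappa> = \<nu> a / 2"
  have \<nu>: "\<nu> x = \<kappa> * \<mu> x" for x
    using ker[of "x - (\<mu> x / 2) *s a"] by (simp add: d \<kappa>_def)
  define c where "c = \<kappa> *s b - a"
  have \<mu>b: "\<kappa> * \<mu> b = 2" using \<nu>[of b] d by simp
  then have \<mu>c: "\<mu> c = 0" by (simp add: c_def d)
  have st: "(t ** s) *v x = x + \<mu> x *s c" for x
  proof -
    have "(t ** s) *v x = x - \<mu> x *s a - \<nu> (x - \<mu> x *s a) *s b"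
      by (simp add: matrix_vector_mul_assoc[symmetric] d(3,4))
    also have "\<nu> (x - \<mu> x *s a) = - (\<kappa> * \<mu> x)" by (simp add: \<nu> d(1))
    finally show ?thesis by (simp add: c_def vec_eq_iff algebra_simps)
  qed
  have "t ** s \<in> W" using s t by (auto simp: reflections_def intro: mult_W)
  then obtain n where n: "n > 0" "\<And>x. ((*v) (t ** s) ^^ n) x = x" using W_finite_order by blast
  have "((*v) (t ** s) ^^ m) x = x + (of_nat m * \<mu> x) *s c" for m x
    by (induction m) (auto simp: st \<mu>c algebra_simps vec.scale_left_distrib)
  then have "a + (of_nat n * \<mu> a) *s c = a" using n(2)[of a] by metis
  then have "c = 0" using n(1) d by simp
  then have "(t ** s) *v x = x" for x by (simp add: st)
  then have "t *v (s *v x) = t *v (t *v x)" for x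
    using reflection_involution[OF t(1)] by (simp add: matrix_vector_mul_assoc)
  then have "s *v x = t *v x" for x using inv_apply[of t] t(1) by (metis (no_types, lifting) reflections_def mem_Collect_eq)
  then show ?thesis by (simp add: matrix_eq)
qed

end

section \<open>Reflection hypertori\<close>

context torus_reflection_group begin

lemma topspace_torus: "topspace (torus_topology L) = torus L"
proof -
  have "\<Union>(torus L) = UNIV" using L_zero by (auto simp: torus_def in_coset_iff intro!: exI)
  then have "openin (torus_topology L) (torus L)" by (simp add: openin_torus_topology[OF lattice_L])
  moreover have "U \<subseteq> torus L" if "openin (torus_topology L) U" for U
    using that by (simp add: openin_torus_topology[OF lattice_L])
  ultimately show ?thesis unfolding topspace_def by blast
qed

lemma fixed_set_iff: "s \<in> W \<Longrightarrow> coset L x \<in> fixed_set L s \<longleftrightarrow> x - s *v x \<in> L"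
  by (auto simp: fixed_set_def torus_def image_coset coset_eq_iff L_diff_commute)

lemma fixed_set_data:
  "s \<in> W \<Longrightarrow> reflection_data L s \<mu> a \<Longrightarrow> coset L x \<in> fixed_set L s \<longleftrightarrow> \<mu> x *s a \<in> L"
  by (simp add: fixed_set_iff reflection_data_def)

lemma topspace_fixed: "topspace (subtopology (torus_topology L) (fixed_set L s)) = fixed_set L s"
  by (auto simp: topspace_torus fixed_set_def)

definition component :: "complex^'n^'n \<Rightarrow> complex^'n \<Rightarrow> (complex^'n) set set" where
  "component s x = connected_component_of_set (subtopology (torus_topology L) (fixed_set L s)) (coset L x)"

lemma coset_in_component: "coset L x \<in> fixed_set L s \<Longrightarrow> coset L x \<in> component s x"
  unfolding component_def by (auto simp: connected_component_of_refl topspace_torus torus_def)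

lemma convex_affine_hyperplane:
  fixes \<mu> :: "complex^'n \<Rightarrow> complex"
  assumes "linear_form \<mu>"
  shows "convex {y. \<mu> (y - x) = 0}"
proof (rule convexI)
  fix y z :: "complex^'n" and u v :: real
  assume *: "y \<in> {y. \<mu> (y - x) = 0}" "z \<in> {y. \<mu> (y - x) = 0}" "u + v = 1"
  have sc: "u *\<^sub>R w = complex_of_real u *s w" for u and w :: "complex^'n"
    by (simp add: vec_eq_iff) (simp add: scaleR_conv_of_real)
  have "\<mu> (u *\<^sub>R y + v *\<^sub>R z - x) = of_real u * \<mu> (y - x) + of_real v * \<mu> (z - x)
      + (of_real (u + v) - 1) * \<mu> x"
    by (simp add: sc linear_form_simps[OF assms] algebra_simps)
  with * show "u *\<^sub>R y + v *\<^sub>R z \<in> {y. \<mu> (y - x) = 0}" by simp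
qed

lemma coset_continuous: "continuous_map euclidean (torus_topology L) (coset L)"
proof -
  have "{x. coset L x \<in> U} = \<Union>U" if "U \<subseteq> torus L" for U
  proof (intro set_eqI iffI)
    fix x assume "x \<in> \<Union>U"
    then obtain y where "coset L y \<in> U" "x \<in> coset L y" using \<open>U \<subseteq> torus L\<close> unfolding torus_def by blast
    then show "x \<in> {x. coset L x \<in> U}" by (metis coset_eq_iff in_coset_iff mem_Collect_eq)
  next
    fix x assume "x \<in> {x. coset L x \<in> U}"
    moreover have "x \<in> coset L x" using L_zero by (simp add: in_coset_iff)
    ultimately show "x \<in> \<Union>U" by blast
  qed
  then show ?thesis
    by (auto simp: continuous_map_def openin_torus_topology[OF lattice_L] topspace_torus torus_def)
qed

text \<open>An open condition that is invariant under \<open>L\<close> is saturated, so it descends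
  to the quotient.\<close>

lemma openin_torus_Collect:
  assumes "open {y. Q y}" "\<And>y l. l \<in> L \<Longrightarrow> Q y \<Longrightarrow> Q (y + l)"
  shows "openin (torus_topology L) {coset L y | y. Q y}"
proof -
  have "\<Union>{coset L y | y. Q y} = {y. Q y}"
  proof (intro set_eqI iffI)
    fix z assume "z \<in> \<Union>{coset L y | y. Q y}"
    then obtain y where "Q y" "z - y \<in> L" by (auto simp: in_coset_iff)
    then show "z \<in> {y. Q y}" using assms(2)[of "z - y" y] by simp
  next
    fix z assume "z \<in> {y. Q y}"
    moreover have "z \<in> coset L z" using L_zero by (simp add: in_coset_iff)
    ultimately show "z \<in> \<Union>{coset L y | y. Q y}" by blast
  qed
  with assms(1) show ?thesis by (auto simp: openin_torus_topology[OF lattice_L] torus_def)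
qed

text \<open>On the fixed set \<open>2 * \<mu> (y - x)\<close> is an integer, so
  \<open>expi (\<mu> (y - x))\<close> is 1 or -1 there. Open sets separate the two values, and the
  part with value 1 is the image of a single affine hyperplane, hence connected.\<close>

lemma component_data:
  assumes s: "s \<in> W" and d: "reflection_data L s \<mu> a" and x: "coset L x \<in> fixed_set L s"
  shows "component s x = {coset L y | y. \<mu> (y - x) \<in> \<int>}"
proof
  let ?X = "subtopology (torus_topology L) (fixed_set L s)"
  have lin: "linear_form \<mu>" by (rule reflection_data_form[OF d])
  note ls = linear_form_simps[OF lin]
  have \<mu>a: "\<mu> a = 2" and aL: "a \<in> L" using d by (auto simp: reflection_data_def)
  obtain l0 where l0: "l0 \<in> L" "\<mu> l0 = 1" using d by (auto simp: reflection_data_def)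
  have xa: "\<mu> x *s a \<in> L" using x fixed_set_data[OF s d] by simp
  have fixed: "coset L y \<in> fixed_set L s" if "\<mu> (y - x) \<in> \<int>" for y
  proof -
    have "\<mu> (y - x) *s a + \<mu> x *s a \<in> L" by (intro L_add L_scale xa aL that)
    then show ?thesis by (simp add: fixed_set_data[OF s d] ls vec.scale_left_diff_distrib)
  qed
  have "connectedin (torus_topology L) (coset L ` {y. \<mu> (y - x) = 0})"
    by (rule connectedin_continuous_map_image[OF coset_continuous])
      (simp add: connectedin_iff_connected convex_connected convex_affine_hyperplane lin)
  moreover have "coset L ` {y. \<mu> (y - x) = 0} \<subseteq> fixed_set L s" using fixed by auto
  ultimately have "connectedin ?X (coset L ` {y. \<mu> (y - x) = 0})"
    by (simp add: connectedin_subtopology)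
  then have sub: "coset L ` {y. \<mu> (y - x) = 0} \<subseteq> component s x"
    unfolding component_def by (rule connected_component_of_maximal) (auto simp: ls)
  show "{coset L y | y. \<mu> (y - x) \<in> \<int>} \<subseteq> component s x"
  proof clarify
    fix y assume y: "\<mu> (y - x) \<in> \<int>"
    \<comment> \<open>Primitivity of \<open>\<mu>\<close> enters here: a multiple of
      \<open>l0\<close> brings every integral level of \<open>\<mu>\<close> to level 0.\<close>
    have "coset L y = coset L (y - \<mu> (y - x) *s l0)"
      using L_scale[OF y l0(1)] by (simp add: coset_eq_iff)
    moreover have "\<mu> (y - \<mu> (y - x) *s l0 - x) = 0" using l0(2) by (simp add: ls)
    ultimately show "coset L y \<in> component s x" using sub by blast
  qed
  show "component s x \<subseteq> {coset L y | y. \<mu> (y - x) \<in> \<int>}"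
  proof (rule ccontr)
    assume "\<not> component s x \<subseteq> {coset L y | y. \<mu> (y - x) \<in> \<int>}"
    then obtain g where g: "g \<in> component s x" "g \<notin> {coset L y | y. \<mu> (y - x) \<in> \<int>}" by blast
    have con: "connectedin ?X (component s x)"
      unfolding component_def by (rule connectedin_connected_component_of)
    then have con': "connectedin (torus_topology L) (component s x)"
      and subs: "component s x \<subseteq> fixed_set L s" by (auto simp: connectedin_subtopology)
    \<comment> \<open>For \<open>r = 1\<close> and \<open>r = - 1\<close> these are disjoint, open,
      periodic conditions that cover the fixed set.\<close>
    define Q where "Q = (\<lambda>r y. 0 < r * Re (expi (\<mu> (y - x))))"
    have Qo: "open {y. Q r y}" for r
      unfolding Q_def
      by (intro open_Collect_less continuous_intros
          continuous_on_compose2[OF continuous_on_linear_form[OF lin]]) auto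
    have per: "Q r (y + l)" if "Q r y" "l \<in> L" for r y l
    proof -
      have "expi (\<mu> l) = 1" using reflection_data_L[OF d that(2)] by (simp add: expi_eq_1_iff)
      then have "expi (\<mu> (y + l - x)) = expi (\<mu> (y - x))"
        using expi_add[of "\<mu> (y - x)" "\<mu> l"] by (simp add: ls algebra_simps)
      with that show ?thesis by (simp add: Q_def)
    qed
    have dich: "Q 1 y \<and> \<mu> (y - x) \<in> \<int> \<or> Q (- 1) y \<and> \<not> Q 1 y \<and> \<mu> (y - x) \<notin> \<int>"
      if "coset L y \<in> fixed_set L s" for y
    proof -
      have "\<mu> y *s a - \<mu> x *s a \<in> L" using that fixed_set_data[OF s d] xa by (intro L_diff) auto
      then have "\<mu> (\<mu> y *s a - \<mu> x *s a) \<in> \<int>" by (rule reflection_data_L[OF d])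
      then have "2 * \<mu> (y - x) \<in> \<int>" by (simp add: ls \<mu>a algebra_simps)
      then have "expi (\<mu> (y - x) + \<mu> (y - x)) = 1" by (simp only: expi_eq_1_iff mult_2[symmetric])
      then have "expi (\<mu> (y - x)) ^ 2 = 1" by (simp only: expi_add power2_eq_square)
      then have "expi (\<mu> (y - x)) = 1 \<or> expi (\<mu> (y - x)) = -1" by (simp only: power2_eq_1_iff)
      moreover have "\<mu> (y - x) \<in> \<int> \<longleftrightarrow> expi (\<mu> (y - x)) = 1" by (simp only: expi_eq_1_iff)
      ultimately show ?thesis by (auto simp: Q_def)
    qed
    define E1 where "E1 = {coset L y | y. Q 1 y}"
    define E2 where "E2 = {coset L y | y. Q (- 1) y}"
    have op: "openin (torus_topology L) E1" "openin (torus_topology L) E2"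
      unfolding E1_def E2_def by (intro openin_torus_Collect Qo per; assumption)+
    have cov: "component s x \<subseteq> E1 \<union> E2"
    proof
      fix h assume h: "h \<in> component s x"
      then obtain y where "h = coset L y" using subs by (auto simp: fixed_set_def torus_def)
      with dich[of y] h subs show "h \<in> E1 \<union> E2" unfolding E1_def E2_def by blast
    qed
    have disj: "E1 \<inter> E2 \<inter> component s x = {}"
    proof (rule ccontr)
      assume "E1 \<inter> E2 \<inter> component s x \<noteq> {}"
      then obtain y z where yz: "Q 1 y" "Q (- 1) z" "coset L y = coset L z"
        unfolding E1_def E2_def by blast
      then have "z - y \<in> L" by (simp add: coset_eq_iff L_diff_commute)
      then have "Q 1 z" using per[OF yz(1), of "z - y"] by simp
      with yz(2) show False by (simp add: Q_def)
    qed
    have "coset L x \<in> component s x" by (rule coset_in_component[OF x])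
    moreover have "coset L x \<in> E1" unfolding E1_def Q_def by (auto intro!: exI[of _ x] simp: ls)
    ultimately have n1: "E1 \<inter> component s x \<noteq> {}" by blast
    obtain y where y: "g = coset L y" using g subs by (auto simp: fixed_set_def torus_def)
    then have "Q (- 1) y" using g dich[of y] subs by blast
    then have n2: "E2 \<inter> component s x \<noteq> {}" using g y unfolding E2_def by blast
    show False using con' op cov disj n1 n2 unfolding connectedin by blast
  qed
qed

lemma fixed_components_eq: "fixed_components L s = component s ` {x. coset L x \<in> fixed_set L s}"
proof -
  have *: "fixed_set L s = coset L ` {x. coset L x \<in> fixed_set L s}"
    by (auto simp: fixed_set_def torus_def)
  have "fixed_components L s =
      connected_component_of_set (subtopology (torus_topology L) (fixed_set L s)) ` fixed_set L s"
    by (simp only: fixed_components_def connected_components_of_def topspace_fixed)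
  also have "\<dots> = connected_component_of_set (subtopology (torus_topology L) (fixed_set L s)) `
      coset L ` {x. coset L x \<in> fixed_set L s}" by (rule arg_cong[OF *])
  finally show ?thesis by (simp only: image_image component_def[abs_def])
qed

lemma component_in_hypertori:
  "s \<in> reflections W \<Longrightarrow> coset L x \<in> fixed_set L s \<Longrightarrow> component s x \<in> hypertori W L"
  unfolding hypertori_def fixed_components_eq by blast

text \<open>It makes the description in \<open>hypertorus_reflection\<close> proper. On a hyperplane
  of \<open>\<mu>\<close> the values of \<open>\<nu>\<close> stay in a translate of the integers, so
  \<open>\<nu>\<close> is constant there, and reflections with the same hyperplane coincide.\<close>

lemma fixed_components_reflection_unique:
  assumes "s \<in> reflections W" "T \<in> fixed_components L s"
    and "t \<in> reflections W" "T \<in> fixed_components L t"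
  shows "s = t"
proof -
  obtain \<mu> a where m: "reflection_data L s \<mu> a" using reflections_data[OF assms(1)] by blast
  obtain \<nu> b where n: "reflection_data L t \<nu> b" using reflections_data[OF assms(3)] by blast
  have sW: "s \<in> W" "t \<in> W" using assms by (auto simp: reflections_def)
  obtain x where x: "coset L x \<in> fixed_set L s" "T = component s x"
    using assms(2) by (auto simp: fixed_components_eq)
  obtain y where y: "coset L y \<in> fixed_set L t" "T = component t y"
    using assms(4) by (auto simp: fixed_components_eq)
  have T1: "T = {coset L z | z. \<mu> (z - x) \<in> \<int>}" using component_data[OF sW(1) m x(1)] x by simp
  have T2: "T = {coset L z | z. \<nu> (z - y) \<in> \<int>}" using component_data[OF sW(2) n y(1)] y by simp
  note ls = linear_form_simps[OF reflection_data_form[OF m]] linear_form_simps[OF reflection_data_form[OF n]]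
  have int: "\<nu> (z - y) \<in> \<int>" if "\<mu> (z - x) \<in> \<int>" for z
  proof -
    have "coset L z \<in> T" using that T1 by blast
    then obtain z' where z': "coset L z = coset L z'" "\<nu> (z' - y) \<in> \<int>" unfolding T2 by blast
    then have "\<nu> (z - z') \<in> \<int>" using reflection_data_L[OF n] by (simp add: coset_eq_iff)
    then have "\<nu> (z - z') + \<nu> (z' - y) \<in> \<int>" using z' by simp
    then show ?thesis by (simp add: ls)
  qed
  have "\<nu> v = 0" if v: "\<mu> v = 0" for v
  proof (rule ccontr)
    assume nz: "\<nu> v \<noteq> 0"
    have i: "\<nu> (x + c *s v - y) \<in> \<int>" for c by (rule int) (simp add: ls v)
    \<comment> \<open>The step along \<open>v\<close> is scaled so that \<open>\<nu>\<close> changes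
      by 1/2.\<close>
    have "\<nu> (x + (1 / (2 * \<nu> v)) *s v - y) - \<nu> (x + 0 *s v - y) \<in> \<int>" by (intro Ints_diff i)
    then have "(1 / 2 :: complex) \<in> \<int>" using nz by (simp add: ls)
    then obtain k :: int where "(1 / 2 :: complex) = of_int k" by (elim Ints_cases)
    then have "(of_int (2 * k) :: complex) = of_int 1" by (simp add: mult.commute)
    then have "2 * k = 1" by (simp only: of_int_eq_iff)
    then show False by presburger
  qed
  then show ?thesis by (rule reflections_eq[OF assms(1) m assms(3) n])
qed

lemma hypertorus_reflection_eq:
  "s \<in> reflections W \<Longrightarrow> T \<in> fixed_components L s \<Longrightarrow> hypertorus_reflection W L T = s"
  unfolding hypertorus_reflection_def
  by (rule the_equality) (auto intro: fixed_components_reflection_unique)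

lemma hypertorus_reflection_component:
  "s \<in> reflections W \<Longrightarrow> coset L x \<in> fixed_set L s \<Longrightarrow> hypertorus_reflection W L (component s x) = s"
  by (rule hypertorus_reflection_eq) (auto simp: fixed_components_eq)

lemma hypertoriE:
  assumes "T \<in> hypertori W L"
  obtains s \<mu> a x where "s \<in> reflections W" "s \<in> W" "reflection_data L s \<mu> a" "coset L x \<in> fixed_set L s"
    "T = component s x" "hypertorus_reflection W L T = s" "\<And>y. coset L y \<in> T \<longleftrightarrow> \<mu> (y - x) \<in> \<int>"
proof -
  obtain s x where s: "s \<in> reflections W" "coset L x \<in> fixed_set L s" "T = component s x"
    using assms unfolding hypertori_def fixed_components_eq by blast
  have sW: "s \<in> W" using s by (simp add: reflections_def)
  obtain \<mu> a where m: "reflection_data L s \<mu> a" using reflections_data[OF s(1)] by blast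
  have "coset L y \<in> T \<longleftrightarrow> \<mu> (y - x) \<in> \<int>" for y
  proof
    assume "coset L y \<in> T"
    then obtain z where z: "coset L y = coset L z" "\<mu> (z - x) \<in> \<int>"
      using s component_data[OF sW m s(2)] by auto
    then have "\<mu> (y - z) + \<mu> (z - x) \<in> \<int>" using reflection_data_L[OF m] by (simp add: coset_eq_iff)
    then show "\<mu> (y - x) \<in> \<int>" by (simp add: linear_form_simps[OF reflection_data_form[OF m]])
  qed (use s component_data[OF sW m s(2)] in blast)
  then show thesis using s sW m hypertorus_reflection_component by (intro that) auto
qed

lemma hypertorus_through:
  assumes "T \<in> hypertori W L" "coset L x \<in> T" "s = hypertorus_reflection W L T"
  shows "s \<in> reflections W" "coset L x \<in> fixed_set L s" "T = component s x"
proof -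
  obtain s' \<mu> a z where s: "s' \<in> reflections W" "s' \<in> W" "reflection_data L s' \<mu> a" "coset L z \<in> fixed_set L s'"
    "T = component s' z" "hypertorus_reflection W L T = s'"
    using hypertoriE[OF assms(1)] by metis
  have [simp]: "s = s'" using s assms by simp
  show "s \<in> reflections W" using s by simp
  have "connected_component_of (subtopology (torus_topology L) (fixed_set L s)) (coset L z) (coset L x)"
    using assms(2) s(5) unfolding component_def by simp
  note * = connected_component_of_equiv[THEN iffD1, OF this]
  show "coset L x \<in> fixed_set L s" using * by (simp only: topspace_fixed)
  show "T = component s x" using * s(5) by (simp only: component_def \<open>s = s'\<close>)
qed

text \<open>The fixed set of a reflection has at most two components, because
  \<open>expi (\<mu> x)\<close> is 1 or -1 on it and determines the component.\<close>

lemma finite_hypertori: "finite (hypertori W L)"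
proof -
  have "finite (fixed_components L s)" if s: "s \<in> reflections W" for s
  proof -
    obtain \<mu> a where m: "reflection_data L s \<mu> a" using reflections_data[OF s] by blast
    have sW: "s \<in> W" using s by (simp add: reflections_def)
    note ls = linear_form_simps[OF reflection_data_form[OF m]]
    have "component s x \<in> (\<lambda>z. {coset L y | y. expi (\<mu> y) = z}) ` {1, - 1}" if x: "coset L x \<in> fixed_set L s" for x
    proof -
      have "\<mu> (\<mu> x *s a) \<in> \<int>" using x reflection_data_L[OF m] fixed_set_data[OF sW m] by simp
      then have "\<mu> x + \<mu> x \<in> \<int>" using m by (simp add: ls reflection_data_def mult_2_right)
      then have "expi (\<mu> x) ^ 2 = 1" by (simp only: expi_eq_1_iff[symmetric] expi_add power2_eq_square)
      then have "expi (\<mu> x) \<in> {1, - 1}" by (simp only: power2_eq_1_iff) blast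
      moreover have "\<mu> (y - x) \<in> \<int> \<longleftrightarrow> expi (\<mu> y) = expi (\<mu> x)" for y
        by (simp add: expi_eq_1_iff[symmetric] ls expi_diff)
      then have "component s x = {coset L y | y. expi (\<mu> y) = expi (\<mu> x)}"
        by (simp only: component_data[OF sW m x])
      ultimately show ?thesis by blast
    qed
    then have "fixed_components L s \<subseteq> (\<lambda>z. {coset L y | y. expi (\<mu> y) = z}) ` {1, - 1}"
      unfolding fixed_components_eq by blast
    then show ?thesis by (rule finite_subset) simp
  qed
  moreover have "finite (reflections W)" using finite_W by (simp add: reflections_def)
  ultimately show ?thesis unfolding hypertori_def by blast
qed

lemma reflections_stabilizer:
  "reflections (stabilizer W (coset L x)) = {s \<in> reflections W. coset L x \<in> fixed_set L s}"
  by (auto simp: reflections_def stabilizer_def fixed_set_def torus_def)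

lemma stabilizer_iff: "w \<in> stabilizer W (coset L x) \<longleftrightarrow> w \<in> W \<and> w *v x - x \<in> L"
  by (simp add: stabilizer_def image_coset coset_eq_iff cong: conj_cong)

text \<open>It turns the part of a sum over hypertori that is singular at a point into the sum over
  reflections of a rational Dunkl operator.\<close>

lemma hypertori_through_bij:
  "bij_betw (\<lambda>s. component s x) (reflections (stabilizer W (coset L x))) {T \<in> hypertori W L. coset L x \<in> T}"
proof (rule bij_betw_byWitness[where f' = "hypertorus_reflection W L"])
  show "\<forall>s\<in>reflections (stabilizer W (coset L x)). hypertorus_reflection W L (component s x) = s"
    by (auto simp: reflections_stabilizer hypertorus_reflection_component)
  show "\<forall>T\<in>{T \<in> hypertori W L. coset L x \<in> T}. component (hypertorus_reflection W L T) x = T"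
    using hypertorus_through(3) by blast
  show "(\<lambda>s. component s x) ` reflections (stabilizer W (coset L x)) \<subseteq> {T \<in> hypertori W L. coset L x \<in> T}"
    by (auto simp: reflections_stabilizer component_in_hypertori coset_in_component)
  show "hypertorus_reflection W L ` {T \<in> hypertori W L. coset L x \<in> T} \<subseteq> reflections (stabilizer W (coset L x))"
    using hypertorus_through(1,2) by (auto simp: reflections_stabilizer)
qed

section \<open>Conjugation of reflections, components and parameters\<close>

lemma reflection_data_conjugate:
  assumes "w \<in> W" "reflection_data L s \<mu> a"
  shows "reflection_data L (w ** s ** matrix_inv w) (\<lambda>x. \<mu> (matrix_inv w *v x)) (w *v a)"
proof -
  have "linear_form (\<lambda>x. \<mu> (matrix_inv w *v x))"
    by (rule linear_form_comp_matrix[OF reflection_data_form[OF assms(2)]])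
  moreover have "\<mu> (matrix_inv w *v l) \<in> \<int>" if "l \<in> L" for l
    using that by (intro reflection_data_L[OF assms(2)] L_apply inv_W assms(1))
  moreover obtain l where "l \<in> L" "\<mu> l = 1" using assms(2) by (auto simp: reflection_data_def)
  then have "\<exists>l\<in>L. \<mu> (matrix_inv w *v l) = 1"
    by (intro bexI[of _ "w *v l"]) (auto simp: inv_apply assms(1) L_apply)
  moreover have "(w ** s ** matrix_inv w) *v x = x - \<mu> (matrix_inv w *v x) *s (w *v a)" for x
    using assms(2)
    by (simp add: matrix_vector_mul_assoc[symmetric] reflection_data_def matrix_vector_mult_diff_distrib
        apply_inv assms(1) vector_scalar_commute)
  ultimately show ?thesis
    using assms by (auto simp: reflection_data_def dual_lattice_def L_apply inv_apply)
qed

lemma reflections_conjugate: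
  assumes "w \<in> W" "s \<in> reflections W"
  shows "w ** s ** matrix_inv w \<in> reflections W"
proof -
  obtain \<mu> a where "reflection_data L s \<mu> a" using reflections_data[OF assms(2)] by blast
  then have "reflection_data L (w ** s ** matrix_inv w) (\<lambda>x. \<mu> (matrix_inv w *v x)) (w *v a)"
    by (rule reflection_data_conjugate[OF assms(1)])
  moreover have "w ** s ** matrix_inv w \<in> W"
    using assms by (auto simp: reflections_def intro: mult_W inv_W)
  ultimately show ?thesis by (rule reflection_data_reflection)
qed

lemma fixed_set_conjugate:
  assumes "w \<in> W" "s \<in> W"
  shows "coset L (w *v x) \<in> fixed_set L (w ** s ** matrix_inv w) \<longleftrightarrow> coset L x \<in> fixed_set L s"
proof -
  have "w ** s ** matrix_inv w \<in> W" using assms by (auto intro: mult_W inv_W)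
  then have "coset L (w *v x) \<in> fixed_set L (w ** s ** matrix_inv w) \<longleftrightarrow> w *v (x - s *v x) \<in> L"
    by (simp add: fixed_set_iff matrix_vector_mul_assoc[symmetric] inv_apply assms matrix_vector_mult_diff_distrib)
  then show ?thesis by (simp add: L_apply_iff fixed_set_iff assms)
qed

lemma component_conjugate:
  assumes w: "w \<in> W" and s: "s \<in> reflections W" and x: "coset L x \<in> fixed_set L s"
  shows "component (w ** s ** matrix_inv w) (w *v x) = (\<lambda>g. (*v) w ` g) ` component s x"
proof -
  obtain \<mu> a where m: "reflection_data L s \<mu> a" using reflections_data[OF s] by blast
  have sW: "s \<in> W" using s by (simp add: reflections_def)
  have tW: "w ** s ** matrix_inv w \<in> W" using w sW by (auto intro: mult_W inv_W)
  have "component (w ** s ** matrix_inv w) (w *v x) = {coset L y | y. \<mu> (matrix_inv w *v (y - w *v x)) \<in> \<int>}"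
    by (rule component_data[OF tW reflection_data_conjugate[OF w m]]) (simp add: fixed_set_conjugate w sW x)
  also have "\<dots> = {coset L (w *v y) | y. \<mu> (y - x) \<in> \<int>}"
  proof -
    have "(\<exists>y. g = coset L y \<and> \<mu> (matrix_inv w *v (y - w *v x)) \<in> \<int>)
        \<longleftrightarrow> (\<exists>y. g = coset L (w *v y) \<and> \<mu> (y - x) \<in> \<int>)" for g
      using inv_apply[OF w] apply_inv[OF w] by (metis matrix_vector_mult_diff_distrib)
    then show ?thesis by auto
  qed
  also have "\<dots> = (\<lambda>g. (*v) w ` g) ` component s x"
    by (auto simp: component_data[OF sW m x] image_coset[OF w, symmetric])
  finally show ?thesis .
qed

lemma local_parameter_eq: "local_parameter L c (coset L x) s = c (component s x)"
  by (simp add: local_parameter_def component_def)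

text \<open>The parameter at \<open>w *v x\<close> is carried back to the one at \<open>x\<close>,
  so that one submodule at \<open>x\<close> can be tested at all points of the orbit.\<close>

lemma local_parameter_conjugate:
  assumes "invariant_parameter W L c" "w \<in> W" "s \<in> reflections W" "coset L x \<in> fixed_set L s"
  shows "local_parameter L c (coset L (w *v x)) (w ** s ** matrix_inv w) = local_parameter L c (coset L x) s"
proof -
  have "\<forall>w\<in>W. \<forall>T\<in>hypertori W L. c ((\<lambda>g. (*v) w ` g) ` T) = c T"
    using assms(1) by (simp only: invariant_parameter_def)
  then have "c ((\<lambda>g. (*v) w ` g) ` component s x) = c (component s x)"
    using assms(2) component_in_hypertori[OF assms(3,4)] by (elim ballE) auto
  then show ?thesis by (simp only: local_parameter_eq component_conjugate[OF assms(2-4)])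
qed

lemma local_parameter_invariant:
  assumes "invariant_parameter W L c" "w \<in> stabilizer W (coset L x)"
    "s \<in> reflections (stabilizer W (coset L x))"
  shows "local_parameter L c (coset L x) (w ** s ** matrix_inv w) = local_parameter L c (coset L x) s"
proof -
  have "w \<in> W" "coset L (w *v x) = coset L x" using assms(2) by (auto simp: stabilizer_iff coset_eq_iff)
  then show ?thesis
    using local_parameter_conjugate[OF assms(1), of w s x] assms(3) by (simp add: reflections_stabilizer)
qed

section \<open>Roots and their integrality at a point\<close>

text \<open>The coroot \<open>a\<close> generates the lattice points of the (-1)-eigenspace, and
  \<open>x - s *v x\<close> is \<open>\<alpha> x *s a\<close>; so \<open>\<alpha> x\<close> is an
  integer exactly when \<open>s\<close> fixes the coset of \<open>x\<close>.\<close>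

lemma roots_data:
  assumes "\<alpha> \<in> roots W L"
  shows "\<exists>s \<mu> a \<kappa>. s \<in> reflections W \<and> reflection_data L s \<mu> a \<and> \<kappa> \<noteq> 0 \<and> \<alpha> = (\<lambda>x. \<kappa> * \<mu> x) \<and>
    \<alpha> \<in> dual_lattice L \<and> (\<forall>x. \<alpha> x \<in> \<int> \<longleftrightarrow> coset L x \<in> fixed_set L s)"
proof -
  obtain s a where s: "s \<in> reflections W" and a: "is_coroot L s a" and \<alpha>: "linear_form \<alpha>"
    "act s \<alpha> = (\<lambda>x. - \<alpha> x)" "\<alpha> a = 2" using assms unfolding roots_def by blast
  obtain \<mu> b where m: "reflection_data L s \<mu> b" using reflections_data[OF s] by blast
  have sW: "s \<in> W" using s by (simp add: reflections_def)
  have \<mu>: "linear_form \<mu>" by (rule reflection_data_form[OF m])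
  have sx: "\<And>x. s *v x = x - \<mu> x *s b" using m by (simp add: reflection_data_def)
  have line: "y \<in> L \<and> s *v y = - y \<longleftrightarrow> y \<in> range (\<lambda>m :: int. of_int m *s a)" for y
    using a unfolding is_coroot_def by blast
  have sa: "s *v a = - a" and aL: "a \<in> L" using line[of a] by (auto intro: range_eqI[of _ _ 1])
  have "\<alpha> (s *v x) = - \<alpha> x" for x using \<alpha>(2) by (simp add: act_reflection[OF s] fun_eq_iff)
  then have e1: "2 * \<alpha> x = \<mu> x * \<alpha> b" for x
    by (simp add: sx linear_form_simps[OF \<alpha>(1)] algebra_simps minus_equation_iff[of "\<alpha> x"])
  have e2: "a = (\<mu> a / 2) *s b"
  proof -
    have "2 *s a = \<mu> a *s b" using sa sx[of a] by (simp add: vec_eq_iff)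
    then show ?thesis by (simp add: vec_eq_iff field_simps)
  qed
  define \<kappa> where "\<kappa> = \<alpha> b / 2"
  have ak: "\<alpha> x = \<kappa> * \<mu> x" for x using e1[of x] by (simp add: \<kappa>_def field_simps)
  have k1: "\<kappa> * \<mu> a = 2" using ak[of a] \<alpha>(3) by simp
  have sxa: "x - s *v x = \<alpha> x *s a" for x
  proof -
    have "\<alpha> x *s a = (\<kappa> * \<mu> a / 2 * \<mu> x) *s b" by (subst e2) (simp add: ak vector_smult_assoc mult_ac)
    then show ?thesis by (simp add: k1 sx)
  qed
  have a0: "a \<noteq> 0" using \<alpha>(3) linear_form_zero[OF \<alpha>(1)] by auto
  have iff: "\<alpha> x \<in> \<int> \<longleftrightarrow> x - s *v x \<in> L" for x
  proof
    assume "x - s *v x \<in> L"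
    moreover have "s *v (x - s *v x) = - (x - s *v x)"
      by (simp add: matrix_vector_mult_diff_distrib reflection_involution[OF s])
    ultimately obtain k :: int where "x - s *v x = of_int k *s a" using line by blast
    then have "\<alpha> x = of_int k" using a0 by (simp add: sxa)
    then show "\<alpha> x \<in> \<int>" by simp
  next
    assume "\<alpha> x \<in> \<int>"
    then show "x - s *v x \<in> L" by (simp add: sxa L_scale aL)
  qed
  have "\<alpha> ` L \<subseteq> \<int>" by (auto simp: iff intro!: L_diff L_apply[OF sW])
  then have "\<alpha> \<in> dual_lattice L" using \<alpha> by (simp add: dual_lattice_def)
  then show ?thesis using s m k1 ak iff
    by (intro exI[of _ s] exI[of _ \<mu>] exI[of _ b] exI[of _ \<kappa>]) (auto simp: fixed_set_iff[OF sW])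
qed

text \<open>The coroot is a generator \<open>z *s b\<close> of the lattice points on the line of
  \<open>b\<close>, and division of \<open>\<mu>\<close> by \<open>z\<close> restores the value 2 on
  it.\<close>

lemma reflection_root:
  assumes s: "s \<in> reflections W" and m: "reflection_data L s \<mu> b"
  shows "\<exists>\<alpha>\<in>roots W L. \<exists>\<kappa>. \<kappa> \<noteq> 0 \<and> \<alpha> = (\<lambda>x. \<kappa> * \<mu> x) \<and> (\<forall>x. \<alpha> x \<in> \<int> \<longleftrightarrow> coset L x \<in> fixed_set L s)"
proof -
  have sW: "s \<in> W" using s by (simp add: reflections_def)
  have \<mu>: "linear_form \<mu>" by (rule reflection_data_form[OF m])
  have d: "\<And>x. s *v x = x - \<mu> x *s b" "\<mu> b = 2" "b \<in> L" using m by (simp_all add: reflection_data_def)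
  have b0: "b \<noteq> 0" using d linear_form_zero[OF \<mu>] by auto
  obtain z where z: "z \<noteq> 0" "z *s b \<in> L" "\<And>y. y *s b \<in> L \<Longrightarrow> y / z \<in> \<int>"
    using lattice_line_cyclic[OF d(3) b0] by blast
  have co: "is_coroot L s (z *s b)"
    unfolding is_coroot_def
  proof (intro set_eqI iffI)
    fix y assume "y \<in> L \<inter> {x. s *v x = - x}"
    then have y: "y \<in> L" "y + y = \<mu> y *s b" by (auto simp: d(1) algebra_simps)
    have "y = (1 / 2) *s (y + y)" by (simp add: vec_eq_iff)
    then have yb: "y = (\<mu> y / 2) *s b" by (simp add: y(2) vector_smult_assoc)
    then have "\<mu> y / 2 / z \<in> \<int>" using y(1) by (intro z(3)) simp
    then obtain k :: int where "\<mu> y / 2 = of_int k * z" using z(1) by (elim Ints_cases) (simp add: field_simps)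
    then have "y = of_int k *s (z *s b)" using yb by (simp add: vector_smult_assoc)
    then show "y \<in> range (\<lambda>m :: int. of_int m *s (z *s b))" by blast
  next
    fix y assume "y \<in> range (\<lambda>m :: int. of_int m *s (z *s b))"
    then obtain k :: int where k: "y = of_int k *s (z *s b)" by blast
    then have "y \<in> L" using L_scale[OF _ z(2)] by simp
    moreover have "s *v y = - y" by (simp add: k d linear_form_simps[OF \<mu>] vec_eq_iff)
    ultimately show "y \<in> L \<inter> {x. s *v x = - x}" by simp
  qed
  define \<alpha> where "\<alpha> = (\<lambda>x. \<mu> x / z)"
  have h1: "linear_form \<alpha>" using linear_form_mult[OF \<mu>, of "1 / z"] by (simp add: \<alpha>_def)
  have h2: "act s \<alpha> = (\<lambda>x. - \<alpha> x)"
    unfolding act_reflection[OF s] \<alpha>_def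
    by (rule ext) (simp add: d linear_form_simps[OF \<mu>] diff_divide_distrib)
  have h3: "\<alpha> (z *s b) = 2" using z(1) by (simp add: \<alpha>_def linear_form_simps[OF \<mu>] d)
  have "\<alpha> \<in> roots W L"
    unfolding roots_def by (intro CollectI bexI[OF _ s] exI[of _ "z *s b"] conjI co h1 h2 h3)
  moreover have "\<alpha> x \<in> \<int> \<longleftrightarrow> coset L x \<in> fixed_set L s" for x
  proof
    assume "\<alpha> x \<in> \<int>"
    then have "\<alpha> x *s (z *s b) \<in> L" by (intro L_scale z(2))
    then show "coset L x \<in> fixed_set L s" using z(1) by (simp add: fixed_set_data[OF sW m] \<alpha>_def vector_smult_assoc)
  next
    assume "coset L x \<in> fixed_set L s"
    then show "\<alpha> x \<in> \<int>" using z(3) by (simp add: fixed_set_data[OF sW m] \<alpha>_def)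
  qed
  ultimately show ?thesis using z(1) by (intro bexI[of _ \<alpha>] exI[of _ "1 / z"]) (auto simp: \<alpha>_def)
qed

end

section \<open>Regular functions on the torus\<close>

text \<open>Gaussian elimination for vectors with finitely many coordinates: the coordinate
  \<open>m\<close> is cleared with a pivot \<open>y\<close>, whose own coefficient is put back at
  the end.\<close>

lemma infinite_family_dependent:
  assumes "finite M" "infinite \<Lambda>"
  shows "\<exists>S c. finite S \<and> S \<subseteq> \<Lambda> \<and> (\<exists>z\<in>S. c z \<noteq> (0::'c::field)) \<and> (\<forall>m\<in>M. (\<Sum>z\<in>S. c z * a z m) = 0)"
  using assms
proof (induction M arbitrary: a \<Lambda>)
  case empty
  then obtain z where "z \<in> \<Lambda>" using infinite_imp_nonempty by blast
  then show ?case by (intro exI[of _ "{z}"] exI[of _ "\<lambda>_. 1"]) auto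
next
  case (insert m M)
  show ?case
  proof (cases "\<forall>z\<in>\<Lambda>. a z m = 0")
    case True
    from insert.IH[OF insert.prems, of a] obtain S c where S: "finite S" "S \<subseteq> \<Lambda>"
      "\<exists>z\<in>S. c z \<noteq> 0" "\<forall>m\<in>M. (\<Sum>z\<in>S. c z * a z m) = 0" by (elim exE conjE) (rule that)
    have "(\<Sum>z\<in>S. c z * a z m) = 0" using True S(2) by (intro sum.neutral) auto
    with S show ?thesis by (intro exI[of _ S] exI[of _ c]) simp
  next
    case False
    then obtain y where y: "y \<in> \<Lambda>" "a y m \<noteq> 0" by blast
    have "infinite (\<Lambda> - {y})" using insert.prems by simp
    from insert.IH[OF this, of "\<lambda>z k. a z k - a z m / a y m * a y k"]
    obtain S c where S: "finite S" "S \<subseteq> \<Lambda> - {y}" "\<exists>z\<in>S. c z \<noteq> 0"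
      "\<forall>k\<in>M. (\<Sum>z\<in>S. c z * (a z k - a z m / a y m * a y k)) = 0" by (elim exE conjE) (rule that)
    define d where "d = c(y := - (\<Sum>z\<in>S. c z * a z m) / a y m)"
    have yS: "y \<notin> S" using S by blast
    have eq: "(\<Sum>z\<in>insert y S. d z * a z k) = (\<Sum>z\<in>S. c z * (a z k - a z m / a y m * a y k))" for k
    proof -
      have "(\<Sum>z\<in>insert y S. d z * a z k) = d y * a y k + (\<Sum>z\<in>S. c z * a z k)"
        using S yS by (auto simp: d_def intro!: sum.cong)
      also have "d y * a y k = - (\<Sum>z\<in>S. c z * (a z m / a y m * a y k))"
        by (simp add: d_def sum_divide_distrib sum_distrib_left sum_distrib_right mult_ac)
      finally show ?thesis by (simp add: right_diff_distrib sum_subtractf)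
    qed
    have "(\<Sum>z\<in>insert y S. d z * a z k) = 0" if "k \<in> insert m M" for k
      unfolding eq using that S(4) y by auto
    moreover have "\<exists>z\<in>insert y S. d z \<noteq> 0" using S yS by (auto simp: d_def)
    ultimately show ?thesis using S y by (intro exI[of _ "insert y S"] exI[of _ d]) auto
  qed
qed

context torus_reflection_group begin

abbreviation CH :: "(complex^'n \<Rightarrow> complex) set" where "CH \<equiv> torus_functions L"

lemma CH_I: "finite S \<Longrightarrow> S \<subseteq> dual_lattice L \<Longrightarrow> (\<lambda>x. \<Sum>\<mu>\<in>S. a \<mu> * expi (\<mu> x)) \<in> CH"
  unfolding torus_functions_def expi_def by blast

lemma CH_repr: "F \<in> CH \<Longrightarrow> \<exists>p. finite (fst p) \<and> fst p \<subseteq> dual_lattice L \<and>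
    F = (\<lambda>x. \<Sum>\<mu>\<in>fst p. snd p \<mu> * expi (\<mu> x))"
  unfolding torus_functions_def expi_def by auto

lemma dual_form: "\<mu> \<in> dual_lattice L \<Longrightarrow> linear_form \<mu>"
  and dual_L: "\<mu> \<in> dual_lattice L \<Longrightarrow> l \<in> L \<Longrightarrow> \<mu> l \<in> \<int>"
  by (auto simp: dual_lattice_def)

lemma dual_zero: "(\<lambda>x. 0) \<in> dual_lattice L"
  by (auto simp: dual_lattice_def linear_form_null)

lemma dual_add: "\<mu> \<in> dual_lattice L \<Longrightarrow> \<nu> \<in> dual_lattice L \<Longrightarrow> (\<lambda>x. \<mu> x + \<nu> x) \<in> dual_lattice L"
  by (auto simp: dual_lattice_def linear_form_plus image_subset_iff)

lemma dual_mult: "\<mu> \<in> dual_lattice L \<Longrightarrow> (\<lambda>x. of_int k * \<mu> x) \<in> dual_lattice L"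
  by (auto simp: dual_lattice_def linear_form_mult image_subset_iff)

lemma dual_comp: "\<mu> \<in> dual_lattice L \<Longrightarrow> w \<in> W \<Longrightarrow> (\<lambda>x. \<mu> (w *v x)) \<in> dual_lattice L"
  by (auto simp: dual_lattice_def linear_form_comp_matrix L_apply)

lemma coord_dual: "coord i \<in> dual_lattice L"
  by (auto simp: dual_lattice_def coord_form in_L_iff)

lemma CH_zero: "(\<lambda>x. 0) \<in> CH"
  using CH_I[of "{}"] by simp

lemma CH_scaled_chr: "\<mu> \<in> dual_lattice L \<Longrightarrow> (\<lambda>x. a * expi (\<mu> x)) \<in> CH"
  using CH_I[of "{\<mu>}" "\<lambda>_. a"] by simp

lemma CH_chr: "\<mu> \<in> dual_lattice L \<Longrightarrow> (\<lambda>x. expi (\<mu> x)) \<in> CH"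
  using CH_scaled_chr[of \<mu> 1] by simp

lemma CH_const: "(\<lambda>x. a) \<in> CH"
  using CH_scaled_chr[OF dual_zero, of a] by simp

lemma CH_add:
  assumes "F \<in> CH" "G \<in> CH"
  shows "(\<lambda>x. F x + G x) \<in> CH"
proof -
  obtain S a where F: "F = (\<lambda>x. \<Sum>\<mu>\<in>S. a \<mu> * expi (\<mu> x))" "finite S" "S \<subseteq> dual_lattice L"
    using assms(1) unfolding torus_functions_def expi_def by blast
  obtain T b where G: "G = (\<lambda>x. \<Sum>\<mu>\<in>T. b \<mu> * expi (\<mu> x))" "finite T" "T \<subseteq> dual_lattice L"
    using assms(2) unfolding torus_functions_def expi_def by blast
  have "F x + G x = (\<Sum>\<mu>\<in>S \<union> T. ((if \<mu> \<in> S then a \<mu> else 0) + (if \<mu> \<in> T then b \<mu> else 0)) * expi (\<mu> x))" for x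
  proof -
    have "F x = (\<Sum>\<mu>\<in>S \<union> T. (if \<mu> \<in> S then a \<mu> else 0) * expi (\<mu> x))"
      unfolding F(1) using F G by (intro sum.mono_neutral_cong_left) auto
    moreover have "G x = (\<Sum>\<mu>\<in>S \<union> T. (if \<mu> \<in> T then b \<mu> else 0) * expi (\<mu> x))"
      unfolding G(1) using F G by (intro sum.mono_neutral_cong_left) auto
    ultimately show ?thesis by (simp add: sum.distrib distrib_right)
  qed
  then show ?thesis using CH_I[of "S \<union> T"] F G by simp
qed

text \<open>Adding one character at a time spares every closure property the reindexing of finite
  sums.\<close>

lemma CH_induct [consumes 1, case_names zero add]:
  assumes "F \<in> CH" "P (\<lambda>x. 0)"
    and "\<And>a \<mu> F. \<mu> \<in> dual_lattice L \<Longrightarrow> F \<in> CH \<Longrightarrow> P F \<Longrightarrow> P (\<lambda>x. a * expi (\<mu> x) + F x)"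
  shows "P F"
proof -
  obtain S a where F: "F = (\<lambda>x. \<Sum>\<mu>\<in>S. a \<mu> * expi (\<mu> x))" "finite S" "S \<subseteq> dual_lattice L"
    using assms(1) unfolding torus_functions_def expi_def by blast
  have "P (\<lambda>x. \<Sum>\<mu>\<in>S. a \<mu> * expi (\<mu> x))" using F(2,3)
  proof (induction S)
    case (insert \<mu> S)
    then show ?case using assms(3)[of \<mu> "\<lambda>x. \<Sum>\<mu>\<in>S. a \<mu> * expi (\<mu> x)" "a \<mu>"] by (simp add: CH_I)
  qed (simp add: assms(2))
  with F(1) show ?thesis by simp
qed

lemma CH_chr_mult: "F \<in> CH \<Longrightarrow> \<mu> \<in> dual_lattice L \<Longrightarrow> (\<lambda>x. a * expi (\<mu> x) * F x) \<in> CH"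
proof (induction rule: CH_induct)
  case zero
  then show ?case by (simp add: CH_zero)
next
  case (add b \<nu> F)
  have "(\<lambda>x. (a * b) * expi (\<mu> x + \<nu> x) + a * expi (\<mu> x) * F x) \<in> CH"
    using add by (intro CH_add CH_scaled_chr dual_add) auto
  then show ?case by (simp add: expi_add algebra_simps)
qed

lemma CH_mult: "F \<in> CH \<Longrightarrow> G \<in> CH \<Longrightarrow> (\<lambda>x. F x * G x) \<in> CH"
proof (induction rule: CH_induct)
  case zero
  then show ?case by (simp add: CH_zero)
next
  case (add b \<nu> F)
  have "(\<lambda>x. b * expi (\<nu> x) * G x + F x * G x) \<in> CH"
    using add by (intro CH_add CH_chr_mult) auto
  then show ?case by (simp add: algebra_simps)
qed

lemma CH_scale: "F \<in> CH \<Longrightarrow> (\<lambda>x. a * F x) \<in> CH"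
  by (intro CH_mult CH_const)

lemma CH_diff: "F \<in> CH \<Longrightarrow> G \<in> CH \<Longrightarrow> (\<lambda>x. F x - G x) \<in> CH"
  using CH_add[OF _ CH_scale[of G "-1"]] by simp

lemma CH_sum: "(\<And>i. i \<in> A \<Longrightarrow> F i \<in> CH) \<Longrightarrow> (\<lambda>x. \<Sum>i\<in>A. F i x) \<in> CH"
  by (induction A rule: infinite_finite_induct) (auto intro: CH_zero CH_add)

lemma CH_prod: "(\<And>i. i \<in> A \<Longrightarrow> F i \<in> CH) \<Longrightarrow> (\<lambda>x. \<Prod>i\<in>A. F i x) \<in> CH"
  by (induction A rule: infinite_finite_induct) (auto intro: CH_const CH_mult)

lemma CH_power: "F \<in> CH \<Longrightarrow> (\<lambda>x. F x ^ k) \<in> CH"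
  by (induction k) (auto intro: CH_const CH_mult)

lemma CH_poly: "F \<in> CH \<Longrightarrow> (\<lambda>x. poly p (F x)) \<in> CH"
  by (induction p) (auto intro: CH_const CH_add CH_mult)

lemma exp_poly_expi: "linear_form \<mu> \<Longrightarrow> (\<lambda>x. expi (\<mu> x)) \<in> exp_poly"
  unfolding expi_def by (intro exp_poly.exp linear_form_mult)

lemma CH_exp_poly: "F \<in> CH \<Longrightarrow> F \<in> exp_poly"
proof (induction rule: CH_induct)
  case (add a \<mu> F)
  then show ?case
    by (intro exp_poly.add exp_poly_scale exp_poly_expi dual_form)
qed (rule exp_poly.const)

lemma CH_shift: "F \<in> CH \<Longrightarrow> (\<lambda>x. F (p + x)) \<in> CH"
proof (induction rule: CH_induct)
  case (add a \<mu> F)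
  have "(\<lambda>x. (a * expi (\<mu> p)) * expi (\<mu> x) + F (p + x)) \<in> CH"
    using add by (intro CH_add CH_scaled_chr) auto
  then show ?case using add by (simp add: linear_form_add[OF dual_form] expi_add mult.assoc)
qed (rule CH_zero)

lemma CH_comp: "F \<in> CH \<Longrightarrow> w \<in> W \<Longrightarrow> (\<lambda>x. F (w *v x)) \<in> CH"
proof (induction rule: CH_induct)
  case (add a \<mu> F)
  then show ?case by (intro CH_add CH_scaled_chr[of "\<lambda>x. \<mu> (w *v x)"] dual_comp) auto
qed (rule CH_zero)

lemma CH_periodic: "F \<in> CH \<Longrightarrow> l \<in> L \<Longrightarrow> F (x + l) = F x"
proof (induction rule: CH_induct)
  case (add a \<mu> F)
  then have "expi (\<mu> l) = 1" by (simp only: expi_eq_1_iff dual_L)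
  then show ?case using add by (simp add: linear_form_add[OF dual_form] expi_add)
qed simp

lemma CH_coset: "F \<in> CH \<Longrightarrow> x - y \<in> L \<Longrightarrow> F x = F y"
  using CH_periodic[of F "x - y" y] by simp

lemma directional_chr:
  "linear_form \<mu> \<Longrightarrow> directional v (\<lambda>x. expi (\<mu> x)) = (\<lambda>x. 2 * of_real pi * \<i> * \<mu> v * expi (\<mu> x))"
  unfolding expi_def using directional_exp[OF linear_form_mult[of \<mu> "2 * of_real pi * \<i>"]] by simp

lemma CH_directional: "F \<in> CH \<Longrightarrow> directional v F \<in> CH"
proof (induction rule: CH_induct)
  case (add a \<mu> F)
  have "directional v (\<lambda>x. a * expi (\<mu> x) + F x) =
      (\<lambda>x. (a * (2 * of_real pi * \<i> * \<mu> v)) * expi (\<mu> x) + directional v F x)"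
    using add by (simp add: directional_add directional_scale CH_exp_poly CH_chr CH_scaled_chr
        directional_chr dual_form mult.assoc)
  then show ?case using add by (simp only:) (intro CH_add CH_scaled_chr)
qed (simp add: directional_const CH_zero)

section \<open>Ideals of regular functions and the Nullstellensatz\<close>

definition CH_ideal :: "(complex^'n \<Rightarrow> complex) set \<Rightarrow> bool" where
  "CH_ideal J \<longleftrightarrow> J \<subseteq> CH \<and> (\<lambda>x. 0) \<in> J \<and> (\<forall>F\<in>J. \<forall>G\<in>J. (\<lambda>x. F x + G x) \<in> J) \<and>
     (\<forall>F\<in>CH. \<forall>G\<in>J. (\<lambda>x. F x * G x) \<in> J)"

lemma CH_idealD:
  assumes "CH_ideal J"
  shows CH_ideal_subset: "F \<in> J \<Longrightarrow> F \<in> CH"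
    and CH_ideal_zero: "(\<lambda>x. 0) \<in> J"
    and CH_ideal_add: "F \<in> J \<Longrightarrow> G \<in> J \<Longrightarrow> (\<lambda>x. F x + G x) \<in> J"
    and CH_ideal_mult: "F \<in> CH \<Longrightarrow> G \<in> J \<Longrightarrow> (\<lambda>x. F x * G x) \<in> J"
proof -
  have *: "J \<subseteq> CH" "(\<lambda>x. 0) \<in> J" "\<forall>F\<in>J. \<forall>G\<in>J. (\<lambda>x. F x + G x) \<in> J"
     "\<forall>F\<in>CH. \<forall>G\<in>J. (\<lambda>x. F x * G x) \<in> J"
    by (insert assms[unfolded CH_ideal_def], elim conjE, assumption)+
  show "F \<in> J \<Longrightarrow> F \<in> CH" by (rule subsetD[OF *(1)])
  show "(\<lambda>x. 0) \<in> J" by (rule *(2))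
  show "F \<in> J \<Longrightarrow> G \<in> J \<Longrightarrow> (\<lambda>x. F x + G x) \<in> J" by (rule *(3)[rule_format])
  show "F \<in> CH \<Longrightarrow> G \<in> J \<Longrightarrow> (\<lambda>x. F x * G x) \<in> J" by (rule *(4)[rule_format])
qed

lemma CH_ideal_diff:
  assumes "CH_ideal J" "F \<in> J" "G \<in> J"
  shows "(\<lambda>x. F x - G x) \<in> J"
proof -
  have "(\<lambda>x. - 1 * G x) \<in> J" by (rule CH_ideal_mult[OF assms(1) CH_const assms(3)])
  then have "(\<lambda>x. F x + - 1 * G x) \<in> J" by (rule CH_ideal_add[OF assms(1,2)])
  then show ?thesis by simp
qed

lemma CH_ideal_sum:
  "CH_ideal J \<Longrightarrow> (\<And>i. i \<in> A \<Longrightarrow> F i \<in> J) \<Longrightarrow> (\<lambda>x. \<Sum>i\<in>A. F i x) \<in> J"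
  by (induction A rule: infinite_finite_induct) (auto intro: CH_ideal_zero CH_ideal_add)

lemma dual_expand:
  assumes "\<mu> \<in> dual_lattice L"
  shows "\<exists>m :: 'n \<Rightarrow> int. \<mu> = (\<lambda>x. \<Sum>i\<in>UNIV. of_int (m i) * coord i x)"
proof -
  have "basis i \<in> L" for i by (auto simp: in_L_iff coord_basis)
  then have "\<forall>i. \<exists>k :: int. \<mu> (basis i) = of_int k" using dual_L[OF assms] by (meson Ints_cases)
  then obtain m :: "'n \<Rightarrow> int" where m: "\<And>i. \<mu> (basis i) = of_int (m i)" by metis
  have "\<mu> x = (\<Sum>i\<in>UNIV. of_int (m i) * coord i x)" for x
    by (subst coord_expand[of x])
      (simp add: linear_form_sum[OF dual_form[OF assms]] linear_form_scale[OF dual_form[OF assms]] m mult.commute)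
  then show ?thesis by blast
qed

lemma countable_dual: "countable (dual_lattice L)"
proof -
  have "dual_lattice L \<subseteq> range (\<lambda>m :: 'n \<Rightarrow> int. \<lambda>x. \<Sum>i\<in>UNIV. of_int (m i) * coord i x)"
  proof
    fix \<mu> assume "\<mu> \<in> dual_lattice L"
    from dual_expand[OF this] obtain m where "\<mu> = (\<lambda>x. \<Sum>i\<in>UNIV. of_int (m i) * coord i x)" ..
    then show "\<mu> \<in> range (\<lambda>m :: 'n \<Rightarrow> int. \<lambda>x. \<Sum>i\<in>UNIV. of_int (m i) * coord i x)"
      by (intro range_eqI[of _ _ m])
  qed
  then show ?thesis by (rule countable_subset) simp
qed

lemma nontrivial_zero:
  assumes "0 < degree (q :: complex poly)"
  shows "\<exists>r. poly q r = 0"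
proof -
  have "coeff q (degree q) \<noteq> 0" using assms by auto
  then obtain r where "(\<Sum>i\<le>degree q. coeff q i * r ^ i) = 0"
    using fundamental_theorem_of_algebra[of "coeff q" "degree q"] assms by (metis atLeastAtMost_iff le_refl Suc_leI One_nat_def)
  then show ?thesis by (auto simp: poly_altdef)
qed

text \<open>If \<open>e - z\<close> were invertible modulo \<open>J\<close> for every nonzero \<open>z\<close>, then the uncountably many inverses
  would be linearly dependent, because \<open>\<complex>[H]\<close> has a countable basis; hence a nonzero polynomial in \<open>e\<close>
  would lie in \<open>J\<close>, and its linear factors are units modulo \<open>J\<close>.\<close>

lemma ideal_character_value:
  assumes J: "CH_ideal J" and proper: "(\<lambda>x. 1) \<notin> J" and \<mu>: "\<mu> \<in> dual_lattice L"
  shows "\<exists>z. z \<noteq> 0 \<and> (\<forall>G\<in>CH. (\<lambda>x. 1 - G x * (expi (\<mu> x) - z)) \<notin> J)"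
proof (rule ccontr)
  define e where "e = (\<lambda>x. expi (\<mu> x))"
  have e: "e \<in> CH" unfolding e_def by (rule CH_chr[OF \<mu>])
  assume "\<not> ?thesis"
  then have "\<forall>z. \<exists>G. z \<noteq> 0 \<longrightarrow> G \<in> CH \<and> (\<lambda>x. 1 - G x * (e x - z)) \<in> J" unfolding e_def by blast
  then obtain G where G: "\<And>z. z \<noteq> 0 \<Longrightarrow> G z \<in> CH" "\<And>z. z \<noteq> 0 \<Longrightarrow> (\<lambda>x. 1 - G z x * (e x - z)) \<in> J" by metis
  \<comment> \<open>A polynomial in \<open>e\<close> splits into linear factors that are invertible
    modulo \<open>J\<close>: \<open>e - r\<close> with \<open>r \<noteq> 0\<close> by assumption,
    and \<open>e\<close> itself because it is a character.\<close>
  have unit: "(\<lambda>x. 1) \<in> J" if "q \<noteq> 0" "(\<lambda>x. poly q (e x)) \<in> J" for q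
    using that
  proof (induction "degree q" arbitrary: q)
    case 0
    then obtain a where a: "q = [:a:]" "a \<noteq> 0" by (metis degree_eq_zeroE pCons_eq_0_iff)
    show ?case using CH_ideal_mult[OF J CH_const[of "1 / a"] 0(3)] a by simp
  next
    case (Suc n)
    then obtain r where r: "poly q r = 0" using nontrivial_zero[of q] by auto
    then obtain p where p: "q = [:- r, 1:] * p" by (metis dvdE poly_eq_0_iff_dvd)
    have p0: "p \<noteq> 0" using Suc p by auto
    then have "degree q = Suc (degree p)" unfolding p by (subst degree_mult_eq) auto
    then have deg: "n = degree p" using Suc by simp
    have pCH: "(\<lambda>x. poly p (e x)) \<in> CH" by (rule CH_poly[OF e])
    have "(\<lambda>x. poly p (e x)) \<in> J"
    proof (cases "r = 0")
      case True
      have "(\<lambda>x. expi (- \<mu> x)) \<in> CH" using CH_chr[OF dual_mult[OF \<mu>, of "-1"]] by simp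
      then have "(\<lambda>x. expi (- \<mu> x) * poly q (e x)) \<in> J" by (rule CH_ideal_mult[OF J _ Suc(4)])
      then show ?thesis by (simp add: p True e_def expi_minus field_simps)
    next
      case False
      have "(\<lambda>x. poly p (e x) * (1 - G r x * (e x - r)) + G r x * poly q (e x)) \<in> J"
        by (intro CH_ideal_add[OF J] CH_ideal_mult[OF J] pCH G Suc(4) False)
      then show ?thesis by (simp add: p algebra_simps)
    qed
    then show ?case using Suc(1)[OF deg p0] by blast
  qed
  have "\<forall>z\<in>- {0}. \<exists>p. finite (fst p) \<and> fst p \<subseteq> dual_lattice L \<and>
      G z = (\<lambda>x. \<Sum>\<mu>\<in>fst p. snd p \<mu> * expi (\<mu> x))"
    by (intro ballI CH_repr G(1)) simp
  from bchoice[OF this] obtain r where r: "\<forall>z\<in>- {0}. finite (fst (r z)) \<and> fst (r z) \<subseteq> dual_lattice L \<and>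
      G z = (\<lambda>x. \<Sum>\<mu>\<in>fst (r z). snd (r z) \<mu> * expi (\<mu> x))" ..
  define S a where "S = (\<lambda>z. fst (r z))" and "a = (\<lambda>z. snd (r z))"
  have S: "finite (S z)" "S z \<subseteq> dual_lattice L" "G z = (\<lambda>x. \<Sum>\<mu>\<in>S z. a z \<mu> * expi (\<mu> x))"
    if "z \<noteq> 0" for z
    using bspec[OF r, of z] that unfolding S_def a_def by simp_all
  \<comment> \<open>There are uncountably many \<open>z\<close> but only countably many finite
    supports, so infinitely many of the inverses \<open>G z\<close> lie in the span of one finite
    set \<open>M\<close> of characters.\<close>
  have "\<exists>M. infinite {z. z \<noteq> 0 \<and> S z = M}"
  proof (rule ccontr)
    assume "\<not> ?thesis"
    then have fin: "finite {z. z \<noteq> 0 \<and> S z = M}" for M by blast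
    have "countable {M. finite M \<and> M \<subseteq> dual_lattice L}"
      using countable_Collect_finite_subset[OF countable_dual] by (simp add: conj_commute)
    then have c: "countable (\<Union>M\<in>{M. finite M \<and> M \<subseteq> dual_lattice L}. {z. z \<noteq> 0 \<and> S z = M})"
      by (rule countable_UN) (rule countable_finite[OF fin])
    have "UNIV - {0} \<subseteq> (\<Union>M\<in>{M. finite M \<and> M \<subseteq> dual_lattice L}. {z. z \<noteq> 0 \<and> S z = M})"
    proof
      fix z :: complex assume "z \<in> UNIV - {0}"
      then show "z \<in> (\<Union>M\<in>{M. finite M \<and> M \<subseteq> dual_lattice L}. {z. z \<noteq> 0 \<and> S z = M})"
        using S(1)[of z] S(2)[of z] by blast
    qed
    from countable_subset[OF this c] have "countable (UNIV - {0 :: complex})" .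
    then have "countable (UNIV :: complex set)" by (simp add: uncountable_minus_countable)
    then show False using uncountable_UNIV_complex by simp
  qed
  then obtain M where M: "infinite {z. z \<noteq> 0 \<and> S z = M}" by blast
  then obtain z1 where "z1 \<noteq> 0" "S z1 = M" using infinite_imp_nonempty by blast
  then have "finite M" using S(1) by blast
  from infinite_family_dependent[OF this M, of a] obtain K c where K: "finite K"
    "K \<subseteq> {z. z \<noteq> 0 \<and> S z = M}" "\<exists>z\<in>K. c z \<noteq> 0" "\<forall>m\<in>M. (\<Sum>z\<in>K. c z * a z m) = 0" by blast
  have sum0: "(\<Sum>z\<in>K. c z * G z x) = 0" for x
  proof -
    have "(\<Sum>z\<in>K. c z * G z x) = (\<Sum>z\<in>K. \<Sum>m\<in>M. c z * a z m * expi (m x))"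
      using K(2) S(3) by (intro sum.cong) (auto simp: sum_distrib_left mult.assoc)
    also have "\<dots> = (\<Sum>m\<in>M. (\<Sum>z\<in>K. c z * a z m) * expi (m x))"
      by (subst sum.swap) (simp add: sum_distrib_right)
    finally show ?thesis using K(4) by simp
  qed
  \<comment> \<open>The numerator of the sum of \<open>c z / (t - z)\<close>: the linear relation
    among the inverses with its denominators cleared. At a point \<open>z0\<close> of
    \<open>K\<close> only the term of \<open>z0\<close> survives, so \<open>q\<close> is not
    zero.\<close>
  define q where "q = (\<Sum>z\<in>K. smult (c z) (\<Prod>y\<in>K - {z}. [:- y, 1:]))"
  have qx: "poly q t = (\<Sum>z\<in>K. c z * (\<Prod>y\<in>K - {z}. t - y))" for t
    by (simp add: q_def poly_sum poly_prod)
  obtain z0 where z0: "z0 \<in> K" "c z0 \<noteq> 0" using K by blast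
  have "poly q z0 = c z0 * (\<Prod>y\<in>K - {z0}. z0 - y)"
  proof -
    have "c z * (\<Prod>y\<in>K - {z}. z0 - y) = 0" if "z \<in> K - {z0}" for z
      using that z0 K(1) by (auto intro!: prod_zero)
    then have "(\<Sum>z\<in>K - {z0}. c z * (\<Prod>y\<in>K - {z}. z0 - y)) = 0" by (intro sum.neutral ballI)
    then show ?thesis unfolding qx sum.remove[OF K(1) z0(1)] by simp
  qed
  then have q0: "q \<noteq> 0" using z0 K(1) by (auto simp: prod_zero_iff)
  have "poly q (e x) = (\<Sum>z\<in>K. (c z * (\<Prod>y\<in>K - {z}. e x - y)) * (1 - G z x * (e x - z)))" for x
  proof -
    have "(\<Sum>z\<in>K. (c z * (\<Prod>y\<in>K - {z}. e x - y)) * (1 - G z x * (e x - z)))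
        = poly q (e x) - (\<Sum>z\<in>K. (c z * G z x) * ((e x - z) * (\<Prod>y\<in>K - {z}. e x - y)))"
      by (simp add: qx sum_subtractf[symmetric] algebra_simps)
    also have "(\<Sum>z\<in>K. (c z * G z x) * ((e x - z) * (\<Prod>y\<in>K - {z}. e x - y)))
        = (\<Sum>z\<in>K. (c z * G z x) * (\<Prod>y\<in>K. e x - y))"
      using K(1) by (intro sum.cong refl arg_cong[where f = "\<lambda>t. _ * t"]) (rule prod.remove[symmetric])
    also have "\<dots> = 0" by (simp add: sum_distrib_right[symmetric] sum0)
    finally show ?thesis by simp
  qed
  moreover have "(\<lambda>x. \<Sum>z\<in>K. (c z * (\<Prod>y\<in>K - {z}. e x - y)) * (1 - G z x * (e x - z))) \<in> J"
    using K(2) by (intro CH_ideal_sum[OF J] CH_ideal_mult[OF J] G(2) CH_mult CH_const CH_prod CH_diff e) auto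
  ultimately have "(\<lambda>x. poly q (e x)) \<in> J" by simp
  from proper unit[OF q0 this] show False by (rule notE)
qed

definition adjoin :: "(complex^'n \<Rightarrow> complex) set \<Rightarrow> (complex^'n \<Rightarrow> complex) \<Rightarrow> (complex^'n \<Rightarrow> complex) set" where
  "adjoin J g = {H. \<exists>F\<in>J. \<exists>G\<in>CH. H = (\<lambda>x. F x + G x * g x)}"

lemma adjoinI: "F \<in> J \<Longrightarrow> G \<in> CH \<Longrightarrow> (\<lambda>x. F x + G x * g x) \<in> adjoin J g"
  unfolding adjoin_def by blast

lemma CH_ideal_adjoin:
  assumes J: "CH_ideal J" and g: "g \<in> CH"
  shows "CH_ideal (adjoin J g)"
  unfolding CH_ideal_def
proof (intro conjI ballI subsetI)
  fix H assume "H \<in> adjoin J g"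
  then obtain F G where *: "F \<in> J" "G \<in> CH" "H = (\<lambda>x. F x + G x * g x)" unfolding adjoin_def by blast
  show "H \<in> CH" unfolding *(3) by (intro CH_add CH_mult g CH_ideal_subset[OF J] *)
next
  show "(\<lambda>x. 0) \<in> adjoin J g" using adjoinI[OF CH_ideal_zero[OF J] CH_zero, of g] by simp
next
  fix H H' assume "H \<in> adjoin J g" "H' \<in> adjoin J g"
  then obtain F G F' G' where *: "F \<in> J" "G \<in> CH" "H = (\<lambda>x. F x + G x * g x)"
    "F' \<in> J" "G' \<in> CH" "H' = (\<lambda>x. F' x + G' x * g x)" unfolding adjoin_def by blast
  have "(\<lambda>x. (F x + F' x) + (G x + G' x) * g x) \<in> adjoin J g"
    by (intro adjoinI CH_ideal_add[OF J] CH_add *)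
  then show "(\<lambda>x. H x + H' x) \<in> adjoin J g" by (simp add: *(3,6) algebra_simps)
next
  fix E H assume E: "E \<in> CH" and "H \<in> adjoin J g"
  then obtain F G where *: "F \<in> J" "G \<in> CH" "H = (\<lambda>x. F x + G x * g x)" unfolding adjoin_def by blast
  have "(\<lambda>x. E x * F x + (E x * G x) * g x) \<in> adjoin J g"
    by (intro adjoinI CH_ideal_mult[OF J] CH_mult E *)
  then show "(\<lambda>x. E x * H x) \<in> adjoin J g" by (simp add: *(3) algebra_simps)
qed

lemma adjoin_base: "F \<in> J \<Longrightarrow> F \<in> adjoin J g"
  using adjoinI[OF _ CH_zero, of F J g] by simp

lemma adjoin_generator: "CH_ideal J \<Longrightarrow> g \<in> adjoin J g"
  using adjoinI[OF CH_ideal_zero CH_const[of 1], of J g] by simp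

lemma adjoin_one:
  assumes "(\<lambda>x. 1) \<in> adjoin J g"
  shows "\<exists>G\<in>CH. (\<lambda>x. 1 - G x * g x) \<in> J"
proof -
  obtain F G where *: "F \<in> J" "G \<in> CH" "(\<lambda>x. 1) = (\<lambda>x. F x + G x * g x)"
    using assms unfolding adjoin_def by blast
  have "1 - G x * g x = F x" for x using fun_cong[OF *(3), of x] by (simp add: algebra_simps eq_diff_eq)
  then show ?thesis using * by (intro bexI[of _ G]) simp_all
qed

text \<open>The values of the coordinates are fixed one at a time: the ideal is enlarged by
  \<open>expi (coord i x) - z\<close>, and the choice of \<open>z\<close> keeps it proper. The
  outcome does the work of a maximal ideal.\<close>

lemma ideal_coordinate_values:
  assumes "CH_ideal J" "(\<lambda>x. 1) \<notin> J" "finite (A :: 'n set)"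
  shows "\<exists>I. CH_ideal I \<and> J \<subseteq> I \<and> (\<lambda>x. 1) \<notin> I \<and> (\<forall>i\<in>A. \<exists>z. z \<noteq> 0 \<and> (\<lambda>x. expi (coord i x) - z) \<in> I)"
  using assms(3)
proof induction
  case empty
  show ?case by (rule exI[of _ J]) (simp add: assms(1,2))
next
  case (insert i A)
  then obtain I where I: "CH_ideal I" "J \<subseteq> I" "(\<lambda>x. 1) \<notin> I"
    "\<And>i. i \<in> A \<Longrightarrow> \<exists>z. z \<noteq> 0 \<and> (\<lambda>x. expi (coord i x) - z) \<in> I" by (elim exE conjE) (rule that, auto)
  obtain z where z: "z \<noteq> 0" "\<And>G. G \<in> CH \<Longrightarrow> (\<lambda>x. 1 - G x * (expi (coord i x) - z)) \<notin> I"
    using ideal_character_value[OF I(1,3) coord_dual[of i]] by (elim exE conjE) (rule that, auto)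
  define g where "g = (\<lambda>x. expi (coord i x) - z)"
  have g: "g \<in> CH" unfolding g_def by (intro CH_diff CH_chr coord_dual CH_const)
  have "\<exists>z. z \<noteq> 0 \<and> (\<lambda>x. expi (coord j x) - z) \<in> adjoin I g" if j: "j \<in> insert i A" for j
  proof (cases "j = i")
    case True
    then show ?thesis using adjoin_generator[OF I(1), of g] z(1) unfolding g_def by (intro exI[of _ z]) simp
  next
    case False
    then obtain y where "y \<noteq> 0" "(\<lambda>x. expi (coord j x) - y) \<in> I" using I(4)[of j] j False by auto
    then show ?thesis by (intro exI[of _ y] conjI adjoin_base)
  qed
  moreover have "(\<lambda>x. 1) \<notin> adjoin I g"
    using adjoin_one[of I g] z(2) unfolding g_def by auto
  moreover have "J \<subseteq> adjoin I g" using I(2) adjoin_base by (meson subsetD subsetI)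
  ultimately show ?case using CH_ideal_adjoin[OF I(1) g] by (intro exI[of _ "adjoin I g"]) simp
qed

text \<open>The characters that are congruent modulo \<open>I\<close> to their value at
  \<open>p\<close> form a subgroup of the dual lattice; it contains the coordinates, which
  generate.\<close>

lemma ideal_evaluation:
  assumes I: "CH_ideal I" and c: "\<And>i. (\<lambda>x. expi (coord i x) - expi (coord i p)) \<in> I" and F: "F \<in> CH"
  shows "(\<lambda>x. F x - F p) \<in> I"
proof -
  define U where "U = {\<mu>. \<mu> \<in> dual_lattice L \<and> (\<lambda>x. expi (\<mu> x) - expi (\<mu> p)) \<in> I}"
  have U0: "(\<lambda>x. 0) \<in> U" using CH_ideal_zero[OF I] dual_zero by (simp add: U_def)
  have Uadd: "(\<lambda>x. \<mu> x + \<nu> x) \<in> U" if "\<mu> \<in> U" "\<nu> \<in> U" for \<mu> \<nu>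
  proof -
    have "(\<lambda>x. expi (\<nu> x) * (expi (\<mu> x) - expi (\<mu> p)) + expi (\<mu> p) * (expi (\<nu> x) - expi (\<nu> p))) \<in> I"
      using that unfolding U_def by (intro CH_ideal_add[OF I] CH_ideal_mult[OF I] CH_const CH_chr) auto
    moreover have "expi (\<nu> x) * (expi (\<mu> x) - expi (\<mu> p)) + expi (\<mu> p) * (expi (\<nu> x) - expi (\<nu> p))
        = expi (\<mu> x + \<nu> x) - expi (\<mu> p + \<nu> p)" for x by (simp add: expi_add algebra_simps)
    ultimately show ?thesis using that by (simp add: U_def dual_add)
  qed
  have Uminus: "(\<lambda>x. - \<mu> x) \<in> U" if "\<mu> \<in> U" for \<mu>
  proof -
    have m: "(\<lambda>x. - \<mu> x) \<in> dual_lattice L" using that dual_mult[of \<mu> "-1"] by (simp add: U_def)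
    have "(\<lambda>x. (- expi (- \<mu> p) * expi (- \<mu> x)) * (expi (\<mu> x) - expi (\<mu> p))) \<in> I"
      using that CH_scaled_chr[OF m, of "- expi (- \<mu> p)"] unfolding U_def by (intro CH_ideal_mult[OF I]) auto
    moreover have "(- expi (- \<mu> p) * expi (- \<mu> x)) * (expi (\<mu> x) - expi (\<mu> p)) = expi (- \<mu> x) - expi (- \<mu> p)" for x
      by (simp add: expi_minus field_simps)
    ultimately show ?thesis using m by (simp add: U_def)
  qed
  have Unat: "(\<lambda>x. of_nat k * \<mu> x) \<in> U" if "\<mu> \<in> U" for k \<mu>
  proof (induction k)
    case (Suc k)
    then show ?case using Uadd[OF that Suc] by (simp add: algebra_simps)
  qed (simp add: U0)
  have Uint: "(\<lambda>x. of_int k * \<mu> x) \<in> U" if "\<mu> \<in> U" for k \<mu>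
  proof (cases k)
    case (nonneg n)
    then show ?thesis using Unat[OF that] by simp
  next
    case (neg n)
    then have "(of_int k :: complex) = - of_nat (Suc n)" by simp
    then show ?thesis using Uminus[OF Unat[OF that, of "Suc n"]] by (simp only: mult_minus_left)
  qed
  have Uc: "coord i \<in> U" for i using c[of i] coord_dual by (simp add: U_def)
  have Usum: "(\<lambda>x. \<Sum>i\<in>A. of_int (m i) * coord i x) \<in> U" if "finite A" for A and m :: "'n \<Rightarrow> int"
    using that
  proof induction
    case (insert i A)
    then show ?case using Uadd[OF Uint[OF Uc] insert.IH] by simp
  qed (simp add: U0)
  have Uall: "\<mu> \<in> U" if \<mu>: "\<mu> \<in> dual_lattice L" for \<mu>
  proof -
    obtain m where "\<mu> = (\<lambda>x. \<Sum>i\<in>UNIV. of_int (m i) * coord i x)" using dual_expand[OF \<mu>] by (rule exE)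
    then show ?thesis using Usum[of UNIV m] by simp
  qed
  show ?thesis using F
  proof (induction rule: CH_induct)
    case zero
    then show ?case using CH_ideal_zero[OF I] by simp
  next
    case (add a \<mu> F)
    have "(\<lambda>x. expi (\<mu> x) - expi (\<mu> p)) \<in> I" using Uall[OF add(1)] by (simp add: U_def)
    then have "(\<lambda>x. a * (expi (\<mu> x) - expi (\<mu> p)) + (F x - F p)) \<in> I"
      by (intro CH_ideal_add[OF I] CH_ideal_mult[OF I] CH_const add)
    then show ?case by (simp add: algebra_simps)
  qed
qed

lemma nullstellensatz:
  assumes "CH_ideal J" "\<And>p. \<exists>F\<in>J. F p \<noteq> 0"
  shows "(\<lambda>x. 1) \<in> J"
proof (rule ccontr)
  assume proper: "(\<lambda>x. 1) \<notin> J"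
  obtain I where I: "CH_ideal I" "J \<subseteq> I" "(\<lambda>x. 1) \<notin> I"
    and "\<forall>i\<in>UNIV. \<exists>z. z \<noteq> 0 \<and> (\<lambda>x. expi (coord i x) - z) \<in> I"
    using ideal_coordinate_values[OF assms(1) proper finite_class.finite_UNIV] by (elim exE conjE) (rule that, auto)
  from bchoice[OF this(4)] obtain z where z: "\<forall>i\<in>UNIV. z i \<noteq> 0 \<and> (\<lambda>x. expi (coord i x) - z i) \<in> I" ..
  \<comment> \<open>The values \<open>z i\<close> are nonzero, so logarithms turn them into the
    coordinates of an actual point.\<close>
  define p where "p = (\<Sum>i\<in>UNIV. (Ln (z i) / (2 * of_real pi * \<i>)) *s basis i)"
  have cp: "coord i p = Ln (z i) / (2 * of_real pi * \<i>)" for i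
    by (simp add: p_def linear_form_sum[OF coord_form] coord_simps coord_basis if_distrib cong: if_cong)
  have ep: "expi (coord i p) = z i" for i
    using z by (simp add: cp expi_def)
  obtain F where F: "F \<in> J" "F p \<noteq> 0" using assms(2)[of p] by (elim bexE)
  then have "F \<in> CH" using CH_ideal_subset[OF assms(1)] by simp
  have "(\<lambda>x. expi (coord i x) - expi (coord i p)) \<in> I" for i using z by (simp add: ep)
  from ideal_evaluation[where p = p, OF I(1) this \<open>F \<in> CH\<close>] have "(\<lambda>x. F x - F p) \<in> I" .
  from CH_ideal_diff[OF I(1) subsetD[OF I(2) F(1)] this] have "(\<lambda>x. F x - (F x - F p)) \<in> I" .
  from CH_ideal_mult[OF I(1) CH_const[of "1 / F p"] this] have "(\<lambda>x. 1 / F p * (F x - (F x - F p))) \<in> I" .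
  moreover have "1 / F p * (F x - (F x - F p)) = 1" for x using F(2) by simp
  ultimately have "(\<lambda>x. 1) \<in> I" by (simp only:)
  with I(3) show False by (rule notE)
qed

end

section \<open>Submodules over algebras given by generators\<close>

lemma operator_algebra_stable:
  assumes "function_subspace N" "\<And>A F. A \<in> S \<Longrightarrow> F \<in> N \<Longrightarrow> A F \<in> N"
    and "A \<in> operator_algebra S" "F \<in> N"
  shows "A F \<in> N"
  using assms(3,4)
proof (induction arbitrary: F)
  case (add A B)
  have *: "\<forall>F\<in>N. \<forall>G\<in>N. (\<lambda>x. F x + G x) \<in> N"
    by (insert assms(1)[unfolded function_subspace_def], elim conjE, assumption)
  show ?case by (rule bspec[OF bspec[OF * add.IH(1)[OF add.prems]] add.IH(2)[OF add.prems]])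
next
  case (scale A a)
  have *: "\<forall>a. \<forall>F\<in>N. (\<lambda>x. a * F x) \<in> N"
    by (insert assms(1)[unfolded function_subspace_def], elim conjE, assumption)
  show ?case by (rule bspec[OF spec[OF *] scale.IH[OF scale.prems]])
qed (simp_all add: assms(2))

lemma submodule_operator_algebra_iff:
  "submodule (operator_algebra S) M N \<longleftrightarrow>
     function_subspace N \<and> N \<subseteq> M \<and> (\<forall>A\<in>S. \<forall>F\<in>N. A F \<in> N)"
  using operator_algebra_stable[of N S] operator_algebra.gen[of _ S]
  unfolding submodule_def by (safe; blast)

lemma function_subspaceI:
  assumes "(\<lambda>x. 0) \<in> N" "\<And>F G. F \<in> N \<Longrightarrow> G \<in> N \<Longrightarrow> (\<lambda>x. F x + G x) \<in> N"
    "\<And>a F. F \<in> N \<Longrightarrow> (\<lambda>x. a * F x) \<in> N"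
  shows "function_subspace N"
  unfolding function_subspace_def using assms by simp

context torus_reflection_group begin

section \<open>Equations of the reflection hypertori\<close>

text \<open>A geometric series in \<open>e = expi (\<mu> (y - x))\<close>; for negative
  \<open>k\<close> it is multiplied by a power of the unit \<open>inverse e\<close>.\<close>

lemma one_minus_expi_divisible:
  assumes "\<mu> \<in> dual_lattice L"
  shows "\<exists>Q\<in>CH. \<forall>y. 1 - expi (of_int k * \<mu> (y - x)) = Q y * (expi (\<mu> (y - x)) - 1)"
proof -
  note ls = linear_form_simps[OF dual_form[OF assms]]
  define e where "e = (\<lambda>y. expi (\<mu> (y - x)))"
  have "(\<lambda>y. expi (- \<mu> x) * expi (\<mu> y)) \<in> CH" by (rule CH_scaled_chr[OF assms])
  then have e: "e \<in> CH" by (simp add: e_def ls expi_diff expi_minus field_simps)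
  have "(\<lambda>y. expi (\<mu> x) * expi (of_int (- 1) * \<mu> y)) \<in> CH" by (rule CH_scaled_chr[OF dual_mult[OF assms]])
  then have e': "(\<lambda>y. inverse (e y)) \<in> CH" by (simp add: e_def ls expi_diff expi_minus field_simps)
  have pow: "expi (of_nat n * z) = expi z ^ n" for n z
    by (induction n) (simp_all add: expi_add distrib_right)
  show ?thesis
  proof (cases k)
    case (nonneg n)
    have "1 - expi (of_int k * \<mu> (y - x)) = - (\<Sum>j<n. e y ^ j) * (e y - 1)" for y
      using one_diff_power_eq[of "e y" n] by (simp add: nonneg pow e_def algebra_simps)
    moreover have "(\<lambda>y. - 1 * (\<Sum>j<n. e y ^ j)) \<in> CH" by (intro CH_scale CH_sum CH_power e)
    ultimately show ?thesis by (intro bexI[of _ "\<lambda>y. - (\<Sum>j<n. e y ^ j)"]) (simp_all add: e_def)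
  next
    case (neg n)
    define m where "m = Suc n"
    have "1 - expi (of_int k * \<mu> (y - x)) = (inverse (e y) ^ m * (\<Sum>j<m. e y ^ j)) * (e y - 1)" for y
    proof -
      have "(of_int k :: complex) = - of_nat m" by (simp add: neg m_def)
      then have "expi (of_int k * \<mu> (y - x)) = inverse (e y) ^ m"
        by (simp add: expi_minus pow e_def power_inverse)
      moreover have "inverse (e y) ^ m * (e y ^ m - 1) = 1 - inverse (e y) ^ m"
        by (simp add: e_def right_diff_distrib power_mult_distrib[symmetric])
      moreover have "e y ^ m - 1 = (\<Sum>j<m. e y ^ j) * (e y - 1)"
        using power_diff_1_eq[of "e y" m] by (simp add: mult.commute)
      ultimately show ?thesis by (simp add: mult.assoc)
    qed
    moreover have "(\<lambda>y. inverse (e y) ^ m * (\<Sum>j<m. e y ^ j)) \<in> CH"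
      by (intro CH_mult CH_power CH_sum e e')
    ultimately show ?thesis by (intro bexI[of _ "\<lambda>y. inverse (e y) ^ m * (\<Sum>j<m. e y ^ j)"]) (simp_all add: e_def)
  qed
qed

text \<open>The translation of \<open>y\<close> along \<open>l\<close> into the hyperplane \<open>\<mu> = \<mu> x\<close> changes \<open>F\<close> by a multiple of the
  equation.\<close>

lemma divisible_by_equation:
  assumes d: "reflection_data L s \<mu> a" and F: "F \<in> CH"
    and van: "\<And>y. \<mu> (y - x) \<in> \<int> \<Longrightarrow> F y = 0"
  shows "\<exists>Q\<in>CH. \<forall>y. F y = Q y * (expi (\<mu> (y - x)) - 1)"
proof -
  have \<mu>: "\<mu> \<in> dual_lattice L" using d by (simp add: reflection_data_def)
  note ls = linear_form_simps[OF dual_form[OF \<mu>]]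
  obtain l where l: "l \<in> L" "\<mu> l = 1" using d by (auto simp: reflection_data_def)
  have "\<exists>Q\<in>CH. \<forall>y. F y - F (y - \<mu> (y - x) *s l) = Q y * (expi (\<mu> (y - x)) - 1)"
    using F
  proof (induction rule: CH_induct)
    case zero
    show ?case by (rule bexI[OF _ CH_zero]) simp
  next
    case (add b \<nu> F)
    obtain Q where Q: "Q \<in> CH" "\<forall>y. F y - F (y - \<mu> (y - x) *s l) = Q y * (expi (\<mu> (y - x)) - 1)"
      using add.IH by (elim bexE)
    obtain m :: int where m: "\<nu> l = of_int m" using dual_L[OF add(1) l(1)] by (elim Ints_cases)
    from one_minus_expi_divisible[OF \<mu>, of "- m" x]
    obtain P where P: "P \<in> CH" "\<forall>y. 1 - expi (of_int (- m) * \<mu> (y - x)) = P y * (expi (\<mu> (y - x)) - 1)"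
      by (elim bexE)
    have "b * expi (\<nu> y) + F y - (b * expi (\<nu> (y - \<mu> (y - x) *s l)) + F (y - \<mu> (y - x) *s l))
        = (b * expi (\<nu> y) * P y + Q y) * (expi (\<mu> (y - x)) - 1)" for y
    proof -
      have "\<nu> (y - \<mu> (y - x) *s l) = \<nu> y + of_int (- m) * \<mu> (y - x)"
        by (simp add: linear_form_simps[OF dual_form[OF add(1)]] m)
      then have "expi (\<nu> (y - \<mu> (y - x) *s l)) = expi (\<nu> y) * expi (of_int (- m) * \<mu> (y - x))"
        by (simp only: expi_add)
      then have "b * expi (\<nu> y) + F y - (b * expi (\<nu> (y - \<mu> (y - x) *s l)) + F (y - \<mu> (y - x) *s l))
          = b * expi (\<nu> y) * (1 - expi (of_int (- m) * \<mu> (y - x))) + (F y - F (y - \<mu> (y - x) *s l))"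
        by (simp add: algebra_simps)
      also have "\<dots> = b * expi (\<nu> y) * (P y * (expi (\<mu> (y - x)) - 1)) + Q y * (expi (\<mu> (y - x)) - 1)"
        using P(2) Q(2) by (simp only:)
      finally show ?thesis by (simp add: algebra_simps)
    qed
    moreover have "(\<lambda>y. b * expi (\<nu> y) * P y + Q y) \<in> CH" using P Q add by (intro CH_add CH_mult CH_scaled_chr)
    ultimately show ?case by (intro bexI[of _ "\<lambda>y. b * expi (\<nu> y) * P y + Q y"]) simp_all
  qed
  moreover have "F (y - \<mu> (y - x) *s l) = 0" for y
    by (rule van) (simp add: ls l)
  ultimately show ?thesis by simp
qed

lemma equation_CH: "\<mu> \<in> dual_lattice L \<Longrightarrow> (\<lambda>y. expi (\<mu> (y - x)) - 1) \<in> CH"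
proof -
  assume \<mu>: "\<mu> \<in> dual_lattice L"
  have "(\<lambda>y. expi (- \<mu> x) * expi (\<mu> y) - 1) \<in> CH" by (intro CH_diff CH_scaled_chr \<mu> CH_const)
  then show ?thesis by (simp add: linear_form_simps[OF dual_form[OF \<mu>]] expi_diff expi_minus field_simps)
qed

lemma regular_near_CH:
  assumes "A \<in> CH" "B \<in> CH" "B p \<noteq> 0" "\<And>y. y \<in> U \<Longrightarrow> B y \<noteq> 0 \<Longrightarrow> \<phi> y = A y / B y"
  shows "regular_near L U \<phi> p"
  unfolding regular_near_def
  by (intro bexI[of _ A] bexI[of _ B] conjI ballI impI assms)

text \<open>One function generates the ideal of \<open>T\<close> on the whole torus, so it is a
  local equation at every point, with all denominators equal to 1.\<close>

lemma local_equation_expi: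
  assumes d: "reflection_data L s \<mu> a" and T: "\<And>y. coset L y \<in> T \<longleftrightarrow> \<mu> (y - x) \<in> \<int>"
  shows "local_equation L T p (\<lambda>y. expi (\<mu> (y - x)) - 1)"
proof -
  have \<mu>: "\<mu> \<in> dual_lattice L" using d by (simp add: reflection_data_def)
  let ?l = "\<lambda>y. expi (\<mu> (y - x)) - 1"
  have l0: "?l y = 0" if "coset L y \<in> T" for y using that by (simp add: T expi_eq_1_iff)
  have ideal: "\<exists>q. regular_near L UNIV q p \<and> (\<exists>D\<in>CH. D p \<noteq> 0 \<and> (\<forall>y. D y \<noteq> 0 \<longrightarrow> F y = q y * ?l y))"
    if F: "F \<in> CH" "\<forall>y. coset L y \<in> T \<longrightarrow> F y = 0" for F
  proof -
    have "\<exists>Q\<in>CH. \<forall>y. F y = Q y * ?l y"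
      using F(2) by (intro divisible_by_equation[OF d F(1)]) (simp add: T)
    then obtain Q where Q: "Q \<in> CH" "\<forall>y. F y = Q y * ?l y" by (elim bexE)
    have "regular_near L UNIV Q p" by (rule regular_near_CH[OF Q(1) CH_const[of 1]]) auto
    then show ?thesis using Q(2) by (intro exI[of _ Q] conjI bexI[OF _ CH_const[of 1]]) simp_all
  qed
  show ?thesis
    unfolding local_equation_def
  proof (rule bexI[OF _ equation_CH[OF \<mu>, of x]], rule bexI[OF _ CH_const[of 1]], intro conjI allI impI ballI)
    fix F assume "F \<in> CH" "\<forall>y. coset L y \<in> T \<longrightarrow> F y = 0"
    then show "\<exists>q. regular_near L UNIV q p \<and> (\<exists>D\<in>CH. D p \<noteq> 0 \<and> (\<forall>y. D y \<noteq> 0 \<longrightarrow> F y = q y * ?l y))"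
      by (rule ideal)
  qed (use l0 in auto)
qed

text \<open>The product of the equations of all hypertori. It serves as the \<open>D\<close> of
  \<open>exp_poly_eqI\<close> on the torus.\<close>

lemma hypertori_discriminant:
  "\<exists>D\<in>CH. (\<exists>y. D y \<noteq> 0) \<and> (\<forall>y. D y \<noteq> 0 \<longleftrightarrow> (\<forall>T\<in>hypertori W L. coset L y \<notin> T))"
proof -
  have "\<forall>T\<in>hypertori W L. \<exists>l. l \<in> CH \<and> (\<exists>y. l y \<noteq> 0) \<and> (\<forall>y. l y = 0 \<longleftrightarrow> coset L y \<in> T)"
  proof
    fix T assume "T \<in> hypertori W L"
    then obtain s \<mu> a x where d: "reflection_data L s \<mu> a" and T: "\<And>y. coset L y \<in> T \<longleftrightarrow> \<mu> (y - x) \<in> \<int>"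
      by (elim hypertoriE) (rule that, auto)
    have \<mu>: "\<mu> \<in> dual_lattice L" "\<mu> a = 2" using d by (simp_all add: reflection_data_def)
    \<comment> \<open>As \<open>\<mu> a = 2\<close>, a quarter of \<open>a\<close> moves
      \<open>\<mu>\<close> by 1/2, off the integers.\<close>
    have val: "\<mu> ((x + (1 / 4) *s a) - x) = 1 / 2" by (simp add: linear_form_simps[OF dual_form[OF \<mu>(1)]] \<mu>)
    have "(1 / 2 :: complex) \<notin> \<int>"
    proof
      assume "(1 / 2 :: complex) \<in> \<int>"
      then obtain k :: int where "(1 / 2 :: complex) = of_int k" by (elim Ints_cases)
      then have "(of_int (2 * k) :: complex) = of_int 1" by (simp add: mult.commute)
      then have "2 * k = 1" by (simp only: of_int_eq_iff)
      then show False by presburger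
    qed
    then have "expi (\<mu> ((x + (1 / 4) *s a) - x)) - 1 \<noteq> 0"
      unfolding val right_minus_eq expi_eq_1_iff .
    then show "\<exists>l. l \<in> CH \<and> (\<exists>y. l y \<noteq> 0) \<and> (\<forall>y. l y = 0 \<longleftrightarrow> coset L y \<in> T)"
      by (intro exI[of _ "\<lambda>y. expi (\<mu> (y - x)) - 1"] conjI equation_CH[OF \<mu>(1)] exI[of _ "x + (1 / 4) *s a"])
        (simp_all add: T expi_eq_1_iff)
  qed
  from bchoice[OF this] obtain l where l: "\<forall>T\<in>hypertori W L. l T \<in> CH \<and> (\<exists>y. l T y \<noteq> 0) \<and>
    (\<forall>y. l T y = 0 \<longleftrightarrow> coset L y \<in> T)" ..
  define D where "D = (\<lambda>y. \<Prod>T\<in>hypertori W L. l T y)"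
  have "D \<in> CH" unfolding D_def using l by (intro CH_prod) simp
  moreover have "\<exists>y. D y \<noteq> 0" unfolding D_def
  proof (rule exp_poly_prod_nonzero[OF finite_hypertori])
    fix T assume T: "T \<in> hypertori W L"
    show "l T \<in> exp_poly" using bspec[OF l T] by (simp add: CH_exp_poly)
    show "\<exists>y. l T y \<noteq> 0" using bspec[OF l T] by (elim conjE)
  qed
  moreover have "D y \<noteq> 0 \<longleftrightarrow> (\<forall>T\<in>hypertori W L. coset L y \<notin> T)" for y
    unfolding D_def using l by (simp add: prod_zero_iff finite_hypertori)
  ultimately show ?thesis by (intro bexI[of _ D]) simp_all
qed

end

section \<open>Trigonometric Dunkl operators\<close>

locale trigonometric_DAHA = torus_reflection_group W L for W :: "(complex^'n^'n) set" and L +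
  fixes c :: "(complex^'n) set set \<Rightarrow> complex"
    and f :: "(complex^'n) set set \<Rightarrow> complex^'n \<Rightarrow> complex^'n \<Rightarrow> complex"
  assumes invariant_c: "invariant_parameter W L c"
    and admissible_f: "admissible_family W L f"
begin

abbreviation refl :: "(complex^'n) set set \<Rightarrow> complex^'n^'n" where
  "refl T \<equiv> hypertorus_reflection W L T"

lemma f_regular_off:
  assumes "T \<in> hypertori W L" "coset L p \<notin> T"
  shows "\<exists>A\<in>CH. \<exists>B\<in>CH. B p \<noteq> 0 \<and> (\<forall>y. coset L y \<notin> T \<longrightarrow> B y \<noteq> 0 \<longrightarrow> f T v y = A y / B y)"
proof -
  have "admissible L T v (f T v)" using admissible_f assms(1) by (simp add: admissible_family_def)
  then have "regular_near L (off_hypertorus L T) (f T v) p"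
    using assms(2) by (simp add: admissible_def off_hypertorus_def)
  then show ?thesis by (simp add: regular_near_def off_hypertorus_def)
qed

lemma f_regular_on:
  assumes "T \<in> hypertori W L" "coset L p \<in> T" "local_equation L T p l"
  shows "\<exists>A\<in>CH. \<exists>B\<in>CH. B p \<noteq> 0 \<and> (\<forall>y. coset L y \<notin> T \<longrightarrow> B y \<noteq> 0 \<longrightarrow> l y * f T v y = A y / B y)"
    and "\<exists>A\<in>CH. \<exists>B\<in>CH. B p \<noteq> 0 \<and>
      (\<forall>y. coset L y \<notin> T \<longrightarrow> B y \<noteq> 0 \<longrightarrow> f T v y - directional v l y / l y = A y / B y)"
proof -
  have adm: "admissible L T v (f T v)" using admissible_f assms(1) by (simp add: admissible_family_def)
  have "regular_near L (off_hypertorus L T) (\<lambda>y. l y * f T v y) p"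
    using adm assms(2,3) by (simp add: admissible_def)
  then show "\<exists>A\<in>CH. \<exists>B\<in>CH. B p \<noteq> 0 \<and> (\<forall>y. coset L y \<notin> T \<longrightarrow> B y \<noteq> 0 \<longrightarrow> l y * f T v y = A y / B y)"
    by (simp add: regular_near_def off_hypertorus_def)
  have "regular_near L (off_hypertorus L T) (\<lambda>y. f T v y - directional v l y / l y) p"
    using adm assms(2,3) by (simp add: admissible_def)
  then show "\<exists>A\<in>CH. \<exists>B\<in>CH. B p \<noteq> 0 \<and>
      (\<forall>y. coset L y \<notin> T \<longrightarrow> B y \<noteq> 0 \<longrightarrow> f T v y - directional v l y / l y = A y / B y)"
    by (simp add: regular_near_def off_hypertorus_def)
qed

lemma difference_vanishes:
  assumes F: "F \<in> CH" and T: "T \<in> hypertori W L" "coset L y \<in> T"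
  shows "F y - F (refl T *v y) = 0"
proof -
  have s: "refl T \<in> reflections W" "coset L y \<in> fixed_set L (refl T)"
    using hypertorus_through[OF T refl] by simp_all
  then have "y - refl T *v y \<in> L" by (simp add: fixed_set_iff reflections_def)
  then show ?thesis using CH_coset[OF F] by simp
qed

text \<open>\<open>F - s_T F\<close> vanishes on \<open>T\<close>, so it is divisible by the
  equation of \<open>T\<close>, which cancels the simple pole of \<open>f T v\<close> locally. The
  functions \<open>B\<close> that clear the remaining denominators form an ideal containing, for
  each point, a function nonzero there; hence it contains 1.\<close>

lemma f_times_difference_CH:
  assumes F: "F \<in> CH" and T: "T \<in> hypertori W L"
  shows "\<exists>A\<in>CH. \<forall>y. coset L y \<notin> T \<longrightarrow> A y = f T v y * (F y - F (refl T *v y))"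
proof -
  define D where "D = (\<lambda>y. F y - F (refl T *v y))"
  obtain s \<mu> a x where s: "s \<in> W" "refl T = s" and d: "reflection_data L s \<mu> a"
    and Tx: "\<And>y. coset L y \<in> T \<longleftrightarrow> \<mu> (y - x) \<in> \<int>"
    using hypertoriE[OF T] by metis
  have D: "D \<in> CH" unfolding D_def s(2) by (intro CH_diff F CH_comp s)
  define l where "l = (\<lambda>y. expi (\<mu> (y - x)) - 1)"
  have Dv: "D y = 0" if "\<mu> (y - x) \<in> \<int>" for y
    unfolding D_def using that by (intro difference_vanishes F T) (simp add: Tx)
  have "\<exists>Q\<in>CH. \<forall>y. D y = Q y * l y" unfolding l_def by (rule divisible_by_equation[OF d D Dv])
  then obtain Q where Q: "Q \<in> CH" "\<forall>y. D y = Q y * l y" by (elim bexE)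
  define J where "J = {B \<in> CH. \<exists>A\<in>CH. \<forall>y. coset L y \<notin> T \<longrightarrow> A y = B y * (f T v y * D y)}"
  have JI: "B \<in> J" if "B \<in> CH" "A \<in> CH" "\<And>y. coset L y \<notin> T \<Longrightarrow> A y = B y * (f T v y * D y)" for A B
    unfolding J_def using that by auto
  have JE: "\<exists>A\<in>CH. \<forall>y. coset L y \<notin> T \<longrightarrow> A y = B y * (f T v y * D y)" if "B \<in> J" for B
    using that unfolding J_def by simp
  have J: "CH_ideal J"
    unfolding CH_ideal_def
  proof (intro conjI ballI)
    show "J \<subseteq> CH" unfolding J_def by auto
    show "(\<lambda>x. 0) \<in> J" by (rule JI[OF CH_zero CH_zero]) simp
    fix B B' assume B: "B \<in> J" "B' \<in> J"
    obtain A where A: "A \<in> CH" "\<forall>y. coset L y \<notin> T \<longrightarrow> A y = B y * (f T v y * D y)" using JE[OF B(1)] by (elim bexE)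
    obtain A' where A': "A' \<in> CH" "\<forall>y. coset L y \<notin> T \<longrightarrow> A' y = B' y * (f T v y * D y)" using JE[OF B(2)] by (elim bexE)
    show "(\<lambda>x. B x + B' x) \<in> J"
      by (rule JI[OF CH_add CH_add[OF A(1) A'(1)]]) (use B A A' in \<open>simp_all add: J_def distrib_right\<close>)
  next
    fix E B assume B: "E \<in> CH" "B \<in> J"
    obtain A where A: "A \<in> CH" "\<forall>y. coset L y \<notin> T \<longrightarrow> A y = B y * (f T v y * D y)" using JE[OF B(2)] by (elim bexE)
    show "(\<lambda>x. E x * B x) \<in> J"
      by (rule JI[OF CH_mult CH_mult[OF B(1) A(1)]]) (use B A in \<open>simp_all add: J_def mult.assoc\<close>)
  qed
  have "\<exists>B\<in>J. B p \<noteq> 0" for p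
  proof (cases "coset L p \<in> T")
    case False
    from f_regular_off[OF T False, of v] obtain A B where AB: "A \<in> CH" "B \<in> CH" "B p \<noteq> 0"
      "\<forall>y. coset L y \<notin> T \<longrightarrow> B y \<noteq> 0 \<longrightarrow> f T v y = A y / B y" by (elim bexE conjE)
    \<comment> \<open>The fraction \<open>A / B\<close> is known only where
      \<open>B \<noteq> 0\<close>; the second factor \<open>B\<close> makes both sides vanish
      together elsewhere.\<close>
    have "(\<lambda>y. B y * B y) \<in> J"
    proof (rule JI[OF CH_mult[OF AB(2,2)] CH_mult[OF CH_mult[OF AB(1,2)] D]])
      fix y assume "coset L y \<notin> T"
      then show "A y * B y * D y = B y * B y * (f T v y * D y)" using AB(4) by (cases "B y = 0") auto
    qed
    then show ?thesis using AB(3) by (intro bexI[of _ "\<lambda>y. B y * B y"]) simp_all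
  next
    case True
    have "local_equation L T p l" unfolding l_def by (rule local_equation_expi[OF d Tx])
    from f_regular_on(1)[OF T True this, of v] obtain A B where AB: "A \<in> CH" "B \<in> CH" "B p \<noteq> 0"
      "\<forall>y. coset L y \<notin> T \<longrightarrow> B y \<noteq> 0 \<longrightarrow> l y * f T v y = A y / B y" by (elim bexE conjE)
    have "(\<lambda>y. B y * B y) \<in> J"
    proof (rule JI[OF CH_mult[OF AB(2,2)] CH_mult[OF CH_mult[OF AB(1,2)] Q(1)]])
      fix y assume y: "coset L y \<notin> T"
      show "A y * B y * Q y = B y * B y * (f T v y * D y)"
      proof (cases "B y = 0")
        case False
        then have "A y = B y * (l y * f T v y)" using AB(4) y by simp
        then show ?thesis using Q(2) by (simp add: mult_ac)
      qed simp
    qed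
    then show ?thesis using AB(3) by (intro bexI[of _ "\<lambda>y. B y * B y"]) simp_all
  qed
  from JE[OF nullstellensatz[OF J this]] show ?thesis by (simp add: D_def)
qed

abbreviation trig :: "complex^'n \<Rightarrow> 'n operator" where
  "trig \<equiv> trig_dunkl W L c f"

text \<open>The definite description is proper: existence comes from cancelling the poles term by
  term, uniqueness from the density of the complement of the hypertori.\<close>

lemma trig_dunkl_properties:
  assumes F: "F \<in> CH"
  shows "trig v F \<in> CH"
    and "(\<And>T. T \<in> hypertori W L \<Longrightarrow> coset L x \<notin> T) \<Longrightarrow>
      trig v F x = directional v F x - (\<Sum>T\<in>hypertori W L. c T * f T v x * (F x - F (refl T *v x)))"
proof -
  have act: "act (refl T) F x = F (refl T *v x)" if T: "T \<in> hypertori W L" for T x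
  proof -
    have "refl T \<in> reflections W" using hypertoriE[OF T] by metis
    then show ?thesis by (simp add: act_reflection)
  qed
  obtain D where D: "D \<in> CH" "\<exists>y. D y \<noteq> 0"
    "\<forall>y. D y \<noteq> 0 \<longleftrightarrow> (\<forall>T\<in>hypertori W L. coset L y \<notin> T)" using hypertori_discriminant by (elim bexE conjE)
  let ?P = "\<lambda>G. G \<in> CH \<and> (\<forall>x. (\<forall>T\<in>hypertori W L. coset L x \<notin> T) \<longrightarrow>
           G x = directional v F x - (\<Sum>T\<in>hypertori W L. c T * f T v x * (F x - act (refl T) F x)))"
  have "\<forall>T\<in>hypertori W L. \<exists>A. A \<in> CH \<and> (\<forall>y. coset L y \<notin> T \<longrightarrow> A y = f T v y * (F y - F (refl T *v y)))"
    using f_times_difference_CH[OF F, of _ v] by (simp add: Bex_def)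
  from bchoice[OF this] obtain A where A: "\<forall>T\<in>hypertori W L. A T \<in> CH \<and>
    (\<forall>y. coset L y \<notin> T \<longrightarrow> A T y = f T v y * (F y - F (refl T *v y)))" ..
  define G where "G = (\<lambda>x. directional v F x - (\<Sum>T\<in>hypertori W L. c T * A T x))"
  have "G \<in> CH" unfolding G_def using A by (intro CH_diff CH_directional F CH_sum CH_scale) simp
  moreover have "G x = directional v F x - (\<Sum>T\<in>hypertori W L. c T * f T v x * (F x - act (refl T) F x))"
    if "\<forall>T\<in>hypertori W L. coset L x \<notin> T" for x
    unfolding G_def using A that by (simp add: act mult.assoc)
  ultimately have ex: "?P G" by simp
  have uniq: "G' = G" if "?P G'" for G'
  proof -
    obtain y where "D y \<noteq> 0" using D(2) by (elim exE)
    then show ?thesis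
      using that ex D(1,3) by (intro exp_poly_eqI[of G' G D y] CH_exp_poly) simp_all
  qed
  have P: "?P (trig v F)" unfolding trig_dunkl_def by (rule theI[of ?P, OF ex uniq])
  show "trig v F \<in> CH" using P by simp
  assume "\<And>T. T \<in> hypertori W L \<Longrightarrow> coset L x \<notin> T"
  then show "trig v F x = directional v F x - (\<Sum>T\<in>hypertori W L. c T * f T v x * (F x - F (refl T *v x)))"
    using P by (simp add: act)
qed

lemma submodule_DAHA_iff:
  "submodule (degenerate_DAHA W L c f) CH N \<longleftrightarrow> function_subspace N \<and> N \<subseteq> CH \<and>
     (\<forall>F\<in>N. (\<forall>P\<in>CH. (\<lambda>x. P x * F x) \<in> N) \<and> (\<forall>w\<in>W. act w F \<in> N) \<and> (\<forall>v. trig v F \<in> N))"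
proof -
  have "(\<forall>A\<in>{\<lambda>F x. P x * F x | P. P \<in> CH} \<union> act ` W \<union> range trig. \<forall>F\<in>N. A F \<in> N) \<longleftrightarrow>
     (\<forall>F\<in>N. (\<forall>P\<in>CH. (\<lambda>x. P x * F x) \<in> N) \<and> (\<forall>w\<in>W. act w F \<in> N) \<and> (\<forall>v. trig v F \<in> N))" (is "?l \<longleftrightarrow> ?r")
  proof
    assume l: ?l
    show ?r
    proof (intro ballI conjI allI)
      fix F P assume "F \<in> N" "P \<in> CH"
      then show "(\<lambda>x. P x * F x) \<in> N" using bspec[OF l, of "\<lambda>F x. P x * F x"] by auto
    qed (use l in auto)
  qed auto
  then show ?thesis unfolding degenerate_DAHA_def submodule_operator_algebra_iff by simp
qed

end

section \<open>Polynomials and rational Dunkl operators\<close>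

lemma polynomial_scale: "P \<in> polynomial_functions \<Longrightarrow> (\<lambda>x. a * P x) \<in> polynomial_functions"
  by (intro polynomial_functions.mult polynomial_functions.const)

lemma polynomial_diff:
  "P \<in> polynomial_functions \<Longrightarrow> Q \<in> polynomial_functions \<Longrightarrow> (\<lambda>x. P x - Q x) \<in> polynomial_functions"
  using polynomial_functions.add[OF _ polynomial_scale[of Q "-1"]] by simp

lemma polynomial_sum:
  "(\<And>i. i \<in> A \<Longrightarrow> P i \<in> polynomial_functions) \<Longrightarrow> (\<lambda>x. \<Sum>i\<in>A. P i x) \<in> polynomial_functions"
  by (induction A rule: infinite_finite_induct)
    (auto intro: polynomial_functions.const polynomial_functions.add)

lemma polynomial_prod:
  "(\<And>i. i \<in> A \<Longrightarrow> P i \<in> polynomial_functions) \<Longrightarrow> (\<lambda>x. \<Prod>i\<in>A. P i x) \<in> polynomial_functions"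
  by (induction A rule: infinite_finite_induct)
    (auto intro: polynomial_functions.const polynomial_functions.mult)

lemma polynomial_power: "P \<in> polynomial_functions \<Longrightarrow> (\<lambda>x. P x ^ n) \<in> polynomial_functions"
  by (induction n) (auto intro: polynomial_functions.const polynomial_functions.mult)

lemma polynomial_poly: "P \<in> polynomial_functions \<Longrightarrow> (\<lambda>x. poly p (P x)) \<in> polynomial_functions"
  by (induction p) (auto intro: polynomial_functions.intros)

lemma polynomial_form: "linear_form \<mu> \<Longrightarrow> \<mu> \<in> polynomial_functions"
proof -
  assume \<mu>: "linear_form \<mu>"
  have "(\<lambda>x. \<Sum>i\<in>UNIV. x $ i * \<mu> (axis i 1)) \<in> polynomial_functions"
    by (intro polynomial_sum polynomial_functions.mult polynomial_functions.coord polynomial_functions.const)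
  then show ?thesis by (simp add: linear_form_expand[OF \<mu>, symmetric])
qed

lemma polynomial_exp_poly: "P \<in> polynomial_functions \<Longrightarrow> P \<in> exp_poly"
  using polynomial_functions_subset_exp_poly by (rule subsetD)

lemma polynomial_comp_matrix:
  "P \<in> polynomial_functions \<Longrightarrow> (\<lambda>x. P (A *v x)) \<in> polynomial_functions"
proof (induction rule: polynomial_functions.induct)
  case (coord i)
  show ?case by (rule polynomial_form) (rule linear_form_comp_matrix[OF linear_form_coord])
qed (auto intro: polynomial_functions.intros)

lemma polynomial_directional: "P \<in> polynomial_functions \<Longrightarrow> directional v P \<in> polynomial_functions"
proof (induction rule: polynomial_functions.induct)
  case (coord i)
  show ?case by (simp add: directional_form linear_form_coord polynomial_functions.const)
qed (simp_all add: directional_const directional_add directional_mult polynomial_exp_poly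
    polynomial_functions.intros)

text \<open>The difference operator obeys a twisted Leibniz rule, so divisibility passes from the
  generators to products.\<close>

lemma polynomial_divided_difference:
  assumes "P \<in> polynomial_functions" "linear_form \<mu>"
  shows "\<exists>Q\<in>polynomial_functions. \<forall>y. P y - P (y - \<mu> y *s a) = \<mu> y * Q y"
  using assms(1)
proof induction
  case (const b)
  show ?case by (rule bexI[OF _ polynomial_functions.const[of 0]]) simp
next
  case (coord i)
  show ?case by (rule bexI[OF _ polynomial_functions.const[of "a $ i"]]) simp
next
  case (add P Q)
  obtain P' where P': "P' \<in> polynomial_functions" "\<forall>y. P y - P (y - \<mu> y *s a) = \<mu> y * P' y"
    using add.IH(1) by (elim bexE)
  obtain Q' where Q': "Q' \<in> polynomial_functions" "\<forall>y. Q y - Q (y - \<mu> y *s a) = \<mu> y * Q' y"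
    using add.IH(2) by (elim bexE)
  have "P y + Q y - (P (y - \<mu> y *s a) + Q (y - \<mu> y *s a)) = \<mu> y * (P' y + Q' y)" for y
    using P'(2)[rule_format, of y] Q'(2)[rule_format, of y] by (simp add: algebra_simps)
  then show ?case
    by (intro bexI[of _ "\<lambda>y. P' y + Q' y"] allI) (auto intro: polynomial_functions.intros P' Q')
next
  case (mult P Q)
  obtain P' where P': "P' \<in> polynomial_functions" "\<forall>y. P y - P (y - \<mu> y *s a) = \<mu> y * P' y"
    using mult.IH(1) by (elim bexE)
  obtain Q' where Q': "Q' \<in> polynomial_functions" "\<forall>y. Q y - Q (y - \<mu> y *s a) = \<mu> y * Q' y"
    using mult.IH(2) by (elim bexE)
  have "P y * Q y - P (y - \<mu> y *s a) * Q (y - \<mu> y *s a)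
      = \<mu> y * (P' y * Q y + (P y - \<mu> y * P' y) * Q' y)" for y
  proof -
    have e: "P (y - \<mu> y *s a) = P y - \<mu> y * P' y" "Q (y - \<mu> y *s a) = Q y - \<mu> y * Q' y"
      using P'(2)[rule_format, of y] Q'(2)[rule_format, of y] by (simp_all add: algebra_simps)
    show ?thesis unfolding e by (simp add: algebra_simps)
  qed
  moreover have "(\<lambda>y. P' y * Q y + (P y - \<mu> y * P' y) * Q' y) \<in> polynomial_functions"
    by (intro polynomial_functions.add polynomial_functions.mult polynomial_diff polynomial_form
        assms(2) P'(1) Q'(1) mult.hyps)
  ultimately show ?case by (intro bexI[of _ "\<lambda>y. P' y * Q y + (P y - \<mu> y * P' y) * Q' y"] allI)
qed

section \<open>Rational Dunkl operators of subgroups of \<open>W\<close>\<close>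

context torus_reflection_group begin

definition rform :: "complex^'n^'n \<Rightarrow> complex^'n \<Rightarrow> complex" where
  "rform s = (SOME \<mu>. \<exists>a. reflection_data L s \<mu> a)"

definition rvec :: "complex^'n^'n \<Rightarrow> complex^'n" where
  "rvec s = (SOME a. reflection_data L s (rform s) a)"

lemma rdata: "s \<in> reflections W \<Longrightarrow> reflection_data L s (rform s) (rvec s)"
proof -
  assume "s \<in> reflections W"
  then have "\<exists>\<mu> a. reflection_data L s \<mu> a" by (elim reflections_data) (intro exI)
  then have "\<exists>a. reflection_data L s (rform s) a" unfolding rform_def by (rule someI_ex)
  then show ?thesis unfolding rvec_def by (rule someI_ex)
qed

lemma
  assumes "s \<in> reflections W"
  shows rform_linear: "linear_form (rform s)"
    and rform_dual: "rform s \<in> dual_lattice L"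
    and rform_rvec: "rform s (rvec s) = 2"
    and rform_apply: "s *v x = x - rform s x *s rvec s"
  using rdata[OF assms] reflection_data_form[OF rdata[OF assms]] by (simp_all add: reflection_data_def)

text \<open>The (-1)-eigenspace of \<open>s\<close> on linear forms is a line. Forms that are chosen
  independently can thus be compared: \<open>reflection_form s\<close> with \<open>rform s\<close>,
  and a transported form with that of a conjugate reflection.\<close>

lemma antiinvariant_form:
  assumes "s \<in> reflections W" "linear_form \<rho>" "\<And>x. \<rho> (s *v x) = - \<rho> x"
  shows "\<rho> x = \<rho> (rvec s) / 2 * rform s x"
proof -
  have "\<rho> x - rform s x * \<rho> (rvec s) = - \<rho> x"
    using assms(3)[of x] by (simp add: rform_apply[OF assms(1)] linear_form_simps[OF assms(2)])
  then have "2 * \<rho> x = rform s x * \<rho> (rvec s)" by (simp add: algebra_simps minus_equation_iff[of "\<rho> x"])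
  then show ?thesis by (simp add: field_simps)
qed

lemma reflection_form_ratio:
  assumes s: "s \<in> reflections W"
  shows "reflection_form s y \<noteq> 0 \<longleftrightarrow> rform s y \<noteq> 0"
    and "reflection_form s v / reflection_form s y = rform s v / rform s y"
proof -
  let ?P = "\<lambda>\<alpha>. linear_form \<alpha> \<and> \<alpha> \<noteq> (\<lambda>x. 0) \<and> act s \<alpha> = (\<lambda>x. - \<alpha> x)"
  have "?P (rform s)"
  proof (intro conjI)
    show "rform s \<noteq> (\<lambda>x. 0)" using rform_rvec[OF s] by (metis zero_neq_numeral)
    show "act s (rform s) = (\<lambda>x. - rform s x)"
      unfolding act_reflection[OF s]
      by (rule ext) (simp add: rform_apply[OF s] linear_form_simps[OF rform_linear[OF s]] rform_rvec[OF s])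
  qed (rule rform_linear[OF s])
  then have P: "?P (reflection_form s)" unfolding reflection_form_def by (rule someI[where P = ?P])
  then have anti: "reflection_form s (s *v x) = - reflection_form s x" for x
    by (simp add: act_reflection[OF s] fun_eq_iff)
  define \<kappa> where "\<kappa> = reflection_form s (rvec s) / 2"
  have eq: "reflection_form s x = \<kappa> * rform s x" for x
    unfolding \<kappa>_def using P by (intro antiinvariant_form s anti) simp
  have "\<kappa> \<noteq> 0" using P eq by auto
  then show "reflection_form s y \<noteq> 0 \<longleftrightarrow> rform s y \<noteq> 0"
    "reflection_form s v / reflection_form s y = rform s v / rform s y" by (simp_all add: eq)
qed

lemma rational_discriminant:
  assumes "\<Gamma> \<subseteq> W"
  shows "\<exists>D\<in>polynomial_functions. (\<exists>y. D y \<noteq> 0) \<and> (\<forall>y. D y \<noteq> 0 \<longleftrightarrow> (\<forall>s\<in>reflections \<Gamma>. rform s y \<noteq> 0))"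
proof -
  have fin: "finite (reflections \<Gamma>)" using assms finite_W by (auto simp: reflections_def intro: finite_subset)
  have sub: "s \<in> reflections W" if "s \<in> reflections \<Gamma>" for s using that assms by (auto simp: reflections_def)
  let ?D = "\<lambda>y. \<Prod>s\<in>reflections \<Gamma>. rform s y"
  have "?D \<in> polynomial_functions" by (intro polynomial_prod polynomial_form rform_linear sub)
  moreover have "\<exists>y. ?D y \<noteq> 0"
  proof (rule exp_poly_prod_nonzero[OF fin])
    fix s assume "s \<in> reflections \<Gamma>"
    then have s: "s \<in> reflections W" by (rule sub)
    show "rform s \<in> exp_poly" by (rule exp_poly.form[OF rform_linear[OF s]])
    show "\<exists>y. rform s y \<noteq> 0" using rform_rvec[OF s] by (intro exI[of _ "rvec s"]) simp
  qed
  moreover have "?D y \<noteq> 0 \<longleftrightarrow> (\<forall>s\<in>reflections \<Gamma>. rform s y \<noteq> 0)" for y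
    by (simp add: prod_zero_iff fin)
  ultimately show ?thesis by (intro bexI[of _ ?D] conjI allI)
qed

text \<open>Here polynomial divided differences give existence in the definite description, and
  density of the complement of the mirrors gives uniqueness.\<close>

lemma rational_dunkl_properties:
  assumes \<Gamma>: "\<Gamma> \<subseteq> W" and P: "P \<in> polynomial_functions"
  shows "rational_dunkl \<Gamma> k v P \<in> polynomial_functions"
    and "(\<And>s. s \<in> reflections \<Gamma> \<Longrightarrow> rform s y \<noteq> 0) \<Longrightarrow>
      rational_dunkl \<Gamma> k v P y = directional v P y -
        (\<Sum>s\<in>reflections \<Gamma>. k s * (rform s v / rform s y) * (P y - P (s *v y)))"
proof -
  have sub: "s \<in> reflections W" if "s \<in> reflections \<Gamma>" for s using that \<Gamma> by (auto simp: reflections_def)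
  obtain D where D: "D \<in> polynomial_functions" "\<exists>y. D y \<noteq> 0"
    "\<forall>y. D y \<noteq> 0 \<longleftrightarrow> (\<forall>s\<in>reflections \<Gamma>. rform s y \<noteq> 0)" using rational_discriminant[OF \<Gamma>] by (elim bexE conjE)
  have form: "(\<Sum>s\<in>reflections \<Gamma>. k s * (reflection_form s v / reflection_form s x) * (P x - act s P x))
      = (\<Sum>s\<in>reflections \<Gamma>. k s * (rform s v / rform s x) * (P x - P (s *v x)))" for x
    by (intro sum.cong refl) (simp add: reflection_form_ratio(2) act_reflection sub)
  have cond: "(\<forall>s\<in>reflections \<Gamma>. reflection_form s x \<noteq> 0) \<longleftrightarrow> (\<forall>s\<in>reflections \<Gamma>. rform s x \<noteq> 0)" for x
    using reflection_form_ratio(1) sub by auto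
  let ?P = "\<lambda>G. G \<in> polynomial_functions \<and> (\<forall>x. (\<forall>s\<in>reflections \<Gamma>. reflection_form s x \<noteq> 0) \<longrightarrow>
           G x = directional v P x - (\<Sum>s\<in>reflections \<Gamma>.
                k s * (reflection_form s v / reflection_form s x) * (P x - act s P x)))"
  have "\<forall>s\<in>reflections \<Gamma>. \<exists>Q. Q \<in> polynomial_functions \<and> (\<forall>y. P y - P (s *v y) = rform s y * Q y)"
    using polynomial_divided_difference[OF P rform_linear] by (simp add: rform_apply sub Bex_def)
  from bchoice[OF this] obtain Q where Q: "\<forall>s\<in>reflections \<Gamma>. Q s \<in> polynomial_functions \<and>
    (\<forall>y. P y - P (s *v y) = rform s y * Q s y)" ..
  define G where "G = (\<lambda>x. directional v P x - (\<Sum>s\<in>reflections \<Gamma>. k s * rform s v * Q s x))"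
  have "G \<in> polynomial_functions"
    unfolding G_def using Q by (intro polynomial_diff polynomial_directional P polynomial_sum polynomial_scale) simp
  moreover have "G x = directional v P x - (\<Sum>s\<in>reflections \<Gamma>.
                k s * (reflection_form s v / reflection_form s x) * (P x - act s P x))"
    if "\<forall>s\<in>reflections \<Gamma>. reflection_form s x \<noteq> 0" for x
  proof -
    have "k s * (rform s v / rform s x) * (P x - P (s *v x)) = k s * rform s v * Q s x" if s: "s \<in> reflections \<Gamma>" for s
      using bspec[OF Q s] cond[of x] \<open>\<forall>s\<in>reflections \<Gamma>. reflection_form s x \<noteq> 0\<close> s by simp
    then show ?thesis unfolding form G_def by simp
  qed
  ultimately have ex: "?P G" by simp
  have uniq: "G' = G" if "?P G'" for G'
  proof -
    obtain y where "D y \<noteq> 0" using D(2) by (elim exE)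
    then show ?thesis
      using that ex D(1,3) cond by (intro exp_poly_eqI[of G' G D y] polynomial_exp_poly) simp_all
  qed
  have *: "?P (rational_dunkl \<Gamma> k v P)" unfolding rational_dunkl_def by (rule theI[of ?P, OF ex uniq])
  show "rational_dunkl \<Gamma> k v P \<in> polynomial_functions" using * by simp
  assume "\<And>s. s \<in> reflections \<Gamma> \<Longrightarrow> rform s y \<noteq> 0"
  then have "\<forall>s\<in>reflections \<Gamma>. reflection_form s y \<noteq> 0" using cond[of y] by simp
  then show "rational_dunkl \<Gamma> k v P y = directional v P y -
        (\<Sum>s\<in>reflections \<Gamma>. k s * (rform s v / rform s y) * (P y - P (s *v y)))"
    using * form[of y] by simp
qed

lemma rational_dunkl_eqI:
  assumes "\<Gamma> \<subseteq> W" "P \<in> polynomial_functions" "G \<in> polynomial_functions"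
    and "\<And>y. (\<And>s. s \<in> reflections \<Gamma> \<Longrightarrow> rform s y \<noteq> 0) \<Longrightarrow> G y = directional v P y -
        (\<Sum>s\<in>reflections \<Gamma>. k s * (rform s v / rform s y) * (P y - P (s *v y)))"
  shows "rational_dunkl \<Gamma> k v P = G"
proof -
  obtain D where D: "D \<in> polynomial_functions" "\<exists>y. D y \<noteq> 0"
    "\<forall>y. D y \<noteq> 0 \<longleftrightarrow> (\<forall>s\<in>reflections \<Gamma>. rform s y \<noteq> 0)" using rational_discriminant[OF assms(1)] by (elim bexE conjE)
  obtain y where y: "D y \<noteq> 0" using D(2) by (elim exE)
  show ?thesis
  proof (rule exp_poly_eqI[of _ _ D y])
    show "rational_dunkl \<Gamma> k v P \<in> exp_poly"
      by (intro polynomial_exp_poly rational_dunkl_properties(1) assms)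
    fix x assume "D x \<noteq> 0"
    then have nz: "rform s x \<noteq> 0" if "s \<in> reflections \<Gamma>" for s using D(3) that by simp
    show "rational_dunkl \<Gamma> k v P x = G x"
      using rational_dunkl_properties(2)[OF assms(1,2), of x k v] assms(4)[of x] nz by simp
  qed (use D y assms polynomial_exp_poly in auto)
qed

lemma submodule_rational_iff:
  fixes \<Gamma> :: "(complex^'n^'n) set" and N :: "(complex^'n \<Rightarrow> complex) set"
  shows
  "submodule (rational_Cherednik_algebra \<Gamma> k) polynomial_functions N \<longleftrightarrow>
     function_subspace N \<and> N \<subseteq> polynomial_functions \<and>
     (\<forall>F\<in>N. (\<forall>P\<in>polynomial_functions. (\<lambda>x. P x * F x) \<in> N) \<and> (\<forall>w\<in>\<Gamma>. act w F \<in> N) \<and>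
        (\<forall>v. rational_dunkl \<Gamma> k v F \<in> N))"
proof -
  have "(\<forall>A\<in>{\<lambda>F x. P x * F x | P. P \<in> polynomial_functions} \<union> act ` \<Gamma> \<union> range (rational_dunkl \<Gamma> k).
        \<forall>F\<in>N. A F \<in> N) \<longleftrightarrow>
     (\<forall>F\<in>N. (\<forall>P\<in>polynomial_functions. (\<lambda>x. P x * F x) \<in> N) \<and> (\<forall>w\<in>\<Gamma>. act w F \<in> N) \<and>
        (\<forall>v. rational_dunkl \<Gamma> k v F \<in> N))" (is "?l \<longleftrightarrow> ?r")
  proof
    assume l: ?l
    show ?r
    proof (intro ballI conjI allI)
      fix F P :: "complex^'n \<Rightarrow> complex" assume "F \<in> N" "P \<in> polynomial_functions"
      then show "(\<lambda>x. P x * F x) \<in> N" using bspec[OF l, of "\<lambda>F x. P x * F x"] by auto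
    qed (use l in auto)
  qed auto
  then show ?thesis unfolding rational_Cherednik_algebra_def submodule_operator_algebra_iff by simp
qed

end

section \<open>Comparison of trigonometric and rational Dunkl operators\<close>

lemma exp_poly_vanishes_to_1:
  assumes "P \<in> exp_poly"
  shows "vanishes_to 1 (\<lambda>y. P y - P 0)"
  using assms
proof induction
  case (const a)
  show ?case by (simp add: vanishes_to_zero)
next
  case (form \<mu>)
  then show ?case by (simp add: linear_form_zero vanishes_to_form[unfolded One_nat_def])
next
  case (exp \<mu>)
  have "(\<lambda>z. exp z - 1) holomorphic_on ball 0 1" by (intro holomorphic_intros)
  from holomorphic_taylor_compose[OF this _ vanishes_to_form[OF exp], of 1]
  obtain p where p: "vanishes_to 1 (\<lambda>y. exp (\<mu> y) - 1 - poly p (\<mu> y))" by auto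
  have "poly p 0 = 0" using vanishes_to_at_0[OF p] by (simp add: linear_form_zero exp)
  then obtain q where q: "p = [:0, 1:] * q" by (metis dvdE minus_zero poly_eq_0_iff_dvd)
  have "vanishes_to (1 + 0) (\<lambda>y. \<mu> y * poly q (\<mu> y))"
    by (intro vanishes_to_mult vanishes_to_form exp vanishes_to_continuous
        continuous_on_poly continuous_on_linear_form)
  then have "vanishes_to 1 (\<lambda>y. exp (\<mu> y) - 1 - poly p (\<mu> y) + \<mu> y * poly q (\<mu> y))"
    by (intro vanishes_to_add p) simp
  then show ?case by (simp add: q linear_form_zero exp)
next
  case (add P Q)
  have "vanishes_to 1 (\<lambda>y. (P y - P 0) + (Q y - Q 0))" by (intro vanishes_to_add add.IH)
  then show ?case by (simp add: algebra_simps)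
next
  case (mult P Q)
  have "vanishes_to 1 (\<lambda>y. Q y * (P y - P 0) + P 0 * (Q y - Q 0))"
    by (intro vanishes_to_add vanishes_to_mult_bounded[OF vanishes_to_exp_poly] vanishes_to_scale mult)
  then show ?case by (simp add: algebra_simps)
qed

text \<open>For \<open>u = expi (\<mu> z) - 1\<close>, the two terms are, up to the factor
  \<open>\<mu> v\<close>, the logarithmic derivatives along \<open>v\<close> of the equation
  \<open>u\<close> of a hypertorus and of the linear form \<open>\<mu>\<close>. Both have a simple
  pole with the same residue, so their difference is holomorphic.\<close>

lemma logarithmic_derivative_regular:
  "\<exists>\<phi>. \<phi> holomorphic_on ball 0 1 \<and>
     (\<forall>u. u \<noteq> 0 \<and> cmod u < 1 \<longrightarrow> \<phi> u = 2 * of_real pi * \<i> * ((1 + u) / u - 1 / Ln (1 + u)))"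
proof -
  have pos: "1 + u \<notin> \<real>\<^sub>\<le>\<^sub>0" if "cmod u < 1" for u
  proof
    assume "1 + u \<in> \<real>\<^sub>\<le>\<^sub>0"
    then have "Re u \<le> - 1" by (auto simp: complex_nonpos_Reals_iff)
    then show False using that abs_Re_le_cmod[of u] by linarith
  qed
  define g where "g = (\<lambda>u. Ln (1 + u))"
  have g: "g holomorphic_on ball 0 1" unfolding g_def
    by (intro holomorphic_intros) (use pos in auto)
  \<comment> \<open>This is \<open>Ln (1 + u) / u\<close>, which has no zero in the disc. With
    \<open>\<rho>\<close> below equal to \<open>((1 + u) * \<Lambda> u - 1) / u\<close>, the
    quotient of \<open>\<rho>\<close> by \<open>\<Lambda>\<close> is the difference of the two polar
    terms.\<close>
  define \<Lambda> where "\<Lambda> = (\<lambda>u. if u = 0 then deriv g 0 else (g u - g 0) / (u - 0))"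
  have \<Lambda>: "\<Lambda> holomorphic_on ball 0 1" unfolding \<Lambda>_def by (rule pole_lemma_open[OF g open_ball])
  have "(g has_field_derivative 1) (at 0)" unfolding g_def by (auto intro!: derivative_eq_intros)
  then have d0: "deriv g 0 = 1" by (rule DERIV_imp_deriv)
  have g0: "g 0 = 0" by (simp add: g_def)
  have gn: "g u \<noteq> 0" if "u \<noteq> 0" "cmod u < 1" for u
  proof
    assume "g u = 0"
    moreover have "1 + u \<noteq> 0" using pos[OF that(2)] by auto
    ultimately have "1 + u = exp 0" unfolding g_def by (metis exp_Ln)
    then show False using that(1) by simp
  qed
  have \<Lambda>n: "\<Lambda> u \<noteq> 0" if "cmod u < 1" for u
    unfolding \<Lambda>_def using gn[OF _ that] d0 g0 by auto
  define N where "N = (\<lambda>u. (1 + u) * \<Lambda> u - 1)"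
  have N: "N holomorphic_on ball 0 1" unfolding N_def by (intro holomorphic_intros \<Lambda>)
  have N0: "N 0 = 0" by (simp add: N_def \<Lambda>_def d0)
  define \<rho> where "\<rho> = (\<lambda>u. if u = 0 then deriv N 0 else (N u - N 0) / (u - 0))"
  have \<rho>: "\<rho> holomorphic_on ball 0 1" unfolding \<rho>_def by (rule pole_lemma_open[OF N open_ball])
  have "(\<lambda>u. 2 * of_real pi * \<i> * (\<rho> u / \<Lambda> u)) holomorphic_on ball 0 1"
    by (intro holomorphic_intros \<rho> \<Lambda>) (use \<Lambda>n in auto)
  moreover have "\<rho> u / \<Lambda> u = (1 + u) / u - 1 / Ln (1 + u)" if u: "u \<noteq> 0" "cmod u < 1" for u
  proof -
    have \<Lambda>u: "\<Lambda> u = Ln (1 + u) / u" using u g0 by (simp add: \<Lambda>_def g_def)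
    have Ln0: "Ln (1 + u) \<noteq> 0" using gn[OF u] by (simp add: g_def)
    have "\<rho> u = ((1 + u) * \<Lambda> u - 1) / u" using u N0 by (simp add: \<rho>_def N_def)
    then show ?thesis using u Ln0 by (simp add: \<Lambda>u field_simps)
  qed
  ultimately show ?thesis by (intro exI[of _ "\<lambda>u. 2 * of_real pi * \<i> * (\<rho> u / \<Lambda> u)"]) simp
qed

lemma vanishes_to_dense_eq:
  assumes "h \<in> exp_poly" "D \<in> exp_poly" "D z \<noteq> 0" "vanishes_to k E" "\<And>y. D y \<noteq> 0 \<Longrightarrow> h y = E y"
  shows "vanishes_to k h"
proof -
  obtain C r where r: "0 < r" "\<And>y. norm y < r \<Longrightarrow> cmod (E y) \<le> C * norm y ^ k"
    using assms(4) by (rule vanishes_toE) blast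
  show ?thesis
    by (rule vanishes_to_dense[OF exp_poly_continuous[OF assms(1)] assms(2,3) r(1), of C]) (simp add: assms(5) r(2))
qed

lemma exp_poly_near:
  fixes B :: "complex^'n \<Rightarrow> complex"
  assumes "B \<in> exp_poly" "open U" "B 0 \<in> U"
  obtains r where "0 < r" "\<And>z. norm z < r \<Longrightarrow> B z \<in> U"
proof -
  have "open (B -` U)" using exp_poly_continuous[OF assms(1)] assms(2) by (simp add: open_vimage)
  then obtain r where "0 < r" "ball 0 r \<subseteq> B -` U" using assms(3) by (meson openE vimageI2)
  then show thesis by (intro that[of r]) auto
qed

section \<open>Local expansion of the functions \<open>f T v\<close>\<close>

context trigonometric_DAHA begin

lemma CH_shift_exp_poly: "F \<in> CH \<Longrightarrow> (\<lambda>z. F (p + z)) \<in> exp_poly"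
  by (intro CH_exp_poly CH_shift)

text \<open>\<open>1 / B\<close> is expanded in powers of \<open>B - B p\<close>, which vanishes at
  \<open>p\<close>. A polynomial in \<open>B - B p\<close> is regular on the whole torus, so a local
  fraction is replaced by a global function to any order.\<close>

lemma quotient_approximation:
  assumes A: "A \<in> CH" and B: "B \<in> CH" "B p \<noteq> 0"
  shows "\<exists>r\<in>CH. vanishes_to m (\<lambda>z. A (p + z) / B (p + z) - r (p + z))"
proof -
  define u where "u = (\<lambda>z. B (p + z) - B p)"
  have u: "vanishes_to 1 u" unfolding u_def
    using exp_poly_vanishes_to_1[OF CH_shift_exp_poly[OF B(1), of p]] by simp
  have "(\<lambda>t. 1 / (B p + t)) holomorphic_on ball 0 (cmod (B p))"
  proof (intro holomorphic_intros)
    fix t :: complex assume t: "t \<in> ball 0 (cmod (B p))"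
    show "B p + t \<noteq> 0"
    proof
      assume "B p + t = 0"
      then have "t = - B p" by (simp add: eq_neg_iff_add_eq_0 add.commute)
      with t show False by simp
    qed
  qed
  from holomorphic_taylor_compose[OF this _ u, of m] B(2)
  obtain q where q: "vanishes_to m (\<lambda>z. 1 / (B p + u z) - poly q (u z))" by auto
  have "vanishes_to m (\<lambda>z. A (p + z) * (1 / (B p + u z) - poly q (u z)))"
    by (rule vanishes_to_mult_bounded[OF vanishes_to_exp_poly[OF CH_shift_exp_poly[OF A]] q])
  moreover have "A (p + z) * (1 / (B p + u z) - poly q (u z))
      = A (p + z) / B (p + z) - (\<lambda>y. A y * poly q (B y - B p)) (p + z)" for z
    by (simp add: u_def right_diff_distrib)
  moreover have "(\<lambda>y. A y * poly q (B y - B p)) \<in> CH"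
    by (intro CH_mult CH_poly CH_diff A B CH_const)
  ultimately show ?thesis by (intro bexI[of _ "\<lambda>y. A y * poly q (B y - B p)"]) simp_all
qed

lemma hypertorus_through_iff:
  assumes T: "T \<in> hypertori W L" "coset L p \<in> T"
  shows "coset L y \<in> T \<longleftrightarrow> rform (refl T) (y - p) \<in> \<int>"
proof -
  define s where "s = refl T"
  have s: "s \<in> reflections W" "coset L p \<in> fixed_set L s" "T = component s p"
    using hypertorus_through[OF T s_def] by simp_all
  have sW: "s \<in> W" using s(1) by (simp add: reflections_def)
  note \<mu> = rform_dual[OF s(1)]
  have "coset L y \<in> T \<longleftrightarrow> (\<exists>z. coset L y = coset L z \<and> rform s (z - p) \<in> \<int>)"
    unfolding s(3) component_data[OF sW rdata[OF s(1)] s(2)] by auto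
  also have "\<dots> \<longleftrightarrow> rform s (y - p) \<in> \<int>"
  proof
    assume "\<exists>z. coset L y = coset L z \<and> rform s (z - p) \<in> \<int>"
    then obtain z where z: "y - z \<in> L" "rform s (z - p) \<in> \<int>" by (auto simp: coset_eq_iff)
    have "rform s (y - z) + rform s (z - p) \<in> \<int>" by (intro Ints_add z dual_L[OF \<mu>])
    then show "rform s (y - p) \<in> \<int>" by (simp add: linear_form_simps[OF dual_form[OF \<mu>]])
  qed auto
  finally show ?thesis by (simp add: s_def)
qed

lemma directional_equation:
  assumes "\<mu> \<in> dual_lattice L"
  shows "directional v (\<lambda>y. expi (\<mu> (y - p)) - 1) y = 2 * of_real pi * \<i> * \<mu> v * expi (\<mu> (y - p))"
proof -
  note lin = dual_form[OF assms]
  have eq: "(\<lambda>y. expi (\<mu> (y - p)) - 1) = (\<lambda>y. expi (- \<mu> p) * expi (\<mu> y) - 1)"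
    by (simp add: linear_form_simps[OF lin] expi_diff expi_minus field_simps)
  have "directional v (\<lambda>y. expi (- \<mu> p) * expi (\<mu> y) - 1)
      = (\<lambda>y. expi (- \<mu> p) * (2 * of_real pi * \<i> * \<mu> v * expi (\<mu> y)))"
    by (simp add: directional_diff directional_scale directional_const directional_chr lin
        exp_poly_expi exp_poly_scale exp_poly.const)
  then show ?thesis unfolding eq
    by (simp add: linear_form_simps[OF lin] expi_diff expi_minus field_simps)
qed

text \<open>The principal part of \<open>f T v\<close> at \<open>p\<close> in the coordinate
  \<open>z = y - p\<close>: exactly the coefficient that occurs in a rational Dunkl
  operator.\<close>

definition singular_part :: "complex^'n \<Rightarrow> (complex^'n) set set \<Rightarrow> complex^'n \<Rightarrow> complex^'n \<Rightarrow> complex" where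
  "singular_part p T v z = (if coset L p \<in> T then rform (refl T) v / rform (refl T) z else 0)"

text \<open>The remainder is approximated by an element \<open>r\<close> of \<open>CH\<close> and
  not by a polynomial in \<open>z\<close>, because the operator \<open>r (1 - s_T)\<close> then
  preserves submodules of C[H]. On \<open>T\<close> the values of \<open>f T v\<close> carry no
  information, whence the value 0.\<close>

lemma f_approximation:
  assumes T: "T \<in> hypertori W L"
  shows "\<exists>r\<in>CH. vanishes_to m (\<lambda>z. if coset L (p + z) \<in> T then 0
      else f T v (p + z) - singular_part p T v z - r (p + z))"
proof (cases "coset L p \<in> T")
  case False
  from f_regular_off[OF T False, of v] obtain A B where AB: "A \<in> CH" "B \<in> CH" "B p \<noteq> 0"
    "\<forall>y. coset L y \<notin> T \<longrightarrow> B y \<noteq> 0 \<longrightarrow> f T v y = A y / B y" by (elim bexE conjE)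
  from quotient_approximation[OF AB(1-3), of m]
  obtain r where r: "r \<in> CH" "vanishes_to m (\<lambda>z. A (p + z) / B (p + z) - r (p + z))" by (elim bexE)
  obtain \<epsilon> where \<epsilon>: "0 < \<epsilon>" "\<And>z. norm z < \<epsilon> \<Longrightarrow> B (p + z) \<in> - {0}"
    by (rule exp_poly_near[OF CH_shift_exp_poly[OF AB(2), of p], of "- {0}"]) (use AB(3) in auto)
  have "vanishes_to m (\<lambda>z. if coset L (p + z) \<in> T then 0
      else f T v (p + z) - singular_part p T v z - r (p + z))"
  proof -
    obtain C \<delta> where C: "0 \<le> C" "0 < \<delta>" "\<And>z. norm z < \<delta> \<Longrightarrow> cmod (A (p + z) / B (p + z) - r (p + z)) \<le> C * norm z ^ m"
      using r(2) by (rule vanishes_toE) blast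
    show ?thesis
    proof (rule vanishes_toI[of "min \<epsilon> \<delta>" _ C])
      fix z :: "complex^'n" assume z: "norm z < min \<epsilon> \<delta>"
      show "cmod (if coset L (p + z) \<in> T then 0 else f T v (p + z) - singular_part p T v z - r (p + z)) \<le> C * norm z ^ m"
      proof (cases "coset L (p + z) \<in> T")
        case True
        then show ?thesis using C(1) by simp
      next
        case nin: False
        have "f T v (p + z) = A (p + z) / B (p + z)" using AB(4) nin \<epsilon>(2)[of z] z by simp
        then show ?thesis using C(3)[of z] z nin False by (simp add: singular_part_def)
      qed
    qed (use \<epsilon> C in auto)
  qed
  then show ?thesis using r(1) by (intro bexI[of _ r])
next
  case True
  define s where "s = refl T"
  define \<mu> where "\<mu> = rform s"
  have s: "s \<in> reflections W" "coset L p \<in> fixed_set L s" "T = component s p"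
    using hypertorus_through[OF T True s_def] by simp_all
  have sW: "s \<in> W" using s(1) by (simp add: reflections_def)
  have d: "reflection_data L s \<mu> (rvec s)" unfolding \<mu>_def by (rule rdata[OF s(1)])
  have \<mu>: "\<mu> \<in> dual_lattice L" using d by (simp add: reflection_data_def)
  note lin = dual_form[OF \<mu>]
  have Tp: "coset L y \<in> T \<longleftrightarrow> \<mu> (y - p) \<in> \<int>" for y
    unfolding \<mu>_def s_def by (rule hypertorus_through_iff[OF T True])
  define l where "l = (\<lambda>y. expi (\<mu> (y - p)) - 1)"
  have l: "l \<in> CH" unfolding l_def by (rule equation_CH[OF \<mu>])
  have dl: "directional v l y = 2 * of_real pi * \<i> * \<mu> v * (1 + l y)" for y
    unfolding l_def by (simp add: directional_equation[OF \<mu>])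
  have "local_equation L T p l" unfolding l_def by (rule local_equation_expi[OF d Tp])
  from f_regular_on(2)[OF T True this, of v] obtain A B where AB: "A \<in> CH" "B \<in> CH" "B p \<noteq> 0"
    "\<forall>y. coset L y \<notin> T \<longrightarrow> B y \<noteq> 0 \<longrightarrow> f T v y - directional v l y / l y = A y / B y" by (elim bexE conjE)
  from quotient_approximation[OF AB(1-3), of m]
  obtain r1 where r1: "r1 \<in> CH" "vanishes_to m (\<lambda>z. A (p + z) / B (p + z) - r1 (p + z))" by (elim bexE)
  obtain \<phi> where \<phi>: "\<phi> holomorphic_on ball 0 1"
    "\<And>u. u \<noteq> 0 \<Longrightarrow> cmod u < 1 \<Longrightarrow> \<phi> u = 2 * of_real pi * \<i> * ((1 + u) / u - 1 / Ln (1 + u))"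
    using logarithmic_derivative_regular by (elim exE conjE) (rule that, assumption, simp)
  define q where "q = (\<lambda>z. l (p + z))"
  have qz: "q z = expi (\<mu> z) - 1" for z by (simp add: q_def l_def)
  have q0: "q 0 = 0" by (simp add: qz linear_form_zero[OF lin])
  have qE: "q \<in> exp_poly" unfolding q_def by (rule CH_shift_exp_poly[OF l])
  have "vanishes_to 1 q" using exp_poly_vanishes_to_1[OF qE] by (simp add: q0)
  from holomorphic_taylor_compose[OF \<phi>(1) _ this, of m]
  obtain t where t: "vanishes_to m (\<lambda>z. \<phi> (q z) - poly t (q z))" by auto
  \<comment> \<open>\<open>r1\<close> approximates the difference of \<open>f T v\<close> and the
    logarithmic derivative of \<open>l\<close>; the second term approximates the difference of the
    logarithmic derivatives of \<open>l\<close> and \<open>\<mu>\<close>.\<close>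
  define r where "r = (\<lambda>y. r1 y + \<mu> v * poly t (l y))"
  have r: "r \<in> CH" unfolding r_def by (intro CH_add r1 CH_scale CH_poly l)
  have van: "vanishes_to m (\<lambda>z. (A (p + z) / B (p + z) - r1 (p + z)) + \<mu> v * (\<phi> (q z) - poly t (q z)))"
    by (intro vanishes_to_add vanishes_to_scale r1 t)
  obtain \<epsilon>1 where \<epsilon>1: "0 < \<epsilon>1" "\<And>z. norm z < \<epsilon>1 \<Longrightarrow> B (p + z) \<in> - {0}"
    by (rule exp_poly_near[OF CH_shift_exp_poly[OF AB(2), of p], of "- {0}"]) (use AB(3) in auto)
  obtain \<epsilon>2 where \<epsilon>2: "0 < \<epsilon>2" "\<And>z. norm z < \<epsilon>2 \<Longrightarrow> q z \<in> ball 0 1"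
    by (rule exp_poly_near[OF qE, of "ball 0 1"]) (use q0 in auto)
  obtain \<epsilon>3 where \<epsilon>3: "0 < \<epsilon>3" "\<And>z. norm z < \<epsilon>3 \<Longrightarrow> \<mu> z \<in> ball 0 (1 / 2)"
    by (rule exp_poly_near[OF exp_poly.form[OF lin], of "ball 0 (1 / 2)"]) (use linear_form_zero[OF lin] in auto)
  have eq: "f T v (p + z) - singular_part p T v z - r (p + z)
      = (A (p + z) / B (p + z) - r1 (p + z)) + \<mu> v * (\<phi> (q z) - poly t (q z))"
    if z: "norm z < min \<epsilon>1 (min \<epsilon>2 \<epsilon>3)" "coset L (p + z) \<notin> T" for z
  proof -
    have "\<mu> z \<notin> \<int>" using z(2) Tp[of "p + z"] by simp
    then have \<mu>z: "\<mu> z \<noteq> 0" by auto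
    have q0': "q z \<noteq> 0" using \<open>\<mu> z \<notin> \<int>\<close> by (simp add: qz expi_eq_1_iff)
    \<comment> \<open>Within this radius the principal logarithm inverts the exponential, so
      \<open>Ln (1 + q z)\<close> is the exponent itself.\<close>
    have "cmod (\<mu> z) < 1 / 2" using \<epsilon>3(2)[of z] z(1) by simp
    then have "\<bar>Re (\<mu> z)\<bar> < 1 / 2" using abs_Re_le_cmod[of "\<mu> z"] by linarith
    then have "\<bar>2 * pi * Re (\<mu> z)\<bar> < pi" by (simp add: abs_mult)
    then have "Ln (expi (\<mu> z)) = 2 * of_real pi * \<i> * \<mu> z"
      unfolding expi_def by (intro Ln_exp) (auto simp: abs_less_iff)
    then have "Ln (1 + q z) = 2 * of_real pi * \<i> * \<mu> z" by (simp add: qz)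
    define X where "X = 2 * of_real pi * \<i> * ((1 + q z) / q z)"
    have lq: "l (p + z) = q z" by (simp add: q_def)
    have e1: "\<phi> (q z) = X - 1 / \<mu> z"
      using \<phi>(2)[OF q0'] \<epsilon>2(2)[of z] z(1) \<mu>z \<open>Ln (1 + q z) = _\<close> by (simp add: right_diff_distrib X_def)
    have e2: "f T v (p + z) = A (p + z) / B (p + z) + \<mu> v * X"
      using AB(4)[rule_format, of "p + z"] z \<epsilon>1(2)[of z] by (simp add: dl lq X_def mult_ac diff_eq_eq)
    have e3: "singular_part p T v z = \<mu> v * (1 / \<mu> z)"
      using True by (simp add: singular_part_def \<mu>_def s_def)
    show ?thesis unfolding e1 e2 e3 r_def lq by (simp add: algebra_simps)
  qed
  obtain C \<delta> where C: "0 \<le> C" "0 < \<delta>"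
    "\<And>z. norm z < \<delta> \<Longrightarrow> cmod ((A (p + z) / B (p + z) - r1 (p + z)) + \<mu> v * (\<phi> (q z) - poly t (q z))) \<le> C * norm z ^ m"
    using van by (rule vanishes_toE) blast
  have "vanishes_to m (\<lambda>z. if coset L (p + z) \<in> T then 0 else f T v (p + z) - singular_part p T v z - r (p + z))"
  proof (rule vanishes_toI[of "min \<delta> (min \<epsilon>1 (min \<epsilon>2 \<epsilon>3))" _ C])
    fix z :: "complex^'n" assume z: "norm z < min \<delta> (min \<epsilon>1 (min \<epsilon>2 \<epsilon>3))"
    show "cmod (if coset L (p + z) \<in> T then 0 else f T v (p + z) - singular_part p T v z - r (p + z)) \<le> C * norm z ^ m"
    proof (cases "coset L (p + z) \<in> T")
      case True
      then show ?thesis using C(1) by simp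
    next
      case False
      then show ?thesis using C(3)[of z] eq[of z] z by simp
    qed
  qed (use \<epsilon>1 \<epsilon>2 \<epsilon>3 C in auto)
  then show ?thesis using r by (intro bexI[of _ r])
qed

text \<open>The bridge between the two algebras, at any point \<open>w *v x\<close> of the orbit but
  in coordinates pulled back to \<open>x\<close>: the direction becomes
  \<open>matrix_inv w *v v\<close>, and the reflections at \<open>w *v x\<close> are conjugates of
  those at \<open>x\<close>. The sum with \<open>r T\<close> compensates the regular parts of the
  \<open>f T v\<close>; derivatives and divided differences of the error cost one order.\<close>

lemma dunkl_comparison:
  fixes P :: "complex^'n \<Rightarrow> complex"
  assumes F: "F \<in> CH" and P: "P \<in> polynomial_functions" and w: "w \<in> W"
    and van: "vanishes_to (Suc m) (\<lambda>y. F (w *v (x + y)) - P y)"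
  shows "\<exists>r. (\<forall>T\<in>hypertori W L. r T \<in> CH) \<and>
    vanishes_to m (\<lambda>y. trig v F (w *v (x + y))
      + (\<Sum>T\<in>hypertori W L. c T * (r T (w *v (x + y)) * (F (w *v (x + y)) - F (refl T *v (w *v (x + y))))))
      - rational_dunkl (stabilizer W (coset L x)) (local_parameter L c (coset L x)) (matrix_inv w *v v) P y)"
proof -
  define p where "p = w *v x"
  define \<Gamma> where "\<Gamma> = stabilizer W (coset L x)"
  define k where "k = local_parameter L c (coset L x)"
  define v' where "v' = matrix_inv w *v v"
  define g where "g = (\<lambda>y. F (w *v (x + y)))"
  define h where "h = (\<lambda>y. g y - P y)"
  have wxy: "w *v (x + y) = p + w *v y" for y by (simp add: p_def matrix_vector_right_distrib)
  have \<Gamma>W: "\<Gamma> \<subseteq> W" by (auto simp: \<Gamma>_def stabilizer_def)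
  have gE: "g \<in> exp_poly" unfolding g_def wxy
    using exp_poly_affine[OF CH_exp_poly[OF F], of w p] by (simp add: add.commute)
  have hE: "h \<in> exp_poly" unfolding h_def by (intro exp_poly_diff gE polynomial_exp_poly P)
  have hv: "vanishes_to (Suc m) h" using van by (simp add: h_def g_def)
  have dg: "directional v F (w *v (x + y)) = directional v' g y" for y
    using directional_affine[OF CH_exp_poly[OF F], of v' w p]
    by (simp add: g_def wxy v'_def apply_inv w add.commute[of _ p])
  have "\<forall>T\<in>hypertori W L. \<exists>r. r \<in> CH \<and> vanishes_to m (\<lambda>z. if coset L (p + z) \<in> T then 0
      else f T v (p + z) - singular_part p T v z - r (p + z))"
    using f_approximation[of _ m p v] by (simp add: Bex_def)
  from bchoice[OF this] obtain r where r: "\<forall>T\<in>hypertori W L. r T \<in> CH \<and>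
    vanishes_to m (\<lambda>z. if coset L (p + z) \<in> T then 0 else f T v (p + z) - singular_part p T v z - r T (p + z))" ..
  define e where "e = (\<lambda>T y. if coset L (p + w *v y) \<in> T then 0
      else f T v (p + w *v y) - singular_part p T v (w *v y) - r T (p + w *v y))"
  have ev: "vanishes_to m (e T)" if "T \<in> hypertori W L" for T
    using vanishes_to_comp_matrix[of m _ w] bspec[OF r that] unfolding e_def by blast
  define \<Delta> where "\<Delta> = (\<lambda>T y. F (p + w *v y) - F (refl T *v (p + w *v y)))"
  have \<Delta>0: "vanishes_to 0 (\<Delta> T)" if T: "T \<in> hypertori W L" for T
  proof (rule vanishes_to_exp_poly)
    have R: "refl T \<in> W" using hypertoriE[OF T] by metis
    have "(\<lambda>y. (\<lambda>z. F z - F (refl T *v z)) (w *v y + p)) \<in> exp_poly"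
      by (intro exp_poly_affine CH_exp_poly CH_diff F CH_comp R)
    then show "\<Delta> T \<in> exp_poly" by (simp add: \<Delta>_def add.commute)
  qed
  define H where "H = (\<lambda>y. trig v F (w *v (x + y)) + (\<Sum>T\<in>hypertori W L. c T * (r T (w *v (x + y)) *
      (F (w *v (x + y)) - F (refl T *v (w *v (x + y)))))) - rational_dunkl \<Gamma> k v' P y)"
  obtain D1 where D1: "D1 \<in> CH" "\<exists>y. D1 y \<noteq> 0"
    "\<forall>y. D1 y \<noteq> 0 \<longleftrightarrow> (\<forall>T\<in>hypertori W L. coset L y \<notin> T)" using hypertori_discriminant by (elim bexE conjE)
  obtain D2 where D2: "D2 \<in> polynomial_functions" "\<exists>y. D2 y \<noteq> 0"
    "\<forall>y. D2 y \<noteq> 0 \<longleftrightarrow> (\<forall>s\<in>reflections \<Gamma>. rform s y \<noteq> 0)" using rational_discriminant[OF \<Gamma>W] by (elim bexE conjE)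
  define D where "D = (\<lambda>y. D1 (w *v y + p) * D2 y)"
  have DE1: "(\<lambda>y. D1 (w *v y + p)) \<in> exp_poly" by (rule exp_poly_affine[OF CH_exp_poly[OF D1(1)]])
  have DE: "D \<in> exp_poly" unfolding D_def by (intro exp_poly.mult DE1 polynomial_exp_poly D2)
  have "\<exists>y. D y \<noteq> 0"
  proof (rule ccontr)
    assume no: "\<not> ?thesis"
    obtain y1 where y1: "D1 y1 \<noteq> 0" using D1(2) by (elim exE)
    have "D1 (w *v (matrix_inv w *v (y1 - p)) + p) \<noteq> 0" using y1 by (simp add: apply_inv w)
    from exp_poly_mult_eq_0[OF DE1 polynomial_exp_poly[OF D2(1)] _ this] no
    have "D2 y = 0" for y unfolding D_def by blast
    with D2(2) show False by simp
  qed
  then obtain z0 where z0: "D z0 \<noteq> 0" by (elim exE)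
  have refl\<Gamma>: "s \<in> reflections W" "coset L x \<in> fixed_set L s" if "s \<in> reflections \<Gamma>" for s
    using that by (simp_all add: \<Gamma>_def reflections_stabilizer)
  \<comment> \<open>The hypertorus through \<open>w *v x\<close> that corresponds to the reflection
    \<open>s\<close> at \<open>x\<close>.\<close>
  define \<tau> where "\<tau> = (\<lambda>s. component (w ** s ** matrix_inv w) p)"
  define \<Theta> where "\<Theta> = {T \<in> hypertori W L. coset L p \<in> T}"
  have conj_bij: "bij_betw (\<lambda>s. w ** s ** matrix_inv w) (reflections \<Gamma>) (reflections (stabilizer W (coset L p)))"
  proof (rule bij_betw_byWitness[where f' = "\<lambda>s. matrix_inv w ** s ** w"])
    have iw: "matrix_inv w ** w = mat 1" "w ** matrix_inv w = mat 1" "matrix_inv (matrix_inv w) = w"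
      using left_inverse_W[OF w] right_inverse_W[OF w] left_inverse_W[OF inv_W[OF w]]
      by (simp, simp, metis matrix_mul_assoc matrix_mul_rid)
    show "\<forall>s\<in>reflections \<Gamma>. matrix_inv w ** (w ** s ** matrix_inv w) ** w = s"
      by (metis iw matrix_mul_assoc matrix_mul_lid matrix_mul_rid)
    show "\<forall>s\<in>reflections (stabilizer W (coset L p)). w ** (matrix_inv w ** s ** w) ** matrix_inv w = s"
      by (metis iw matrix_mul_assoc matrix_mul_lid matrix_mul_rid)
    show "(\<lambda>s. w ** s ** matrix_inv w) ` reflections \<Gamma> \<subseteq> reflections (stabilizer W (coset L p))"
    proof
      fix t assume "t \<in> (\<lambda>s. w ** s ** matrix_inv w) ` reflections \<Gamma>"
      then obtain s where s: "s \<in> reflections \<Gamma>" "t = w ** s ** matrix_inv w" by blast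
      have sW: "s \<in> W" using refl\<Gamma>(1)[OF s(1)] by (simp add: reflections_def)
      show "t \<in> reflections (stabilizer W (coset L p))"
        using reflections_conjugate[OF w refl\<Gamma>(1)[OF s(1)]] fixed_set_conjugate[OF w sW, of x] refl\<Gamma>(2)[OF s(1)]
        by (simp add: reflections_stabilizer p_def s(2))
    qed
    show "(\<lambda>s. matrix_inv w ** s ** w) ` reflections (stabilizer W (coset L p)) \<subseteq> reflections \<Gamma>"
    proof
      fix t assume "t \<in> (\<lambda>s. matrix_inv w ** s ** w) ` reflections (stabilizer W (coset L p))"
      then obtain s where s: "s \<in> reflections W" "coset L p \<in> fixed_set L s" "t = matrix_inv w ** s ** w"
        by (auto simp: reflections_stabilizer)
      have sW: "s \<in> W" using s(1) by (simp add: reflections_def)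
      show "t \<in> reflections \<Gamma>"
        using reflections_conjugate[OF inv_W[OF w] s(1)] fixed_set_conjugate[OF inv_W[OF w] sW, of p] s(2)
        by (simp add: reflections_stabilizer p_def s(3) iw \<Gamma>_def inv_apply w)
    qed
  qed
  have \<tau>bij: "bij_betw \<tau> (reflections \<Gamma>) \<Theta>"
    using bij_betw_trans[OF conj_bij hypertori_through_bij[of p]] by (simp add: \<tau>_def \<Theta>_def comp_def)
  have \<tau>prop: "c (\<tau> s) = k s" "refl (\<tau> s) = w ** s ** matrix_inv w"
    "singular_part p (\<tau> s) v (w *v y) = rform s v' / rform s y"
    "\<Delta> (\<tau> s) y = g y - g (s *v y)" if s: "s \<in> reflections \<Gamma>" for s y
  proof -
    note sr = refl\<Gamma>[OF s]
    have sW: "s \<in> W" using sr(1) by (simp add: reflections_def)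
    define t where "t = w ** s ** matrix_inv w"
    have tr: "t \<in> reflections W" unfolding t_def by (rule reflections_conjugate[OF w sr(1)])
    have tp: "coset L p \<in> fixed_set L t" unfolding t_def p_def using sr(2) by (simp add: fixed_set_conjugate w sW)
    show "c (\<tau> s) = k s"
      using local_parameter_conjugate[OF invariant_c w sr] by (simp add: \<tau>_def k_def local_parameter_eq p_def)
    show rt: "refl (\<tau> s) = w ** s ** matrix_inv w"
      unfolding \<tau>_def using hypertorus_reflection_component[OF tr tp] by (simp add: t_def)
    have "rform t (w *v (s *v z)) = - rform t (w *v z)" for z
    proof -
      have "w *v (s *v z) = t *v (w *v z)" by (simp add: t_def matrix_vector_mul_assoc[symmetric] inv_apply w)
      then show ?thesis
        by (simp add: rform_apply[OF tr] linear_form_simps[OF rform_linear[OF tr]] rform_rvec[OF tr])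
    qed
    \<comment> \<open>The form of the conjugate reflection, pulled back by \<open>w\<close>, is
      anti-invariant under \<open>s\<close>, hence proportional to \<open>rform s\<close>; the ratio
      drops out of the principal part.\<close>
    then have pp: "rform t (w *v z) = rform t (w *v rvec s) / 2 * rform s z" for z
      by (intro antiinvariant_form[OF sr(1) linear_form_comp_matrix[OF rform_linear[OF tr]]])
    define \<kappa> where "\<kappa> = rform t (w *v rvec s) / 2"
    have pr: "rform t (w *v z) = \<kappa> * rform s z" for z using pp[of z] by (simp add: \<kappa>_def)
    have "\<kappa> \<noteq> 0"
      using pr[of "matrix_inv w *v rvec t"] rform_rvec[OF tr] by (auto simp: apply_inv w)
    then have "rform t v / rform t (w *v y) = rform s v' / rform s y"
      using pr[of y] pr[of v'] by (simp add: v'_def apply_inv w)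
    moreover have "coset L p \<in> \<tau> s" unfolding \<tau>_def t_def[symmetric] by (rule coset_in_component[OF tp])
    ultimately show "singular_part p (\<tau> s) v (w *v y) = rform s v' / rform s y"
      by (simp add: singular_part_def rt t_def)
    have "t *v (p + w *v y) = w *v (s *v (x + y))"
      by (simp add: t_def wxy[symmetric] matrix_vector_mul_assoc[symmetric] inv_apply w)
    \<comment> \<open>\<open>s\<close> fixes the coset of \<open>x\<close> but perhaps not
      \<open>x\<close>; the discrepancy is a lattice vector, invisible to \<open>F\<close>.\<close>
    moreover have "w *v (s *v (x + y)) - w *v (x + s *v y) \<in> L"
    proof -
      have "s *v x - x \<in> L" using sr(2) by (simp add: fixed_set_iff sW L_diff_commute)
      then have "w *v (s *v x - x) \<in> L" by (rule L_apply[OF w])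
      then show ?thesis by (simp add: matrix_vector_right_distrib matrix_vector_mult_diff_distrib)
    qed
    ultimately have "F (t *v (p + w *v y)) = g (s *v y)" unfolding g_def using CH_coset[OF F] by simp
    then show "\<Delta> (\<tau> s) y = g y - g (s *v y)" unfolding \<Delta>_def rt t_def[symmetric] g_def wxy by simp
  qed
  \<comment> \<open>The error in a form that can be estimated term by term: a derivative of
    \<open>h\<close>, remainders of the approximation of \<open>f T v\<close>, and divided
    differences of \<open>h\<close>. The value 0 on a mirror keeps the bound, and the identity with
    \<open>H\<close> is claimed only where \<open>D y \<noteq> 0\<close>.\<close>
  define E where "E = (\<lambda>y. directional v' h y - (\<Sum>T\<in>hypertori W L. c T * (e T y * \<Delta> T y))
      - (\<Sum>s\<in>reflections \<Gamma>. k s * (if rform s y = 0 then 0 else rform s v' / rform s y * (h y - h (s *v y)))))"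
  have Ev: "vanishes_to m E"
    unfolding E_def
  proof (intro vanishes_to_diff vanishes_to_sum vanishes_to_scale)
    show "vanishes_to m (directional v' h)" by (rule vanishes_to_directional[OF hE hv])
    fix T assume T: "T \<in> hypertori W L"
    show "vanishes_to m (\<lambda>y. e T y * \<Delta> T y)"
      using vanishes_to_mult[OF ev[OF T] \<Delta>0[OF T]] by simp
  next
    fix s assume s: "s \<in> reflections \<Gamma>"
    obtain C \<delta> where C: "0 < \<delta>" "\<And>y. norm y < \<delta> \<Longrightarrow>
        cmod (h y - h (y - rform s y *s rvec s)) \<le> cmod (rform s y) * (C * norm y ^ m)"
      using vanishes_to_divided_difference[OF hE hv rform_linear[OF refl\<Gamma>(1)[OF s]]] by blast
    show "vanishes_to m (\<lambda>y. if rform s y = 0 then 0 else rform s v' / rform s y * (h y - h (s *v y)))"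
    proof (rule vanishes_toI[OF C(1), of _ "cmod (rform s v') * \<bar>C\<bar>"])
      fix y :: "complex^'n" assume y: "norm y < \<delta>"
      show "cmod (if rform s y = 0 then 0 else rform s v' / rform s y * (h y - h (s *v y)))
          \<le> cmod (rform s v') * \<bar>C\<bar> * norm y ^ m"
      proof (cases "rform s y = 0")
        case False
        have "cmod (h y - h (s *v y)) \<le> cmod (rform s y) * (C * norm y ^ m)"
          using C(2)[OF y] by (simp add: rform_apply[OF refl\<Gamma>(1)[OF s]])
        also have "\<dots> \<le> cmod (rform s y) * (\<bar>C\<bar> * norm y ^ m)"
          by (intro mult_left_mono mult_right_mono) auto
        finally have "cmod (rform s v') / cmod (rform s y) * cmod (h y - h (s *v y))
            \<le> cmod (rform s v') / cmod (rform s y) * (cmod (rform s y) * (\<bar>C\<bar> * norm y ^ m))"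
          by (intro mult_left_mono) auto
        then show ?thesis using False by (simp add: norm_mult norm_divide mult.assoc)
      qed simp
    qed
  qed
  have HE: "H \<in> exp_poly"
  proof -
    have aff: "(\<lambda>y. G (w *v (x + y))) \<in> exp_poly" if "G \<in> CH" for G
      unfolding wxy using exp_poly_affine[OF CH_exp_poly[OF that], of w p] by (simp add: add.commute)
    have Fr: "(\<lambda>y. F (refl T *v (w *v (x + y)))) \<in> exp_poly" if T: "T \<in> hypertori W L" for T
    proof -
      have R: "refl T \<in> W" using hypertoriE[OF T] by metis
      show ?thesis by (rule aff[OF CH_comp[OF F R]])
    qed
    have rE: "(\<lambda>y. r T (w *v (x + y))) \<in> exp_poly" if T: "T \<in> hypertori W L" for T
      using bspec[OF r T] by (intro aff) simp
    have "rational_dunkl \<Gamma> k v' P \<in> exp_poly"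
      by (intro polynomial_exp_poly rational_dunkl_properties(1) \<Gamma>W P)
    then show ?thesis unfolding H_def
      by (intro exp_poly_diff exp_poly.add exp_poly_sum exp_poly_scale exp_poly.mult
          aff[OF F] aff[OF trig_dunkl_properties(1)[OF F]] rE Fr)
  qed
  have HEeq: "H y = E y" if Dy: "D y \<noteq> 0" for y
  proof -
    have nT: "coset L (p + w *v y) \<notin> T" if "T \<in> hypertori W L" for T
      using Dy D1(3) that by (simp add: D_def add.commute)
    have ns: "rform s y \<noteq> 0" if "s \<in> reflections \<Gamma>" for s
      using Dy D2(3) that by (simp add: D_def)
    have 1: "trig v F (w *v (x + y)) = directional v' g y - (\<Sum>T\<in>hypertori W L. c T * (f T v (p + w *v y) * \<Delta> T y))"
      using trig_dunkl_properties(2)[OF F, of "w *v (x + y)" v] nT dg[of y] by (simp add: wxy \<Delta>_def mult.assoc)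
    have 2: "rational_dunkl \<Gamma> k v' P y = directional v' P y -
        (\<Sum>s\<in>reflections \<Gamma>. k s * (rform s v' / rform s y * (P y - P (s *v y))))"
      using rational_dunkl_properties(2)[OF \<Gamma>W P, of y k v'] ns by (simp add: mult.assoc)
    have 3: "directional v' h y = directional v' g y - directional v' P y"
      unfolding h_def by (simp add: directional_diff gE polynomial_exp_poly P)
    have 4: "(\<Sum>T\<in>hypertori W L. c T * (singular_part p T v (w *v y) * \<Delta> T y))
        = (\<Sum>s\<in>reflections \<Gamma>. k s * (rform s v' / rform s y * (g y - g (s *v y))))"
    proof -
      have "(\<Sum>T\<in>hypertori W L. c T * (singular_part p T v (w *v y) * \<Delta> T y))
          = (\<Sum>T\<in>\<Theta>. c T * (singular_part p T v (w *v y) * \<Delta> T y))"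
        unfolding \<Theta>_def by (rule sum.mono_neutral_right) (auto simp: finite_hypertori singular_part_def)
      also have "\<dots> = (\<Sum>s\<in>reflections \<Gamma>. c (\<tau> s) * (singular_part p (\<tau> s) v (w *v y) * \<Delta> (\<tau> s) y))"
        by (rule sum.reindex_bij_betw[OF \<tau>bij, symmetric])
      finally show ?thesis by (simp add: \<tau>prop)
    qed
    have 5: "(\<Sum>T\<in>hypertori W L. c T * (f T v (p + w *v y) * \<Delta> T y))
        = (\<Sum>T\<in>hypertori W L. c T * (e T y * \<Delta> T y)) + (\<Sum>T\<in>hypertori W L. c T * (singular_part p T v (w *v y) * \<Delta> T y))
          + (\<Sum>T\<in>hypertori W L. c T * (r T (p + w *v y) * \<Delta> T y))"
      unfolding sum.distrib[symmetric]
      by (intro sum.cong refl) (simp add: e_def nT algebra_simps)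
    have 6: "(\<Sum>s\<in>reflections \<Gamma>. k s * (if rform s y = 0 then 0 else rform s v' / rform s y * (h y - h (s *v y))))
        = (\<Sum>s\<in>reflections \<Gamma>. k s * (rform s v' / rform s y * (g y - g (s *v y))))
          - (\<Sum>s\<in>reflections \<Gamma>. k s * (rform s v' / rform s y * (P y - P (s *v y))))"
      unfolding sum_subtractf[symmetric]
      by (intro sum.cong refl) (simp add: ns h_def right_diff_distrib diff_divide_distrib)
    have 7: "H y = trig v F (w *v (x + y)) + (\<Sum>T\<in>hypertori W L. c T * (r T (p + w *v y) * \<Delta> T y))
        - rational_dunkl \<Gamma> k v' P y"
      by (simp only: H_def \<Delta>_def wxy)
    show ?thesis unfolding 7 E_def 1 2 3 6 5 4 by simp
  qed
  have "vanishes_to m H" by (rule vanishes_to_dense_eq[OF HE DE z0 Ev HEeq])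
  then show ?thesis using r unfolding H_def \<Gamma>_def k_def v'_def by (intro exI[of _ r]) simp
qed

end

section \<open>Homogeneous polynomials\<close>

text \<open>Scaling is used instead of monomials: derivatives and Dunkl operators are compatible
  with dilations, so their degrees can be read off directly.\<close>

definition homogeneous :: "nat \<Rightarrow> (complex^'n \<Rightarrow> complex) \<Rightarrow> bool" where
  "homogeneous m P \<longleftrightarrow> P \<in> polynomial_functions \<and> (\<forall>t y. P (t *s y) = t ^ m * P y)"

text \<open>Checking degrees of derivatives and Dunkl operators involves division by
  \<open>t\<close>; the value at \<open>t = 0\<close> follows by continuity.\<close>

lemma homogeneousI:
  fixes P :: "complex^'n \<Rightarrow> complex"
  assumes P: "P \<in> polynomial_functions" and h: "\<And>t y. t \<noteq> 0 \<Longrightarrow> P (t *s y) = t ^ m * P y"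
  shows "homogeneous m P"
proof -
  have "P (t *s y) = t ^ m * P y" for t y
  proof (cases "t = 0")
    case True
    define g where "g = (\<lambda>t. P (0 + t *s y) - t ^ m * P y)"
    have "(\<lambda>t. P (0 + t *s y)) holomorphic_on UNIV"
      by (rule exp_poly_line_holomorphic[OF polynomial_exp_poly[OF P]])
    then have "continuous_on UNIV g" unfolding g_def
      by (intro continuous_intros holomorphic_on_imp_continuous_on)
    then have "(g \<longlongrightarrow> g 0) (at 0)" by (simp add: continuous_on_def)
    moreover have "(g \<longlongrightarrow> 0) (at 0)"
      by (rule tendsto_eventually) (auto simp: g_def h eventually_at_filter)
    ultimately have "g 0 = 0" using tendsto_unique[OF at_neq_bot] by blast
    then show ?thesis by (simp add: g_def True)
  qed (rule h)
  with P show ?thesis by (simp add: homogeneous_def)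
qed

lemma homogeneous_polynomial: "homogeneous m P \<Longrightarrow> P \<in> polynomial_functions"
  and homogeneous_scale: "homogeneous m P \<Longrightarrow> P (t *s y) = t ^ m * P y"
  by (simp_all add: homogeneous_def)

lemma homogeneous_zero: "homogeneous m (\<lambda>y. 0)"
  by (simp add: homogeneous_def polynomial_functions.const)

lemma homogeneous_at_0: "homogeneous m P \<Longrightarrow> m > 0 \<Longrightarrow> P 0 = 0"
  using homogeneous_scale[of m P 0 0] by (simp add: zero_power)

lemma homogeneous_0_const: "homogeneous 0 P \<Longrightarrow> P y = P 0"
  using homogeneous_scale[of 0 P 0 y] by simp

lemma mat_mult_vector: "mat t *v z = t *s (z :: complex^'n)"
proof -
  have "(if i = j then t else 0) * z $ j = (if i = j then t * z $ j else 0)" for i j by simp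
  then show ?thesis by (simp add: matrix_vector_mult_def mat_def vec_eq_iff)
qed

lemma homogeneous_directional:
  assumes P: "homogeneous (Suc m) P"
  shows "homogeneous m (directional v P)"
proof (rule homogeneousI)
  have PE: "P \<in> exp_poly" by (rule polynomial_exp_poly[OF homogeneous_polynomial[OF P]])
  show "directional v P \<in> polynomial_functions"
    by (rule polynomial_directional[OF homogeneous_polynomial[OF P]])
  fix t :: complex and y assume t: "t \<noteq> 0"
  have eq: "(\<lambda>y. P (mat t *v y + 0)) = (\<lambda>y. t ^ Suc m * P y)"
    using homogeneous_scale[OF P] by (simp add: mat_mult_vector)
  have "directional (mat t *v v) P (mat t *v y + 0) = t ^ Suc m * directional v P y"
    using fun_cong[OF directional_affine[OF PE, of v "mat t" 0], of y]
    unfolding eq by (simp add: directional_scale PE)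
  then have "t * directional v P (t *s y) = t ^ Suc m * directional v P y"
    by (simp add: directional_scale_vector[OF PE] mat_mult_vector)
  then show "directional v P (t *s y) = t ^ m * directional v P y" using t by simp
qed

lemma homogeneous_0_directional: "homogeneous 0 P \<Longrightarrow> directional v P = (\<lambda>y. 0)"
proof -
  assume "homogeneous 0 P"
  then have "P = (\<lambda>y. P 0)" using homogeneous_0_const by blast
  then show ?thesis using directional_const[of v "P 0"] by simp
qed

lemma homogeneous_euler:
  assumes "homogeneous m P"
  shows "directional y P y = of_nat m * P y"
proof -
  have "((\<lambda>t. (1 + t) ^ m * P y) has_field_derivative of_nat m * P y) (at 0)"
    by (auto intro!: derivative_eq_intros)
  moreover have "(1 + t) ^ m * P y = P (y + t *s y)" for t
    using homogeneous_scale[OF assms, of "1 + t" y] by (simp add: vec.scale_left_distrib)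
  ultimately show ?thesis by (simp add: directional_def DERIV_imp_deriv)
qed

section \<open>Filtration of polynomials by degree\<close>

definition degree_le :: "nat \<Rightarrow> (complex^'n \<Rightarrow> complex) \<Rightarrow> bool" where
  "degree_le d P \<longleftrightarrow> (\<exists>Q. (\<forall>m. homogeneous m (Q m)) \<and> P = (\<lambda>y. \<Sum>m\<le>d. Q m y))"

lemma degree_leI: "(\<And>m. homogeneous m (Q m)) \<Longrightarrow> P = (\<lambda>y. \<Sum>m\<le>d. Q m y) \<Longrightarrow> degree_le d P"
  unfolding degree_le_def by blast

lemma degree_leE:
  assumes "degree_le d P"
  obtains Q where "\<And>m. homogeneous m (Q m)" "P = (\<lambda>y. \<Sum>m\<le>d. Q m y)"
  using assms unfolding degree_le_def by blast

lemma degree_le_homogeneous: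
  assumes "homogeneous k P" "k \<le> d"
  shows "degree_le d P"
  by (rule degree_leI[of "\<lambda>m. if m = k then P else (\<lambda>y. 0)"])
    (use assms in \<open>auto simp: homogeneous_zero if_distrib[of "\<lambda>f. f _"] cong: if_cong\<close>)

lemma degree_le_add:
  assumes "degree_le d P" "degree_le d Q"
  shows "degree_le d (\<lambda>y. P y + Q y)"
proof -
  obtain A where A: "\<And>m. homogeneous m (A m)" "P = (\<lambda>y. \<Sum>m\<le>d. A m y)" using assms(1) by (rule degree_leE) blast
  obtain B where B: "\<And>m. homogeneous m (B m)" "Q = (\<lambda>y. \<Sum>m\<le>d. B m y)" using assms(2) by (rule degree_leE) blast
  show ?thesis
    by (rule degree_leI[of "\<lambda>m y. A m y + B m y"])
      (use A B in \<open>auto simp: sum.distrib homogeneous_def algebra_simps intro: polynomial_functions.add\<close>)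
qed

lemma degree_le_sum:
  "(\<And>i. i \<in> I \<Longrightarrow> degree_le d (P i)) \<Longrightarrow> degree_le d (\<lambda>y. \<Sum>i\<in>I. P i y)"
  by (induction I rule: infinite_finite_induct)
    (auto intro: degree_le_add degree_le_homogeneous[OF homogeneous_zero[of 0]])

lemma degree_le_mult:
  assumes "degree_le d P" "degree_le e Q"
  shows "degree_le (d + e) (\<lambda>y. P y * Q y)"
proof -
  obtain A where A: "\<And>m. homogeneous m (A m)" "P = (\<lambda>y. \<Sum>m\<le>d. A m y)" using assms(1) by (rule degree_leE) blast
  obtain B where B: "\<And>m. homogeneous m (B m)" "Q = (\<lambda>y. \<Sum>m\<le>e. B m y)" using assms(2) by (rule degree_leE) blast
  have "homogeneous (i + j) (\<lambda>y. A i y * B j y)" for i j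
    using A(1)[of i] B(1)[of j] by (simp add: homogeneous_def power_add polynomial_functions.mult)
  then have "degree_le (d + e) (\<lambda>y. A i y * B j y)" if "i \<le> d" "j \<le> e" for i j
    by (rule degree_le_homogeneous) (use that in simp)
  then have "degree_le (d + e) (\<lambda>y. \<Sum>i\<le>d. \<Sum>j\<le>e. A i y * B j y)" by (intro degree_le_sum) auto
  then show ?thesis by (simp add: A(2) B(2) sum_product)
qed

lemma polynomial_degree_le: "P \<in> polynomial_functions \<Longrightarrow> \<exists>d. degree_le d P"
proof (induction rule: polynomial_functions.induct)
  case (const a)
  have "homogeneous 0 (\<lambda>y. a)" by (simp add: homogeneous_def polynomial_functions.const)
  then show ?case using degree_le_homogeneous[of 0 _ 0] by blast
next
  case (coord i)
  have "homogeneous 1 (\<lambda>y. y $ i)" by (simp add: homogeneous_def polynomial_functions.coord)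
  then show ?case using degree_le_homogeneous[of 1 _ 1] by blast
next
  case (add P Q)
  then obtain d e where de: "degree_le d P" "degree_le e Q" by blast
  have mono: "degree_le (max d e) R" if R: "degree_le k R" "k \<le> max d e" for k and R :: "complex^'a \<Rightarrow> complex"
  proof -
    obtain A where A: "\<And>m. homogeneous m (A m)" "R = (\<lambda>y. \<Sum>m\<le>k. A m y)" using R(1) by (rule degree_leE) blast
    show ?thesis unfolding A(2) using R(2) by (intro degree_le_sum degree_le_homogeneous[OF A(1)]) auto
  qed
  show ?case using degree_le_add[OF mono[OF de(1)] mono[OF de(2)]] by auto
next
  case (mult P Q)
  then show ?case using degree_le_mult by blast
qed

lemma degree_le_directional:
  assumes "degree_le (Suc d) P"
  shows "degree_le d (directional v P)"
proof -
  obtain A where A: "\<And>m. homogeneous m (A m)" "P = (\<lambda>y. \<Sum>m\<le>Suc d. A m y)" using assms by (rule degree_leE) blast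
  have "directional v P = (\<lambda>y. \<Sum>m\<le>Suc d. directional v (A m) y)"
    unfolding A(2) by (intro directional_sum polynomial_exp_poly homogeneous_polynomial[OF A(1)])
  also have "\<dots> = (\<lambda>y. \<Sum>m\<le>d. directional v (A (Suc m)) y)"
    by (subst sum.atMost_Suc_shift) (simp add: homogeneous_0_directional[OF A(1)])
  finally show ?thesis by (intro degree_leI[of "\<lambda>m. directional v (A (Suc m))"] homogeneous_directional A)
qed

lemma polynomial_directional_expand:
  "P \<in> polynomial_functions \<Longrightarrow> directional v P x = (\<Sum>i\<in>UNIV. v $ i * directional (axis i 1) P x)"
proof (induction rule: polynomial_functions.induct)
  case (coord i)
  show ?case by (simp add: directional_form linear_form_coord axis_def if_distrib cong: if_cong)
next
  case (add P Q)
  then show ?case by (simp add: directional_add polynomial_exp_poly sum.distrib[symmetric] distrib_left)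
next
  case (mult P Q)
  then show ?case
    by (simp add: directional_mult polynomial_exp_poly sum_distrib_left sum_distrib_right
        sum.distrib[symmetric] algebra_simps)
qed (simp add: directional_const)

lemma polynomial_const_if_directional_0:
  assumes "P \<in> polynomial_functions" "\<And>v. directional v P = (\<lambda>y. 0)"
  shows "P y = P 0"
proof -
  have "((\<lambda>t. P (0 + t *s y)) has_field_derivative 0) (at t within UNIV)" for t
    using exp_poly_has_field_derivative[OF polynomial_exp_poly[OF assms(1)], of 0 y t] by (simp add: assms(2))
  then obtain c where "\<forall>t\<in>UNIV. P (0 + t *s y) = c"
    using has_field_derivative_zero_constant[of UNIV "\<lambda>t. P (0 + t *s y)"] by auto
  then have "P (0 + 1 *s y) = c" "P (0 + 0 *s y) = c" by blast+
  then show ?thesis by simp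
qed

text \<open>The product rule for \<open>B ^ j * P\<close>, multiplied by \<open>B\<close> so that
  the exponent \<open>j - 1\<close> does not appear. It serves for the discriminant of a rational
  algebra and for a denominator on the torus.\<close>

lemma power_directional:
  assumes B: "B \<in> exp_poly" and P: "P \<in> exp_poly"
  shows "B y * directional v (\<lambda>y. B y ^ j * P y) y
    = of_nat j * directional v B y * (B y ^ j * P y) + B y ^ Suc j * directional v P y"
proof (induction j)
  case (Suc j)
  have E: "(\<lambda>y. B y ^ j * P y) \<in> exp_poly" by (intro exp_poly.mult exp_poly_power assms)
  have "directional v (\<lambda>y. B y * (B y ^ j * P y)) y
      = directional v B y * (B y ^ j * P y) + B y * directional v (\<lambda>y. B y ^ j * P y) y"
    by (simp add: directional_mult[OF B E])
  then have "B y * directional v (\<lambda>y. B y ^ Suc j * P y) y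
      = B y * (directional v B y * (B y ^ j * P y) + B y * directional v (\<lambda>y. B y ^ j * P y) y)"
    by (simp only: power_Suc mult.assoc)
  also have "\<dots> = B y * (directional v B y * (B y ^ j * P y)
      + (of_nat j * directional v B y * (B y ^ j * P y) + B y ^ Suc j * directional v P y))"
    by (simp only: Suc)
  finally show ?case by (simp add: algebra_simps)
qed simp

section \<open>Taylor approximation by polynomials\<close>

text \<open>A formal power series at the origin, encoded by polynomial approximations to every
  order. This also covers functions such as \<open>(expi z - 1) / z\<close>, which do not arise from
  the constructors of \<open>exp_poly\<close>.\<close>

definition taylor :: "(complex^'n \<Rightarrow> complex) \<Rightarrow> bool" where
  "taylor h \<longleftrightarrow> (\<forall>m. \<exists>P\<in>polynomial_functions. vanishes_to m (\<lambda>y. h y - P y))"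

lemma taylorE:
  assumes "taylor h"
  obtains P where "P \<in> polynomial_functions" "vanishes_to m (\<lambda>y. h y - P y)"
  using assms unfolding taylor_def by blast

lemma taylor_polynomial: "P \<in> polynomial_functions \<Longrightarrow> taylor P"
  unfolding taylor_def by (intro allI bexI[of _ P]) (simp_all add: vanishes_to_zero)

lemma taylor_bounded: "taylor h \<Longrightarrow> vanishes_to 0 h"
proof -
  assume "taylor h"
  then obtain P where P: "P \<in> polynomial_functions" "vanishes_to 0 (\<lambda>y. h y - P y)" by (rule taylorE)
  have "vanishes_to 0 (\<lambda>y. (h y - P y) + P y)"
    by (intro vanishes_to_add P vanishes_to_exp_poly polynomial_exp_poly)
  then show ?thesis by simp
qed

lemma taylor_add:
  assumes "taylor g" "taylor h"
  shows "taylor (\<lambda>y. g y + h y)"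
  unfolding taylor_def
proof
  fix m
  obtain P where P: "P \<in> polynomial_functions" "vanishes_to m (\<lambda>y. g y - P y)" using assms(1) by (rule taylorE)
  obtain Q where Q: "Q \<in> polynomial_functions" "vanishes_to m (\<lambda>y. h y - Q y)" using assms(2) by (rule taylorE)
  have "vanishes_to m (\<lambda>y. (g y - P y) + (h y - Q y))" by (intro vanishes_to_add P Q)
  then show "\<exists>P\<in>polynomial_functions. vanishes_to m (\<lambda>y. g y + h y - P y)"
    by (intro bexI[of _ "\<lambda>y. P y + Q y"]) (simp_all add: algebra_simps polynomial_functions.add P Q)
qed

lemma vanishes_to_mult_diff:
  assumes "vanishes_to m (\<lambda>y. g y - P y)" "vanishes_to m (\<lambda>y. h y - Q y)"
    and "vanishes_to 0 h" "P \<in> polynomial_functions"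
  shows "vanishes_to m (\<lambda>y. g y * h y - P y * Q y)"
proof -
  have "vanishes_to m (\<lambda>y. h y * (g y - P y) + P y * (h y - Q y))"
    by (intro vanishes_to_add vanishes_to_mult_bounded assms vanishes_to_exp_poly polynomial_exp_poly)
  then show ?thesis by (simp add: algebra_simps)
qed

lemma taylor_mult:
  assumes "taylor g" "taylor h"
  shows "taylor (\<lambda>y. g y * h y)"
  unfolding taylor_def
proof
  fix m
  obtain P where P: "P \<in> polynomial_functions" "vanishes_to m (\<lambda>y. g y - P y)" using assms(1) by (rule taylorE)
  obtain Q where Q: "Q \<in> polynomial_functions" "vanishes_to m (\<lambda>y. h y - Q y)" using assms(2) by (rule taylorE)
  show "\<exists>P\<in>polynomial_functions. vanishes_to m (\<lambda>y. g y * h y - P y)"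
    by (intro bexI[of _ "\<lambda>y. P y * Q y"] vanishes_to_mult_diff P Q taylor_bounded assms polynomial_functions.mult)
qed

lemma taylor_compose:
  assumes "\<phi> holomorphic_on ball 0 \<rho>" "0 < \<rho>" "linear_form \<mu>"
  shows "taylor (\<lambda>y. \<phi> (\<mu> y))"
  unfolding taylor_def
proof
  fix m
  obtain p where "vanishes_to m (\<lambda>y. \<phi> (\<mu> y) - poly p (\<mu> y))"
    using holomorphic_taylor_compose[OF assms(1,2) vanishes_to_form[OF assms(3)]] by blast
  then show "\<exists>P\<in>polynomial_functions. vanishes_to m (\<lambda>y. \<phi> (\<mu> y) - P y)"
    by (intro bexI[of _ "\<lambda>y. poly p (\<mu> y)"] polynomial_poly polynomial_form assms(3))
qed

lemma taylor_exp_poly: "P \<in> exp_poly \<Longrightarrow> taylor P"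
proof (induction rule: exp_poly.induct)
  case (exp \<mu>)
  show ?case by (rule taylor_compose[of _ 1, OF _ _ exp]) (auto intro: holomorphic_intros)
qed (auto intro: taylor_add taylor_mult taylor_polynomial polynomial_functions.const polynomial_form)

lemma taylor_prod: "(\<And>i. i \<in> A \<Longrightarrow> taylor (h i)) \<Longrightarrow> taylor (\<lambda>y. \<Prod>i\<in>A. h i y)"
  by (induction A rule: infinite_finite_induct)
    (auto intro: taylor_mult taylor_polynomial polynomial_functions.const)

lemma taylor_power: "taylor h \<Longrightarrow> taylor (\<lambda>y. h y ^ k)"
  by (induction k) (auto intro: taylor_mult taylor_polynomial polynomial_functions.const)

section \<open>Submodules of the rational polynomial representation\<close>

locale rational_submodule = torus_reflection_group W L for W :: "(complex^'n^'n) set" and L +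
  fixes \<Gamma> :: "(complex^'n^'n) set" and k :: "complex^'n^'n \<Rightarrow> complex" and I :: "(complex^'n \<Rightarrow> complex) set"
  assumes \<Gamma>_subset: "\<Gamma> \<subseteq> W"
    and sub: "submodule (rational_Cherednik_algebra \<Gamma> k) polynomial_functions I"
begin

lemma I_facts:
  shows I_zero: "(\<lambda>y. 0) \<in> I"
    and I_add: "F \<in> I \<Longrightarrow> G \<in> I \<Longrightarrow> (\<lambda>y. F y + G y) \<in> I"
    and I_scale: "F \<in> I \<Longrightarrow> (\<lambda>y. a * F y) \<in> I"
    and I_polynomial: "F \<in> I \<Longrightarrow> F \<in> polynomial_functions"
    and I_mult: "P \<in> polynomial_functions \<Longrightarrow> F \<in> I \<Longrightarrow> (\<lambda>y. P y * F y) \<in> I"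
    and I_act: "w \<in> \<Gamma> \<Longrightarrow> F \<in> I \<Longrightarrow> act w F \<in> I"
    and I_dunkl: "F \<in> I \<Longrightarrow> rational_dunkl \<Gamma> k v F \<in> I"
proof -
  have *: "function_subspace I" "I \<subseteq> polynomial_functions" "\<forall>F\<in>I. (\<forall>P\<in>polynomial_functions. (\<lambda>x. P x * F x) \<in> I) \<and>
     (\<forall>w\<in>\<Gamma>. act w F \<in> I) \<and> (\<forall>v. rational_dunkl \<Gamma> k v F \<in> I)"
    by (insert sub[unfolded submodule_rational_iff], elim conjE, assumption)+
  have **: "(\<lambda>y. 0) \<in> I" "\<forall>F\<in>I. \<forall>G\<in>I. (\<lambda>x. F x + G x) \<in> I" "\<forall>a. \<forall>F\<in>I. (\<lambda>x. a * F x) \<in> I"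
    by (insert *(1)[unfolded function_subspace_def], elim conjE, assumption)+
  show "(\<lambda>y. 0) \<in> I" by (rule **(1))
  show "F \<in> I \<Longrightarrow> G \<in> I \<Longrightarrow> (\<lambda>y. F y + G y) \<in> I" by (rule **(2)[rule_format])
  show "F \<in> I \<Longrightarrow> (\<lambda>y. a * F y) \<in> I" by (rule **(3)[rule_format])
  show "F \<in> I \<Longrightarrow> F \<in> polynomial_functions" by (rule subsetD[OF *(2)])
  show "P \<in> polynomial_functions \<Longrightarrow> F \<in> I \<Longrightarrow> (\<lambda>y. P y * F y) \<in> I"
    by (rule bspec[OF conjunct1[OF bspec[OF *(3)]]])
  show "w \<in> \<Gamma> \<Longrightarrow> F \<in> I \<Longrightarrow> act w F \<in> I" using bspec[OF *(3), of F] by simp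
  show "F \<in> I \<Longrightarrow> rational_dunkl \<Gamma> k v F \<in> I" using bspec[OF *(3), of F] by simp
qed

lemma I_diff: "F \<in> I \<Longrightarrow> G \<in> I \<Longrightarrow> (\<lambda>y. F y - G y) \<in> I"
  using I_add[OF _ I_scale[of G "-1"]] by simp

lemma I_sum: "(\<And>i. i \<in> A \<Longrightarrow> F i \<in> I) \<Longrightarrow> (\<lambda>y. \<Sum>i\<in>A. F i y) \<in> I"
  by (induction A rule: infinite_finite_induct) (auto intro: I_zero I_add)

lemma refl_W: "s \<in> reflections \<Gamma> \<Longrightarrow> s \<in> reflections W"
  using \<Gamma>_subset by (auto simp: reflections_def)

lemma finite_refl: "finite (reflections \<Gamma>)"
  using \<Gamma>_subset finite_W by (auto simp: reflections_def intro: finite_subset)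

lemma I_reflection: "s \<in> reflections \<Gamma> \<Longrightarrow> F \<in> I \<Longrightarrow> (\<lambda>y. F (s *v y)) \<in> I"
  using I_act[of s F] act_reflection[OF refl_W] by (auto simp: reflections_def)

text \<open>The sum of \<open>x_i D_i\<close> and \<open>k(s) (1 - s)\<close> is the Euler field.\<close>

lemma I_euler:
  assumes F: "F \<in> I"
  shows "(\<lambda>y. directional y F y) \<in> I"
proof -
  have P: "F \<in> polynomial_functions" by (rule I_polynomial[OF F])
  let ?G = "\<lambda>y. (\<Sum>i\<in>UNIV. y $ i * rational_dunkl \<Gamma> k (axis i 1) F y) + (\<Sum>s\<in>reflections \<Gamma>. k s * (F y - F (s *v y)))"
  have G: "?G \<in> I"
    by (intro I_add I_sum I_mult I_dunkl F polynomial_functions.coord I_scale I_diff I_reflection)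
  have eu: "directional y F y = (\<Sum>i\<in>UNIV. y $ i * directional (axis i 1) F y)" for y
    by (rule polynomial_directional_expand[OF P])
  obtain D where D: "D \<in> polynomial_functions" "\<exists>y. D y \<noteq> 0"
    "\<forall>y. D y \<noteq> 0 \<longleftrightarrow> (\<forall>s\<in>reflections \<Gamma>. rform s y \<noteq> 0)" using rational_discriminant[OF \<Gamma>_subset] by (elim bexE conjE)
  obtain z where z: "D z \<noteq> 0" using D(2) by (elim exE)
  have "(\<lambda>y. directional y F y) = ?G"
  proof (rule exp_poly_eqI[of _ _ D z])
    show "(\<lambda>y. directional y F y) \<in> exp_poly" unfolding eu
      by (intro exp_poly_sum exp_poly.mult exp_poly.form linear_form_coord exp_poly_directional polynomial_exp_poly P)
    show "?G \<in> exp_poly" by (rule polynomial_exp_poly[OF I_polynomial[OF G]])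
    show "D \<in> exp_poly" by (rule polynomial_exp_poly[OF D(1)])
    show "D z \<noteq> 0" by (rule z)
    fix y assume "D y \<noteq> 0"
    then have nz: "rform s y \<noteq> 0" if "s \<in> reflections \<Gamma>" for s using D(3) that by simp
    have "(\<Sum>i\<in>UNIV. y $ i * rational_dunkl \<Gamma> k (axis i 1) F y)
        = (\<Sum>i\<in>UNIV. y $ i * directional (axis i 1) F y)
          - (\<Sum>i\<in>UNIV. \<Sum>s\<in>reflections \<Gamma>. y $ i * (k s * (rform s (axis i 1) / rform s y) * (F y - F (s *v y))))"
      using nz by (simp add: rational_dunkl_properties(2)[OF \<Gamma>_subset P] right_diff_distrib sum_subtractf sum_distrib_left)
    also have "(\<Sum>i\<in>UNIV. \<Sum>s\<in>reflections \<Gamma>. y $ i * (k s * (rform s (axis i 1) / rform s y) * (F y - F (s *v y))))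
        = (\<Sum>s\<in>reflections \<Gamma>. k s * (F y - F (s *v y)))"
    proof (subst sum.swap, intro sum.cong refl)
      fix s assume s: "s \<in> reflections \<Gamma>"
      have "(\<Sum>i\<in>UNIV. y $ i * (k s * (rform s (axis i 1) / rform s y) * (F y - F (s *v y))))
          = (\<Sum>i\<in>UNIV. y $ i * rform s (axis i 1)) * (k s * (F y - F (s *v y)) / rform s y)"
        unfolding sum_distrib_right by (intro sum.cong refl) (simp add: mult_ac)
      \<comment> \<open>Summation over the coordinates rebuilds the linear form and cancels the
        pole.\<close>
      also have "(\<Sum>i\<in>UNIV. y $ i * rform s (axis i 1)) = rform s y"
        by (rule linear_form_expand[OF rform_linear[OF refl_W[OF s]], symmetric])
      finally show "(\<Sum>i\<in>UNIV. y $ i * (k s * (rform s (axis i 1) / rform s y) * (F y - F (s *v y))))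
          = k s * (F y - F (s *v y))" using nz[OF s] by simp
    qed
    finally show "directional y F y = ?G y" by (simp add: eu)
  qed
  then show ?thesis using G by simp
qed

text \<open>Let \<open>F\<close> in \<open>I\<close> have degree at most \<open>d\<close> and
  \<open>F 0 \<noteq> 0\<close>. The product of the operators \<open>E - i\<close> for
  \<open>i = 1, ..., d\<close>, with \<open>E\<close> the Euler field, kills the components of
  degrees 1 to d and multiplies the constant term by a nonzero number. So \<open>I\<close> contains
  a nonzero constant and is everything.\<close>

lemma I_vanishes_at_0:
  assumes proper: "I \<noteq> polynomial_functions" and F: "F \<in> I"
  shows "F 0 = 0"
proof (rule ccontr)
  assume F0: "F 0 \<noteq> 0"
  obtain d where "degree_le d F" using polynomial_degree_le[OF I_polynomial[OF F]] by (elim exE)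
  then obtain Q where Q: "\<And>m. homogeneous m (Q m)" "F = (\<lambda>y. \<Sum>m\<le>d. Q m y)" by (rule degree_leE) blast
  have Qp: "Q m \<in> polynomial_functions" for m by (rule homogeneous_polynomial[OF Q(1)])
  have "(\<lambda>y. \<Sum>m\<le>d. (\<Prod>i\<in>{1..j}. of_nat m - of_nat i) * Q m y) \<in> I" for j
  proof (induction j)
    case 0
    then show ?case using F by (simp add: Q(2))
  next
    case (Suc j)
    let ?S = "\<lambda>y. \<Sum>m\<le>d. (\<Prod>i\<in>{1..j}. of_nat m - of_nat i) * Q m y"
    have "directional y ?S y = (\<Sum>m\<le>d. (\<Prod>i\<in>{1..j}. of_nat m - of_nat i) * (of_nat m * Q m y))" for y
      by (simp add: directional_sum directional_scale exp_poly_scale polynomial_exp_poly Qp homogeneous_euler[OF Q(1)])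
    then have "directional y ?S y - of_nat (Suc j) * ?S y
        = (\<Sum>m\<le>d. (\<Prod>i\<in>{1..Suc j}. of_nat m - of_nat i) * Q m y)" for y
      by (simp add: sum_distrib_left sum_subtractf[symmetric] algebra_simps del: of_nat_Suc)
    moreover have "(\<lambda>y. directional y ?S y - of_nat (Suc j) * ?S y) \<in> I"
      by (intro I_diff I_euler I_scale Suc)
    ultimately show ?case by simp
  qed
  from this[of d] have "(\<lambda>y. \<Sum>m\<le>d. (\<Prod>i\<in>{1..d}. of_nat m - of_nat i) * Q m y) \<in> I" .
  moreover have "(\<Sum>m\<le>d. (\<Prod>i\<in>{1..d}. of_nat m - of_nat i) * Q m y) = (\<Prod>i\<in>{1..d}. - of_nat i) * F 0" for y
  proof -
    have "(\<Prod>i\<in>{1..d}. of_nat m - of_nat i :: complex) = 0" if "m \<in> {..d} - {0}" for m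
      using that by (intro prod_zero) auto
    then have "(\<Sum>m\<in>{..d} - {0}. (\<Prod>i\<in>{1..d}. of_nat m - of_nat i) * Q m y) = 0"
      by (intro sum.neutral) simp
    then have "(\<Sum>m\<le>d. (\<Prod>i\<in>{1..d}. of_nat m - of_nat i) * Q m y) = (\<Prod>i\<in>{1..d}. - of_nat i) * Q 0 y"
      by (subst sum.remove[of _ 0]) simp_all
    moreover have "(\<Sum>m\<in>{..d} - {0}. Q m 0) = 0"
      using homogeneous_at_0[OF Q(1)] by (intro sum.neutral) simp
    then have "F 0 = Q 0 0" unfolding Q(2) by (subst sum.remove[of _ 0]) simp_all
    ultimately show ?thesis using homogeneous_0_const[OF Q(1), of y] by simp
  qed
  ultimately have const: "(\<lambda>y. (\<Prod>i\<in>{1..d}. - of_nat i) * F 0) \<in> I" by simp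
  define a where "a = (\<Prod>i\<in>{1..d}. - of_nat i) * F 0"
  have a: "a \<noteq> 0" using F0 by (simp add: a_def prod_zero_iff)
  have "P \<in> I" if P: "P \<in> polynomial_functions" for P
  proof -
    have "(\<lambda>y. (1 / a * P y) * a) \<in> I" using const unfolding a_def[symmetric] by (intro I_mult polynomial_scale P)
    then show ?thesis using a by simp
  qed
  then show False using proper I_polynomial by blast
qed

definition \<delta> :: "complex^'n \<Rightarrow> complex" where
  "\<delta> y = (\<Prod>s\<in>reflections \<Gamma>. rform s y)"

lemma \<delta>_polynomial: "\<delta> \<in> polynomial_functions"
  unfolding \<delta>_def[abs_def] by (intro polynomial_prod polynomial_form rform_linear refl_W)

lemma \<delta>_nonzero: "\<delta> y \<noteq> 0 \<longleftrightarrow> (\<forall>s\<in>reflections \<Gamma>. rform s y \<noteq> 0)"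
  by (simp add: \<delta>_def prod_zero_iff finite_refl)

lemma \<delta>_not_zero: "\<exists>y. \<delta> y \<noteq> 0"
  using rational_discriminant[OF \<Gamma>_subset] \<delta>_nonzero by auto

text \<open>Multiplication by \<open>\<delta>\<close> clears all poles, so \<open>\<delta>\<close>
  times a derivative is a combination of a Dunkl operator and reflections with polynomial
  coefficients.\<close>

lemma I_directional:
  assumes F: "F \<in> I"
  shows "(\<lambda>y. \<delta> y * directional v F y) \<in> I"
proof -
  have P: "F \<in> polynomial_functions" by (rule I_polynomial[OF F])
  define \<delta>' where "\<delta>' = (\<lambda>s y. \<Prod>t\<in>reflections \<Gamma> - {s}. rform t y)"
  have \<delta>'p: "\<delta>' s \<in> polynomial_functions" for s
    unfolding \<delta>'_def by (intro polynomial_prod polynomial_form rform_linear refl_W) auto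
  have \<delta>\<delta>': "\<delta> y = rform s y * \<delta>' s y" if "s \<in> reflections \<Gamma>" for s y
    unfolding \<delta>_def \<delta>'_def by (rule prod.remove[OF finite_refl that])
  let ?G = "\<lambda>y. \<delta> y * rational_dunkl \<Gamma> k v F y
      + (\<Sum>s\<in>reflections \<Gamma>. (k s * rform s v) * (\<delta>' s y * (F y - F (s *v y))))"
  have G: "?G \<in> I"
    by (intro I_add I_sum I_mult I_dunkl F I_scale I_diff I_reflection \<delta>_polynomial \<delta>'p)
  obtain z where z: "\<delta> z \<noteq> 0" using \<delta>_not_zero by (elim exE)
  have "(\<lambda>y. \<delta> y * directional v F y) = ?G"
  proof (rule exp_poly_eqI[of _ _ \<delta> z])
    show "(\<lambda>y. \<delta> y * directional v F y) \<in> exp_poly"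
      by (intro exp_poly.mult polynomial_exp_poly \<delta>_polynomial polynomial_directional P)
    show "?G \<in> exp_poly" by (rule polynomial_exp_poly[OF I_polynomial[OF G]])
    show "\<delta> \<in> exp_poly" by (rule polynomial_exp_poly[OF \<delta>_polynomial])
    show "\<delta> z \<noteq> 0" by (rule z)
    fix y assume "\<delta> y \<noteq> 0"
    then have nz: "rform s y \<noteq> 0" if "s \<in> reflections \<Gamma>" for s using \<delta>_nonzero that by simp
    have "\<delta> y * (\<Sum>s\<in>reflections \<Gamma>. k s * (rform s v / rform s y) * (F y - F (s *v y)))
        = (\<Sum>s\<in>reflections \<Gamma>. (k s * rform s v) * (\<delta>' s y * (F y - F (s *v y))))"
      unfolding sum_distrib_left by (intro sum.cong refl) (simp add: nz \<delta>\<delta>')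
    then show "\<delta> y * directional v F y = ?G y"
      using rational_dunkl_properties(2)[OF \<Gamma>_subset P, of y k v] nz by (simp add: right_diff_distrib)
  qed
  then show ?thesis using G by simp
qed

text \<open>If \<open>\<delta> ^ j * P\<close> lies in \<open>I\<close>, applying
  \<open>\<delta>\<close> times a derivative replaces \<open>P\<close> by its derivative at the cost
  of one more factor \<open>\<delta>\<close>. This is repeated until \<open>P\<close> is a nonzero
  constant: off the mirrors, a nonzero submodule is everything.\<close>

lemma I_discriminant_power:
  assumes "I \<noteq> {\<lambda>y. 0}"
  shows "\<exists>j. (\<lambda>y. \<delta> y ^ j) \<in> I"
proof -
  have const: "\<exists>j. (\<lambda>y. \<delta> y ^ j) \<in> I" if "(\<lambda>y. \<delta> y ^ j * P y) \<in> I" "\<And>y. P y = P 0" "P \<noteq> (\<lambda>y. 0)" for j P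
  proof -
    have P0: "P 0 \<noteq> 0" using that(2,3) by metis
    have "(\<lambda>y. 1 / P 0 * (\<delta> y ^ j * P y)) \<in> I" by (rule I_scale[OF that(1)])
    moreover have "1 / P 0 * (\<delta> y ^ j * P y) = \<delta> y ^ j" for y using that(2)[of y] P0 by simp
    ultimately show ?thesis by auto
  qed
  have "\<exists>j. (\<lambda>y. \<delta> y ^ j) \<in> I"
    if "degree_le d P" "P \<in> polynomial_functions" "P \<noteq> (\<lambda>y. 0)" "(\<lambda>y. \<delta> y ^ j * P y) \<in> I" for d P j
    using that
  proof (induction d arbitrary: P j)
    case 0
    obtain Q where Q: "\<And>m. homogeneous m (Q m)" "P = (\<lambda>y. \<Sum>m\<le>0. Q m y)" using 0(1) by (rule degree_leE) blast
    have "P y = P 0" for y using homogeneous_0_const[OF Q(1), of y] by (simp add: Q(2))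
    then show ?case using const[OF 0(4)] 0(3) by blast
  next
    case (Suc d)
    show ?case
    proof (cases "\<forall>v. directional v P = (\<lambda>y. 0)")
      case True
      then show ?thesis using const[OF Suc.prems(4)] polynomial_const_if_directional_0[OF Suc.prems(2)] Suc.prems(3) by blast
    next
      case False
      then obtain v where v: "directional v P \<noteq> (\<lambda>y. 0)" by blast
      have "(\<lambda>y. \<delta> y * directional v (\<lambda>y. \<delta> y ^ j * P y) y
          - (of_nat j * directional v \<delta> y) * (\<delta> y ^ j * P y)) \<in> I"
        by (intro I_diff I_directional I_mult Suc.prems polynomial_scale polynomial_directional \<delta>_polynomial)
      then have "(\<lambda>y. \<delta> y ^ Suc j * directional v P y) \<in> I"
        by (simp add: power_directional[OF polynomial_exp_poly[OF \<delta>_polynomial] polynomial_exp_poly[OF Suc.prems(2)]])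
      then show ?thesis
        by (rule Suc.IH[OF degree_le_directional[OF Suc.prems(1)] polynomial_directional[OF Suc.prems(2)] v])
    qed
  qed
  moreover obtain P where P: "P \<in> I" "P \<noteq> (\<lambda>y. 0)" using assms I_zero by blast
  moreover obtain d where "degree_le d P" using polynomial_degree_le[OF I_polynomial[OF P(1)]] by (elim exE)
  moreover have "(\<lambda>y. \<delta> y ^ 0 * P y) \<in> I" using P(1) by simp
  ultimately show ?thesis using I_polynomial by blast
qed

end

section \<open>From singular local parameters to reducibility\<close>

lemma CH_shift_affine_exp_poly:
  assumes "F \<in> exp_poly"
  shows "(\<lambda>y. F (w *v (x + y))) \<in> exp_poly"
  using exp_poly_affine[OF assms, of w "w *v x"] by (simp add: matrix_vector_right_distrib add.commute)

text \<open>It splits the equation of a hypertorus into its linear form and a cofactor with Taylor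
  polynomials.\<close>

lemma expm1_taylor:
  assumes "linear_form \<mu>"
  obtains \<psi> where "taylor \<psi>" "\<And>y. expi (\<mu> y) - 1 = \<mu> y * \<psi> y"
proof -
  define g where "g = (\<lambda>t. if t = 0 then deriv expi 0 else (expi t - expi 0) / (t - 0))"
  have "expi holomorphic_on ball 0 1" unfolding expi_def[abs_def] by (intro holomorphic_intros)
  then have "g holomorphic_on ball 0 1" unfolding g_def by (rule pole_lemma_open[OF _ open_ball])
  then have "taylor (\<lambda>y. g (\<mu> y))" by (rule taylor_compose[OF _ _ assms]) simp
  moreover have "expi (\<mu> y) - 1 = \<mu> y * g (\<mu> y)" for y by (simp add: g_def)
  ultimately show thesis by (rule that)
qed

context trigonometric_DAHA begin

theorem reducible_if_singular:
  assumes "reducible_module (rational_Cherednik_algebra (stabilizer W (coset L x)) (local_parameter L c (coset L x)))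
    polynomial_functions"
  shows "reducible_module (degenerate_DAHA W L c f) CH"
proof -
  define \<Gamma> where "\<Gamma> = stabilizer W (coset L x)"
  define k where "k = local_parameter L c (coset L x)"
  have "\<exists>I. submodule (rational_Cherednik_algebra \<Gamma> k) polynomial_functions I \<and> I \<noteq> {\<lambda>y. 0} \<and> I \<noteq> polynomial_functions"
    using assms by (simp only: reducible_module_def \<Gamma>_def k_def)
  then obtain I where I: "submodule (rational_Cherednik_algebra \<Gamma> k) polynomial_functions I"
    "I \<noteq> {\<lambda>y. 0}" "I \<noteq> polynomial_functions" by (elim exE conjE)
  have \<Gamma>W: "\<Gamma> \<subseteq> W" by (auto simp: \<Gamma>_def stabilizer_def)
  interpret I: rational_submodule W L \<Gamma> k I by unfold_locales (use \<Gamma>W I(1) in auto)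
  \<comment> \<open>Membership of a Taylor series in the completion of \<open>I\<close>, expressed
    without completing: an approximation from \<open>I\<close> to each order.\<close>
  define N where "N = {F \<in> CH. \<forall>w\<in>W. \<forall>m. \<exists>P\<in>I. vanishes_to m (\<lambda>y. F (w *v (x + y)) - P y)}"
  have NI: "F \<in> N" if "F \<in> CH" "\<And>w m. w \<in> W \<Longrightarrow> \<exists>P\<in>I. vanishes_to m (\<lambda>y. F (w *v (x + y)) - P y)" for F
    using that by (simp add: N_def)
  have NCH: "F \<in> CH" if "F \<in> N" for F using that by (simp add: N_def)
  have NE: "\<exists>P\<in>I. vanishes_to m (\<lambda>y. F (w *v (x + y)) - P y)" if "F \<in> N" "w \<in> W" for F w m
    using that by (simp add: N_def)
  have N_mult: "(\<lambda>y. G y * F y) \<in> N" if G: "G \<in> CH" and F: "F \<in> N" for G F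
  proof (rule NI[OF CH_mult[OF G NCH[OF F]]])
    fix w m assume w: "w \<in> W"
    have FE: "(\<lambda>y. F (w *v (x + y))) \<in> exp_poly" by (rule CH_shift_affine_exp_poly[OF CH_exp_poly[OF NCH[OF F]]])
    have GE: "(\<lambda>y. G (w *v (x + y))) \<in> exp_poly" by (rule CH_shift_affine_exp_poly[OF CH_exp_poly[OF G]])
    obtain P where P: "P \<in> I" "vanishes_to m (\<lambda>y. F (w *v (x + y)) - P y)" using NE[OF F w, of m] by (elim bexE)
    obtain Q where Q: "Q \<in> polynomial_functions" "vanishes_to m (\<lambda>y. G (w *v (x + y)) - Q y)"
      using taylor_exp_poly[OF GE] by (rule taylorE)
    have "vanishes_to m (\<lambda>y. G (w *v (x + y)) * F (w *v (x + y)) - Q y * P y)"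
      by (rule vanishes_to_mult_diff[OF Q(2) P(2) vanishes_to_exp_poly[OF FE] Q(1)])
    then show "\<exists>P\<in>I. vanishes_to m (\<lambda>y. G (w *v (x + y)) * F (w *v (x + y)) - P y)"
      by (rule bexI[of _ "\<lambda>y. Q y * P y", OF _ I.I_mult[OF Q(1) P(1)]])
  qed
  have N_zero: "(\<lambda>y. 0) \<in> N"
    by (rule NI[OF CH_zero]) (rule bexI[OF _ I.I_zero], simp add: vanishes_to_zero)
  have N_add: "(\<lambda>y. F y + G y) \<in> N" if F: "F \<in> N" and G: "G \<in> N" for F G
  proof (rule NI[OF CH_add[OF NCH[OF F] NCH[OF G]]])
    fix w m assume w: "w \<in> W"
    obtain P where P: "P \<in> I" "vanishes_to m (\<lambda>y. F (w *v (x + y)) - P y)" using NE[OF F w, of m] by (elim bexE)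
    obtain Q where Q: "Q \<in> I" "vanishes_to m (\<lambda>y. G (w *v (x + y)) - Q y)" using NE[OF G w, of m] by (elim bexE)
    have "vanishes_to m (\<lambda>y. (F (w *v (x + y)) - P y) + (G (w *v (x + y)) - Q y))"
      by (rule vanishes_to_add[OF P(2) Q(2)])
    then have "vanishes_to m (\<lambda>y. F (w *v (x + y)) + G (w *v (x + y)) - (P y + Q y))"
      by (simp add: algebra_simps)
    then show "\<exists>P\<in>I. vanishes_to m (\<lambda>y. F (w *v (x + y)) + G (w *v (x + y)) - P y)"
      by (rule bexI[of _ "\<lambda>y. P y + Q y", OF _ I.I_add[OF P(1) Q(1)]])
  qed
  have N_scale: "(\<lambda>y. a * F y) \<in> N" if "F \<in> N" for a F by (rule N_mult[OF CH_const that])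
  have N_sum: "(\<lambda>y. \<Sum>i\<in>A. F i y) \<in> N" if "\<And>i. i \<in> A \<Longrightarrow> F i \<in> N" for A :: "(complex^'n) set set set" and F
    using that by (induction A rule: infinite_finite_induct) (simp_all add: N_zero N_add)
  have N_comp: "(\<lambda>y. F (u *v y)) \<in> N" if F: "F \<in> N" and u: "u \<in> W" for F u
  proof (rule NI[OF CH_comp[OF NCH[OF F] u]])
    fix w m assume "w \<in> W"
    from NE[OF F mult_W[OF u this], of m]
    show "\<exists>P\<in>I. vanishes_to m (\<lambda>y. F (u *v (w *v (x + y))) - P y)" by (simp add: matrix_vector_mul_assoc)
  qed
  have N_dunkl: "trig v F \<in> N" if F: "F \<in> N" for v F
  proof (rule NI[OF trig_dunkl_properties(1)[OF NCH[OF F]]])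
    fix w m assume w: "w \<in> W"
    obtain P where P: "P \<in> I" "vanishes_to (Suc m) (\<lambda>y. F (w *v (x + y)) - P y)" using NE[OF F w, of "Suc m"] by (elim bexE)
    from dunkl_comparison[OF NCH[OF F] I.I_polynomial[OF P(1)] w P(2), of v]
    obtain r where r: "\<forall>T\<in>hypertori W L. r T \<in> CH" "vanishes_to m (\<lambda>y. trig v F (w *v (x + y))
      + (\<Sum>T\<in>hypertori W L. c T * (r T (w *v (x + y)) * (F (w *v (x + y)) - F (refl T *v (w *v (x + y))))))
      - rational_dunkl \<Gamma> k (matrix_inv w *v v) P y)" unfolding \<Gamma>_def k_def by (elim exE conjE)
    \<comment> \<open>The correction already lies in \<open>N\<close>, being a combination of
      \<open>F\<close> and its reflections with regular coefficients; its approximation from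
      \<open>I\<close> can therefore be subtracted.\<close>
    define E where "E = (\<lambda>z. \<Sum>T\<in>hypertori W L. c T * (r T z * (F z - F (refl T *v z))))"
    have EN: "E \<in> N" unfolding E_def
    proof (rule N_sum)
      fix T assume T: "T \<in> hypertori W L"
      have R: "refl T \<in> W" using hypertoriE[OF T] by metis
      have "(\<lambda>z. F z + - 1 * F (refl T *v z)) \<in> N" by (intro N_add N_scale N_comp F R)
      then have "(\<lambda>z. c T * (r T z * (F z + - 1 * F (refl T *v z)))) \<in> N"
        using r(1) T by (intro N_scale N_mult) simp_all
      then show "(\<lambda>z. c T * (r T z * (F z - F (refl T *v z)))) \<in> N" by simp
    qed
    obtain Q where Q: "Q \<in> I" "vanishes_to m (\<lambda>y. E (w *v (x + y)) - Q y)" using NE[OF EN w, of m] by (elim bexE)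
    have "vanishes_to m (\<lambda>y. trig v F (w *v (x + y)) + E (w *v (x + y))
      - rational_dunkl \<Gamma> k (matrix_inv w *v v) P y)" using r(2) by (simp only: E_def)
    from vanishes_to_diff[OF this Q(2)]
    have "vanishes_to m (\<lambda>y. (trig v F (w *v (x + y)) + E (w *v (x + y))
      - rational_dunkl \<Gamma> k (matrix_inv w *v v) P y) - (E (w *v (x + y)) - Q y))" .
    then have "vanishes_to m (\<lambda>y. trig v F (w *v (x + y)) - (rational_dunkl \<Gamma> k (matrix_inv w *v v) P y - Q y))"
      by (simp add: algebra_simps)
    then show "\<exists>P\<in>I. vanishes_to m (\<lambda>y. trig v F (w *v (x + y)) - P y)"
      by (rule bexI[of _ "\<lambda>y. rational_dunkl \<Gamma> k (matrix_inv w *v v) P y - Q y",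
            OF _ I.I_diff[OF I.I_dunkl[OF P(1)] Q(1)]])
  qed
  have "submodule (degenerate_DAHA W L c f) CH N"
    unfolding submodule_DAHA_iff
  proof (intro conjI ballI allI)
    show "function_subspace N" by (rule function_subspaceI[OF N_zero N_add N_scale])
    show "N \<subseteq> CH" using NCH by (rule subsetI)
    fix F assume F: "F \<in> N"
    show "(\<lambda>y. P y * F y) \<in> N" if "P \<in> CH" for P by (rule N_mult[OF that F])
    show "act w F \<in> N" if "w \<in> W" for w unfolding act_def by (rule N_comp[OF F inv_W[OF that]])
    show "trig v F \<in> N" for v by (rule N_dunkl[OF F])
  qed
  moreover have "N \<noteq> CH"
  proof
    assume "N = CH"
    then have "(\<lambda>y. 1) \<in> N" using CH_const by simp
    from NE[OF this one_W, of 1] obtain P where P: "P \<in> I" "vanishes_to 1 (\<lambda>y. 1 - P y)" by (elim bexE)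
    have "1 - P 0 = 0" using vanishes_to_at_0[OF P(2)] .
    then show False using I.I_vanishes_at_0[OF I(3) P(1)] by simp
  qed
  moreover have "N \<noteq> {\<lambda>y. 0}"
  proof -
    obtain j where j: "(\<lambda>y. I.\<delta> y ^ j) \<in> I" using I.I_discriminant_power[OF I(2)] by (elim exE)
    \<comment> \<open>A global substitute for \<open>\<delta> ^ j\<close> at \<open>x\<close>: each
      linear form is replaced by the equation of the hypertorus that it is tangent to. The product
      over \<open>W\<close> in \<open>F0\<close> makes it invariant, so one check at
      \<open>x\<close> serves the whole orbit.\<close>
    define F1 where "F1 = (\<lambda>z. \<Prod>s\<in>reflections \<Gamma>. (expi (rform s (z - x)) - 1) ^ j)"
    define F0 where "F0 = (\<lambda>z. \<Prod>w\<in>W. F1 (w *v z))"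
    have F1: "F1 \<in> CH" unfolding F1_def
      by (intro CH_prod CH_power equation_CH rform_dual I.refl_W)
    have F0: "F0 \<in> CH" unfolding F0_def by (intro CH_prod CH_comp F1)
    have inv: "F0 (w *v z) = F0 z" if w: "w \<in> W" for w z
    proof -
      have "bij_betw (\<lambda>u. u ** w) W W"
      proof (rule bij_betw_byWitness[where f' = "\<lambda>u. u ** matrix_inv w"])
        show "\<forall>u\<in>W. u ** w ** matrix_inv w = u" "\<forall>u\<in>W. u ** matrix_inv w ** w = u"
          by (simp_all add: matrix_mul_assoc[symmetric] right_inverse_W[OF w] left_inverse_W[OF w])
      qed (auto intro: mult_W inv_W w)
      then have "(\<Prod>u\<in>W. F1 ((u ** w) *v z)) = (\<Prod>u\<in>W. F1 (u *v z))" by (rule prod.reindex_bij_betw)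
      then show ?thesis by (simp add: F0_def matrix_vector_mul_assoc)
    qed
    have "\<forall>s\<in>reflections \<Gamma>. \<exists>\<psi>. taylor \<psi> \<and> (\<forall>y. expi (rform s y) - 1 = rform s y * \<psi> y)"
      using expm1_taylor[OF rform_linear[OF I.refl_W]] by metis
    from bchoice[OF this] obtain \<psi> where \<psi>: "\<forall>s\<in>reflections \<Gamma>. taylor (\<psi> s) \<and>
      (\<forall>y. expi (rform s y) - 1 = rform s y * \<psi> s y)" ..
    \<comment> \<open>The cofactor of \<open>\<delta> ^ j\<close> in \<open>F0\<close> near
      \<open>x\<close>.\<close>
    define U where "U = (\<lambda>y. (\<Prod>s\<in>reflections \<Gamma>. \<psi> s y ^ j) * (\<Prod>w\<in>W - {mat 1}. F1 (w *v (x + y))))"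
    have "taylor (\<lambda>y. \<Prod>s\<in>reflections \<Gamma>. \<psi> s y ^ j)"
      using \<psi> by (intro taylor_prod taylor_power) simp
    moreover have "taylor (\<lambda>y. \<Prod>w\<in>W - {mat 1}. F1 (w *v (x + y)))"
      by (intro taylor_exp_poly exp_poly_prod CH_shift_affine_exp_poly CH_exp_poly F1)
    ultimately have U: "taylor U" unfolding U_def by (rule taylor_mult)
    have F0U: "F0 (x + y) = I.\<delta> y ^ j * U y" for y
    proof -
      have "F1 (x + y) = (\<Prod>s\<in>reflections \<Gamma>. (rform s y * \<psi> s y) ^ j)"
        unfolding F1_def using \<psi> by (intro prod.cong refl) simp
      also have "\<dots> = I.\<delta> y ^ j * (\<Prod>s\<in>reflections \<Gamma>. \<psi> s y ^ j)"
        by (simp add: I.\<delta>_def power_mult_distrib prod.distrib prod_power_distrib)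
      finally have F1eq: "F1 (x + y) = I.\<delta> y ^ j * (\<Prod>s\<in>reflections \<Gamma>. \<psi> s y ^ j)" .
      have "F0 (x + y) = F1 (mat 1 *v (x + y)) * (\<Prod>w\<in>W - {mat 1}. F1 (w *v (x + y)))"
        unfolding F0_def by (rule prod.remove[OF finite_W one_W])
      then show ?thesis by (simp add: F1eq U_def)
    qed
    have "F0 \<in> N"
    proof (rule NI[OF F0])
      fix w m assume w: "w \<in> W"
      obtain P where P: "P \<in> polynomial_functions" "vanishes_to m (\<lambda>y. U y - P y)" using U by (rule taylorE)
      have \<delta>p: "(\<lambda>y. I.\<delta> y ^ j) \<in> polynomial_functions" by (rule I.I_polynomial[OF j])
      have "vanishes_to m (\<lambda>y. I.\<delta> y ^ j * (U y - P y))"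
        by (rule vanishes_to_mult_bounded[OF vanishes_to_exp_poly[OF polynomial_exp_poly[OF \<delta>p]] P(2)])
      then have "vanishes_to m (\<lambda>y. F0 (w *v (x + y)) - P y * I.\<delta> y ^ j)"
        unfolding inv[OF w] F0U by (simp add: algebra_simps)
      then show "\<exists>P\<in>I. vanishes_to m (\<lambda>y. F0 (w *v (x + y)) - P y)"
        by (rule bexI[of _ "\<lambda>y. P y * I.\<delta> y ^ j", OF _ I.I_mult[OF P(1) j]])
    qed
    moreover have "F0 \<noteq> (\<lambda>y. 0)"
    proof -
      have nz: "\<exists>y. expi (rform s (y - x)) - 1 \<noteq> 0" if "s \<in> reflections \<Gamma>" for s
      proof -
        note s = I.refl_W[OF that]
        have "rform s ((x + (1 / 4) *s rvec s) - x) = 1 / 2"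
          by (simp add: linear_form_simps[OF rform_linear[OF s]] rform_rvec[OF s])
        moreover have "expi (1 / 2) - 1 \<noteq> 0" by (simp add: expi_def mult.commute[of _ \<i>])
        ultimately show ?thesis by metis
      qed
      have "\<exists>y. (expi (rform s (y - x)) - 1) ^ j \<noteq> 0" if "s \<in> reflections \<Gamma>" for s
        using nz[OF that] power_not_zero by blast
      then have "\<exists>y. F1 y \<noteq> 0" unfolding F1_def
        by (intro exp_poly_prod_nonzero I.finite_refl CH_exp_poly CH_power equation_CH rform_dual I.refl_W)
      then obtain y1 where y1: "F1 y1 \<noteq> 0" by (elim exE)
      have "\<exists>y. F1 (w *v y) \<noteq> 0" if "w \<in> W" for w
        using y1 by (intro exI[of _ "matrix_inv w *v y1"]) (simp add: apply_inv that)
      then have "\<exists>y. F0 y \<noteq> 0" unfolding F0_def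
        by (intro exp_poly_prod_nonzero finite_W CH_exp_poly CH_comp F1)
      then show ?thesis by auto
    qed
    ultimately show ?thesis by blast
  qed
  ultimately show ?thesis unfolding reducible_module_def by blast
qed

end

section \<open>Leading terms\<close>

lemma vanishes_to_exp_taylor:
  assumes "linear_form \<mu>"
  shows "vanishes_to (Suc n) (\<lambda>y. exp (\<mu> y) - (\<Sum>i\<le>n. \<mu> y ^ i / fact i))"
proof -
  obtain K where K: "K \<ge> 0" "\<And>y. cmod (\<mu> y) \<le> K * norm y" using linear_form_bounded[OF assms] by blast
  show ?thesis
  proof (rule vanishes_toI[of 1 _ "exp K * K ^ Suc n"])
    fix y :: "complex^'a" assume y: "norm y < 1"
    have "\<bar>Re (\<mu> y)\<bar> \<le> K * norm y" using abs_Re_le_cmod[of "\<mu> y"] K(2)[of y] by linarith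
    also have "\<dots> \<le> K" using y K(1) by (simp add: mult_left_le)
    finally have e: "exp \<bar>Re (\<mu> y)\<bar> \<le> exp K" by simp
    have "cmod (exp (\<mu> y) - (\<Sum>i\<le>n. \<mu> y ^ i / fact i)) \<le> exp \<bar>Re (\<mu> y)\<bar> * cmod (\<mu> y) ^ Suc n / fact n"
      by (rule Taylor_exp)
    also have "\<dots> \<le> exp \<bar>Re (\<mu> y)\<bar> * cmod (\<mu> y) ^ Suc n / 1"
      by (intro divide_left_mono) (auto simp: fact_ge_1)
    also have "\<dots> \<le> exp K * (K * norm y) ^ Suc n"
      unfolding div_by_1 by (intro mult_mono e power_mono K) auto
    finally show "cmod (exp (\<mu> y) - (\<Sum>i\<le>n. \<mu> y ^ i / fact i)) \<le> exp K * K ^ Suc n * norm y ^ Suc n"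
      by (simp add: power_mult_distrib mult_ac)
  qed simp
qed

text \<open>A bound near 0 spreads by homogeneity, after scaling a nonzero \<open>y\<close> to norm
  \<open>r / 2\<close>.\<close>

lemma homogeneous_vanishes_to:
  fixes P :: "complex^'n \<Rightarrow> complex"
  assumes "homogeneous m P"
  shows "vanishes_to m P"
proof -
  obtain C r where r: "0 \<le> C" "0 < r" "\<And>y. norm y < r \<Longrightarrow> cmod (P y) \<le> C * norm y ^ 0"
    using vanishes_to_exp_poly[OF polynomial_exp_poly[OF homogeneous_polynomial[OF assms]]]
    by (rule vanishes_toE) blast
  show ?thesis
  proof (rule vanishes_toI[OF r(2), of _ "C * (2 / r) ^ m"])
    fix y :: "complex^'n"
    show "cmod (P y) \<le> C * (2 / r) ^ m * norm y ^ m"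
    proof (cases "y = 0")
      case True
      show ?thesis
      proof (cases "m = 0")
        case True
        then show ?thesis using r(3)[of y] \<open>y = 0\<close> r(2) by simp
      next
        case False
        then show ?thesis using homogeneous_at_0[OF assms] \<open>y = 0\<close> by (simp add: zero_power)
      qed
    next
      case False
      define t where "t = complex_of_real (2 * norm y / r)"
      have t: "cmod t = 2 * norm y / r" "t \<noteq> 0" using r(2) False by (simp_all add: t_def norm_divide norm_mult)
      define z where "z = (1 / t) *s y"
      have y: "y = t *s z" using t by (simp add: z_def vector_smult_assoc)
      have "norm z = r / 2" using t(1) False r(2) by (simp add: z_def norm_vec_scale norm_divide)
      then have "cmod (P z) \<le> C" using r(2) r(3)[of z] by simp
      then have "cmod t ^ m * cmod (P z) \<le> cmod t ^ m * C" by (intro mult_left_mono) auto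
      moreover have "cmod (P y) = cmod t ^ m * cmod (P z)"
        by (subst y) (simp add: homogeneous_scale[OF assms] norm_mult norm_power)
      ultimately show ?thesis by (simp add: t(1) power_divide power_mult_distrib mult_ac)
    qed
  qed
qed

text \<open>Leading terms of different degrees need not add up to a leading term, so the submodule
  at a zero consists of finite sums of them. Each operator is then checked on one leading term at a
  time.\<close>

inductive_set sums_of :: "(complex^'n \<Rightarrow> complex) set \<Rightarrow> (complex^'n \<Rightarrow> complex) set" for S where
  zero: "(\<lambda>y. 0) \<in> sums_of S"
| step: "P \<in> S \<Longrightarrow> G \<in> sums_of S \<Longrightarrow> (\<lambda>y. P y + G y) \<in> sums_of S"

lemma sums_of_single: "P \<in> S \<Longrightarrow> P \<in> sums_of S"
  using sums_of.step[OF _ sums_of.zero, of P S] by simp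

lemma sums_of_add:
  assumes "F \<in> sums_of S" "G \<in> sums_of S"
  shows "(\<lambda>y. F y + G y) \<in> sums_of S"
  using assms(1)
proof induction
  case zero
  then show ?case using assms(2) by simp
next
  case (step P H)
  then show ?case using sums_of.step[OF step(1) step.IH] by (simp add: add.assoc)
qed

lemma sums_of_sum: "(\<And>i. i \<in> A \<Longrightarrow> F i \<in> sums_of S) \<Longrightarrow> (\<lambda>y. \<Sum>i\<in>A. F i y) \<in> sums_of S"
  by (induction A rule: infinite_finite_induct) (auto intro: sums_of.zero sums_of_add)

context torus_reflection_group begin

lemma rational_dunkl_zero: "\<Gamma> \<subseteq> W \<Longrightarrow> rational_dunkl \<Gamma> k v (\<lambda>y. 0) = (\<lambda>y. 0)"
  by (rule rational_dunkl_eqI) (simp_all add: polynomial_functions.const directional_const)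

lemma rational_dunkl_add:
  assumes \<Gamma>: "\<Gamma> \<subseteq> W" and P: "P \<in> polynomial_functions" and Q: "Q \<in> polynomial_functions"
  shows "rational_dunkl \<Gamma> k v (\<lambda>y. P y + Q y) = (\<lambda>y. rational_dunkl \<Gamma> k v P y + rational_dunkl \<Gamma> k v Q y)"
proof (rule rational_dunkl_eqI[OF \<Gamma>])
  fix y assume nz: "\<And>s. s \<in> reflections \<Gamma> \<Longrightarrow> rform s y \<noteq> 0"
  have "(\<Sum>s\<in>reflections \<Gamma>. k s * (rform s v / rform s y) * (P y + Q y - (P (s *v y) + Q (s *v y))))
      = (\<Sum>s\<in>reflections \<Gamma>. k s * (rform s v / rform s y) * (P y - P (s *v y)))
        + (\<Sum>s\<in>reflections \<Gamma>. k s * (rform s v / rform s y) * (Q y - Q (s *v y)))"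
    unfolding sum.distrib[symmetric] distrib_left[symmetric] by (simp add: add_diff_add)
  then show "rational_dunkl \<Gamma> k v P y + rational_dunkl \<Gamma> k v Q y = directional v (\<lambda>y. P y + Q y) y -
        (\<Sum>s\<in>reflections \<Gamma>. k s * (rform s v / rform s y) * (P y + Q y - (P (s *v y) + Q (s *v y))))"
    using rational_dunkl_properties(2)[OF \<Gamma> P nz, of k v] rational_dunkl_properties(2)[OF \<Gamma> Q nz, of k v]
    by (simp add: directional_add polynomial_exp_poly P Q)
qed (intro polynomial_functions.add rational_dunkl_properties(1) assms)+

text \<open>Both parts lower the degree by one: the derivative, and the coefficients
  \<open>rform s v / rform s y\<close>, which have degree -1.\<close>

lemma rational_dunkl_homogeneous:
  assumes \<Gamma>: "\<Gamma> \<subseteq> W" and P: "homogeneous (Suc m) P"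
  shows "homogeneous m (rational_dunkl \<Gamma> k v P)"
proof (rule homogeneousI)
  let ?D = "rational_dunkl \<Gamma> k v P"
  note Pp = homogeneous_polynomial[OF P]
  show Dp: "?D \<in> polynomial_functions" by (rule rational_dunkl_properties(1)[OF \<Gamma> Pp])
  fix t :: complex and y assume t: "t \<noteq> 0"
  obtain D where D: "D \<in> polynomial_functions" "\<exists>y. D y \<noteq> 0"
    "\<forall>y. D y \<noteq> 0 \<longleftrightarrow> (\<forall>s\<in>reflections \<Gamma>. rform s y \<noteq> 0)" using rational_discriminant[OF \<Gamma>] by (elim bexE conjE)
  obtain z where z: "D z \<noteq> 0" using D(2) by (elim exE)
  have "(\<lambda>y. ?D (mat t *v y)) = (\<lambda>y. t ^ m * ?D y)"
  proof (rule exp_poly_eqI[of _ _ D z])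
    show "(\<lambda>y. ?D (mat t *v y)) \<in> exp_poly" by (rule exp_poly_comp_matrix[OF polynomial_exp_poly[OF Dp]])
    show "(\<lambda>y. t ^ m * ?D y) \<in> exp_poly" by (rule exp_poly_scale[OF polynomial_exp_poly[OF Dp]])
    fix y assume "D y \<noteq> 0"
    then have nz: "rform s y \<noteq> 0" if "s \<in> reflections \<Gamma>" for s using D(3) that by simp
    have sW: "s \<in> reflections W" if "s \<in> reflections \<Gamma>" for s using that \<Gamma> by (auto simp: reflections_def)
    have rt: "rform s (t *s y) = t * rform s y" if "s \<in> reflections \<Gamma>" for s
      by (rule linear_form_scale[OF rform_linear[OF sW[OF that]]])
    have nzt: "rform s (t *s y) \<noteq> 0" if "s \<in> reflections \<Gamma>" for s using nz[OF that] t rt[OF that] by simp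
    have "(\<Sum>s\<in>reflections \<Gamma>. k s * (rform s v / rform s (t *s y)) * (P (t *s y) - P (s *v (t *s y))))
        = t ^ m * (\<Sum>s\<in>reflections \<Gamma>. k s * (rform s v / rform s y) * (P y - P (s *v y)))"
      unfolding sum_distrib_left
    proof (intro sum.cong refl)
      fix s assume s: "s \<in> reflections \<Gamma>"
      have "P (t *s y) - P (s *v (t *s y)) = t * t ^ m * (P y - P (s *v y))"
        by (simp add: vector_scalar_commute homogeneous_scale[OF P] algebra_simps)
      then show "k s * (rform s v / rform s (t *s y)) * (P (t *s y) - P (s *v (t *s y)))
          = t ^ m * (k s * (rform s v / rform s y) * (P y - P (s *v y)))"
        using t nz[OF s] by (simp add: rt[OF s])
    qed
    moreover have "directional v P (t *s y) = t ^ m * directional v P y"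
      by (rule homogeneous_scale[OF homogeneous_directional[OF P]])
    ultimately show "?D (mat t *v y) = t ^ m * ?D y"
      unfolding mat_mult_vector
      using rational_dunkl_properties(2)[OF \<Gamma> Pp nz, of k v] rational_dunkl_properties(2)[OF \<Gamma> Pp nzt, of k v]
      by (simp add: right_diff_distrib)
  qed (use polynomial_exp_poly[OF D(1)] z in auto)
  then show "?D (t *s y) = t ^ m * ?D y" by (simp only: mat_mult_vector fun_eq_iff)
qed

end

section \<open>From reducibility to a singular local parameter\<close>

locale trigonometric_submodule = trigonometric_DAHA W L c f
  for W :: "(complex^'n^'n) set" and L c f +
  fixes N :: "(complex^'n \<Rightarrow> complex) set"
  assumes sub: "submodule (degenerate_DAHA W L c f) CH N"
begin

lemma N_facts:
  shows N_zero: "(\<lambda>y. 0) \<in> N"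
    and N_add: "F \<in> N \<Longrightarrow> G \<in> N \<Longrightarrow> (\<lambda>y. F y + G y) \<in> N"
    and N_scale: "F \<in> N \<Longrightarrow> (\<lambda>y. a * F y) \<in> N"
    and N_CH: "F \<in> N \<Longrightarrow> F \<in> CH"
    and N_mult: "P \<in> CH \<Longrightarrow> F \<in> N \<Longrightarrow> (\<lambda>y. P y * F y) \<in> N"
    and N_act: "w \<in> W \<Longrightarrow> F \<in> N \<Longrightarrow> act w F \<in> N"
    and N_dunkl: "F \<in> N \<Longrightarrow> trig v F \<in> N"
proof -
  have *: "function_subspace N" "N \<subseteq> CH" "\<forall>F\<in>N. (\<forall>P\<in>CH. (\<lambda>x. P x * F x) \<in> N) \<and>
     (\<forall>w\<in>W. act w F \<in> N) \<and> (\<forall>v. trig v F \<in> N)"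
    by (insert sub[unfolded submodule_DAHA_iff], elim conjE, assumption)+
  have **: "(\<lambda>y. 0) \<in> N" "\<forall>F\<in>N. \<forall>G\<in>N. (\<lambda>x. F x + G x) \<in> N" "\<forall>a. \<forall>F\<in>N. (\<lambda>x. a * F x) \<in> N"
    by (insert *(1)[unfolded function_subspace_def], elim conjE, assumption)+
  show "(\<lambda>y. 0) \<in> N" by (rule **(1))
  show "F \<in> N \<Longrightarrow> G \<in> N \<Longrightarrow> (\<lambda>y. F y + G y) \<in> N" by (rule **(2)[rule_format])
  show "F \<in> N \<Longrightarrow> (\<lambda>y. a * F y) \<in> N" by (rule **(3)[rule_format])
  show "F \<in> N \<Longrightarrow> F \<in> CH" by (rule subsetD[OF *(2)])
  show "P \<in> CH \<Longrightarrow> F \<in> N \<Longrightarrow> (\<lambda>y. P y * F y) \<in> N"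
    by (rule bspec[OF conjunct1[OF bspec[OF *(3)]]])
  show "w \<in> W \<Longrightarrow> F \<in> N \<Longrightarrow> act w F \<in> N" using bspec[OF *(3), of F] by simp
  show "F \<in> N \<Longrightarrow> trig v F \<in> N" using bspec[OF *(3), of F] by simp
qed

lemma N_diff: "F \<in> N \<Longrightarrow> G \<in> N \<Longrightarrow> (\<lambda>y. F y - G y) \<in> N"
  using N_add[OF _ N_scale[of G "-1"]] by simp

lemma N_sum: "(\<And>i. i \<in> A \<Longrightarrow> F i \<in> N) \<Longrightarrow> (\<lambda>y. \<Sum>i\<in>A. F i y) \<in> N"
  by (induction A rule: infinite_finite_induct) (auto intro: N_zero N_add)

lemma refl_W: "T \<in> hypertori W L \<Longrightarrow> refl T \<in> reflections W"
  by (metis hypertoriE)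

lemma N_reflection: "T \<in> hypertori W L \<Longrightarrow> F \<in> N \<Longrightarrow> (\<lambda>y. F (refl T *v y)) \<in> N"
  using N_act[of "refl T" F] act_reflection[OF refl_W] refl_W by (auto simp: reflections_def)

lemma N_common_zero:
  assumes "N \<noteq> CH"
  shows "\<exists>p. \<forall>F\<in>N. F p = 0"
proof (rule ccontr)
  assume no: "\<not> ?thesis"
  have "CH_ideal N"
    unfolding CH_ideal_def
  proof (intro conjI ballI subsetI)
    show "(\<lambda>y. E y * F y) \<in> N" if "E \<in> CH" "F \<in> N" for E F using that by (rule N_mult)
  qed (intro N_CH N_zero N_add; assumption)+
  from nullstellensatz[OF this] no have one: "(\<lambda>y. 1) \<in> N" by blast
  have "F \<in> N" if "F \<in> CH" for F using N_mult[OF that one] by simp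
  then show False using assms N_CH by blast
qed

text \<open>Along directions tangent to all hypertori through \<open>x\<close>, the Dunkl operator is regular at \<open>x\<close>.\<close>

lemma tangent_denominator:
  assumes tan: "\<And>s. s \<in> reflections W \<Longrightarrow> coset L x \<in> fixed_set L s \<Longrightarrow> rform s v = 0"
  shows "\<exists>B\<in>CH. B x \<noteq> 0 \<and> (\<forall>F\<in>N. (\<lambda>y. B y * directional v F y) \<in> N)"
proof -
  have "\<exists>p. fst p \<in> CH \<and> snd p \<in> CH \<and> fst p x \<noteq> 0 \<and> (\<forall>y. coset L y \<notin> T \<longrightarrow> fst p y * f T v y = snd p y)"
    if T: "T \<in> hypertori W L" for T
  proof -
    have "\<exists>A\<in>CH. \<exists>B\<in>CH. B x \<noteq> 0 \<and> (\<forall>y. coset L y \<notin> T \<longrightarrow> B y \<noteq> 0 \<longrightarrow> f T v y = A y / B y)"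
    proof (cases "coset L x \<in> T")
      case False
      then show ?thesis by (rule f_regular_off[OF T])
    next
      case True
      note s = refl_W[OF T]
      have "coset L x \<in> fixed_set L (refl T)" by (rule hypertorus_through(2)[OF T True refl])
      \<comment> \<open>The logarithmic derivative of the equation along \<open>v\<close> is then 0,
        so the condition on the difference says that \<open>f T v\<close> itself is regular at
        \<open>x\<close>.\<close>
      then have v0: "rform (refl T) v = 0" by (rule tan[OF s])
      from f_regular_on(2)[OF T True local_equation_expi[OF rdata[OF s] hypertorus_through_iff[OF T True]], of v]
      show ?thesis by (simp add: directional_equation[OF rform_dual[OF s]] v0)
    qed
    then obtain A B where AB: "A \<in> CH" "B \<in> CH" "B x \<noteq> 0"
      "\<forall>y. coset L y \<notin> T \<longrightarrow> B y \<noteq> 0 \<longrightarrow> f T v y = A y / B y" by (elim bexE conjE)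
    have "B y * B y * f T v y = A y * B y" if "coset L y \<notin> T" for y
      using AB(4) that by (cases "B y = 0") auto
    then show ?thesis
      using AB by (intro exI[of _ "(\<lambda>y. B y * B y, \<lambda>y. A y * B y)"]) (simp add: CH_mult)
  qed
  then have "\<forall>T\<in>hypertori W L. \<exists>p. fst p \<in> CH \<and> snd p \<in> CH \<and> fst p x \<noteq> 0 \<and>
    (\<forall>y. coset L y \<notin> T \<longrightarrow> fst p y * f T v y = snd p y)" by (rule ballI)
  from bchoice[OF this] obtain p where p: "\<forall>T\<in>hypertori W L. fst (p T) \<in> CH \<and> snd (p T) \<in> CH \<and> fst (p T) x \<noteq> 0 \<and>
    (\<forall>y. coset L y \<notin> T \<longrightarrow> fst (p T) y * f T v y = snd (p T) y)" ..
  define B where "B = (\<lambda>y. \<Prod>T\<in>hypertori W L. fst (p T) y)"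
  define A where "A = (\<lambda>T y. snd (p T) y * (\<Prod>S\<in>hypertori W L - {T}. fst (p S) y))"
  have B: "B \<in> CH" unfolding B_def using p by (intro CH_prod) simp
  have A: "A T \<in> CH" if "T \<in> hypertori W L" for T
    unfolding A_def using p that by (intro CH_mult CH_prod) auto
  have Bf: "B y * f T v y = A T y" if T: "T \<in> hypertori W L" "coset L y \<notin> T" for T y
  proof -
    have "B y = fst (p T) y * (\<Prod>S\<in>hypertori W L - {T}. fst (p S) y)"
      unfolding B_def by (rule prod.remove[OF finite_hypertori T(1)])
    moreover have "fst (p T) y * f T v y = snd (p T) y" using p T by simp
    ultimately show ?thesis by (simp add: A_def mult_ac)
  qed
  have "B x \<noteq> 0" unfolding B_def using p by (simp add: prod_zero_iff finite_hypertori)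
  moreover have "(\<lambda>y. B y * directional v F y) \<in> N" if F: "F \<in> N" for F
  proof -
    \<comment> \<open>The Dunkl operator solved for the derivative: \<open>B\<close> times
      \<open>f T v\<close> is regular, so the reflection terms stay in \<open>N\<close>.\<close>
    let ?G = "\<lambda>y. B y * trig v F y + (\<Sum>T\<in>hypertori W L. c T * (A T y * (F y - F (refl T *v y))))"
    have G: "?G \<in> N" by (intro N_add N_sum N_scale N_mult N_diff N_dunkl N_reflection A B F)
    obtain D where D: "D \<in> CH" "\<exists>y. D y \<noteq> 0"
      "\<forall>y. D y \<noteq> 0 \<longleftrightarrow> (\<forall>T\<in>hypertori W L. coset L y \<notin> T)" using hypertori_discriminant by (elim bexE conjE)
    obtain z where z: "D z \<noteq> 0" using D(2) by (elim exE)
    have "(\<lambda>y. B y * directional v F y) = ?G"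
    proof (rule exp_poly_eqI[of _ _ D z])
      show "(\<lambda>y. B y * directional v F y) \<in> exp_poly"
        by (intro CH_exp_poly CH_mult B CH_directional N_CH F)
      show "?G \<in> exp_poly" by (rule CH_exp_poly[OF N_CH[OF G]])
      fix y assume "D y \<noteq> 0"
      then have nT: "coset L y \<notin> T" if "T \<in> hypertori W L" for T using D(3) that by simp
      have "B y * (\<Sum>T\<in>hypertori W L. c T * f T v y * (F y - F (refl T *v y)))
          = (\<Sum>T\<in>hypertori W L. c T * (A T y * (F y - F (refl T *v y))))"
        unfolding sum_distrib_left
      proof (intro sum.cong refl)
        fix T assume T: "T \<in> hypertori W L"
        show "B y * (c T * f T v y * (F y - F (refl T *v y))) = c T * (A T y * (F y - F (refl T *v y)))"
          unfolding Bf[OF T nT[OF T], symmetric] by (simp add: mult_ac)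
      qed
      then show "B y * directional v F y = ?G y"
        using trig_dunkl_properties(2)[OF N_CH[OF F] nT, of v] by (simp add: right_diff_distrib)
    qed (use CH_exp_poly[OF D(1)] z in auto)
    then show ?thesis using G by simp
  qed
  ultimately show ?thesis using B by (intro bexI[of _ B]) simp_all
qed

text \<open>Every iterated derivative along \<open>v\<close>, times a power of \<open>B\<close>,
  lies in \<open>N\<close>, so it vanishes at \<open>x\<close>. An entire function on a line with
  zero Taylor series is zero.\<close>

lemma zero_set_tangent:
  assumes zero: "\<And>F. F \<in> N \<Longrightarrow> F x = 0"
    and tan: "\<And>s. s \<in> reflections W \<Longrightarrow> coset L x \<in> fixed_set L s \<Longrightarrow> rform s v = 0"
    and F: "F \<in> N"
  shows "F (x + t *s v) = 0"
proof -
  obtain B where B: "B \<in> CH" "B x \<noteq> 0" "\<forall>F\<in>N. (\<lambda>y. B y * directional v F y) \<in> N"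
    using tangent_denominator[of x v] tan by (elim meta_impE bexE conjE) simp_all
  define D where "D = (\<lambda>j. (directional v ^^ j) F)"
  have DCH: "D j \<in> CH" for j
    by (induction j) (simp_all add: D_def N_CH F CH_directional)
  have DS: "directional v (D j) = D (Suc j)" for j by (simp add: D_def)
  have "(\<lambda>y. B y ^ j * D j y) \<in> N" for j
  proof (induction j)
    case 0
    then show ?case using F by (simp add: D_def)
  next
    case (Suc j)
    have "(\<lambda>y. (of_nat j * directional v B y) * (B y ^ j * D j y)) \<in> N"
      by (rule N_mult[OF CH_scale[OF CH_directional[OF B(1)]] Suc])
    from N_diff[OF bspec[OF B(3) Suc] this]
    show ?case
      by (simp add: power_directional[OF CH_exp_poly[OF B(1)] CH_exp_poly[OF DCH]] DS)
  qed
  then have "B x ^ j * D j x = 0" for j by (rule zero)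
  then have D0: "D j x = 0" for j using B(2) by simp
  define g where "g = (\<lambda>t. F (x + t *s v))"
  have "(deriv ^^ j) g = (\<lambda>t. D j (x + t *s v))" for j
  proof (induction j)
    case 0
    then show ?case by (simp add: g_def D_def)
  next
    case (Suc j)
    have "deriv (\<lambda>t. D j (x + t *s v)) = (\<lambda>t. D (Suc j) (x + t *s v))"
      using exp_poly_has_field_derivative[OF CH_exp_poly[OF DCH], of j x v] DS[of j]
      by (intro ext DERIV_imp_deriv) simp
    then show ?case by (simp add: Suc)
  qed
  then have "(deriv ^^ j) g 0 = 0" for j by (simp add: D0)
  moreover have "g holomorphic_on UNIV" unfolding g_def
    by (rule exp_poly_line_holomorphic[OF CH_exp_poly[OF N_CH[OF F]]])
  ultimately have "g t = 0"
    by (intro holomorphic_fun_eq_0_on_connected[of g UNIV 0 t]) auto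
  then show ?thesis by (simp add: g_def)
qed

text \<open>Take a common zero lying on as many hypertori as possible: moving it along a common tangent direction
  would reach a further hypertorus.\<close>

lemma rigid_zero:
  assumes "N \<noteq> CH"
  shows "\<exists>x. (\<forall>F\<in>N. F x = 0) \<and> (\<forall>v. (\<forall>\<alpha>\<in>roots W L. \<alpha> x \<in> \<int> \<longrightarrow> \<alpha> v = 0) \<longrightarrow> v = 0)"
proof -
  define S where "S = (\<lambda>x. {s \<in> reflections W. coset L x \<in> fixed_set L s})"
  have fin: "finite (reflections W)" using finite_W by (simp add: reflections_def)
  have finS: "finite (S x)" for x unfolding S_def using fin by simp
  obtain p where "\<forall>F\<in>N. F p = 0" using N_common_zero[OF assms] by (elim exE)
  moreover have "card (S y) < Suc (card (reflections W))" for y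
    unfolding S_def using card_mono[OF fin, of "{s \<in> reflections W. coset L y \<in> fixed_set L s}"] by auto
  ultimately obtain x where x: "\<forall>F\<in>N. F x = 0" "\<And>y. \<forall>F\<in>N. F y = 0 \<Longrightarrow> card (S y) \<le> card (S x)"
    using ex_has_greatest_nat[of "\<lambda>x. \<forall>F\<in>N. F x = 0" p "\<lambda>y. card (S y)" "Suc (card (reflections W))"] by auto
  have "v = 0" if roots: "\<forall>\<alpha>\<in>roots W L. \<alpha> x \<in> \<int> \<longrightarrow> \<alpha> v = 0" for v
  proof (rule fixed_vector, rule ccontr)
    fix s assume s: "s \<in> reflections W" "s *v v \<noteq> v"
    have tan: "rform u v = 0" if u: "u \<in> reflections W" "coset L x \<in> fixed_set L u" for u
    proof -
      obtain \<alpha> \<kappa> where \<alpha>: "\<alpha> \<in> roots W L" "\<kappa> \<noteq> 0" "\<alpha> = (\<lambda>x. \<kappa> * rform u x)"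
        "\<forall>x. \<alpha> x \<in> \<int> \<longleftrightarrow> coset L x \<in> fixed_set L u"
        using reflection_root[OF u(1) rdata[OF u(1)]] by (elim bexE exE conjE)
      have "\<alpha> v = 0" using roots \<alpha>(1,4) u(2) by simp
      then show ?thesis using \<alpha>(2,3) by simp
    qed
    have sv: "rform s v \<noteq> 0"
    proof
      assume "rform s v = 0"
      then have "s *v v = v" by (simp add: rform_apply[OF s(1)])
      with s(2) show False by (rule notE)
    qed
    \<comment> \<open>The point of the line through \<open>x\<close> along \<open>v\<close> at which
      \<open>rform s\<close> vanishes; it lies on a hypertorus of \<open>s\<close>.\<close>
    define y where "y = x + (- rform s x / rform s v) *s v"
    have "F y = 0" if "F \<in> N" for F
      unfolding y_def by (rule zero_set_tangent[of x v F, OF _ tan that]) (simp_all add: x(1))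
    then have "\<forall>F\<in>N. F y = 0" by (rule ballI)
    then have "card (S y) \<le> card (S x)" by (rule x(2))
    moreover have "insert s (S x) \<subseteq> S y"
    proof
      fix u assume "u \<in> insert s (S x)"
      then consider "u = s" | "u \<in> S x" by blast
      then show "u \<in> S y"
      proof cases
        case 1
        have "rform s y = 0" using sv by (simp add: y_def linear_form_simps[OF rform_linear[OF s(1)]])
        then show ?thesis using s(1) fixed_set_data[OF _ rdata[OF s(1)], of y] L_zero
          by (simp add: 1 S_def reflections_def)
      next
        case 2
        then have u: "u \<in> reflections W" "coset L x \<in> fixed_set L u" by (simp_all add: S_def)
        have "rform u y = rform u x" using tan[OF u] by (simp add: y_def linear_form_simps[OF rform_linear[OF u(1)]])
        then show ?thesis using u fixed_set_data[OF _ rdata[OF u(1)]] by (simp add: S_def reflections_def)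
      qed
    qed
    moreover have "s \<notin> S x" using tan[OF s(1)] sv by (auto simp: S_def)
    ultimately show False using card_mono[OF finS, of "insert s (S x)" y] finS[of x] by simp
  qed
  then show ?thesis using x(1) by blast
qed

end

section \<open>Leading terms of a submodule at a common zero\<close>

context torus_reflection_group begin

text \<open>The homogeneous parts of the Taylor series come from expanding each character. If all of
  them were zero, summing the exponential series would give \<open>F = 0\<close>.\<close>

lemma leading_term_exists:
  assumes F: "F \<in> CH" and nz: "F \<noteq> (\<lambda>y. 0)"
  shows "\<exists>m P. homogeneous m P \<and> P \<noteq> (\<lambda>y. 0) \<and> vanishes_to (Suc m) (\<lambda>y. F (x + y) - P y)"
proof -
  obtain p where p: "finite (fst p) \<and> fst p \<subseteq> dual_lattice L \<and> F = (\<lambda>x. \<Sum>\<mu>\<in>fst p. snd p \<mu> * expi (\<mu> x))"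
    using CH_repr[OF F] by (elim exE)
  define S where "S = fst p"
  define b where "b = (\<lambda>\<mu>. snd p \<mu> * expi (\<mu> x))"
  have S: "linear_form \<mu>" if "\<mu> \<in> S" for \<mu> using p that dual_form by (auto simp: S_def)
  define \<kappa> where "\<kappa> = (\<lambda>(\<mu> :: complex^'n \<Rightarrow> complex) y. 2 * of_real pi * \<i> * \<mu> y)"
  have lin: "linear_form (\<kappa> \<mu>)" if "\<mu> \<in> S" for \<mu>
    unfolding \<kappa>_def by (rule linear_form_mult[OF S[OF that]])
  have FS: "F (x + y) = (\<Sum>\<mu>\<in>S. b \<mu> * exp (\<kappa> \<mu> y))" for y
  proof -
    have "F (x + y) = (\<Sum>\<mu>\<in>S. snd p \<mu> * expi (\<mu> (x + y)))" using p by (simp add: S_def)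
    also have "\<dots> = (\<Sum>\<mu>\<in>S. b \<mu> * exp (\<kappa> \<mu> y))"
      by (intro sum.cong refl)
        (simp add: b_def linear_form_add[OF S] expi_add, simp add: expi_def \<kappa>_def)
    finally show ?thesis .
  qed
  define Q where "Q = (\<lambda>m y. \<Sum>\<mu>\<in>S. b \<mu> * (\<kappa> \<mu> y ^ m / fact m))"
  have hom: "homogeneous m (Q m)" for m
    unfolding homogeneous_def
  proof (intro conjI allI)
    have "(\<lambda>y. \<Sum>\<mu>\<in>S. b \<mu> * (1 / fact m * \<kappa> \<mu> y ^ m)) \<in> polynomial_functions"
      by (intro polynomial_sum polynomial_scale polynomial_power polynomial_form lin)
    then show "Q m \<in> polynomial_functions" by (simp add: Q_def)
    show "Q m (t *s y) = t ^ m * Q m y" for t y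
      unfolding Q_def sum_distrib_left
      by (intro sum.cong refl) (simp add: linear_form_scale[OF lin] power_mult_distrib)
  qed
  have van: "vanishes_to (Suc n) (\<lambda>y. F (x + y) - (\<Sum>i\<le>n. Q i y))" for n
  proof -
    have "vanishes_to (Suc n) (\<lambda>y. \<Sum>\<mu>\<in>S. b \<mu> * (exp (\<kappa> \<mu> y) - (\<Sum>i\<le>n. \<kappa> \<mu> y ^ i / fact i)))"
      by (intro vanishes_to_sum vanishes_to_scale vanishes_to_exp_taylor lin)
    moreover have "F (x + y) - (\<Sum>i\<le>n. Q i y) = (\<Sum>\<mu>\<in>S. b \<mu> * (exp (\<kappa> \<mu> y) - (\<Sum>i\<le>n. \<kappa> \<mu> y ^ i / fact i)))" for y
    proof -
      have "(\<Sum>i\<le>n. Q i y) = (\<Sum>\<mu>\<in>S. b \<mu> * (\<Sum>i\<le>n. \<kappa> \<mu> y ^ i / fact i))"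
        unfolding Q_def sum_distrib_left by (rule sum.swap)
      then show ?thesis by (simp add: FS right_diff_distrib sum_subtractf)
    qed
    ultimately show ?thesis by simp
  qed
  have "\<exists>m. Q m \<noteq> (\<lambda>y. 0)"
  proof (rule ccontr)
    assume "\<not> ?thesis"
    then have Q0: "Q m y = 0" for m y by simp
    have "F (x + y) = 0" for y
    proof -
      have "(\<lambda>m. b \<mu> * (\<kappa> \<mu> y ^ m / fact m)) sums (b \<mu> * exp (\<kappa> \<mu> y))" for \<mu>
        using exp_converges[of "\<kappa> \<mu> y"] by (intro sums_mult) (simp add: scaleR_conv_of_real divide_inverse mult.commute)
      then have "(\<lambda>m. Q m y) sums F (x + y)" unfolding Q_def FS by (intro sums_sum)
      then have "(\<lambda>m :: nat. 0) sums F (x + y)" by (simp add: Q0)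
      then show ?thesis using sums_unique2[OF _ sums_zero] by blast
    qed
    from this[of "_ - x"] have "F y = 0" for y by simp
    with nz show False by auto
  qed
  then obtain m where m: "Q m \<noteq> (\<lambda>y. 0)" "\<And>i. i < m \<Longrightarrow> Q i = (\<lambda>y. 0)"
    using exists_least_iff[of "\<lambda>m. Q m \<noteq> (\<lambda>y. 0)"] by blast
  have "(\<Sum>i\<le>m. Q i y) = Q m y" for y
    by (subst sum.remove[of _ m]) (auto intro!: sum.neutral simp: m(2))
  then have "vanishes_to (Suc m) (\<lambda>y. F (x + y) - Q m y)" using van[of m] by simp
  then show ?thesis using hom m(1) by (intro exI[of _ m] exI[of _ "Q m"]) simp
qed

end

context trigonometric_submodule begin

text \<open>For \<open>P = 0\<close> the condition always holds, with \<open>F = 0\<close>. This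
  spares an exception when a Dunkl operator annihilates a leading term.\<close>

definition lead :: "complex^'n \<Rightarrow> nat \<Rightarrow> (complex^'n \<Rightarrow> complex) \<Rightarrow> bool" where
  "lead x m P \<longleftrightarrow> homogeneous m P \<and> (\<exists>F\<in>N. vanishes_to (Suc m) (\<lambda>y. F (x + y) - P y))"

lemma leadI: "homogeneous m P \<Longrightarrow> F \<in> N \<Longrightarrow> vanishes_to (Suc m) (\<lambda>y. F (x + y) - P y) \<Longrightarrow> lead x m P"
  unfolding lead_def by blast

lemma leadE:
  assumes "lead x m P"
  obtains F where "homogeneous m P" "F \<in> N" "vanishes_to (Suc m) (\<lambda>y. F (x + y) - P y)"
  using assms unfolding lead_def by blast

lemma lead_scale:
  assumes "lead x m P"
  shows "lead x m (\<lambda>y. a * P y)"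
proof -
  obtain F where F: "homogeneous m P" "F \<in> N" "vanishes_to (Suc m) (\<lambda>y. F (x + y) - P y)" using assms by (rule leadE)
  show ?thesis
  proof (rule leadI[OF _ N_scale[OF F(2), of a]])
    show "homogeneous m (\<lambda>y. a * P y)" using F(1) by (simp add: homogeneous_def polynomial_scale)
    show "vanishes_to (Suc m) (\<lambda>y. a * F (x + y) - a * P y)"
      using vanishes_to_scale[OF F(3), of a] by (simp add: right_diff_distrib)
  qed
qed

text \<open>A linear coordinate is not a function on the torus; \<open>expi\<close> of it minus 1,
  divided by \<open>2 * pi * \<i>\<close>, is one and has the same linear part.\<close>

lemma lead_coord_mult:
  assumes "lead x m P"
  shows "lead x (Suc m) (\<lambda>y. coord j y * P y)"
proof -
  obtain F where F: "homogeneous m P" "F \<in> N" "vanishes_to (Suc m) (\<lambda>y. F (x + y) - P y)" using assms by (rule leadE)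
  define a where "a = 2 * of_real pi * \<i>"
  have a: "a \<noteq> 0" by (simp add: a_def)
  define e where "e = (\<lambda>z. 1 / a * (expi (coord j (z - x)) - 1))"
  have e: "e \<in> CH" unfolding e_def by (intro CH_scale equation_CH coord_dual)
  have lin: "linear_form (\<lambda>y. a * coord j y)" by (rule linear_form_mult[OF coord_form])
  have "vanishes_to 2 (\<lambda>y. exp (a * coord j y) - (\<Sum>i\<le>1. (a * coord j y) ^ i / fact i))"
    using vanishes_to_exp_taylor[OF lin, of 1] by (simp add: numeral_2_eq_2)
  then have "vanishes_to 2 (\<lambda>y. 1 / a * (exp (a * coord j y) - (\<Sum>i\<le>1. (a * coord j y) ^ i / fact i)))"
    by (rule vanishes_to_scale)
  moreover have "1 / a * (exp (a * coord j y) - (\<Sum>i\<le>1. (a * coord j y) ^ i / fact i)) = e (x + y) - coord j y" for y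
    using a by (simp add: e_def expi_def a_def[symmetric] right_diff_distrib add_divide_distrib)
  ultimately have ev: "vanishes_to 2 (\<lambda>y. e (x + y) - coord j y)" by simp
  have "vanishes_to m (\<lambda>y. (F (x + y) - P y) + P y)"
    by (intro vanishes_to_add vanishes_to_mono[OF F(3)] homogeneous_vanishes_to F(1)) simp
  then have Fm: "vanishes_to m (\<lambda>y. F (x + y))" by simp
  have "vanishes_to (2 + m) (\<lambda>y. (e (x + y) - coord j y) * F (x + y))" by (rule vanishes_to_mult[OF ev Fm])
  moreover have "vanishes_to (1 + Suc m) (\<lambda>y. coord j y * (F (x + y) - P y))"
    by (rule vanishes_to_mult[OF vanishes_to_form[OF coord_form] F(3)])
  ultimately have "vanishes_to (Suc (Suc m)) (\<lambda>y. (e (x + y) - coord j y) * F (x + y) + coord j y * (F (x + y) - P y))"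
    by (intro vanishes_to_add) simp_all
  then have v: "vanishes_to (Suc (Suc m)) (\<lambda>y. e (x + y) * F (x + y) - coord j y * P y)"
    by (simp add: algebra_simps)
  have "homogeneous (Suc m) (\<lambda>y. coord j y * P y)"
    using F(1) by (simp add: homogeneous_def coord_simps polynomial_functions.mult polynomial_form coord_form)
  then show ?thesis by (rule leadI[OF _ N_mult[OF e F(2)] v])
qed

lemma lead_act:
  assumes "lead x m P" and w: "w \<in> stabilizer W (coset L x)"
  shows "lead x m (act w P)"
proof -
  obtain F where F: "homogeneous m P" "F \<in> N" "vanishes_to (Suc m) (\<lambda>y. F (x + y) - P y)" using assms(1) by (rule leadE)
  have wW: "w \<in> W" and wx: "w *v x - x \<in> L" using w by (simp_all add: stabilizer_iff)
  have "matrix_inv w *v (w *v x - x) \<in> L" by (rule L_apply[OF inv_W[OF wW] wx])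
  then have ix: "matrix_inv w *v (x + y) - (x + matrix_inv w *v y) \<in> L" for y
    using L_minus by (fastforce simp: matrix_vector_right_distrib matrix_vector_mult_diff_distrib inv_apply wW)
  have act: "act w F (x + y) = F (x + matrix_inv w *v y)" for y
    unfolding act_def by (rule CH_coset[OF N_CH[OF F(2)] ix])
  show ?thesis
  proof (rule leadI[OF _ N_act[OF wW F(2)]])
    show "homogeneous m (act w P)"
      using F(1) by (simp add: homogeneous_def act_def polynomial_comp_matrix vector_scalar_commute)
    show "vanishes_to (Suc m) (\<lambda>y. act w F (x + y) - act w P y)"
      unfolding act unfolding act_def by (rule vanishes_to_comp_matrix[OF F(3)])
  qed
qed

lemma lead_0:
  assumes zero: "\<forall>F\<in>N. F x = 0" and P: "lead x 0 P"
  shows "P = (\<lambda>y. 0)"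
proof -
  obtain F where F: "homogeneous 0 P" "F \<in> N" "vanishes_to (Suc 0) (\<lambda>y. F (x + y) - P y)" using P by (rule leadE)
  have "F (x + 0) - P 0 = 0" using vanishes_to_at_0[of "\<lambda>y. F (x + y) - P y"] F(3) by simp
  then have "P 0 = 0" using bspec[OF zero F(2)] by simp
  then show ?thesis using homogeneous_0_const[OF F(1)] by auto
qed

text \<open>The correction terms of the comparison at \<open>w = 1\<close> stay in \<open>N\<close>,
  so the rational operator yields a leading term one degree lower. Degree 0 is separate: at a common
  zero it contains only 0.\<close>

lemma lead_dunkl:
  assumes zero: "\<forall>F\<in>N. F x = 0" and P: "lead x m P"
  shows "\<exists>m'. lead x m' (rational_dunkl (stabilizer W (coset L x)) (local_parameter L c (coset L x)) v P)"
    (is "\<exists>m'. lead x m' (?D P)")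
proof -
  have \<Gamma>: "stabilizer W (coset L x) \<subseteq> W" by (auto simp: stabilizer_def)
  show ?thesis
  proof (cases m)
    case 0
    then have "P = (\<lambda>y. 0)" using lead_0[OF zero] P by simp
    then have "?D P = P" using rational_dunkl_zero[OF \<Gamma>] by simp
    then show ?thesis using P by auto
  next
    case (Suc n)
    obtain F where F: "homogeneous m P" "F \<in> N" "vanishes_to (Suc m) (\<lambda>y. F (x + y) - P y)" using P by (rule leadE)
    have one: "matrix_inv (mat 1) *v v = v" using inv_apply[OF one_W, of v] by simp
    have v1: "vanishes_to (Suc m) (\<lambda>y. F (mat 1 *v (x + y)) - P y)" using F(3) by simp
    from dunkl_comparison[OF N_CH[OF F(2)] homogeneous_polynomial[OF F(1)] one_W v1, of v]
    obtain r where r: "\<forall>T\<in>hypertori W L. r T \<in> CH" "vanishes_to m (\<lambda>y. trig v F (x + y)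
      + (\<Sum>T\<in>hypertori W L. c T * (r T (x + y) * (F (x + y) - F (refl T *v (x + y))))) - ?D P y)"
      unfolding one matrix_vector_mul_lid by (elim exE conjE)
    let ?G = "\<lambda>z. trig v F z + (\<Sum>T\<in>hypertori W L. c T * (r T z * (F z - F (refl T *v z))))"
    have G: "?G \<in> N"
      by (intro N_add N_sum N_scale N_mult N_diff N_dunkl N_reflection F(2) bspec[OF r(1)])
    have "homogeneous n (?D P)"
      by (rule rational_dunkl_homogeneous[OF \<Gamma>]) (use F(1) Suc in simp)
    then have "lead x n (?D P)" by (rule leadI[OF _ G]) (use r(2) Suc in simp)
    then show ?thesis by (rule exI)
  qed
qed

theorem singular_at_zero:
  assumes zero: "\<forall>F\<in>N. F x = 0" and nz: "N \<noteq> {\<lambda>y. 0}"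
  shows "reducible_module (rational_Cherednik_algebra (stabilizer W (coset L x)) (local_parameter L c (coset L x)))
    polynomial_functions"
proof -
  define \<Gamma> where "\<Gamma> = stabilizer W (coset L x)"
  define k where "k = local_parameter L c (coset L x)"
  have \<Gamma>: "\<Gamma> \<subseteq> W" by (auto simp: \<Gamma>_def stabilizer_def)
  define S where "S = {P. \<exists>m. lead x m P}"
  have SI: "P \<in> S" if "lead x m P" for P m using that by (auto simp: S_def)
  have SE: "\<exists>m. lead x m P" if "P \<in> S" for P using that by (simp add: S_def)
  define I where "I = sums_of S"
  have I0: "(\<lambda>y. 0) \<in> I" unfolding I_def by (rule sums_of.zero)
  have Iadd: "(\<lambda>y. F y + G y) \<in> I" if "F \<in> I" "G \<in> I" for F G using that unfolding I_def by (rule sums_of_add)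
  have Isingle: "P \<in> I" if "lead x m P" for m P unfolding I_def by (rule sums_of_single[OF SI[OF that]])
  have Ipoly: "P \<in> polynomial_functions" if "P \<in> I" for P
    using that unfolding I_def
  proof induction
    case zero
    show ?case by (rule polynomial_functions.const)
  next
    case (step P G)
    obtain m where "lead x m P" using SE[OF step(1)] by (elim exE)
    then have "P \<in> polynomial_functions" by (elim leadE) (rule homogeneous_polynomial)
    then show ?case by (rule polynomial_functions.add[OF _ step.IH])
  qed
  have Iscale: "(\<lambda>y. a * P y) \<in> I" if "P \<in> I" for a P
    using that unfolding I_def
  proof induction
    case zero
    show ?case using sums_of.zero by simp
  next
    case (step P G)
    obtain m where "lead x m P" using SE[OF step(1)] by (elim exE)
    then have "(\<lambda>y. a * P y) \<in> S" by (rule SI[OF lead_scale])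
    from sums_of.step[OF this step.IH] show ?case by (simp add: distrib_left)
  qed
  have Icoord: "(\<lambda>y. coord j y * P y) \<in> I" if "P \<in> I" for j P
    using that unfolding I_def
  proof induction
    case zero
    show ?case using sums_of.zero by simp
  next
    case (step P G)
    obtain m where "lead x m P" using SE[OF step(1)] by (elim exE)
    then have "(\<lambda>y. coord j y * P y) \<in> S" by (rule SI[OF lead_coord_mult])
    from sums_of.step[OF this step.IH] show ?case by (simp add: distrib_left)
  qed
  have Isum: "(\<lambda>y. \<Sum>i\<in>A. P i y) \<in> I" if "\<And>i. i \<in> A \<Longrightarrow> P i \<in> I" for A :: "'n set" and P
    using that unfolding I_def by (rule sums_of_sum)
  have Imult: "(\<lambda>y. Q y * P y) \<in> I" if "Q \<in> polynomial_functions" "P \<in> I" for Q P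
    using that
  proof (induction arbitrary: P)
    case (const a)
    then show ?case by (rule Iscale)
  next
    case (coord i)
    \<comment> \<open>Standard coordinates are expanded in lattice coordinates, multiplication by
      which is already known to preserve \<open>I\<close>.\<close>
    have "(\<lambda>y. \<Sum>j\<in>UNIV. basis j $ i * (coord j y * P y)) \<in> I" by (intro Isum Iscale Icoord coord)
    moreover have "(\<Sum>j\<in>UNIV. basis j $ i * (coord j y * P y)) = y $ i * P y" for y
    proof -
      have "y $ i = (\<Sum>j\<in>UNIV. coord j y * basis j $ i)"
        using arg_cong[OF coord_expand[of y], of "\<lambda>v. v $ i"] by simp
      moreover have "(\<Sum>j\<in>UNIV. basis j $ i * (coord j y * P y)) = (\<Sum>j\<in>UNIV. coord j y * basis j $ i) * P y"
        unfolding sum_distrib_right by (intro sum.cong refl) (simp add: mult_ac)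
      ultimately show ?thesis by simp
    qed
    ultimately show ?case by simp
  next
    case (add A B)
    from Iadd[OF add.IH(1)[OF add.prems] add.IH(2)[OF add.prems]] show ?case by (simp add: distrib_right)
  next
    case (mult A B)
    from mult.IH(1)[OF mult.IH(2)[OF mult.prems]] show ?case by (simp add: mult.assoc)
  qed
  have Iact: "act w P \<in> I" if w: "w \<in> \<Gamma>" and P: "P \<in> I" for w P
    using P unfolding I_def
  proof induction
    case zero
    show ?case using sums_of.zero by (simp add: act_def)
  next
    case (step P G)
    obtain m where "lead x m P" using SE[OF step(1)] by (elim exE)
    then have "act w P \<in> S" using w unfolding \<Gamma>_def by (rule SI[OF lead_act])
    from sums_of.step[OF this step.IH] show ?case by (simp add: act_def)
  qed
  have Idunkl: "rational_dunkl \<Gamma> k v P \<in> I" if P: "P \<in> I" for v P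
    using P unfolding I_def
  proof induction
    case zero
    show ?case using sums_of.zero by (simp add: rational_dunkl_zero[OF \<Gamma>])
  next
    case (step P G)
    obtain m where m: "lead x m P" using SE[OF step(1)] by (elim exE)
    have Pp: "P \<in> polynomial_functions" using m by (elim leadE) (rule homogeneous_polynomial)
    have Gp: "G \<in> polynomial_functions" using step(2) Ipoly unfolding I_def by simp
    have "\<exists>m'. lead x m' (rational_dunkl \<Gamma> k v P)" unfolding \<Gamma>_def k_def by (rule lead_dunkl[OF zero m])
    then have "rational_dunkl \<Gamma> k v P \<in> S" by (elim exE) (rule SI)
    from sums_of.step[OF this step.IH] show ?case by (simp add: rational_dunkl_add[OF \<Gamma> Pp Gp])
  qed
  have I_at_0: "P 0 = 0" if "P \<in> I" for P
    using that unfolding I_def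
  proof induction
    case (step P G)
    obtain m where m: "lead x m P" using SE[OF step(1)] by (elim exE)
    have "P 0 = 0"
    proof (cases "m = 0")
      case True
      then show ?thesis using lead_0[OF zero, of P] m by simp
    next
      case False
      have "homogeneous m P" using m by (rule leadE)
      then show ?thesis using False by (intro homogeneous_at_0) simp_all
    qed
    then show ?case using step.IH by simp
  qed simp
  have "submodule (rational_Cherednik_algebra \<Gamma> k) polynomial_functions I"
    unfolding submodule_rational_iff
  proof (intro conjI ballI allI)
    show "function_subspace I" by (rule function_subspaceI[OF I0 Iadd Iscale])
    show "I \<subseteq> polynomial_functions" using Ipoly by (rule subsetI)
    fix F assume F: "F \<in> I"
    show "(\<lambda>y. P y * F y) \<in> I" if "P \<in> polynomial_functions" for P by (rule Imult[OF that F])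
    show "act w F \<in> I" if "w \<in> \<Gamma>" for w by (rule Iact[OF that F])
    show "rational_dunkl \<Gamma> k v F \<in> I" for v by (rule Idunkl[OF F])
  qed
  moreover have "I \<noteq> polynomial_functions"
  proof
    assume "I = polynomial_functions"
    then have "(\<lambda>y. 1) \<in> I" using polynomial_functions.const by simp
    from I_at_0[OF this] show False by simp
  qed
  moreover have "I \<noteq> {\<lambda>y. 0}"
  proof -
    obtain F where F: "F \<in> N" "F \<noteq> (\<lambda>y. 0)" using nz N_zero by blast
    obtain m P where P: "homogeneous m P" "P \<noteq> (\<lambda>y. 0)" "vanishes_to (Suc m) (\<lambda>y. F (x + y) - P y)"
      using leading_term_exists[OF N_CH[OF F(1)] F(2), of x] by (elim exE conjE)
    have "P \<in> I" by (rule Isingle[OF leadI[OF P(1) F(1) P(3)]])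
    then show ?thesis using P(2) by blast
  qed
  ultimately show ?thesis unfolding reducible_module_def \<Gamma>_def k_def by blast
qed

end

section \<open>Weyl groups\<close>

text \<open>The group permutes the finite spanning set \<open>\<Phi>\<close>, so it is finite. For
  the fixed vectors, let \<open>A\<close> be the sum of its elements: right multiplication by
  \<open>r \<alpha>\<close> preserves \<open>A\<close>, while \<open>r \<alpha>\<close> negates
  \<open>\<alpha>\<close>, so \<open>A\<close> kills all roots and is zero. On a common fixed vector
  it is multiplication by \<open>card W\<close>.\<close>

lemma generated_group_rank_1_properties:
  fixes \<Phi> :: "(complex^'n) set"
  assumes root: "root_system \<Phi> co"
    and W: "W = generated_group ((\<lambda>\<alpha>. matrix (\<lambda>x. x - co \<alpha> x *s \<alpha>)) ` \<Phi>)"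
  shows "w \<in> W \<Longrightarrow> matrix_inv w ** w = mat 1"
    and "finite W"
    and "(\<And>s. s \<in> reflections W \<Longrightarrow> s *v v = v) \<Longrightarrow> v = 0"
proof -
  define r where "r = (\<lambda>\<alpha>. matrix (\<lambda>x. x - co \<alpha> x *s \<alpha>))"
  have \<Phi>: "finite \<Phi>" "0 \<notin> \<Phi>" "vec.span \<Phi> = UNIV" using root by (simp_all add: root_system_def)
  have co: "linear_form (co \<alpha>)" "co \<alpha> \<alpha> = 2" "(\<lambda>x. x - co \<alpha> x *s \<alpha>) ` \<Phi> = \<Phi>" if "\<alpha> \<in> \<Phi>" for \<alpha>
    using root that by (auto simp: root_system_def)
  have rx: "r \<alpha> *v x = x - co \<alpha> x *s \<alpha>" if "\<alpha> \<in> \<Phi>" for \<alpha> x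
    unfolding r_def using linear_form_simps[OF co(1)[OF that]]
    by (intro matrix_works) (auto simp: Vector_Spaces.linear_iff vec.vector_space_axioms
        vec.scale_left_distrib vec.scale_right_diff_distrib algebra_simps)
  have rr: "r \<alpha> ** r \<alpha> = mat 1" if "\<alpha> \<in> \<Phi>" for \<alpha>
    using co(1,2)[OF that]
    by (simp add: matrix_eq matrix_vector_mul_assoc[symmetric] rx[OF that] linear_form_simps)
  have inv: "matrix_inv A ** A = mat 1" "A ** matrix_inv A = mat 1" if "A ** B = mat 1" for A B :: "complex^'n^'n"
  proof -
    have "B ** A = mat 1" using that by (simp add: matrix_left_right_inverse)
    then have "A ** matrix_inv A = mat 1 \<and> matrix_inv A ** A = mat 1"
      unfolding matrix_inv_def using that by (intro someI[of "\<lambda>A'. A ** A' = mat 1 \<and> A' ** A = mat 1" B]) simp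
    then show "matrix_inv A ** A = mat 1" "A ** matrix_inv A = mat 1" by simp_all
  qed
  have W': "W = generated_group (r ` \<Phi>)" by (simp add: W r_def)
  have main: "(\<exists>B. w ** B = mat 1) \<and> (*v) w ` \<Phi> = \<Phi>" if "w \<in> W" for w
    using that unfolding W'
  proof induction
    case one
    show ?case by (auto intro: exI[of _ "mat 1"])
  next
    case (gen s)
    then obtain \<alpha> where \<alpha>: "\<alpha> \<in> \<Phi>" "s = r \<alpha>" by blast
    have "(*v) s ` \<Phi> = (\<lambda>x. x - co \<alpha> x *s \<alpha>) ` \<Phi>" by (simp add: \<alpha> rx)
    then show ?case using rr[OF \<alpha>(1)] co(3)[OF \<alpha>(1)] \<alpha>(2) by auto
  next
    case (mult a b)
    then obtain A B where AB: "a ** A = mat 1" "b ** B = mat 1" by blast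
    have "(a ** b) ** (B ** A) = a ** (b ** B) ** A" by (simp only: matrix_mul_assoc)
    then have 1: "(a ** b) ** (B ** A) = mat 1" by (simp add: AB)
    have "(*v) (a ** b) ` \<Phi> = (*v) a ` (*v) b ` \<Phi>"
      by (simp add: image_image matrix_vector_mul_assoc)
    then show ?case using 1 mult.IH by auto
  next
    case (inv a)
    then obtain A where A: "a ** A = mat 1" by blast
    have "(*v) (matrix_inv a) ` (*v) a ` \<Phi> = \<Phi>"
      by (simp add: image_image matrix_vector_mul_assoc \<open>\<And>B A. A ** B = mat 1 \<Longrightarrow> matrix_inv A ** A = mat 1\<close>[OF A])
    then have "(*v) (matrix_inv a) ` \<Phi> = \<Phi>" using inv.IH by simp
    then show ?case using \<open>\<And>B A. A ** B = mat 1 \<Longrightarrow> matrix_inv A ** A = mat 1\<close>[OF A] by blast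
  qed
  show inv_W: "w \<in> W \<Longrightarrow> matrix_inv w ** w = mat 1" for w using main inv(1) by blast
  have "inj_on (\<lambda>w. restrict ((*v) w) \<Phi>) W"
  proof (rule inj_onI)
    fix a b assume eq: "restrict ((*v) a) \<Phi> = restrict ((*v) b) \<Phi>"
    have "a *v x = b *v x" for x
    proof (rule vec.linear_eq_on[OF matrix_vector_mul_linear_gen matrix_vector_mul_linear_gen])
      show "x \<in> vec.span \<Phi>" by (simp add: \<Phi>)
      show "a *v u = b *v u" if "u \<in> \<Phi>" for u using fun_cong[OF eq, of u] that by simp
    qed
    then show "a = b" by (simp add: matrix_eq)
  qed
  moreover have "(\<lambda>w. restrict ((*v) w) \<Phi>) ` W \<subseteq> \<Phi> \<rightarrow>\<^sub>E \<Phi>" using main by fastforce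
  moreover have "finite (\<Phi> \<rightarrow>\<^sub>E \<Phi>)" using \<Phi>(1) by (intro finite_PiE)
  ultimately show fin: "finite W" by (meson finite_imageD finite_subset)
  assume v: "\<And>s. s \<in> reflections W \<Longrightarrow> s *v v = v"
  have rv: "r \<alpha> *v v = v" if \<alpha>: "\<alpha> \<in> \<Phi>" for \<alpha>
  proof (rule v)
    have "rank (mat 1 - r \<alpha>) = 1"
      using \<alpha> \<Phi>(2) co(2)[OF \<alpha>]
      by (intro rank_1I[of "co \<alpha>" _ \<alpha> \<alpha>] co(1)) (auto simp: matrix_vector_mult_diff_rdistrib rx)
    then show "r \<alpha> \<in> reflections W" using \<alpha> unfolding reflections_def W' by (auto intro: generated_group.gen)
  qed
  have wv: "w *v v = v" if "w \<in> W" for w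
    using that unfolding W'
  proof induction
    case (inv a)
    then have "matrix_inv a ** a = mat 1" using inv_W W' by simp
    then have "matrix_inv a *v (a *v v) = v" by (simp add: matrix_vector_mul_assoc)
    then show ?case by (simp add: inv.IH)
  qed (auto simp: rv matrix_vector_mul_assoc[symmetric])
  define A where "A = (\<Sum>w\<in>W. w)"
  have Ax: "A *v x = (\<Sum>w\<in>W. w *v x)" for x
    unfolding A_def using fin by (induction W) (simp_all add: matrix_vector_mult_add_rdistrib)
  have "A *v \<alpha> = 0" if \<alpha>: "\<alpha> \<in> \<Phi>" for \<alpha>
  proof -
    have rW: "r \<alpha> \<in> W" unfolding W' using \<alpha> by (auto intro: generated_group.gen)
    have "bij_betw (\<lambda>w. w ** r \<alpha>) W W"
      by (rule bij_betw_byWitness[where f' = "\<lambda>w. w ** r \<alpha>"])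
        (auto simp: matrix_mul_assoc[symmetric] rr[OF \<alpha>] intro: generated_group.mult[folded W'] rW
          rW[unfolded W'] generated_group.mult simp: W')
    then have e1: "(\<Sum>w\<in>W. (w ** r \<alpha>) *v \<alpha>) = (\<Sum>w\<in>W. w *v \<alpha>)" by (rule sum.reindex_bij_betw)
    have e2: "(w ** r \<alpha>) *v \<alpha> = - (w *v \<alpha>)" for w
    proof -
      have "r \<alpha> *v \<alpha> = - \<alpha>" using co(2)[OF \<alpha>] by (simp add: rx[OF \<alpha>] vec_eq_iff)
      then have "(w ** r \<alpha>) *v \<alpha> = w *v (- \<alpha>)" by (simp only: matrix_vector_mul_assoc[symmetric])
      then show ?thesis by (simp add: matrix_vector_mult_def vec_eq_iff sum_negf)
    qed
    have "A *v \<alpha> = - (A *v \<alpha>)" using e1 unfolding e2 sum_negf Ax by (rule sym)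
    then have "(A *v \<alpha>) $ i = - ((A *v \<alpha>) $ i)" for i by (metis uminus_vec_def vec_lambda_beta)
    then show ?thesis by (simp add: vec_eq_iff complex_eq_iff)
  qed
  then have "A *v v = 0"
    using vec.linear_eq_on[OF matrix_vector_mul_linear_gen matrix_vector_mul_linear_gen, of v \<Phi> A 0] by (simp add: \<Phi>)
  moreover have "(A *v v) $ i = of_nat (card W) * v $ i" for i
    unfolding Ax sum_component by (simp add: wv)
  moreover have "card W \<noteq> 0" using fin generated_group.one[of "r ` \<Phi>"] by (auto simp: W')
  ultimately show "v = 0" by (simp add: vec_eq_iff)
qed

lemma irreducible_Weyl_group_torus:
  assumes "irreducible_Weyl_group W" "lattice L" "stable_under W L"
  shows "torus_reflection_group W L"
proof -
  obtain \<Phi> co where root: "root_system \<Phi> co"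
    and W: "W = generated_group ((\<lambda>\<alpha>. matrix (\<lambda>x. x - co \<alpha> x *s \<alpha>)) ` \<Phi>)"
    using assms(1) by (auto simp: irreducible_Weyl_group_def irreducible_root_system_def)
  note props = generated_group_rank_1_properties[OF root W]
  show ?thesis
  proof
    show "mat 1 \<in> W" unfolding W by (rule generated_group.one)
    show "a ** b \<in> W" if "a \<in> W" "b \<in> W" for a b using that unfolding W by (rule generated_group.mult)
    show "matrix_inv a \<in> W" if "a \<in> W" for a using that unfolding W by (rule generated_group.inv)
  qed (use props assms in auto)
qed

section \<open>Traces and nilpotent matrices\<close>

text \<open>With a generalized inverse \<open>N G N = N\<close> one has \<open>tr N = tr (N N G)\<close>, and \<open>N N G\<close> has a smaller
  nilpotency index.\<close>

lemma trace_nilpotent: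
  fixes N :: "complex^'m^'m"
  assumes "\<And>v. ((*v) N ^^ Suc k) v = 0"
  shows "trace N = 0"
  using assms
proof (induction k arbitrary: N)
  case 0
  then have "N = 0" by (simp add: matrix_eq)
  then show ?case by (simp add: trace_def)
next
  case (Suc k)
  obtain g where g: "Vector_Spaces.linear (*s) (*s) g" "\<And>v. N *v (g (N *v v)) = N *v v"
    using vec.linear_exists_right_inverse_on[OF matrix_vector_mul_linear_gen vec.subspace_UNIV, of N] by blast
  define G where "G = matrix g"
  have NGN: "N *v (G *v (N *v v)) = N *v v" for v using g by (simp add: G_def matrix_works)
  have NGN': "N ** G ** N = N" by (simp add: matrix_eq matrix_vector_mul_assoc[symmetric] NGN)
  define M where "M = N ** (N ** G)"
  \<comment> \<open>Between consecutive factors \<open>M\<close> the product \<open>N G N\<close>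
    collapses to \<open>N\<close>, so the nilpotency index drops by one.\<close>
  have pow: "((*v) M ^^ Suc j) v = ((*v) N ^^ Suc (Suc j)) (G *v v)" for j v
  proof (induction j)
    case 0
    show ?case by (simp add: M_def matrix_vector_mul_assoc)
  next
    case (Suc j)
    have "((*v) M ^^ Suc (Suc j)) v = M *v (((*v) N ^^ Suc (Suc j)) (G *v v))"
      using Suc by (simp only: funpow.simps comp_apply)
    also have "\<dots> = N *v (N *v (G *v (N *v (((*v) N ^^ Suc j) (G *v v)))))"
      by (simp add: M_def matrix_vector_mul_assoc[symmetric])
    also have "\<dots> = ((*v) N ^^ Suc (Suc (Suc j))) (G *v v)" by (simp add: NGN)
    finally show ?case .
  qed
  have "((*v) M ^^ Suc k) v = 0" for v unfolding pow by (rule Suc.prems)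
  then have "trace M = 0" by (rule Suc.IH)
  moreover have "trace M = trace (N ** G ** N)" unfolding M_def by (rule trace_mul_sym)
  ultimately show ?case by (simp add: NGN')
qed

text \<open>In a basis of eigenvectors the trace is a sum of squares of integers; integrality takes
  the place of real eigenvalues.\<close>

lemma trace_square_eigenbasis:
  fixes A :: "complex^'m^'m"
  assumes span: "vec.span E = UNIV" and eig: "\<And>y. y \<in> E \<Longrightarrow> \<exists>k :: int. A *v y = of_int k *s y"
    and nz: "A \<noteq> 0"
  shows "trace (A ** A) \<noteq> 0"
proof -
  obtain B where B: "B \<subseteq> E" "vec.independent B" "E \<subseteq> vec.span B" by (rule vec.maximal_independent_subset)
  have spanB: "vec.span B = UNIV" using vec.span_mono[OF B(3)] span by (simp add: vec.span_span) auto
  have fin: "finite B" by (rule vec.finiteI_independent[OF B(2)])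
  have "card B = CARD('m)" using vec.dim_eq_card_independent[OF B(2)] vec.dim_span[of B] spanB by (simp add: vec.dim_UNIV card_cart_basis)
  then obtain b :: "'m \<Rightarrow> complex^'m" where b: "bij_betw b UNIV B"
    using finite_same_card_bij[of "UNIV :: 'm set" B] fin by auto
  have "\<forall>i. \<exists>k :: int. A *v b i = of_int k *s b i" using eig B(1) bij_betwE[OF b] by blast
  then obtain k :: "'m \<Rightarrow> int" where k: "\<And>i. A *v b i = of_int (k i) *s b i" by metis
  define P :: "complex^'m^'m" where "P = transpose (\<chi> i. b i)"
  define D :: "complex^'m^'m" where "D = (\<chi> i j. if i = j then of_int (k i) else 0)"
  have "columns P = range b" by (auto simp: columns_def column_def P_def transpose_def)
  then have "vec.span (columns P) = UNIV" using b spanB by (simp add: bij_betw_def)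
  then obtain Q where PQ: "P ** Q = mat 1" using matrix_right_invertible_span_columns[of P] by blast
  have AP: "A ** P = P ** D"
  proof -
    have "(A ** P) $ i $ j = (P ** D) $ i $ j" for i j
    proof -
      have "(A ** P) $ i $ j = (A *v b j) $ i"
        by (simp add: matrix_matrix_mult_def matrix_vector_mult_def P_def transpose_def)
      also have "\<dots> = of_int (k j) * b j $ i" by (simp add: k)
      also have "\<dots> = (P ** D) $ i $ j"
        by (simp add: matrix_matrix_mult_def P_def transpose_def D_def if_distrib cong: if_cong)
      finally show ?thesis .
    qed
    then show ?thesis by (simp add: vec_eq_iff)
  qed
  have QP: "Q ** P = mat 1" using PQ by (simp add: matrix_left_right_inverse)
  have "A = A ** (P ** Q)" by (simp add: PQ)
  then have A: "A = P ** D ** Q" by (simp add: matrix_mul_assoc AP)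
  have "A ** A = P ** (D ** (Q ** P) ** D ** Q)" by (subst (1 2) A) (simp only: matrix_mul_assoc)
  then have "A ** A = P ** (D ** D ** Q)" by (simp add: QP matrix_mul_assoc)
  then have "trace (A ** A) = trace (P ** (D ** D ** Q))" by (rule arg_cong)
  also have "\<dots> = trace (D ** D ** Q ** P)" by (rule trace_mul_sym)
  also have "D ** D ** Q ** P = D ** D" by (simp add: matrix_mul_assoc[symmetric] QP)
  also have "trace (D ** D) = of_int (\<Sum>i\<in>UNIV. k i * k i)"
    by (simp add: trace_def matrix_matrix_mult_def D_def if_distrib cong: if_cong)
  finally have tr: "trace (A ** A) = of_int (\<Sum>i\<in>UNIV. k i * k i)" .
  have "\<exists>i. k i \<noteq> 0"
  proof (rule ccontr)
    assume "\<not> ?thesis"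
    then have "D = 0" by (simp add: D_def vec_eq_iff)
    then show False using nz A by simp
  qed
  then obtain i where "k i \<noteq> 0" by blast
  then have "0 < k i * k i" by (simp add: zero_less_mult_iff linorder_neq_iff disj_commute)
  then have "(\<Sum>i\<in>UNIV. k i * k i) > 0" by (intro sum_pos2[of UNIV i]) auto
  then show ?thesis unfolding tr by (simp only: of_int_eq_0_iff)
qed

lemma bounded_linear_scale_vector: "bounded_linear (\<lambda>c. c *s (v :: complex^'m))"
  by (rule bounded_linear_intro[where K = "norm v"])
    (simp_all add: vec.scale_left_distrib norm_vec_scale vec_eq_iff)

section \<open>The Lie algebra\<close>

context torus_reflection_group begin

text \<open>All roots of one reflection are proportional and integral at the same points, which
  forces the ratio to be 1 or -1.\<close>

lemma finite_roots: "finite (roots W L)"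
proof -
  have "\<forall>s\<in>reflections W. \<exists>\<alpha>0. \<alpha>0 \<in> roots W L \<and> (\<exists>\<kappa>. \<kappa> \<noteq> 0 \<and> \<alpha>0 = (\<lambda>x. \<kappa> * rform s x)) \<and>
      (\<forall>x. \<alpha>0 x \<in> \<int> \<longleftrightarrow> coset L x \<in> fixed_set L s)"
    using reflection_root[OF _ rdata] by (simp add: Bex_def) blast
  from bchoice[OF this] obtain \<alpha>0 where \<alpha>0: "\<forall>s\<in>reflections W. \<alpha>0 s \<in> roots W L \<and>
    (\<exists>\<kappa>. \<kappa> \<noteq> 0 \<and> \<alpha>0 s = (\<lambda>x. \<kappa> * rform s x)) \<and> (\<forall>x. \<alpha>0 s x \<in> \<int> \<longleftrightarrow> coset L x \<in> fixed_set L s)" ..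
  have "roots W L \<subseteq> (\<Union>s\<in>reflections W. {\<alpha>0 s, \<lambda>x. - \<alpha>0 s x})"
  proof
    fix \<alpha> assume \<alpha>R: "\<alpha> \<in> roots W L"
    obtain s \<mu> a \<kappa>1 where s: "s \<in> reflections W" "reflection_data L s \<mu> a" "\<kappa>1 \<noteq> 0" "\<alpha> = (\<lambda>x. \<kappa>1 * \<mu> x)"
      "\<forall>x. \<alpha> x \<in> \<int> \<longleftrightarrow> coset L x \<in> fixed_set L s"
      using roots_data[OF \<alpha>R] by (elim exE conjE) blast
    obtain \<kappa>0 where k0: "\<kappa>0 \<noteq> 0" "\<alpha>0 s = (\<lambda>x. \<kappa>0 * rform s x)" "\<forall>x. \<alpha>0 s x \<in> \<int> \<longleftrightarrow> coset L x \<in> fixed_set L s"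
      using bspec[OF \<alpha>0 s(1)] by (elim conjE exE)
    have \<mu>: "linear_form \<mu>" "\<mu> a = 2" "\<And>x. s *v x = x - \<mu> x *s a"
      using s(2) reflection_data_form[OF s(2)] by (simp_all add: reflection_data_def)
    have "\<mu> (s *v x) = - \<mu> x" for x using \<mu> by (simp add: linear_form_simps[OF \<mu>(1)])
    then have "\<mu> x = \<mu> (rvec s) / 2 * rform s x" for x by (rule antiinvariant_form[OF s(1) \<mu>(1)])
    then have ax: "\<alpha> x = \<kappa>1 * (\<mu> (rvec s) / 2) * rform s x" for x unfolding s(4) by simp
    define \<kappa> where "\<kappa> = \<kappa>1 * (\<mu> (rvec s) / 2)"
    have \<alpha>: "\<alpha> x = \<kappa> * rform s x" for x using ax by (simp add: \<kappa>_def)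
    have \<kappa>: "\<kappa> \<noteq> 0"
    proof
      assume "\<kappa> = 0"
      then have "\<alpha> a = 0" using \<alpha> by simp
      then show False using s(3,4) \<mu>(2) by simp
    qed
    have rf: "rform s ((t / 2) *s rvec s) = t" for t
      by (simp add: linear_form_simps[OF rform_linear[OF s(1)]] rform_rvec[OF s(1)])
    have iff: "\<kappa> * t \<in> \<int> \<longleftrightarrow> \<kappa>0 * t \<in> \<int>" for t
      using s(5)[rule_format, of "(t / 2) *s rvec s"] k0(3)[rule_format, of "(t / 2) *s rvec s"]
      by (simp add: \<alpha> k0(2) rf)
    \<comment> \<open>Testing integrality at \<open>1 / \<kappa>\<close> and
      \<open>1 / \<kappa>0\<close> makes both quotients integers.\<close>
    obtain m n :: int where mn: "\<kappa>0 / \<kappa> = of_int m" "\<kappa> / \<kappa>0 = of_int n"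
      using iff[of "1 / \<kappa>"] iff[of "1 / \<kappa>0"] \<kappa> k0(1) by (auto elim!: Ints_cases)
    then have "(of_int (m * n) :: complex) = of_int 1" using \<kappa> k0(1) by (simp add: mn[symmetric])
    then have "m * n = 1" by (simp only: of_int_eq_iff)
    then have "n = 1 \<or> n = - 1" by (metis zmult_eq_1_iff)
    then have "\<kappa> = \<kappa>0 \<or> \<kappa> = - \<kappa>0" using mn(2) k0(1) by (auto simp: field_simps)
    then have "\<alpha> = \<alpha>0 s \<or> \<alpha> = (\<lambda>x. - \<alpha>0 s x)" using \<alpha> k0(2) by auto
    then show "\<alpha> \<in> (\<Union>s\<in>reflections W. {\<alpha>0 s, \<lambda>x. - \<alpha>0 s x})" using s(1) by blast
  qed
  moreover have "finite (\<Union>s\<in>reflections W. {\<alpha>0 s, \<lambda>x. - \<alpha>0 s x})"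
    using finite_W by (simp add: reflections_def)
  ultimately show ?thesis by (rule finite_subset)
qed

lemma roots_dual: "\<alpha> \<in> roots W L \<Longrightarrow> \<alpha> \<in> dual_lattice L"
  using roots_data by blast

end

locale lie_torus = torus_reflection_group W L for W :: "(complex^'n^'n) set" and L +
  fixes br :: "'m::finite bracket" and \<iota> :: "complex^'n \<Rightarrow> complex^'m"
  assumes lie: "simple_lie_algebra_with_roots br \<iota> (roots W L)"
begin

abbreviation "R \<equiv> roots W L"
abbreviation "R0 \<equiv> insert (\<lambda>t. 0) R"
abbreviation "gsp \<equiv> root_space br \<iota>"

lemma simple: "simple_lie_algebra br"
  and \<iota>_lin: "Vector_Spaces.linear (*s) (*s) \<iota>"
  and \<iota>_inj: "inj \<iota>"
  and gsp_0: "gsp (\<lambda>t. 0) = range \<iota>"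
  and R_eq: "R = {\<alpha>. linear_form \<alpha> \<and> \<alpha> \<noteq> (\<lambda>t. 0) \<and> gsp \<alpha> \<noteq> {0}}"
  and gsp_span: "vec.span (\<Union>\<alpha>\<in>R0. gsp \<alpha>) = UNIV"
  by (insert lie[unfolded simple_lie_algebra_with_roots_def], (elim conjE, assumption)+)

lemma lie_alg: "lie_algebra br"
  using simple by (simp add: simple_lie_algebra_def)

lemma br_lin: "Vector_Spaces.linear (*s) (*s) (br x)" "Vector_Spaces.linear (*s) (*s) (\<lambda>x. br x y)"
  and br_self: "br x x = 0"
  and jacobi: "br x (br y z) + br y (br z x) + br z (br x y) = 0"
  using lie_alg by (simp_all add: lie_algebra_def)

lemma br_simps:
  "br (x + y) z = br x z + br y z" "br x (y + z) = br x y + br x z"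
  "br (a *s x) z = a *s br x z" "br x (a *s y) = a *s br x y"
  "br 0 z = 0" "br x 0 = 0"
proof -
  show 1: "br (x + y) z = br x z + br y z" for x y z using br_lin(2) by (simp add: Vector_Spaces.linear_iff)
  show 2: "br x (y + z) = br x y + br x z" for x y z using br_lin(1) by (simp add: Vector_Spaces.linear_iff)
  show 3: "br (a *s x) z = a *s br x z" for a x z using br_lin(2) by (simp add: Vector_Spaces.linear_iff)
  show 4: "br x (a *s y) = a *s br x y" for a x y using br_lin(1) by (simp add: Vector_Spaces.linear_iff)
  show "br 0 z = 0" "br x 0 = 0" using 3[of 0 0 z] 4[of x 0 0] by simp_all
qed

lemma br_anti: "br x y = - br y x"
proof -
  have "br (x + y) (x + y) = br x x + br x y + (br y x + br y y)" by (simp only: br_simps(1,2) add_ac)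
  then have "br x y + br y x = 0" by (simp add: br_self)
  then show ?thesis by (simp only: eq_neg_iff_add_eq_0)
qed

lemma br_minus: "br x (- y) = - br x y"
  using br_simps(4)[of x "-1" y] by simp

lemma derivation: "br x (br y z) = br (br x y) z + br y (br x z)"
proof -
  have "br y (br z x) = - br y (br x z)" using br_anti[of z x] by (simp add: br_minus)
  moreover have "br z (br x y) = - br (br x y) z" by (rule br_anti)
  ultimately show ?thesis using jacobi[of x y z] by (simp add: algebra_simps add_eq_0_iff)
qed

lemma gsp_iff: "y \<in> gsp \<alpha> \<longleftrightarrow> (\<forall>t. br (\<iota> t) y = \<alpha> t *s y)"
  by (simp add: root_space_def)

lemma gsp_zero: "0 \<in> gsp \<alpha>"
  by (simp add: gsp_iff br_simps)

lemma gsp_add: "y \<in> gsp \<alpha> \<Longrightarrow> z \<in> gsp \<alpha> \<Longrightarrow> y + z \<in> gsp \<alpha>"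
  by (simp add: gsp_iff br_simps vec.scale_right_distrib)

lemma gsp_scale: "y \<in> gsp \<alpha> \<Longrightarrow> a *s y \<in> gsp \<alpha>"
  by (simp add: gsp_iff br_simps vector_smult_assoc mult.commute)

lemma gsp_br: "y \<in> gsp \<alpha> \<Longrightarrow> z \<in> gsp \<beta> \<Longrightarrow> br y z \<in> gsp (\<lambda>t. \<alpha> t + \<beta> t)"
  by (simp add: gsp_iff derivation br_simps vec.scale_left_distrib)

lemma gsp_outside: "linear_form \<gamma> \<Longrightarrow> \<gamma> \<notin> R0 \<Longrightarrow> y \<in> gsp \<gamma> \<Longrightarrow> y = 0"
  using R_eq by blast

lemma root_vector:
  assumes "\<alpha> \<in> R"
  obtains y where "y \<in> gsp \<alpha>" "y \<noteq> 0"
proof -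
  have "gsp \<alpha> \<noteq> {0}" using assms by (subst (asm) R_eq) simp
  moreover have "0 \<in> gsp \<alpha>" by (rule gsp_zero)
  ultimately have "\<exists>y\<in>gsp \<alpha>. y \<noteq> 0" by blast
  then show thesis using that by blast
qed

lemma gsp_decompose: "\<exists>Y. (\<forall>\<alpha>\<in>R0. Y \<alpha> \<in> gsp \<alpha>) \<and> y = (\<Sum>\<alpha>\<in>R0. Y \<alpha>)"
proof -
  have fin: "finite R0" using finite_roots by simp
  have "y \<in> vec.span (\<Union>\<alpha>\<in>R0. gsp \<alpha>)" by (simp only: gsp_span UNIV_I)
  then show ?thesis
  proof (induction rule: vec.span_induct_alt)
    case base
    show ?case by (rule exI[of _ "\<lambda>\<alpha>. 0"]) (simp add: gsp_zero)
  next
    case (step c x y)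
    obtain Y where Y: "\<forall>\<alpha>\<in>R0. Y \<alpha> \<in> gsp \<alpha>" "y = (\<Sum>\<alpha>\<in>R0. Y \<alpha>)" using step(2) by (elim exE conjE)
    obtain \<beta> where \<beta>: "\<beta> \<in> R0" "x \<in> gsp \<beta>" using step(1) by blast
    define Z where "Z = (\<lambda>\<alpha>. (if \<alpha> = \<beta> then c *s x else 0) + Y \<alpha>)"
    have "\<forall>\<alpha>\<in>R0. Z \<alpha> \<in> gsp \<alpha>"
    proof
      fix \<alpha> assume \<alpha>: "\<alpha> \<in> R0"
      show "Z \<alpha> \<in> gsp \<alpha>" unfolding Z_def
        using \<beta>(2) bspec[OF Y(1) \<alpha>] by (cases "\<alpha> = \<beta>") (simp_all add: gsp_add gsp_scale)
    qed
    moreover have "c *s x + y = (\<Sum>\<alpha>\<in>R0. Z \<alpha>)"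
      unfolding Z_def sum.distrib Y(2)[symmetric] by (simp only: sum.delta'[OF fin] sum.delta[OF fin] \<beta>(1) if_True)
    ultimately show ?case by (intro exI[of _ Z] conjI)
  qed
qed

text \<open>The operator \<open>br (\<iota> t) - \<beta> t\<close> removes the component of weight
  \<open>\<beta>\<close> and scales that of weight \<open>\<gamma>\<close> by
  \<open>\<gamma> t - \<beta> t\<close>, nonzero for a suitable \<open>t\<close>; distinct weights
  can thus be separated inside \<open>J\<close>.\<close>

lemma graded_component:
  assumes J: "vec.subspace J" and stable: "\<And>t y. y \<in> J \<Longrightarrow> br (\<iota> t) y \<in> J"
    and S: "finite S" "\<And>\<alpha>. \<alpha> \<in> S \<Longrightarrow> Y \<alpha> \<in> gsp \<alpha>" "(\<Sum>\<alpha>\<in>S. Y \<alpha>) \<in> J" "\<alpha> \<in> S"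
  shows "Y \<alpha> \<in> J"
  using S
proof (induction S arbitrary: Y \<alpha>)
  case (insert \<beta> S)
  have eig: "br (\<iota> t) (Y \<alpha>) = \<alpha> t *s Y \<alpha>" if "\<alpha> \<in> insert \<beta> S" for \<alpha> t
    using insert.prems(1)[OF that] by (simp add: gsp_iff)
  have brsum: "br x (\<Sum>\<alpha>\<in>A. Z \<alpha>) = (\<Sum>\<alpha>\<in>A. br x (Z \<alpha>))" for x A and Z :: "(complex^'n \<Rightarrow> complex) \<Rightarrow> complex^'m"
    by (induction A rule: infinite_finite_induct) (simp_all add: br_simps)
  have inS: "Y \<gamma> \<in> J" if \<gamma>: "\<gamma> \<in> S" for \<gamma>
  proof -
    have "\<gamma> \<noteq> \<beta>" using \<gamma> insert.hyps by auto
    then obtain t where t: "\<gamma> t \<noteq> \<beta> t" by auto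
    have "br (\<iota> t) (\<Sum>\<alpha>\<in>insert \<beta> S. Y \<alpha>) - \<beta> t *s (\<Sum>\<alpha>\<in>insert \<beta> S. Y \<alpha>) \<in> J"
      using insert.prems(2) J by (intro vec.subspace_diff vec.subspace_scale stable)
    moreover have "br (\<iota> t) (\<Sum>\<alpha>\<in>insert \<beta> S. Y \<alpha>) - \<beta> t *s (\<Sum>\<alpha>\<in>insert \<beta> S. Y \<alpha>) = (\<Sum>\<alpha>\<in>S. (\<alpha> t - \<beta> t) *s Y \<alpha>)"
    proof -
      have "br (\<iota> t) (\<Sum>\<alpha>\<in>insert \<beta> S. Y \<alpha>) = (\<Sum>\<alpha>\<in>insert \<beta> S. \<alpha> t *s Y \<alpha>)"
        unfolding brsum by (intro sum.cong refl eig)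
      then show ?thesis
        using insert.hyps
        by (simp add: vec.scale_right_distrib vec.scale_sum_right sum_subtractf[symmetric] vec.scale_left_diff_distrib)
    qed
    ultimately have in1: "(\<Sum>\<alpha>\<in>S. (\<alpha> t - \<beta> t) *s Y \<alpha>) \<in> J" by simp
    have "(\<gamma> t - \<beta> t) *s Y \<gamma> \<in> J"
      by (rule insert.IH[of "\<lambda>\<alpha>. (\<alpha> t - \<beta> t) *s Y \<alpha>", OF _ in1 \<gamma>]) (intro gsp_scale insert.prems(1) insertI2)
    then have "(1 / (\<gamma> t - \<beta> t)) *s ((\<gamma> t - \<beta> t) *s Y \<gamma>) \<in> J" by (rule vec.subspace_scale[OF J])
    moreover have "(1 / (\<gamma> t - \<beta> t)) *s ((\<gamma> t - \<beta> t) *s Y \<gamma>) = Y \<gamma>"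
      unfolding vector_smult_assoc using t by simp
    ultimately show ?thesis by (simp only:)
  qed
  show ?case
  proof (cases "\<alpha> \<in> S")
    case False
    then have \<alpha>: "\<alpha> = \<beta>" using insert.prems(3) by simp
    have "(\<Sum>\<alpha>\<in>insert \<beta> S. Y \<alpha>) - (\<Sum>\<alpha>\<in>S. Y \<alpha>) \<in> J"
      by (intro vec.subspace_diff[OF J] insert.prems(2) vec.subspace_sum[OF J] inS)
    then show ?thesis using insert.hyps by (simp add: \<alpha>)
  qed (rule inS)
qed simp

section \<open>The Killing form\<close>

definition ad :: "complex^'m \<Rightarrow> complex^'m^'m" where "ad x = matrix (br x)"

lemma ad_apply: "ad x *v y = br x y"
  unfolding ad_def by (rule matrix_works[OF br_lin(1)])

lemma ad_br: "ad (br x y) = ad x ** ad y - ad y ** ad x"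
proof -
  have "ad (br x y) *v z = (ad x ** ad y - ad y ** ad x) *v z" for z
    unfolding matrix_vector_mult_diff_rdistrib matrix_vector_mul_assoc[symmetric] ad_apply derivation[of x y z]
    by simp
  then show ?thesis by (simp only: matrix_eq) simp
qed

definition killing :: "complex^'m \<Rightarrow> complex^'m \<Rightarrow> complex" where
  "killing x y = trace (ad x ** ad y)"

lemma ad_add: "ad (x + y) = ad x + ad y"
  and ad_scale: "ad (a *s x) = (\<chi> i j. a * ad x $ i $ j)"
proof -
  show "ad (x + y) = ad x + ad y" by (simp add: matrix_eq matrix_vector_mult_add_rdistrib ad_apply br_simps)
  have "(\<chi> i j. a * ad x $ i $ j) *v z = a *s (ad x *v z)" for z
    by (simp add: matrix_vector_mult_def vec_eq_iff sum_distrib_left mult.assoc)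
  then show "ad (a *s x) = (\<chi> i j. a * ad x $ i $ j)" by (simp add: matrix_eq ad_apply br_simps)
qed

lemma matrix_distribs:
  fixes A B C :: "complex^'k^'k"
  shows "(A + B) ** C = A ** C + B ** C" "(A - B) ** C = A ** C - B ** C" "A ** (B - C) = A ** B - A ** C"
  by (simp_all add: vec_eq_iff matrix_matrix_mult_def ring_distribs sum.distrib sum_subtractf)

lemma killing_simps:
  "killing (x + y) z = killing x z + killing y z" "killing x (y + z) = killing x y + killing x z"
  "killing (a *s x) z = a * killing x z" "killing x (a *s z) = a * killing x z"
  by (simp_all add: killing_def ad_add ad_scale matrix_add_ldistrib matrix_distribs trace_add)
    (simp_all add: trace_def matrix_matrix_mult_def sum_distrib_left mult_ac)

lemma killing_invariant: "killing (br x y) z = killing y (br z x)"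
proof -
  have "killing (br x y) z = trace (ad x ** (ad y ** ad z)) - trace (ad y ** ad x ** ad z)"
    unfolding killing_def ad_br by (simp add: matrix_distribs trace_sub matrix_mul_assoc)
  also have "trace (ad x ** (ad y ** ad z)) = trace (ad y ** ad z ** ad x)" by (rule trace_mul_sym)
  finally show ?thesis
    unfolding killing_def ad_br by (simp add: matrix_distribs trace_sub matrix_mul_assoc)
qed

lemma killing_zero_left: "killing 0 z = 0"
  using killing_simps(3)[of 0 0 z] by simp

text \<open>The radical of the form is an ideal of a simple algebra. It is not everything: for a
  lattice vector \<open>l\<close> on which some root is nonzero, \<open>\<iota> l\<close> acts with
  integral eigenvalues that are not all zero, so its square has nonzero trace.\<close>

lemma killing_nondegenerate:
  assumes rigid: "\<And>v. (\<And>\<alpha>. \<alpha> \<in> R \<Longrightarrow> \<alpha> v = 0) \<Longrightarrow> v = 0" and rad: "\<And>z. killing y z = 0"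
  shows "y = 0"
proof -
  define I where "I = {y. \<forall>z. killing y z = 0}"
  have ideal: "lie_ideal br UNIV I"
    unfolding lie_ideal_def vec.subspace_def I_def
    by (auto simp: killing_simps killing_zero_left intro: killing_invariant[THEN trans])
  have "\<forall>I. lie_ideal br UNIV I \<longrightarrow> I = {0} \<or> I = UNIV"
    using simple unfolding simple_lie_algebra_def by (elim conjE)
  from mp[OF spec[OF this] ideal] have "I = {0} \<or> I = UNIV" .
  moreover have "I \<noteq> UNIV"
  proof
    assume all: "I = UNIV"
    have "\<exists>\<alpha>\<in>R. \<exists>l\<in>L. \<alpha> l \<noteq> 0"
    proof (rule ccontr)
      assume "\<not> ?thesis"
      then have no: "\<alpha> l = 0" if "\<alpha> \<in> R" "l \<in> L" for \<alpha> l using that by (simp add: Bex_def)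
      have "\<alpha> v = 0" if "\<alpha> \<in> R" for \<alpha> v
        by (rule linear_form_zero_on_L[OF dual_form[OF roots_dual[OF that]] no[OF that]])
      then have "v = 0" for v :: "complex^'n" by (rule rigid)
      from this[of "axis undefined 1"] show False by simp
    qed
    then obtain \<alpha> l where \<alpha>: "\<alpha> \<in> R" "l \<in> L" "\<alpha> l \<noteq> 0" by (elim bexE)
    obtain y where y: "y \<in> gsp \<alpha>" "y \<noteq> 0" by (rule root_vector[OF \<alpha>(1)])
    have "trace (ad (\<iota> l) ** ad (\<iota> l)) \<noteq> 0"
    proof (rule trace_square_eigenbasis[OF gsp_span])
      fix z assume "z \<in> (\<Union>\<alpha>\<in>R0. gsp \<alpha>)"
      then obtain \<beta> where \<beta>: "\<beta> \<in> R0" "z \<in> gsp \<beta>" by (elim UN_E)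
      have "\<beta> l \<in> \<int>" using \<beta>(1) \<alpha>(2) dual_L[OF roots_dual] by auto
      then obtain k :: int where "\<beta> l = of_int k" by (elim Ints_cases)
      then show "\<exists>k :: int. ad (\<iota> l) *v z = of_int k *s z" using \<beta>(2) by (auto simp: ad_apply gsp_iff)
    next
      have "ad (\<iota> l) *v y \<noteq> 0" using y \<alpha>(3) by (simp add: ad_apply gsp_iff)
      then show "ad (\<iota> l) \<noteq> 0" by auto
    qed
    moreover have "\<iota> l \<in> I" by (simp add: all)
    then have "killing (\<iota> l) (\<iota> l) = 0" by (simp add: I_def)
    ultimately show False by (simp add: killing_def)
  qed
  moreover have "y \<in> I" using rad by (simp add: I_def)
  ultimately show ?thesis by simp
qed

text \<open>Each application shifts the weight by the fixed nonzero \<open>\<delta>\<close>, and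
  there are only finitely many weights.\<close>

lemma shift_nilpotent:
  assumes \<delta>: "linear_form \<delta>" "\<delta> \<noteq> (\<lambda>t. 0)"
    and shift: "\<And>\<gamma> v. v \<in> gsp \<gamma> \<Longrightarrow> A *v v \<in> gsp (\<lambda>t. \<gamma> t + \<delta> t)"
  shows "\<exists>n. \<forall>v. ((*v) A ^^ Suc n) v = 0"
proof -
  have fin: "finite R0" using finite_roots by simp
  have pow: "((*v) A ^^ j) v \<in> gsp (\<lambda>t. \<gamma> t + of_nat j * \<delta> t)" if "v \<in> gsp \<gamma>" for v \<gamma> j
  proof (induction j)
    case 0
    then show ?case using that by simp
  next
    case (Suc j)
    from shift[OF this] show ?case by (simp add: algebra_simps)
  qed
  have lin: "Vector_Spaces.linear (*s) (*s) ((*v) A ^^ j)" for j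
  proof (induction j)
    case (Suc j)
    then show ?case by (simp add: Vector_Spaces.linear_iff matrix_vector_right_distrib vector_scalar_commute)
  qed (simp add: Vector_Spaces.linear_iff vec.vector_space_axioms)
  \<comment> \<open>Among the \<open>n + 1\<close> distinct weights
    \<open>\<gamma> + j \<delta>\<close> with \<open>j \<le> n\<close>, at least one lies outside
    \<open>R0\<close>.\<close>
  define n where "n = card R0"
  have zero: "((*v) A ^^ Suc n) v = 0" if v: "v \<in> gsp \<gamma>" "\<gamma> \<in> R0" for v \<gamma>
  proof -
    have \<gamma>: "linear_form \<gamma>" using v(2) dual_form[OF roots_dual] linear_form_null by auto
    obtain t where t: "\<delta> t \<noteq> 0" using \<delta>(2) by auto
    have inj: "inj_on (\<lambda>j. (\<lambda>t. \<gamma> t + of_nat j * \<delta> t)) {..n}"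
    proof (rule inj_onI)
      fix i j assume "(\<lambda>t. \<gamma> t + of_nat i * \<delta> t) = (\<lambda>t. \<gamma> t + of_nat j * \<delta> t)"
      from fun_cong[OF this, of t] show "i = j" using t by simp
    qed
    have "\<not> (\<lambda>j. (\<lambda>t. \<gamma> t + of_nat j * \<delta> t)) ` {..n} \<subseteq> R0"
    proof
      assume "(\<lambda>j. (\<lambda>t. \<gamma> t + of_nat j * \<delta> t)) ` {..n} \<subseteq> R0"
      from card_mono[OF fin this] show False using card_image[OF inj] by (simp add: n_def)
    qed
    then obtain j where j: "j \<le> n" "(\<lambda>t. \<gamma> t + of_nat j * \<delta> t) \<notin> R0" by blast
    have "((*v) A ^^ j) v = 0"
      by (rule gsp_outside[OF linear_form_plus[OF \<gamma> linear_form_mult[OF \<delta>(1)]] j(2) pow[OF v(1)]])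
    moreover have "((*v) A ^^ Suc n) v = ((*v) A ^^ (Suc n - j)) (((*v) A ^^ j) v)"
      using j(1) by (metis add.commute comp_apply funpow_add le_SucI le_add_diff_inverse)
    moreover have "((*v) A ^^ i) 0 = 0" for i by (induction i) simp_all
    ultimately show ?thesis by simp
  qed
  have "((*v) A ^^ Suc n) v = 0" for v
  proof (rule vec.linear_eq_on[OF lin vec.linear_zero])
    show "v \<in> vec.span (\<Union>\<alpha>\<in>R0. gsp \<alpha>)" by (simp only: gsp_span UNIV_I)
    show "((*v) A ^^ Suc n) b = 0" if "b \<in> (\<Union>\<alpha>\<in>R0. gsp \<alpha>)" for b using that zero by blast
  qed
  then show ?thesis by blast
qed

section \<open>Centralizers of points of the torus\<close>

lemma exp_ad_root:
  assumes y: "y \<in> gsp \<alpha>" and \<alpha>: "linear_form \<alpha>"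
  shows "exp_ad br (\<iota> ((2 * of_real pi * \<i>) *s x)) y = expi (\<alpha> x) *s y"
proof -
  define z where "z = \<iota> ((2 * of_real pi * \<i>) *s x)"
  define c where "c = 2 * of_real pi * \<i> * \<alpha> x"
  have "br z y = c *s y" using y by (simp add: gsp_iff z_def c_def linear_form_scale[OF \<alpha>])
  then have pow: "(br z ^^ k) y = c ^ k *s y" for k
    by (induction k) (simp_all add: br_simps vector_smult_assoc mult.commute)
  have "(\<lambda>k. c ^ k / fact k) sums exp c"
    using exp_converges[of c] by (simp add: scaleR_conv_of_real divide_inverse mult.commute)
  then have "(\<lambda>k. (c ^ k / fact k) *s y) sums (exp c *s y)"
    by (rule bounded_linear.sums[OF bounded_linear_scale_vector])
  then have "(\<lambda>k. (1 / fact k) *s (br z ^^ k) y) sums (exp c *s y)"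
    by (simp add: pow vector_smult_assoc)
  then have "exp_ad br z y = exp c *s y" unfolding exp_ad_def by (rule sums_unique[symmetric])
  then show ?thesis by (simp add: z_def c_def expi_def)
qed

lemma gsp_centralizer:
  assumes y: "y \<in> gsp \<alpha>" and \<alpha>: "\<alpha> \<in> dual_lattice L" "\<alpha> x \<in> \<int>"
  shows "y \<in> lie_centralizer br \<iota> (coset L x)"
  unfolding lie_centralizer_def
proof (intro CollectI ballI)
  fix x' assume "x' \<in> coset L x"
  then have "\<alpha> (x' - x) \<in> \<int>" by (intro dual_L[OF \<alpha>(1)]) (simp add: in_coset_iff)
  then have "\<alpha> (x' - x) + \<alpha> x \<in> \<int>" using \<alpha>(2) by (rule Ints_add)
  then have "expi (\<alpha> x') = 1" by (simp add: expi_eq_1_iff linear_form_diff[OF dual_form[OF \<alpha>(1)]])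
  then show "exp_ad br (\<iota> ((2 * of_real pi * \<i>) *s x')) y = y"
    by (simp add: exp_ad_root[OF y dual_form[OF \<alpha>(1)]])
qed

lemma centralizer_gsp:
  assumes y: "y \<in> lie_centralizer br \<iota> (coset L x)" "y \<in> gsp \<alpha>" "y \<noteq> 0" and \<alpha>: "linear_form \<alpha>"
  shows "\<alpha> x \<in> \<int>"
proof -
  have "x \<in> coset L x" using L_zero by (simp add: in_coset_iff)
  then have "exp_ad br (\<iota> ((2 * of_real pi * \<i>) *s x)) y = y" using y(1) by (simp add: lie_centralizer_def)
  then have "expi (\<alpha> x) *s y = 1 *s y" by (simp add: exp_ad_root[OF y(2) \<alpha>])
  then have "expi (\<alpha> x) = 1" using y(3) by (simp only: vec.scale_cancel_right) simp
  then show ?thesis by (simp only: expi_eq_1_iff)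
qed

lemma derived_ideal:
  assumes "lie_ideal br K I"
  shows "lie_ideal br K (derived_subalgebra br I)"
proof -
  have I: "vec.subspace I" "I \<subseteq> K" "\<And>x y. x \<in> K \<Longrightarrow> y \<in> I \<Longrightarrow> br x y \<in> I"
    using assms by (simp_all add: lie_ideal_def)
  have sub: "derived_subalgebra br I \<subseteq> I"
    unfolding derived_subalgebra_def using I by (intro vec.span_minimal) auto
  have "br x z \<in> derived_subalgebra br I" if x: "x \<in> K" and z: "z \<in> derived_subalgebra br I" for x z
    using z unfolding derived_subalgebra_def
  proof (induction rule: vec.span_induct_alt)
    case base
    show ?case by (simp add: br_simps vec.span_zero)
  next
    case (step c u v)
    then obtain p q where pq: "u = br p q" "p \<in> I" "q \<in> I" by blast
    have "br (br x p) q \<in> vec.span {br x y | x y. x \<in> I \<and> y \<in> I}"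
      "br p (br x q) \<in> vec.span {br x y | x y. x \<in> I \<and> y \<in> I}"
      using pq I(3)[OF x] by (auto intro!: vec.span_base)
    then have "br x u \<in> vec.span {br x y | x y. x \<in> I \<and> y \<in> I}"
      unfolding pq(1) derivation[of x] by (rule vec.span_add)
    then show ?case using step by (simp add: br_simps vec.span_add vec.span_scale)
  qed
  then show ?thesis
    using sub I(2) unfolding lie_ideal_def by (auto simp: derived_subalgebra_def)
qed

text \<open>A nonzero solvable ideal yields a nonzero abelian one, the last nonzero term of its
  derived series. For a root vector \<open>u\<close> in an abelian ideal,
  \<open>ad u ** ad z\<close> is nilpotent for every weight vector \<open>z\<close>, so
  \<open>u\<close> is orthogonal to the whole algebra.\<close>

lemma centralizer_semisimple:
  assumes rigid: "\<And>v. (\<And>\<alpha>. \<alpha> \<in> R \<Longrightarrow> \<alpha> x \<in> \<int> \<Longrightarrow> \<alpha> v = 0) \<Longrightarrow> v = 0"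
  shows "semisimple br (lie_centralizer br \<iota> (coset L x))"
proof -
  define K where "K = lie_centralizer br \<iota> (coset L x)"
  have hK: "\<iota> t \<in> K" for t
    unfolding K_def by (rule gsp_centralizer[OF _ dual_zero]) (simp_all add: gsp_0)
  have no_abelian: "J = {0}" if J: "lie_ideal br K J" and ab: "\<And>y z. y \<in> J \<Longrightarrow> z \<in> J \<Longrightarrow> br y z = 0" for J
  proof (rule ccontr)
    assume nz: "J \<noteq> {0}"
    have Jf: "vec.subspace J" "J \<subseteq> K" "\<And>x y. x \<in> K \<Longrightarrow> y \<in> J \<Longrightarrow> br x y \<in> J"
      using J by (simp_all add: lie_ideal_def)
    \<comment> \<open>A root \<open>\<beta>\<close> that is integral at \<open>x\<close> and nonzero
      on \<open>t\<close> would have its root vector in the ideal too, through the bracket with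
      \<open>\<iota> t\<close>; these two elements do not commute.\<close>
    have J0: "\<iota> t = 0" if "\<iota> t \<in> J" for t
    proof (rule ccontr)
      assume "\<iota> t \<noteq> 0"
      then have "t \<noteq> 0" using vec.linear_0[OF \<iota>_lin] by auto
      then obtain \<beta> where \<beta>: "\<beta> \<in> R" "\<beta> x \<in> \<int>" "\<beta> t \<noteq> 0" using rigid by blast
      obtain z where z: "z \<in> gsp \<beta>" "z \<noteq> 0" by (rule root_vector[OF \<beta>(1)])
      have zK: "z \<in> K" unfolding K_def by (rule gsp_centralizer[OF z(1) roots_dual[OF \<beta>(1)] \<beta>(2)])
      have b: "br (\<iota> t) z = \<beta> t *s z" using z(1) by (simp add: gsp_iff)
      have "br z (\<iota> t) \<in> J" by (rule Jf(3)[OF zK that])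
      then have "(- 1 / \<beta> t) *s br z (\<iota> t) \<in> J" by (rule vec.subspace_scale[OF Jf(1)])
      moreover have "(- 1 / \<beta> t) *s br z (\<iota> t) = z"
        unfolding br_anti[of z] b using \<beta>(3) by (simp add: vec_eq_iff)
      ultimately have "z \<in> J" by simp
      from ab[OF that this] show False using b z(2) \<beta>(3) by simp
    qed
    obtain y where y: "y \<in> J" "y \<noteq> 0" using nz vec.subspace_0[OF Jf(1)] by blast
    obtain Y where Y: "\<forall>\<alpha>\<in>R0. Y \<alpha> \<in> gsp \<alpha>" "y = (\<Sum>\<alpha>\<in>R0. Y \<alpha>)" using gsp_decompose by blast
    have YJ: "Y \<alpha> \<in> J" if "\<alpha> \<in> R0" for \<alpha>
    proof (rule graded_component[OF Jf(1) _ _ _ _ that])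
      show "br (\<iota> t) u \<in> J" if "u \<in> J" for t u by (rule Jf(3)[OF hK that])
      show "finite R0" using finite_roots by simp
    qed (use Y y(1) in auto)
    have "\<exists>\<alpha>\<in>R0. Y \<alpha> \<noteq> 0" using y(2) Y(2) by (metis sum.neutral)
    then obtain \<alpha> where \<alpha>: "\<alpha> \<in> R0" "Y \<alpha> \<noteq> 0" by blast
    define u where "u = Y \<alpha>"
    have u: "u \<in> J" "u \<in> gsp \<alpha>" "u \<noteq> 0" using YJ[OF \<alpha>(1)] bspec[OF Y(1) \<alpha>(1)] \<alpha>(2) unfolding u_def by simp_all
    have "\<alpha> \<noteq> (\<lambda>t. 0)"
    proof
      assume "\<alpha> = (\<lambda>t. 0)"
      then obtain t where "u = \<iota> t" using u(2) gsp_0 by auto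
      then show False using J0 u by auto
    qed
    then have \<alpha>R: "\<alpha> \<in> R" using \<alpha>(1) by simp
    note \<alpha>d = roots_dual[OF \<alpha>R]
    note \<alpha>l = dual_form[OF \<alpha>d]
    have \<alpha>x: "\<alpha> x \<in> \<int>"
      by (rule centralizer_gsp[OF _ u(2,3) \<alpha>l]) (use u(1) Jf(2) K_def in auto)
    have kz: "killing u z = 0" if \<beta>: "\<beta> \<in> R0" and z: "z \<in> gsp \<beta>" for z \<beta>
    proof -
      have \<beta>l: "linear_form \<beta>" using \<beta> dual_form[OF roots_dual] linear_form_null by auto
      have "\<exists>n. \<forall>v. ((*v) (ad u ** ad z) ^^ Suc n) v = 0"
      proof (cases "(\<lambda>t. \<alpha> t + \<beta> t) = (\<lambda>t. 0)")
        case False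
        show ?thesis
        proof (rule shift_nilpotent[OF linear_form_plus[OF \<alpha>l \<beta>l] False])
          fix \<gamma> v assume "v \<in> gsp \<gamma>"
          from gsp_br[OF u(2) gsp_br[OF z this]]
          show "ad u ** ad z *v v \<in> gsp (\<lambda>t. \<gamma> t + (\<alpha> t + \<beta> t))"
            by (simp add: matrix_vector_mul_assoc[symmetric] ad_apply algebra_simps)
        qed
      next
        \<comment> \<open>Opposite weights: \<open>br z u\<close> lies both in \<open>J\<close> and
          in the Cartan subalgebra, so it is 0. Then \<open>ad u\<close> and \<open>ad z\<close>
          commute, and the product inherits nilpotency from \<open>ad u\<close>.\<close>
        case True
        then have \<beta>eq: "\<beta> = (\<lambda>t. of_int (- 1) * \<alpha> t)" by (auto simp: fun_eq_iff add_eq_0_iff)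
        have \<beta>x: "\<beta> x \<in> \<int>" using \<alpha>x by (simp add: \<beta>eq)
        have zK: "z \<in> K" unfolding K_def
          by (rule gsp_centralizer[OF z _ \<beta>x]) (use dual_mult[OF \<alpha>d, of "-1"] \<beta>eq in simp)
        have "br z u \<in> J" by (rule Jf(3)[OF zK u(1)])
        moreover have "br z u \<in> range \<iota>"
        proof -
          have "br z u \<in> gsp (\<lambda>t. \<beta> t + \<alpha> t)" by (rule gsp_br[OF z u(2)])
          moreover have "(\<lambda>t. \<beta> t + \<alpha> t) = (\<lambda>t. 0)" using True by (simp add: add.commute)
          ultimately show ?thesis by (simp add: gsp_0)
        qed
        ultimately have "br z u = 0" using J0 by auto
        then have comm: "ad z ** ad u = ad u ** ad z"
          using ad_br[of z u]
          by (simp add: ad_def matrix_eq ad_apply[unfolded ad_def] br_simps matrix_vector_mult_diff_rdistrib)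
        obtain n where n: "\<forall>v. ((*v) (ad u) ^^ Suc n) v = 0"
          using shift_nilpotent[OF \<alpha>l \<open>\<alpha> \<noteq> (\<lambda>t. 0)\<close>, of "ad u"] gsp_br[OF u(2)]
          by (auto simp: ad_apply add.commute)
        have cx: "ad z *v (ad u *v v) = ad u *v (ad z *v v)" for v
          using comm by (simp add: matrix_vector_mul_assoc)
        have cpow: "ad z *v (((*v) (ad u) ^^ j) v) = ((*v) (ad u) ^^ j) (ad z *v v)" for j v
          by (induction j) (simp_all add: cx)
        have pw: "((*v) (ad u ** ad z) ^^ j) v = ((*v) (ad u) ^^ j) (((*v) (ad z) ^^ j) v)" for j v
          by (induction j) (simp_all add: matrix_vector_mul_assoc[symmetric] cpow)
        have "((*v) (ad u ** ad z) ^^ Suc n) v = 0" for v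
          unfolding pw by (rule spec[OF n])
        then show ?thesis by (intro exI[of _ n] allI)
      qed
      then obtain n where "\<forall>v. ((*v) (ad u ** ad z) ^^ Suc n) v = 0" by (elim exE)
      then show ?thesis unfolding killing_def by (intro trace_nilpotent[of n]) simp
    qed
    have "killing u z = 0" for z
    proof -
      have "z \<in> vec.span (\<Union>\<alpha>\<in>R0. gsp \<alpha>)" by (simp only: gsp_span UNIV_I)
      then show ?thesis
      proof (induction rule: vec.span_induct_alt)
        case base
        show ?case using killing_simps(4)[of u 0 0] by simp
      next
        case (step b p q)
        then have "killing u p = 0" using kz by blast
        then show ?case using step(2) by (simp add: killing_simps)
      qed
    qed
    then have "u = 0" by (intro killing_nondegenerate rigid) assumption+
    with u(3) show False by (rule notE)
  qed
  show ?thesis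
    unfolding semisimple_def K_def[symmetric]
  proof (intro allI impI, rule ccontr)
    fix I assume I: "lie_ideal br K I \<and> solvable br I" "I \<noteq> {0}"
    define D where "D = (\<lambda>k. (derived_subalgebra br ^^ k) I)"
    have ideal: "lie_ideal br K (D k)" for k
      by (induction k) (use I in \<open>simp_all add: D_def derived_ideal\<close>)
    have ex: "\<exists>k. D k = {0}" using I(1) unfolding solvable_def D_def by (elim conjE)
    define k where "k = (LEAST k. D k = {0})"
    have k0: "D k = {0}" unfolding k_def by (rule LeastI_ex[OF ex])
    have k1: "D j \<noteq> {0}" if "j < k" for j using that unfolding k_def by (rule not_less_Least)
    have "k \<noteq> 0" using k0 I(2) by (cases k) (simp_all add: D_def)
    then obtain j where j: "k = Suc j" by (cases k) auto
    have "br y z = 0" if "y \<in> D j" "z \<in> D j" for y z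
    proof -
      have "br y z \<in> derived_subalgebra br (D j)"
        unfolding derived_subalgebra_def using that by (intro vec.span_base) blast
      moreover have "derived_subalgebra br (D j) = {0}" using k0 by (simp add: j D_def)
      ultimately show ?thesis by simp
    qed
    then have "D j = {0}" by (rule no_abelian[OF ideal])
    moreover have "D j \<noteq> {0}" by (rule k1) (simp add: j)
    ultimately show False by (rule notE[rotated])
  qed
qed

end

theorem theorem3p2:
  fixes W :: "(complex^'n^'n) set"
    and L :: "(complex^'n) set"
    and c :: "(complex^'n) set set \<Rightarrow> complex"
    and f :: "(complex^'n) set set \<Rightarrow> complex^'n \<Rightarrow> complex^'n \<Rightarrow> complex"
    and br :: "'m::finite bracket"
    and \<iota> :: "complex^'n \<Rightarrow> complex^'m"
  assumes "irreducible_Weyl_group W"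
    and "lattice L"
    and "stable_under W L"
    and "invariant_parameter W L c"
    and "admissible_family W L f"
    and "simple_lie_algebra_with_roots br \<iota> (roots W L)"
  shows "(reducible_module (degenerate_DAHA W L c f) (torus_functions L) \<longleftrightarrow>
            (\<exists>g\<in>Sigma_points br \<iota> L. local_parameter L c g \<in> Sing (stabilizer W g))) \<and>
         (reducible_module (degenerate_DAHA W L c f) (torus_functions L) \<longleftrightarrow>
            c \<in> (\<Union>g\<in>Sigma_points br \<iota> L. Sing_at W L g))"
proof -
  interpret torus_reflection_group W L by (rule irreducible_Weyl_group_torus[OF assms(1-3)])
  interpret trigonometric_DAHA W L c f by unfold_locales (use assms in auto)
  interpret lie_torus W L br \<iota> by unfold_locales (rule assms(6))
  have main: "reducible_module (degenerate_DAHA W L c f) (torus_functions L) \<longleftrightarrow>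
            (\<exists>g\<in>Sigma_points br \<iota> L. local_parameter L c g \<in> Sing (stabilizer W g))"
  proof
    assume "reducible_module (degenerate_DAHA W L c f) (torus_functions L)"
    then obtain N where N: "submodule (degenerate_DAHA W L c f) CH N" "N \<noteq> {\<lambda>x. 0}" "N \<noteq> CH"
      unfolding reducible_module_def by (elim exE conjE)
    interpret trigonometric_submodule W L c f N by unfold_locales (rule N(1))
    obtain x where x: "\<forall>F\<in>N. F x = 0" "\<forall>v. (\<forall>\<alpha>\<in>roots W L. \<alpha> x \<in> \<int> \<longrightarrow> \<alpha> v = 0) \<longrightarrow> v = 0"
      using rigid_zero[OF N(3)] by (elim exE conjE)
    have "semisimple br (lie_centralizer br \<iota> (coset L x))"
      by (rule centralizer_semisimple) (use x(2) in blast)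
    then have "coset L x \<in> Sigma_points br \<iota> L" by (simp add: Sigma_points_def torus_def)
    \<comment> \<open>\<open>Sing\<close> also requires invariance under conjugation in the
      stabilizer, which descends from the invariance of \<open>c\<close> under
      \<open>W\<close>.\<close>
    moreover have "local_parameter L c (coset L x) \<in> Sing (stabilizer W (coset L x))"
      using singular_at_zero[OF x(1) N(2)] local_parameter_invariant[OF assms(4)] by (simp add: Sing_def)
    ultimately show "\<exists>g\<in>Sigma_points br \<iota> L. local_parameter L c g \<in> Sing (stabilizer W g)" by (rule bexI[rotated])
  next
    assume "\<exists>g\<in>Sigma_points br \<iota> L. local_parameter L c g \<in> Sing (stabilizer W g)"
    then obtain g where g: "g \<in> Sigma_points br \<iota> L" "local_parameter L c g \<in> Sing (stabilizer W g)" by (elim bexE)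
    obtain x where "g = coset L x" using g(1) by (auto simp: Sigma_points_def torus_def)
    then show "reducible_module (degenerate_DAHA W L c f) (torus_functions L)"
      using reducible_if_singular[of x] g(2) by (simp add: Sing_def)
  qed
  \<comment> \<open>Beyond the local condition, \<open>Sing_at\<close> asks only that
    \<open>c\<close> be invariant, which is assumed.\<close>
  moreover have "c \<in> (\<Union>g\<in>Sigma_points br \<iota> L. Sing_at W L g) \<longleftrightarrow>
      (\<exists>g\<in>Sigma_points br \<iota> L. local_parameter L c g \<in> Sing (stabilizer W g))"
    using assms(4) by (simp add: Sing_at_def)
  ultimately show ?thesis by simp
qed

end
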